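(* Let $\mu$ be a Foias--Prodi stationary statistical solution on $\dot H$ of the free-shear Navier--Stokes system with viscosity $\nu>0$ and imposed shear profile $U=U(z)$ (all in the sense defined in the context). Let $\delta>0$. Then, for any $\bar\kappa\ge\bar\kappa_1$ such that $$\frac{\kappa_s^2}{2\mathcal{K}_{\bar\kappa,\infty}^2}\le\delta\qquad\text{and}\qquad\frac{\epsilon_{\bar\kappa_1,\bar\kappa}}{\epsilon}\le\delta,$$ we have the following bounds on the restricted energy flux: $$(1-\delta)^2\,\epsilon\ \le\ \overset{\rightarrow}{\Pi}{}_{\bar\kappa}^{*}\ \le\ (1+\delta)\,\epsilon .$$
   Context: **Domain and profile.** Fix $L_x,L_y,h,\nu>0$ and $\Omega=(0,L_x)\times(0,L_y)\times(-h/2,h/2)$, with $\mathbf{x}=(x,y,z)$ and canonical basis $\mathbf{e}_x,\mathbf{e}_y,\mathbf{e}_z$. The profile $U=U(z)$ is a smooth function of $z$ whose derivative $U'$ is uniformly bounded and vanishes at $z=\pm h/2$. **System.** The unknown velocity $\mathbf{u}=(u,v,w)$ and pressure $p$ satisfy $$\partial_t\mathbf{u}-\nu\Delta\mathbf{u}+(\mathbf{u}\cdot\nabla)\mathbf{u}+\nabla p=-\nu U''(z)\mathbf{e}_x-U(z)\partial_x\mathbf{u}-wU'(z)\mathbf{e}_x,\qquad \nabla\cdot\mathbf{u}=0,$$ with $\mathbf{u},p$ $L_x$-periodic in $x$ and $L_y$-periodic in $y$; $\partial_z u=\partial_z v=0$ and $w=0$ at $z=\pm h/2$; and $\int_0^{L_x}\!\int_0^{L_y}u\,dx\,dy=\int_0^{L_x}\!\int_0^{L_y}v\,dx\,dy=0$.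 (The term $-\nu U''\mathbf{e}_x$ is $L^2$-orthogonal to the space $\dot H$ below and does not appear in the functional formulation.) **Spaces.** $\mathcal V$ is the space of restrictions to $\Omega$ of divergence-free fields $(u,v,w)$ in $C^\infty(\mathbb{R}^2\times(-h/2,h/2))$, $L_x$-periodic in $x$ and $L_y$-periodic in $y$, such that $\partial_zu,\partial_zv,w$ have support bounded away from $z=\pm h/2$. $H$ and $V$ are the closures of $\mathcal V$ in $L^2(\Omega)^3$ and $H^1(\Omega)^3$. $\dot H$ is the subspace of $\mathbf{u}\in H$ with $\frac{1}{L_xL_y}\int_0^{L_x}\int_0^{L_y}(u,v)\,dx\,dy=(0,0)$ for a.e. $z$, and $\dot V=V\cap\dot H$, with dual $\dot V'$ and duality product $((\cdot,\cdot))_{\dot V',\dot V}$ ($\dot H$ being identified with its dual). $((\cdot,\cdot))_{L^2}$ and $\|\cdot\|_{L^2}$ are the $L^2(\Omega)$ inner product and norm (for vector or tensor fields). $P_{\dot H}$ is the orthogonal projector of $L^2(\Omega)^3$ onto $\dot H$. The Stokes operator is $A=-P_{\dot H}\Delta$, with domain $D(A)=\{\mathbf{u}\in V:\ A\mathbf{u}\in H\}=H^2(\Omega)^3\cap V$; it is a positive self-adjoint operator in $\dot H$ with compact inverse. The bilinear term is $B(\mathbf{u},\mathbf{v})=P_{\dot H}((\mathbf{u}\cdot\nabla)\mathbf{v})$. For $\mathbf{u}\in\dot V$, $$\mathbf{F}(\mathbf{u})=-U(z)\partial_x\mathbf{u}-wU'(z)\mathbf{e}_x-\nu A\mathbf{u}-B(\mathbf{u},\mathbf{u})\in\dot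 V'.$$ **Foias--Prodi stationary statistical solution.** A Borel probability measure $\mu$ on $\dot H$ such that: (1) $\int_{\dot H}\|\nabla\mathbf{u}\|_{L^2}^2\,d\mu(\mathbf{u})<\infty$; (2) $\int_{\dot H}((\mathbf{F}(\mathbf{u}),\Phi'(\mathbf{u})))_{\dot V',\dot V}\,d\mu(\mathbf{u})=0$ for every cylindrical test function $\Phi$, i.e. every function of the form $\Phi(\mathbf{u})=\varphi(((\mathbf{u},\mathbf{v}_1))_{L^2},\dots,((\mathbf{u},\mathbf{v}_k))_{L^2})$ with $\mathbf{v}_j\in V$, $j=1,\dots,k$, and $\varphi:\mathbb{R}^k\to\mathbb{R}$ of class $C^1$ with compact support, where $\Phi'$ is the Fréchet derivative of $\Phi$ in $H$; (3) $\int_{\dot H}\psi'(\|\mathbf{u}\|_{L^2}^2)\{\nu\|\nabla\mathbf{u}\|_{L^2}^2+((U\partial_x\mathbf{u}+wU'\mathbf{e}_x,\mathbf{u}))_{L^2}\}\,d\mu(\mathbf{u})\le0$ for every nonnegative, nondecreasing, continuously differentiable real-valued function $\psi$ on $[0,\infty)$ with bounded derivative. Ensemble average: $\langle\varphi(\mathbf{u})\rangle=\int_{\dot H}\varphi(\mathbf{u})\,d\mu(\mathbf{u})$ for real-valued $\varphi\in L^1(\mu)$. **Spectral decomposition.** Let $\mathcal I=\{(j,l,k,\iota):\ j,l\in\mathbb Z,\ k\in\mathbb N,\ \iota\in\{1,2\},\ j^2+l^2\ne0\}$, where $\mathbb N$ is the set of strictly positive integers. The Stokes operator has a complete orthonormal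 basis $\{\mathbf{w}_{j,l,k,\iota}\}_{(j,l,k,\iota)\in\mathcal I}$ of $\dot H$ consisting of eigenfunctions, $A\mathbf{w}_{j,l,k,\iota}=\lambda_{j,l,k}\mathbf{w}_{j,l,k,\iota}$, with $\lambda_{j,l,k}=4\pi^2j^2/L_x^2+4\pi^2l^2/L_y^2+k^2\pi^2/h^2$. Each $\mathbf{w}_{j,l,k,\iota}$ is the componentwise product of a horizontal factor in $(x,y)$, whose components are the real trigonometric counterparts of $\exp(2\pi i(jx/L_x+ly/L_y))$, and a vertical factor $$\big(A_{j,l,k,\iota}\cos(\tfrac{k\pi}{h}(z+\tfrac h2)),\ B_{j,l,k,\iota}\cos(\tfrac{k\pi}{h}(z+\tfrac h2)),\ C_{j,l,k,\iota}\sin(\tfrac{k\pi}{h}(z+\tfrac h2))\big),$$ the horizontal combinations and constants being constrained by the divergence-free condition (which leaves a two-dimensional space of constants for each $(j,l,k)$, corresponding to $\iota=1,2$) and normalized in $L^2(\Omega)^3$. For $\mathbf{u}\in\dot H$, $\hat u_{j,l,k,\iota}=((\mathbf{u},\mathbf{w}_{j,l,k,\iota}))_{L^2}$. Horizontal wavenumbers: $\bar\kappa_{j,l}=\big(4\pi^2j^2/L_x^2+4\pi^2l^2/L_y^2\big)^{1/2}$, $j,l\in\mathbb Z$, $j^2+l^2\ne0$; the smallest is $\bar\kappa_1=2\pi/\max\{L_x,L_y\}$. The smallest total wavenumber is $\kappa_1=\big(4\pi^2/(\max\{L_x,L_y\})^2+\pi^2/h^2\big)^{1/2}$. For a range between $\bar\kappa_a$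 and $\bar\kappa_b$, with $\bar\kappa_1\le\bar\kappa_a<\bar\kappa_b\le\infty$, $$\mathbf{u}_{\bar\kappa_a,\bar\kappa_b}=\sum_{(j,l,k,\iota)\in\mathcal I,\ \bar\kappa_a\le\bar\kappa_{j,l}<\bar\kappa_b}\hat u_{j,l,k,\iota}\,\mathbf{w}_{j,l,k,\iota}.$$ Thus $\mathbf{u}=\mathbf{u}_{\bar\kappa_1,\infty}=\mathbf{u}_{\bar\kappa_1,\bar\kappa}+\mathbf{u}_{\bar\kappa,\infty}$ (an empty sum being zero). **Mean quantities.** With $\nabla_{x,y}=(\partial_x,\partial_y)$: - total mean energy dissipation rate $\epsilon=\nu\kappa_1^3\langle\|\nabla\mathbf{u}\|_{L^2}^2\rangle$; - mean energy dissipation rate of a range of horizontal modes $\epsilon_{\bar\kappa_a,\bar\kappa_b}=\nu\kappa_1^3\langle\|\nabla\mathbf{u}_{\bar\kappa_a,\bar\kappa_b}\|_{L^2}^2\rangle$; - $S=\|U'\|_{L^\infty}$ and viscous shear wavenumber $\kappa_s=(S/\nu)^{1/2}$; - horizontal Taylor wavenumber $\mathcal{K}_{\bar\kappa,\infty}=\Big(\langle\|\nabla_{x,y}\mathbf{u}_{\bar\kappa,\infty}\|_{L^2}^2\rangle/\langle\|\mathbf{u}_{\bar\kappa,\infty}\|_{L^2}^2\rangle\Big)^{1/2}$; - mean (low-to-high) energy flux, for $\bar\kappa\ge\bar\kappa_1$, $\overset{\rightarrow}{\Pi}_{\bar\kappa}=-\kappa_1^3\langle(((\mathbf{u}\cdot\nabla)\mathbf{u},\mathbf{u}_{\bar\kappa,\infty}))_{L^2}\rangle=-\kappa_1^3\langle(((\mathbf{u}\cdot\nabla)\mathbf{u}_{\bar\kappa_1,\bar\kappa},\mathbf{u}_{\bar\kappa,\infty}))_{L^2}\rangle$;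 - singularity flux (flux at infinity) $\overset{\rightarrow}{\Pi}_{\infty}=\lim_{\bar\kappa\to\infty}\overset{\rightarrow}{\Pi}_{\bar\kappa}$ (this limit exists and is nonnegative); - restricted (low-to-high) energy flux $\overset{\rightarrow}{\Pi}{}_{\bar\kappa}^{*}=\overset{\rightarrow}{\Pi}_{\bar\kappa}-\overset{\rightarrow}{\Pi}_{\infty}$.
   Formalization: Lower bound only for δ ≤ 1 (for δ > 3 the two bounds contradict each other); modes k = 0 are added, as the basis is incomplete without them; 𝒱 has free-slip conditions at z = ±h/2, else most eigenfunctions are not in V; the flux integrands are taken in L¹(μ). *)

theory Defs
  imports "HOL-Probability.Probability"
begin

text \<open>Points and velocities are elements of \<open>real^3\<close>; the coordinates \<open>x, y, z\<close> have the indices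
  \<open>1, 2, 3\<close>. A class in \<open>L\<^sup>2(\<Omega>)\<^sup>3\<close> is represented by any of its members, a total function whose
  values outside \<open>\<Omega>\<close> are irrelevant: everything below is invariant under changes on null sets and
  outside \<open>\<Omega>\<close>, and equality of classes is vanishing of the \<open>L\<^sup>2\<close> norm of the difference.\<close>

type_synonym point = "real^3"
type_synonym field = "real^3 \<Rightarrow> real^3"
type_synonym mode = "int \<times> int \<times> nat \<times> nat"


section \<open>Classical and weak derivatives\<close>

definition pd :: "3 \<Rightarrow> (point \<Rightarrow> 'a::real_normed_vector) \<Rightarrow> point \<Rightarrow> 'a" where
  "pd i f x = frechet_derivative f (at x) (axis i 1)"

primrec Ck_on :: "nat \<Rightarrow> point set \<Rightarrow> (point \<Rightarrow> 'a::real_normed_vector) \<Rightarrow> bool" where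
  "Ck_on 0 S f \<longleftrightarrow> continuous_on S f"
| "Ck_on (Suc n) S f \<longleftrightarrow> (\<forall>x\<in>S. f differentiable (at x)) \<and> (\<forall>i. Ck_on n S (pd i f))"

text \<open>Only meaningful for open \<open>S\<close>.\<close>

definition smooth_on :: "point set \<Rightarrow> (point \<Rightarrow> 'a::real_normed_vector) \<Rightarrow> bool" where
  "smooth_on S f \<longleftrightarrow> (\<forall>n. Ck_on n S f)"

definition test_function :: "point set \<Rightarrow> (point \<Rightarrow> real) \<Rightarrow> bool" where
  "test_function S \<phi> \<longleftrightarrow> smooth_on UNIV \<phi> \<and> (\<exists>K. compact K \<and> K \<subseteq> S \<and> (\<forall>x. x \<notin> K \<longrightarrow> \<phi> x = 0))"


section \<open>Function spaces on the periodic cell\<close>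

context
  fixes Lx Ly h :: real
begin

definition Omega :: "point set" where
  "Omega = {x. 0 < x$1 \<and> x$1 < Lx \<and> 0 < x$2 \<and> x$2 < Ly \<and> - h/2 < x$3 \<and> x$3 < h/2}"

definition strip :: "point set" where
  "strip = {x. - h/2 < x$3 \<and> x$3 < h/2}"

definition L2 :: "field set" where
  "L2 = {u. u \<in> borel_measurable (lebesgue_on Omega) \<and>
            integrable (lebesgue_on Omega) (\<lambda>x. (norm (u x))\<^sup>2)}"

text \<open>Also used when only the product is integrable, as for \<open>(u \<cdot> \<nabla>)u\<close> against an element of \<open>V\<close>.\<close>

definition l2inner :: "field \<Rightarrow> field \<Rightarrow> real" where
  "l2inner u v = (LINT x|lebesgue_on Omega. u x \<bullet> v x)"

definition l2norm :: "field \<Rightarrow> real" where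
  "l2norm u = sqrt (l2inner u u)"

definition weak_pd :: "3 \<Rightarrow> field \<Rightarrow> field \<Rightarrow> bool" where
  "weak_pd i u g \<longleftrightarrow> (\<forall>\<phi>. test_function Omega \<phi> \<longrightarrow>
     (LINT x|lebesgue_on Omega. pd i \<phi> x *\<^sub>R u x) = - (LINT x|lebesgue_on Omega. \<phi> x *\<^sub>R g x))"

definition H1 :: "field set" where
  "H1 = {u \<in> L2. \<forall>i. \<exists>g\<in>L2. weak_pd i u g}"

text \<open>The weak derivative \<open>\<partial>\<^sub>i u\<close>, determined up to null sets for \<open>u\<close> in \<open>H1\<close>.\<close>

definition wd :: "3 \<Rightarrow> field \<Rightarrow> field" where
  "wd i u = (SOME g. g \<in> L2 \<and> weak_pd i u g)"

definition grad_inner :: "field \<Rightarrow> field \<Rightarrow> real" where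
  "grad_inner u v = (\<Sum>i\<in>UNIV. l2inner (wd i u) (wd i v))"

definition grad_sq :: "field \<Rightarrow> real" where
  "grad_sq u = grad_inner u u"

definition hgrad_sq :: "field \<Rightarrow> real" where
  "hgrad_sq u = (\<Sum>i\<in>{1,2}. l2inner (wd i u) (wd i u))"

definition h1norm :: "field \<Rightarrow> real" where
  "h1norm u = sqrt ((l2norm u)\<^sup>2 + grad_sq u)"

text \<open>The smooth fields that generate the spaces: restrictions of smooth fields on \<open>real^3\<close>
  (equivalently, fields smooth up to \<open>z = \<plusminus>h/2\<close>), divergence-free between the plates, with the free-slip
  conditions on the plates. Requiring instead that \<open>\<partial>\<^sub>z u, \<partial>\<^sub>z v, w\<close> vanish in a neighbourhood of the
  plates gives the same closure in \<open>L\<^sup>2\<close>, but not in \<open>H\<^sup>1\<close>: together with the divergence-free condition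
  it makes \<open>\<partial>\<^sub>x u + \<partial>\<^sub>y v\<close> vanish there, a constraint on the trace of \<open>(u, v)\<close> that persists in the
  \<open>H\<^sup>1\<close> closure and fails for every free-slip Stokes mode with nonzero third component.\<close>

definition VV :: "field set" where
  "VV = {u. smooth_on UNIV u \<and>
     (\<forall>x. u (x + axis 1 Lx) = u x \<and> u (x + axis 2 Ly) = u x) \<and>
     (\<forall>x\<in>strip. (\<Sum>i\<in>UNIV. pd i u x $ i) = 0) \<and>
     (\<forall>x. \<bar>x$3\<bar> = h/2 \<longrightarrow> pd 3 u x $ 1 = 0 \<and> pd 3 u x $ 2 = 0 \<and> u x $ 3 = 0)}"

definition HH :: "field set" where
  "HH = {u \<in> L2. \<forall>e>0. \<exists>\<phi>\<in>VV. l2norm (\<lambda>x. u x - \<phi> x) < e}"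

definition V :: "field set" where
  "V = {u \<in> H1. \<forall>e>0. \<exists>\<phi>\<in>VV. h1norm (\<lambda>x. u x - \<phi> x) < e}"

definition Hdot :: "field set" where
  "Hdot = {u \<in> HH. AE z in lebesgue_on {- h/2<..<h/2}. \<forall>i\<in>{1,2}.
     1 / (Lx * Ly) * (LINT x|lebesgue_on {0<..<Lx}. LINT y|lebesgue_on {0<..<Ly}.
        u (vector [x, y, z]) $ i) = 0}"

definition Vdot :: "field set" where
  "Vdot = V \<inter> Hdot"

text \<open>The Borel sets of \<open>Hdot\<close>. Sets that are open for the \<open>L\<^sup>2\<close> seminorm are unions of classes, so
  this \<open>\<sigma>\<close>-algebra is the Borel \<open>\<sigma>\<close>-algebra of the Hilbert space of classes.\<close>

definition borel_Hdot :: "field measure" where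
  "borel_Hdot = sigma Hdot
     {G. G \<subseteq> Hdot \<and> (\<forall>u\<in>G. \<exists>r>0. \<forall>v\<in>Hdot. l2norm (\<lambda>x. v x - u x) < r \<longrightarrow> v \<in> G)}"


section \<open>Stokes operator and its eigenfunctions\<close>

text \<open>\<open>stokes u f\<close>: \<open>u \<in> D(A)\<close> and \<open>A u = f\<close>. As an operator from \<open>Vdot\<close> to its dual, \<open>A = - P \<Delta>\<close> is
  given by \<open>((A u, v)) = ((\<nabla>u, \<nabla>v))\<close>, and \<open>D(A)\<close> consists of the \<open>u\<close> with \<open>A u\<close> in \<open>Hdot\<close>. (Belonging
  to \<open>H\<^sup>2(\<Omega>) \<inter> V\<close> for the bare cell \<open>\<Omega>\<close> would not encode the Neumann condition and the
  periodicity of the derivatives.)\<close>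

definition stokes :: "field \<Rightarrow> field \<Rightarrow> bool" where
  "stokes u f \<longleftrightarrow> u \<in> Vdot \<and> f \<in> Hdot \<and> (\<forall>v\<in>Vdot. grad_inner u v = l2inner f v)"

text \<open>Besides \<open>k \<ge> 1\<close> with \<open>\<iota> \<in> {1, 2}\<close> we include \<open>k = 0\<close> with \<open>\<iota> = 1\<close>: fields such as
  \<open>(sin (2\<pi>y/Ly), 0, 0)\<close> are Stokes eigenfunctions in \<open>Hdot\<close> that are orthogonal to all modes with
  \<open>k \<ge> 1\<close>, so without them there is no complete system. For \<open>k = 0\<close> the third component vanishes
  and the divergence-free condition leaves a one-dimensional space of constants.\<close>

definition modes :: "mode set" where
  "modes = {(j, l, k, \<iota>). (j \<noteq> 0 \<or> l \<noteq> 0) \<and> (1 \<le> k \<and> \<iota> \<in> {1, 2} \<or> k = 0 \<and> \<iota> = 1)}"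

definition kbar :: "mode \<Rightarrow> real" where
  "kbar = (\<lambda>(j, l, k, \<iota>). sqrt (4 * pi\<^sup>2 * (of_int j)\<^sup>2 / Lx\<^sup>2 + 4 * pi\<^sup>2 * (of_int l)\<^sup>2 / Ly\<^sup>2))"

definition stokes_eigenvalue :: "mode \<Rightarrow> real" where
  "stokes_eigenvalue = (\<lambda>(j, l, k, \<iota>). 4 * pi\<^sup>2 * (of_int j)\<^sup>2 / Lx\<^sup>2 + 4 * pi\<^sup>2 * (of_int l)\<^sup>2 / Ly\<^sup>2
     + (of_nat k)\<^sup>2 * pi\<^sup>2 / h\<^sup>2)"

definition kbar1 :: real where
  "kbar1 = 2 * pi / max Lx Ly"

definition kappa1 :: real where
  "kappa1 = sqrt (4 * pi\<^sup>2 / (max Lx Ly)\<^sup>2 + pi\<^sup>2 / h\<^sup>2)"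

text \<open>Real trigonometric counterparts of \<open>exp(2\<pi>i(jx/Lx + ly/Ly))\<close>. Both the choice
  \<open>cos \<theta>, sin \<theta>\<close> with \<open>\<theta> = 2\<pi>(jx/Lx + ly/Ly)\<close> and the choice of products are admitted.\<close>

definition trig_xy :: "int \<Rightarrow> int \<Rightarrow> (real \<Rightarrow> real \<Rightarrow> real) \<Rightarrow> bool" where
  "trig_xy j l g \<longleftrightarrow> (\<exists>a b c d. \<forall>x y.
     let X = 2 * pi * of_int j * x / Lx; Y = 2 * pi * of_int l * y / Ly in
     g x y = a * cos X * cos Y + b * cos X * sin Y + c * sin X * cos Y + d * sin X * sin Y)"

definition mode_shape :: "mode \<Rightarrow> field \<Rightarrow> bool" where
  "mode_shape = (\<lambda>(j, l, k, \<iota>) u. \<exists>f g q. trig_xy j l f \<and> trig_xy j l g \<and> trig_xy j l q \<and>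
     (\<forall>x\<in>Omega. let Z = of_nat k * pi / h * (x$3 + h/2) in
        u x = vector [f (x$1) (x$2) * cos Z, g (x$1) (x$2) * cos Z, q (x$1) (x$2) * sin Z]))"

definition l2_has_sum :: "(mode \<Rightarrow> field) \<Rightarrow> mode set \<Rightarrow> field \<Rightarrow> bool" where
  "l2_has_sum f S u \<longleftrightarrow> u \<in> L2 \<and>
     ((\<lambda>F. l2norm (\<lambda>x. u x - (\<Sum>m\<in>F. f m x))) \<longlongrightarrow> 0) (finite_subsets_at_top S)"

definition stokes_basis :: "(mode \<Rightarrow> field) \<Rightarrow> bool" where
  "stokes_basis w \<longleftrightarrow>
     (\<forall>m\<in>modes. mode_shape m (w m) \<and> stokes (w m) (\<lambda>x. stokes_eigenvalue m *\<^sub>R w m x)) \<and>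
     (\<forall>m\<in>modes. \<forall>n\<in>modes. l2inner (w m) (w n) = (if m = n then 1 else 0)) \<and>
     (\<forall>u\<in>Hdot. l2_has_sum (\<lambda>m x. l2inner u (w m) *\<^sub>R w m x) modes u)"

text \<open>The component of \<open>u\<close> with horizontal wavenumbers in \<open>[a, b)\<close>, as a sum in \<open>L\<^sup>2\<close>.\<close>

definition band :: "(mode \<Rightarrow> field) \<Rightarrow> real \<Rightarrow> ereal \<Rightarrow> field \<Rightarrow> field" where
  "band w a b u = (SOME r. l2_has_sum (\<lambda>m x. l2inner u (w m) *\<^sub>R w m x)
     {m \<in> modes. a \<le> kbar m \<and> ereal (kbar m) < b} r)"


section \<open>The shear profile and the equation\<close>

text \<open>Since \<open>U\<close> need only be given on the open interval, \<open>U' = 0\<close> at \<open>\<plusminus>h/2\<close> is expressed by one-sided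
  limits.\<close>

definition shear_profile :: "(real \<Rightarrow> real) \<Rightarrow> bool" where
  "shear_profile U \<longleftrightarrow>
     (\<forall>n. \<forall>z\<in>{- h/2<..<h/2}. (deriv ^^ n) U differentiable (at z)) \<and>
     bounded (deriv U ` {- h/2<..<h/2}) \<and>
     (deriv U \<longlongrightarrow> 0) (at_right (- h/2)) \<and> (deriv U \<longlongrightarrow> 0) (at_left (h/2))"

definition shear_rate :: "(real \<Rightarrow> real) \<Rightarrow> real" where
  "shear_rate U = real_of_ereal (esssup (lebesgue_on {- h/2<..<h/2}) (\<lambda>z. ereal \<bar>deriv U z\<bar>))"

definition kappa_s :: "real \<Rightarrow> (real \<Rightarrow> real) \<Rightarrow> real" where
  "kappa_s \<nu> U = sqrt (shear_rate U / \<nu>)"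

text \<open>\<open>(u \<cdot> \<nabla>)v\<close>\<close>

definition conv :: "field \<Rightarrow> field \<Rightarrow> field" where
  "conv u v = (\<lambda>x. \<Sum>i\<in>UNIV. (u x $ i) *\<^sub>R wd i v x)"

text \<open>\<open>U \<partial>\<^sub>x u + w U' e\<^sub>x\<close>, where \<open>w\<close> is the third component of \<open>u\<close>\<close>

definition shear_term :: "(real \<Rightarrow> real) \<Rightarrow> field \<Rightarrow> field" where
  "shear_term U u = (\<lambda>x. U (x$3) *\<^sub>R wd 1 u x + (u x $ 3 * deriv U (x$3)) *\<^sub>R axis 1 1)"

text \<open>The duality product of \<open>F(u)\<close> with \<open>v\<close>, for \<open>u, v \<in> Vdot\<close>. The projector in \<open>B(u,u)\<close>
  disappears because \<open>v\<close> lies in \<open>Hdot\<close>.\<close>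

definition F_pairing :: "real \<Rightarrow> (real \<Rightarrow> real) \<Rightarrow> field \<Rightarrow> field \<Rightarrow> real" where
  "F_pairing \<nu> U u v = - l2inner (shear_term U u) v - \<nu> * grad_inner u v - l2inner (conv u u) v"

end


section \<open>Foias--Prodi stationary statistical solutions\<close>

text \<open>The space of \<open>k\<close>-tuples of reals, with \<open>k\<close> a number, inside \<open>nat \<Rightarrow> real\<close>. The product
  topology of \<open>nat \<Rightarrow> real\<close> induces the usual topology on it.\<close>

definition tuples :: "nat \<Rightarrow> (nat \<Rightarrow> real) set" where
  "tuples k = {x. \<forall>i\<ge>k. x i = 0}"

definition C1_compact_support :: "nat \<Rightarrow> ((nat \<Rightarrow> real) \<Rightarrow> real) \<Rightarrow> bool" where
  "C1_compact_support k \<phi> \<longleftrightarrow>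
     (\<exists>D. \<forall>i<k. continuous_on (tuples k) (D i) \<and>
        (\<forall>x\<in>tuples k. ((\<lambda>t. \<phi> (x(i := t))) has_real_derivative D i x) (at (x i)))) \<and>
     compact (closure {x \<in> tuples k. \<phi> x \<noteq> 0})"

context
  fixes Lx Ly h :: real
begin

definition cylindrical :: "(field \<Rightarrow> real) \<Rightarrow> bool" where
  "cylindrical \<Phi> \<longleftrightarrow> (\<exists>k v \<phi>. (\<forall>j<k. v j \<in> V Lx Ly h) \<and> C1_compact_support k \<phi> \<and>
     \<Phi> = (\<lambda>u. \<phi> (\<lambda>j. if j < k then l2inner Lx Ly h u (v j) else 0)))"

text \<open>\<open>g\<close> represents the Frechet derivative of \<open>\<Phi>\<close> at \<open>u\<close> in the Hilbert space \<open>Hdot\<close>, where the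
  measure lives. For a cylindrical \<open>\<Phi>\<close> it is \<open>\<Sum>\<^sub>j \<partial>\<^sub>j\<phi> P v\<^sub>j\<close> with \<open>P\<close> the projector onto \<open>Hdot\<close>, an
  element of \<open>Vdot\<close>; for \<open>v\<^sub>j \<in> Vdot\<close> this is also the derivative in \<open>H\<close>.\<close>

definition has_gradient :: "(field \<Rightarrow> real) \<Rightarrow> field \<Rightarrow> field \<Rightarrow> bool" where
  "has_gradient \<Phi> u g \<longleftrightarrow> g \<in> Hdot Lx Ly h \<and>
     (\<forall>e>0. \<exists>d>0. \<forall>v\<in>Hdot Lx Ly h. l2norm Lx Ly h v < d \<longrightarrow>
        \<bar>\<Phi> (\<lambda>x. u x + v x) - \<Phi> u - l2inner Lx Ly h g v\<bar> \<le> e * l2norm Lx Ly h v)"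

text \<open>In the first moment condition \<open>\<parallel>\<nabla>u\<parallel> = \<infinity>\<close> off \<open>Vdot\<close>, so that finiteness of the integral
  includes that the measure is carried by \<open>Vdot\<close>.\<close>

definition foias_prodi :: "real \<Rightarrow> (real \<Rightarrow> real) \<Rightarrow> field measure \<Rightarrow> bool" where
  "foias_prodi \<nu> U \<mu> \<longleftrightarrow>
     prob_space \<mu> \<and> space \<mu> = Hdot Lx Ly h \<and> sets \<mu> = sets (borel_Hdot Lx Ly h) \<and>
     (AE u in \<mu>. u \<in> Vdot Lx Ly h) \<and> integrable \<mu> (grad_sq Lx Ly h) \<and>
     (\<forall>\<Phi> G. cylindrical \<Phi> \<and> (\<forall>u\<in>Hdot Lx Ly h. has_gradient \<Phi> u (G u) \<and> G u \<in> Vdot Lx Ly h) \<longrightarrow>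
        (LINT u|\<mu>. F_pairing Lx Ly h \<nu> U u (G u)) = 0) \<and>
     (\<forall>\<psi> \<psi>'. (\<forall>s\<ge>0. 0 \<le> \<psi> s) \<and> mono_on {0..} \<psi> \<and>
        (\<forall>s\<ge>0. (\<psi> has_real_derivative \<psi>' s) (at s within {0..})) \<and>
        continuous_on {0..} \<psi>' \<and> bounded (\<psi>' ` {0..}) \<longrightarrow>
        (LINT u|\<mu>. \<psi>' ((l2norm Lx Ly h u)\<^sup>2) *
           (\<nu> * grad_sq Lx Ly h u + l2inner Lx Ly h (shear_term Lx Ly h U u) u)) \<le> 0)"


section \<open>Mean quantities\<close>

definition dissipation :: "real \<Rightarrow> field measure \<Rightarrow> real" where
  "dissipation \<nu> \<mu> = \<nu> * kappa1 Lx Ly h ^ 3 * (LINT u|\<mu>. grad_sq Lx Ly h u)"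

definition band_dissipation ::
  "real \<Rightarrow> field measure \<Rightarrow> (mode \<Rightarrow> field) \<Rightarrow> real \<Rightarrow> ereal \<Rightarrow> real" where
  "band_dissipation \<nu> \<mu> w a b =
     \<nu> * kappa1 Lx Ly h ^ 3 * (LINT u|\<mu>. grad_sq Lx Ly h (band Lx Ly h w a b u))"

definition taylor_wavenumber :: "field measure \<Rightarrow> (mode \<Rightarrow> field) \<Rightarrow> real \<Rightarrow> real" where
  "taylor_wavenumber \<mu> w \<kappa> =
     sqrt ((LINT u|\<mu>. hgrad_sq Lx Ly h (band Lx Ly h w \<kappa> \<infinity> u)) /
           (LINT u|\<mu>. (l2norm Lx Ly h (band Lx Ly h w \<kappa> \<infinity> u))\<^sup>2))"

definition flux_integrand :: "(mode \<Rightarrow> field) \<Rightarrow> real \<Rightarrow> field \<Rightarrow> real" where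
  "flux_integrand w \<kappa> u = l2inner Lx Ly h (conv Lx Ly h u u) (band Lx Ly h w \<kappa> \<infinity> u)"

text \<open>An ensemble average is defined for integrable quantities only. The integrand is cubic in \<open>u\<close>, so
  its integrability is not among the consequences of the moment condition that the other averages use;
  it has to be required where the flux is used, as the Bochner integral would otherwise be \<open>0\<close>.\<close>

definition energy_flux :: "field measure \<Rightarrow> (mode \<Rightarrow> field) \<Rightarrow> real \<Rightarrow> real" where
  "energy_flux \<mu> w \<kappa> = - (kappa1 Lx Ly h ^ 3) * (LINT u|\<mu>. flux_integrand w \<kappa> u)"

definition singularity_flux :: "field measure \<Rightarrow> (mode \<Rightarrow> field) \<Rightarrow> real" where
  "singularity_flux \<mu> w = Lim at_top (energy_flux \<mu> w)"

definition restricted_flux :: "field measure \<Rightarrow> (mode \<Rightarrow> field) \<Rightarrow> real \<Rightarrow> real" where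
  "restricted_flux \<mu> w \<kappa> = energy_flux \<mu> w \<kappa> - singularity_flux \<mu> w"

end

end

theory Submission
  imports Defs
begin

text \<open>The inequalities come from an energy balance for the modes with horizontal wavenumber at least \<open>\<kappa>\<close>. Write
  \<open>v\<close> for the part of \<open>u\<close> in these modes. Testing stationarity with the kinetic energy of \<open>v\<close> gives,
  formally, the restricted flux as \<open>\<kappa>\<^sub>1\<^sup>3\<close> times the mean of \<open>\<nu> \<parallel>\<nabla>v\<parallel>\<^sup>2 + ((U \<partial>\<^sub>x u + w U' e\<^sub>x, v))\<close>.

  Three facts then give the bounds. Multiplication by a function of \<open>z\<close> does not mix horizontal
  frequencies, so that \<open>u\<close> may be replaced by \<open>v\<close> in the shear term
  (\<open>advection_saturated\<close>, \<open>shear_production_saturated\<close>); \<open>U \<partial>\<^sub>x v\<close> does no work, and what remains,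
  \<open>\<integral> U' v\<^sub>1 v\<^sub>3\<close>, is at most \<open>S/2 \<parallel>v\<parallel>\<^sup>2\<close>. The hypothesis on the Taylor wavenumber turns this into
  a fraction \<open>\<delta>\<close> of the mean dissipation of \<open>v\<close> (\<open>mean_shear_production_bound\<close>). The hypothesis on the
  low modes says that the dissipation of \<open>v\<close> is at least \<open>(1 - \<delta>) \<epsilon>\<close>.

  The substance is the balance itself. The energy of \<open>v\<close> is not a cylindrical function, and the measure
  has a finite second moment of \<open>\<nabla>u\<close> only, whereas the convective term is cubic. Hence the energy of
  finitely many modes with wavenumbers in \<open>[\<kappa>, \<kappa>')\<close> is composed with a cutoff at height \<open>R\<^sup>2\<close>, a
  legitimate test function. Three limits follow.

  \<^item> For fixed \<open>\<kappa>'\<close> and \<open>R\<close>, finitely many modes are replaced by all of them. Domination needs a bound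
    for the convective term that is quadratic in \<open>\<nabla>u\<close>: for a test field with bounded horizontal
    wavenumbers an anisotropic Sobolev inequality gives
    \<open>|((u \<cdot>\<nabla>)u, \<phi>)| \<le> c(\<kappa>') \<parallel>\<phi>\<parallel> \<parallel>\<nabla>u\<parallel>\<^sup>2\<close> (\<open>conv_band_limited_bound\<close>), and the cutoff makes \<open>\<parallel>\<phi>\<parallel> \<le> R\<close>.
  \<^item> As \<open>R\<close> grows, the convective term is a difference of two flux integrands (\<open>flux_split\<close>), which
    are integrable by assumption (\<open>energy_balance_between\<close>).
  \<^item> As \<open>\<kappa>'\<close> grows, only quadratic terms are left; this shows that the flux at infinity exists and
    that its difference to the flux at \<open>\<kappa>\<close> is the stated mean (\<open>restricted_flux_eq\<close>).

  All integrands have to be Borel functions on the phase space, since the integral of any other function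
  is \<open>0\<close> and a vanishing integral would carry no information. The norm of a weak derivative
  is only a lower semicontinuous function of \<open>u\<close> in \<open>L\<^sup>2\<close>, and a square-integrable field need not have
  weak derivatives at all; measurability therefore rests on the closedness of the sublevel sets of \<open>\<parallel>\<partial>\<^sub>i u - g\<parallel>\<close> (\<open>weak_pd_lsc\<close>).\<close>

section \<open>Square-integrable fields on the periodic cell\<close>

text \<open>The optimal \<open>t\<close> is \<open>sqrt (b / a)\<close>; a small \<open>e\<close> is added to both numbers so that the case \<open>a = 0\<close> needs no separate treatment.\<close>

lemma quadratic_bound_imp_product_bound:
  fixes a b c :: real
  assumes "0 \<le> a" "0 \<le> b" and *: "\<And>t. t > 0 \<Longrightarrow> 2 * c \<le> t * a + b / t"
  shows "c \<le> sqrt a * sqrt b"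
proof -
  have **: "c \<le> sqrt (a + e) * sqrt (b + e)" if "e > 0" for e
  proof -
    define t where "t = sqrt (b + e) / sqrt (a + e)"
    have s: "sqrt (a + e) > 0" "sqrt (b + e) > 0" using assms that by auto
    then have t: "t > 0" by (simp add: t_def)
    have "2 * c \<le> t * a + b / t" by (rule *[OF t])
    also have "\<dots> \<le> t * (a + e) + (b + e) / t"
      using t that by (intro add_mono mult_left_mono divide_right_mono) auto
    also have "t * (a + e) = sqrt (b + e) * ((a + e) / sqrt (a + e))" by (simp add: t_def)
    also have "(a + e) / sqrt (a + e) = sqrt (a + e)" by (rule real_div_sqrt) (use assms that in simp)
    also have "(b + e) / t = ((b + e) / sqrt (b + e)) * sqrt (a + e)" by (simp add: t_def)
    also have "(b + e) / sqrt (b + e) = sqrt (b + e)" by (rule real_div_sqrt) (use assms that in simp)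
    finally show ?thesis by (simp add: mult.commute)
  qed
  have "((\<lambda>e. sqrt (a + e) * sqrt (b + e)) \<longlongrightarrow> sqrt (a + 0) * sqrt (b + 0)) (at_right 0)"
    by (intro tendsto_intros) 
  moreover have "eventually (\<lambda>e. c \<le> sqrt (a + e) * sqrt (b + e)) (at_right 0)"
    using eventually_at_right_less[of "0::real"] by eventually_elim (rule **)
  ultimately show ?thesis
    using tendsto_lowerbound by force
qed

locale cell =
  fixes Lx Ly h :: real
  assumes Lx_pos: "0 < Lx" and Ly_pos: "0 < Ly" and h_pos: "0 < h"
begin

abbreviation "Om \<equiv> Omega Lx Ly h"
abbreviation "M \<equiv> lebesgue_on Om"
abbreviation "LL \<equiv> L2 Lx Ly h"
abbreviation "ip \<equiv> l2inner Lx Ly h"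
abbreviation "nrm \<equiv> l2norm Lx Ly h"
abbreviation "wpd \<equiv> weak_pd Lx Ly h"
abbreviation "D \<equiv> wd Lx Ly h"
abbreviation "Sob \<equiv> H1 Lx Ly h"
abbreviation "tst \<equiv> test_function Om"

lemma Omega_eq_box: "Om = box (vector [0, 0, - h/2]) (vector [Lx, Ly, h/2])"
  by (auto simp: Omega_def mem_box_cart forall_3)

lemma open_Omega [simp]: "open Om"
  by (simp add: Omega_eq_box open_box)

lemma Omega_lebesgue [simp, measurable]: "Om \<in> sets lebesgue"
  by (simp add: Omega_eq_box)

lemma Omega_borel [simp, measurable]: "Om \<in> sets borel"
  by (simp add: Omega_eq_box)

lemma space_M [simp]: "space M = Om"
  by simp

lemma finite_measure_M: "finite_measure M"
  unfolding Omega_eq_box by (intro finite_measure_lebesgue_on lmeasurable_box)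

sublocale finite_measure M by (rule finite_measure_M)

lemma L2D: "u \<in> LL \<Longrightarrow> u \<in> borel_measurable M" "u \<in> LL \<Longrightarrow> integrable M (\<lambda>x. (norm (u x))\<^sup>2)"
  by (auto simp: L2_def)

lemma L2I: "u \<in> borel_measurable M \<Longrightarrow> integrable M (\<lambda>x. (norm (u x))\<^sup>2) \<Longrightarrow> u \<in> LL"
  by (auto simp: L2_def)

lemma L2_bounded_by:
  assumes "u \<in> borel_measurable M" "integrable M g" "AE x in M. (norm (u x))\<^sup>2 \<le> g x"
  shows "u \<in> LL"
proof (rule L2I)
  show "integrable M (\<lambda>x. (norm (u x))\<^sup>2)"
    using assms by (intro Bochner_Integration.integrable_bound[OF assms(2)]) (auto elim!: eventually_mono)
qed fact

lemma L2_norm_mult_integrable: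
  assumes "u \<in> LL" "v \<in> LL"
  shows "integrable M (\<lambda>x. norm (u x) * norm (v x))"
proof (rule Bochner_Integration.integrable_bound)
  show "integrable M (\<lambda>x. (norm (u x))\<^sup>2 + (norm (v x))\<^sup>2)" using assms by (simp add: L2D)
  show "(\<lambda>x. norm (u x) * norm (v x)) \<in> borel_measurable M" using assms[THEN L2D(1)] by measurable
  have "norm (u x) * norm (v x) \<le> (norm (u x))\<^sup>2 + (norm (v x))\<^sup>2" for x
    using sum_squares_bound[of "norm (u x)" "norm (v x)"]
      mult_nonneg_nonneg[of "norm (u x)" "norm (v x)"] norm_ge_zero[of "u x"] norm_ge_zero[of "v x"] by linarith
  then show "AE x in M. norm (norm (u x) * norm (v x)) \<le> norm ((norm (u x))\<^sup>2 + (norm (v x))\<^sup>2)"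
    by (auto simp: abs_mult)
qed

lemma L2_inner_integrable:
  assumes "u \<in> LL" "v \<in> LL"
  shows "integrable M (\<lambda>x. u x \<bullet> v x)"
  using assms[THEN L2D(1)]
  by (intro Bochner_Integration.integrable_bound[OF L2_norm_mult_integrable[OF assms]])
     (auto simp: Cauchy_Schwarz_ineq2 intro!: AE_I2)

lemma L2_integrable: "u \<in> LL \<Longrightarrow> integrable M u"
proof -
  assume u: "u \<in> LL"
  have "(\<lambda>x. axis 1 1 :: real^3) \<in> LL" by (rule L2I) auto
  from L2_norm_mult_integrable[OF u this] show "integrable M u"
    using u by (intro Bochner_Integration.integrable_bound[of M "\<lambda>x. norm (u x)" u])
      (auto simp: L2D norm_axis_1)
qed

lemma L2_zero [simp]: "(\<lambda>x. 0) \<in> LL"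
  by (rule L2I) auto

lemma L2_mult_bounded:
  fixes T :: "point \<Rightarrow> real"
  assumes "u \<in> LL" "T \<in> borel_measurable M" "\<And>x. x \<in> Om \<Longrightarrow> \<bar>T x\<bar> \<le> C"
  shows "(\<lambda>x. T x *\<^sub>R u x) \<in> LL"
proof (rule L2_bounded_by)
  show "(\<lambda>x. T x *\<^sub>R u x) \<in> borel_measurable M" using L2D(1)[OF assms(1)] assms(2) by measurable
  show "integrable M (\<lambda>x. C\<^sup>2 * (norm (u x))\<^sup>2)" using assms(1) by (simp add: L2D)
  show "AE x in M. (norm (T x *\<^sub>R u x))\<^sup>2 \<le> C\<^sup>2 * (norm (u x))\<^sup>2"
  proof (rule AE_I2)
    fix x assume "x \<in> space M"
    then have "\<bar>T x\<bar> \<le> \<bar>C\<bar>" using assms(3)[of x] by simp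
    then show "(norm (T x *\<^sub>R u x))\<^sup>2 \<le> C\<^sup>2 * (norm (u x))\<^sup>2"
      by (simp add: power_mult_distrib mult_right_mono flip: abs_le_square_iff)
  qed
qed

lemma L2_scale [intro]: "u \<in> LL \<Longrightarrow> (\<lambda>x. c *\<^sub>R u x) \<in> LL"
  by (rule L2_mult_bounded[of u "\<lambda>_. c" "\<bar>c\<bar>"]) auto

lemma L2_add [intro]: 
  assumes "u \<in> LL" "v \<in> LL" shows "(\<lambda>x. u x + v x) \<in> LL"
proof (rule L2_bounded_by)
  show "(\<lambda>x. u x + v x) \<in> borel_measurable M" using assms[THEN L2D(1)] by measurable
  show "integrable M (\<lambda>x. 2 * (norm (u x))\<^sup>2 + 2 * (norm (v x))\<^sup>2)" using assms by (simp add: L2D)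
  have "(norm (u x + v x))\<^sup>2 \<le> 2 * (norm (u x))\<^sup>2 + 2 * (norm (v x))\<^sup>2" for x
  proof -
    have "(norm (u x + v x))\<^sup>2 \<le> (norm (u x) + norm (v x))\<^sup>2"
      by (intro power_mono norm_triangle_ineq) auto
    also have "\<dots> \<le> 2 * (norm (u x))\<^sup>2 + 2 * (norm (v x))\<^sup>2"
      using sum_squares_bound[of "norm (u x)" "norm (v x)"] by (simp add: power2_sum)
    finally show ?thesis .
  qed
  then show "AE x in M. (norm (u x + v x))\<^sup>2 \<le> 2 * (norm (u x))\<^sup>2 + 2 * (norm (v x))\<^sup>2" by simp
qed

lemma L2_diff [intro]: "u \<in> LL \<Longrightarrow> v \<in> LL \<Longrightarrow> (\<lambda>x. u x - v x) \<in> LL"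
  using L2_add[of u "\<lambda>x. (-1) *\<^sub>R v x"] L2_scale[of v "-1"] by simp

lemma L2_sum [intro]: "(\<And>m. m \<in> F \<Longrightarrow> f m \<in> LL) \<Longrightarrow> (\<lambda>x. \<Sum>m\<in>F. f m x) \<in> LL"
  by (induction F rule: infinite_finite_induct) auto

lemma L2_bounded:
  assumes "u \<in> borel_measurable M" "\<And>x. x \<in> Om \<Longrightarrow> norm (u x) \<le> C"
  shows "u \<in> LL"
  using assms(2) by (intro L2_bounded_by[OF assms(1), of "\<lambda>_. C\<^sup>2"] AE_I2) (auto intro!: power_mono)

lemma ip_commute: "ip u v = ip v u"
  by (simp add: l2inner_def inner_commute)

lemma ip_add_left: "u \<in> LL \<Longrightarrow> v \<in> LL \<Longrightarrow> w \<in> LL \<Longrightarrow> ip (\<lambda>x. u x + v x) w = ip u w + ip v w"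
  by (simp add: l2inner_def inner_add_left L2_inner_integrable)

lemma ip_diff_left: "u \<in> LL \<Longrightarrow> v \<in> LL \<Longrightarrow> w \<in> LL \<Longrightarrow> ip (\<lambda>x. u x - v x) w = ip u w - ip v w"
  by (simp add: l2inner_def inner_diff_left L2_inner_integrable)

lemma ip_scale_left [simp]: "ip (\<lambda>x. c *\<^sub>R u x) w = c * ip u w"
  by (simp add: l2inner_def)

lemma ip_scale_right [simp]: "ip w (\<lambda>x. c *\<^sub>R u x) = c * ip w u"
  by (simp add: l2inner_def)

lemma ip_add_right: "u \<in> LL \<Longrightarrow> v \<in> LL \<Longrightarrow> w \<in> LL \<Longrightarrow> ip w (\<lambda>x. u x + v x) = ip w u + ip w v"
  by (simp add: l2inner_def inner_add_right L2_inner_integrable)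

lemma ip_diff_right: "u \<in> LL \<Longrightarrow> v \<in> LL \<Longrightarrow> w \<in> LL \<Longrightarrow> ip w (\<lambda>x. u x - v x) = ip w u - ip w v"
  by (simp add: l2inner_def inner_diff_right L2_inner_integrable)

lemma ip_sum_left: "(\<And>m. m \<in> F \<Longrightarrow> f m \<in> LL) \<Longrightarrow> w \<in> LL \<Longrightarrow> ip (\<lambda>x. \<Sum>m\<in>F. f m x) w = (\<Sum>m\<in>F. ip (f m) w)"
  by (simp add: l2inner_def inner_sum_left L2_inner_integrable)

lemma ip_sum_right: "(\<And>m. m \<in> F \<Longrightarrow> f m \<in> LL) \<Longrightarrow> w \<in> LL \<Longrightarrow> ip w (\<lambda>x. \<Sum>m\<in>F. f m x) = (\<Sum>m\<in>F. ip w (f m))"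
  by (simp add: l2inner_def inner_sum_right L2_inner_integrable)

lemma ip_cong_AE:
  assumes "AE x in M. u x = u' x" "AE x in M. v x = v' x"
    "u \<in> borel_measurable M" "u' \<in> borel_measurable M" "v \<in> borel_measurable M" "v' \<in> borel_measurable M"
  shows "ip u v = ip u' v'"
  unfolding l2inner_def using assms by (intro integral_cong_AE) auto

lemma ip_self: "ip u u = (LINT x|M. (norm (u x))\<^sup>2)"
  by (simp add: l2inner_def dot_square_norm)

lemma ip_self_nonneg [simp]: "0 \<le> ip u u"
  unfolding l2inner_def by (rule Bochner_Integration.integral_nonneg) simp

lemma nrm_nonneg [simp]: "0 \<le> nrm u"
  by (simp add: l2norm_def)

lemma nrm_sq: "(nrm u)\<^sup>2 = ip u u"
  by (simp add: l2norm_def)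

lemma Cauchy_Schwarz_integral:
  assumes "u \<in> LL" "v \<in> LL"
  shows "(LINT x|M. norm (u x) * norm (v x)) \<le> nrm u * nrm v"
  unfolding l2norm_def
proof (rule quadratic_bound_imp_product_bound)
  fix t :: real assume t: "t > 0"
  have "2 * (LINT x|M. norm (u x) * norm (v x)) = (LINT x|M. 2 * (norm (u x) * norm (v x)))" by simp
  also have "\<dots> \<le> (LINT x|M. t * (norm (u x))\<^sup>2 + (norm (v x))\<^sup>2 / t)"
  proof (rule integral_mono)
    show "integrable M (\<lambda>x. t * (norm (u x))\<^sup>2 + (norm (v x))\<^sup>2 / t)"
      using assms by (simp add: L2D)
    show "integrable M (\<lambda>x. 2 * (norm (u x) * norm (v x)))" using L2_norm_mult_integrable[OF assms] by simp
    fix x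
    have "0 \<le> (t * norm (u x) - norm (v x))\<^sup>2 / t" using t by simp
    also have "\<dots> = t * (norm (u x))\<^sup>2 + (norm (v x))\<^sup>2 / t - 2 * (norm (u x) * norm (v x))"
      using t by (simp add: power2_eq_square field_simps)
    finally show "2 * (norm (u x) * norm (v x)) \<le> t * (norm (u x))\<^sup>2 + (norm (v x))\<^sup>2 / t" by simp
  qed
  also have "\<dots> = t * ip u u + ip v v / t"
    using assms by (simp add: ip_self L2D)
  finally show "2 * (LINT x|M. norm (u x) * norm (v x)) \<le> t * ip u u + ip v v / t" .
qed auto

lemma Cauchy_Schwarz_ip:
  assumes "u \<in> LL" "v \<in> LL"
  shows "\<bar>ip u v\<bar> \<le> nrm u * nrm v"
proof -
  have "\<bar>ip u v\<bar> \<le> (LINT x|M. \<bar>u x \<bullet> v x\<bar>)"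
    unfolding l2inner_def by (rule integral_abs_bound)
  also have "\<dots> \<le> (LINT x|M. norm (u x) * norm (v x))"
    using L2_inner_integrable[OF assms] L2_norm_mult_integrable[OF assms]
    by (intro integral_mono integrable_abs) (auto simp: Cauchy_Schwarz_ineq2)
  finally have "\<bar>ip u v\<bar> \<le> (LINT x|M. norm (u x) * norm (v x))" .
  then show ?thesis using Cauchy_Schwarz_integral[OF assms] by simp
qed

lemma nrm_sq_add:
  assumes "u \<in> LL" "v \<in> LL"
  shows "(nrm (\<lambda>x. u x + v x))\<^sup>2 = (nrm u)\<^sup>2 + 2 * ip u v + (nrm v)\<^sup>2"
  using assms by (simp add: nrm_sq ip_add_left ip_add_right L2_add ip_commute[of v u])

lemma nrm_sq_diff:
  assumes "u \<in> LL" "v \<in> LL"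
  shows "(nrm (\<lambda>x. u x - v x))\<^sup>2 = (nrm u)\<^sup>2 - 2 * ip u v + (nrm v)\<^sup>2"
  using assms by (simp add: nrm_sq ip_diff_left ip_diff_right L2_diff ip_commute[of v u])

lemma nrm_triangle:
  assumes "u \<in> LL" "v \<in> LL"
  shows "nrm (\<lambda>x. u x + v x) \<le> nrm u + nrm v"
proof (rule power2_le_imp_le)
  show "(nrm (\<lambda>x. u x + v x))\<^sup>2 \<le> (nrm u + nrm v)\<^sup>2"
    using Cauchy_Schwarz_ip[OF assms] by (simp add: nrm_sq_add[OF assms] power2_sum)
qed auto

lemma nrm_scale [simp]: "nrm (\<lambda>x. c *\<^sub>R u x) = \<bar>c\<bar> * nrm u"
  by (simp add: l2norm_def real_sqrt_mult)

lemma nrm_minus: "nrm (\<lambda>x. - u x) = nrm u"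
  using nrm_scale[of "-1" u] by simp

lemma nrm_diff_commute: "nrm (\<lambda>x. u x - v x) = nrm (\<lambda>x. v x - u x)"
  using nrm_minus[of "\<lambda>x. u x - v x"] by simp

lemma nrm_triangle_diff:
  assumes "u \<in> LL" "v \<in> LL" "w \<in> LL"
  shows "nrm (\<lambda>x. u x - w x) \<le> nrm (\<lambda>x. u x - v x) + nrm (\<lambda>x. v x - w x)"
  using nrm_triangle[of "\<lambda>x. u x - v x" "\<lambda>x. v x - w x"] assms by (simp add: L2_diff)

lemma nrm_le_add_diff:
  assumes "u \<in> LL" "v \<in> LL"
  shows "nrm u \<le> nrm v + nrm (\<lambda>x. u x - v x)"
  using nrm_triangle[of v "\<lambda>x. u x - v x"] assms by (simp add: L2_diff)

lemma L1_le_nrm: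
  assumes "u \<in> LL"
  shows "(LINT x|M. norm (u x)) \<le> sqrt (measure M Om) * nrm u"
proof -
  have 1: "(\<lambda>x. axis 1 1 :: real^3) \<in> LL" by (rule L2I) auto
  have "nrm (\<lambda>x. axis 1 1) = sqrt (measure M Om)"
    by (simp add: l2norm_def l2inner_def inner_axis_axis)
  then show ?thesis using Cauchy_Schwarz_integral[OF assms 1] by (simp add: norm_axis_1 mult.commute)
qed

lemma nrm_zero_iff:
  assumes "u \<in> LL"
  shows "nrm u = 0 \<longleftrightarrow> (AE x in M. u x = 0)"
  unfolding l2norm_def ip_self real_sqrt_eq_0_iff
  using integral_nonneg_eq_0_iff_AE[OF L2D(2)[OF assms]] by simp

lemma nrm_cong_AE:
  assumes "AE x in M. u x = v x" "u \<in> borel_measurable M" "v \<in> borel_measurable M"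
  shows "nrm u = nrm v"
  unfolding l2norm_def using ip_cong_AE[OF assms(1,1)] assms by simp

lemma nrm_nn: "u \<in> LL \<Longrightarrow> (\<integral>\<^sup>+x. ennreal ((norm (u x))\<^sup>2) \<partial>M) = ennreal ((nrm u)\<^sup>2)"
  by (simp add: nrm_sq ip_self nn_integral_eq_integral L2D)

lemma L2_nnI:
  assumes "u \<in> borel_measurable M" "(\<integral>\<^sup>+x. ennreal ((norm (u x))\<^sup>2) \<partial>M) \<le> ennreal (C\<^sup>2)" "0 \<le> C"
  shows "u \<in> LL" "nrm u \<le> C"
proof -
  show u: "u \<in> LL"
    using assms by (intro L2I integrableI_nonneg) (auto simp: top.not_eq_extremum le_less_trans)
  have "(nrm u)\<^sup>2 \<le> C\<^sup>2" using assms(2) by (simp add: nrm_nn[OF u])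
  then show "nrm u \<le> C" using assms(3) by (rule power2_le_imp_le)
qed

text \<open>On a set of finite measure \<open>L\<^sup>2\<close> convergence implies \<open>L\<^sup>1\<close> convergence, for which almost everywhere convergent subsequences are available.\<close>

lemma L2_limit_AE_subseq:
  assumes "\<And>n. f n \<in> LL" "u \<in> LL" "(\<lambda>n. nrm (\<lambda>x. f n x - u x)) \<longlonglongrightarrow> 0"
  obtains r :: "nat \<Rightarrow> nat" where "strict_mono r" "AE x in M. (\<lambda>n. f (r n) x) \<longlonglongrightarrow> u x"
proof -
  have "(\<lambda>n. LINT x|M. norm (f n x - u x)) \<longlonglongrightarrow> 0"
  proof (rule tendsto_sandwich[OF _ _ tendsto_const])
    show "\<forall>\<^sub>F n in sequentially. (LINT x|M. norm (f n x - u x)) \<le> sqrt (measure M Om) * nrm (\<lambda>x. f n x - u x)"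
      using L1_le_nrm[OF L2_diff[OF assms(1,2)]] by simp
    show "(\<lambda>n. sqrt (measure M Om) * nrm (\<lambda>x. f n x - u x)) \<longlonglongrightarrow> 0"
      using tendsto_mult_left[OF assms(3)] by simp
  qed auto
  from tendsto_L1_AE_subseq[OF L2_integrable[OF L2_diff[OF assms(1,2)]] this] that
  show ?thesis by (auto simp: LIM_zero_iff)
qed

text \<open>Membership in \<open>L\<^sup>2\<close> and a norm bound survive almost everywhere limits, even where norms do not converge.\<close>

lemma L2_Fatou:
  assumes "\<And>n. f n \<in> LL" "u \<in> borel_measurable M" "AE x in M. (\<lambda>n. f n x) \<longlonglongrightarrow> u x"
    "\<And>n. nrm (f n) \<le> C" "0 \<le> C"
  shows "u \<in> LL" "nrm u \<le> C"
proof -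
  have "(\<integral>\<^sup>+x. ennreal ((norm (u x))\<^sup>2) \<partial>M) = (\<integral>\<^sup>+x. liminf (\<lambda>n. ennreal ((norm (f n x))\<^sup>2)) \<partial>M)"
  proof (rule nn_integral_cong_AE, use assms(3) in eventually_elim)
    fix x assume "(\<lambda>n. f n x) \<longlonglongrightarrow> u x"
    then have "(\<lambda>n. ennreal ((norm (f n x))\<^sup>2)) \<longlonglongrightarrow> ennreal ((norm (u x))\<^sup>2)"
      by (intro tendsto_intros)
    from lim_imp_Liminf[OF _ this] show "ennreal ((norm (u x))\<^sup>2) = liminf (\<lambda>n. ennreal ((norm (f n x))\<^sup>2))"
      by simp
  qed
  also have "\<dots> \<le> liminf (\<lambda>n. \<integral>\<^sup>+x. ennreal ((norm (f n x))\<^sup>2) \<partial>M)"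
    using L2D(1)[OF assms(1)] by (intro nn_integral_liminf) measurable
  also have "\<dots> = liminf (\<lambda>n. ennreal ((nrm (f n))\<^sup>2))" by (simp add: nrm_nn[OF assms(1)])
  also have "\<dots> \<le> liminf (\<lambda>n. ennreal (C\<^sup>2))"
    using assms(4,5) by (intro Liminf_mono always_eventually allI ennreal_leI power_mono) auto
  finally have "(\<integral>\<^sup>+x. ennreal ((norm (u x))\<^sup>2) \<partial>M) \<le> ennreal (C\<^sup>2)" by (simp add: Liminf_const)
  from L2_nnI[OF assms(2) this assms(5)] show "u \<in> LL" "nrm u \<le> C" by auto
qed

text \<open>As usual: along a subsequence with summable differences the limit exists almost everywhere, and Fatou's lemma identifies it as the \<open>L\<^sup>2\<close> limit.\<close>

lemma L2_complete:
  assumes f: "\<And>n. f n \<in> LL"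
    and cauchy: "\<And>e. e > 0 \<Longrightarrow> \<exists>N. \<forall>m\<ge>N. \<forall>n\<ge>N. nrm (\<lambda>x. f m x - f n x) < e"
  obtains u where "u \<in> LL" "(\<lambda>n. nrm (\<lambda>x. f n x - u x)) \<longlonglongrightarrow> 0"
proof -
  have "\<exists>N. \<forall>k. \<forall>m\<ge>N k. \<forall>n\<ge>N k. nrm (\<lambda>x. f m x - f n x) < (1/2)^k"
    by (intro choice allI cauchy) simp
  then obtain N0 where N0: "\<And>k m n. m \<ge> N0 k \<Longrightarrow> n \<ge> N0 k \<Longrightarrow> nrm (\<lambda>x. f m x - f n x) < (1/2::real)^k"
    by blast
  define r where "r k = (\<Sum>j\<le>k. N0 j) + k" for k
  have r_ge: "r k \<ge> N0 k" for k unfolding r_def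
    by (simp add: member_le_sum trans_le_add1)
  have r_mono: "strict_mono r" by (auto simp: strict_mono_Suc_iff r_def)
  define d where "d k = (\<lambda>x. f (r (Suc k)) x - f (r k) x)" for k
  have d: "d k \<in> LL" for k by (simp add: d_def L2_diff f)
  have dn: "nrm (d k) \<le> (1/2)^k" for k
    unfolding d_def using r_ge[of k] strict_monoD[OF r_mono, of k "Suc k"] by (intro less_imp_le[OF N0]) auto
  have dm[measurable]: "d k \<in> borel_measurable M" for k using L2D(1)[OF d] .
  let ?s = "sqrt (measure M Om)"
  have "(\<integral>\<^sup>+x. (\<Sum>k. ennreal (norm (d k x))) \<partial>M) = (\<Sum>k. \<integral>\<^sup>+x. ennreal (norm (d k x)) \<partial>M)"
    by (intro nn_integral_suminf) measurable
  also have "\<dots> \<le> (\<Sum>k. ennreal (?s * (1/2)^k))"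
  proof (intro suminf_le)
    show "(\<integral>\<^sup>+x. ennreal (norm (d k x)) \<partial>M) \<le> ennreal (?s * (1/2)^k)" for k
      using L1_le_nrm[OF d[of k]] dn[of k] L2_integrable[OF d[of k]]
      by (subst nn_integral_eq_integral)
         (auto intro!: ennreal_leI order.trans[OF L1_le_nrm[OF d[of k]]] mult_left_mono)
  qed auto
  also have "\<dots> = ennreal (\<Sum>k. ?s * (1/2)^k)"
    by (intro suminf_ennreal2) (auto intro!: summable_mult summable_geometric)
  also have "\<dots> < \<infinity>" by simp
  finally have "AE x in M. (\<Sum>k. ennreal (norm (d k x))) \<noteq> \<infinity>"
    by (intro nn_integral_noteq_infinite) (auto simp del: infinity_ennreal_def)
  then have conv: "AE x in M. convergent (\<lambda>k. f (r k) x)"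
  proof eventually_elim
    case (elim x)
    then have "summable (\<lambda>k. norm (d k x))"
      by (intro summable_suminf_not_top) auto
    then have "summable (\<lambda>k. d k x)" by (rule summable_norm_cancel)
    then have "(\<lambda>n. \<Sum>k<n. d k x) \<longlonglongrightarrow> (\<Sum>k. d k x)" by (rule summable_LIMSEQ)
    moreover have "(\<Sum>k<n. d k x) = f (r n) x - f (r 0) x" for n
      unfolding d_def by (rule sum_lessThan_telescope)
    ultimately have "(\<lambda>n. f (r n) x - f (r 0) x) \<longlonglongrightarrow> (\<Sum>k. d k x)" by simp
    from tendsto_add[OF this tendsto_const[of "f (r 0) x"]] show ?case
      by (auto simp: convergent_def)
  qed
  define u where "u x = lim (\<lambda>k. f (r k) x)" for x
  have fm[measurable]: "f n \<in> borel_measurable M" for n using L2D(1)[OF f] .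
  have um[measurable]: "u \<in> borel_measurable M" unfolding u_def by measurable
  have lim: "AE x in M. (\<lambda>k. f (r k) x) \<longlonglongrightarrow> u x"
    using conv by eventually_elim (simp add: u_def convergent_LIMSEQ_iff)
  have key: "(\<lambda>x. f n x - u x) \<in> LL \<and> nrm (\<lambda>x. f n x - u x) \<le> e"
    if N: "\<forall>m\<ge>N. \<forall>n\<ge>N. nrm (\<lambda>x. f m x - f n x) < e" and n: "n \<ge> N" and e: "e > 0" for n N e
  proof -
    have rr: "r (k + N) \<ge> N" for k using seq_suble[OF r_mono, of "k + N"] by simp
    have 1: "(\<lambda>x. f n x - f (r (k + N)) x) \<in> LL" for k using f by auto
    have 2: "AE x in M. (\<lambda>k. f n x - f (r (k + N)) x) \<longlonglongrightarrow> f n x - u x"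
      using lim by eventually_elim (intro tendsto_diff tendsto_const LIMSEQ_ignore_initial_segment)
    have 3: "nrm (\<lambda>x. f n x - f (r (k + N)) x) \<le> e" for k
      using N n rr[of k] by (intro less_imp_le) blast
    show ?thesis
      using L2_Fatou[OF 1 _ 2 3] e by simp
  qed
  show ?thesis
  proof
    obtain N where N: "\<forall>m\<ge>N. \<forall>n\<ge>N. nrm (\<lambda>x. f m x - f n x) < 1" using cauchy[of 1] by auto
    have "(\<lambda>x. f N x - u x) \<in> LL" using key[OF N] by simp
    from L2_diff[OF f[of N] this] show "u \<in> LL" by simp
    show "(\<lambda>n. nrm (\<lambda>x. f n x - u x)) \<longlonglongrightarrow> 0"
    proof (rule LIMSEQ_I)
      fix e :: real assume "e > 0"
      then obtain N where N: "\<forall>m\<ge>N. \<forall>n\<ge>N. nrm (\<lambda>x. f m x - f n x) < e/2" using cauchy[of "e/2"] by auto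
      show "\<exists>no. \<forall>n\<ge>no. norm (nrm (\<lambda>x. f n x - u x) - 0) < e"
      proof (intro exI[of _ N] allI impI)
        fix n assume "n \<ge> N"
        then have "nrm (\<lambda>x. f n x - u x) \<le> e/2" using key[OF N] \<open>e > 0\<close> by simp
        then show "norm (nrm (\<lambda>x. f n x - u x) - 0) < e" using \<open>e > 0\<close> by simp
      qed
    qed
  qed
qed

lemma ip_tendsto_left:
  assumes "\<And>n. f n \<in> LL" "u \<in> LL" "v \<in> LL" "((\<lambda>n. nrm (\<lambda>x. f n x - u x)) \<longlongrightarrow> 0) F"
  shows "((\<lambda>n. ip (f n) v) \<longlongrightarrow> ip u v) F"
proof -
  have "((\<lambda>n. ip (f n) v - ip u v) \<longlongrightarrow> 0) F"
  proof (rule Lim_null_comparison)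
    show "\<forall>\<^sub>F n in F. norm (ip (f n) v - ip u v) \<le> nrm (\<lambda>x. f n x - u x) * nrm v"
      using Cauchy_Schwarz_ip[OF L2_diff[OF assms(1,2)] assms(3)]
      by (simp add: ip_diff_left assms)
    show "((\<lambda>n. nrm (\<lambda>x. f n x - u x) * nrm v) \<longlongrightarrow> 0) F"
      using tendsto_mult_right[OF assms(4)] by simp
  qed
  then show ?thesis by (simp add: LIM_zero_iff)
qed

lemma nrm_tendsto:
  assumes "\<And>n. f n \<in> LL" "u \<in> LL" "((\<lambda>n. nrm (\<lambda>x. f n x - u x)) \<longlongrightarrow> 0) F"
  shows "((\<lambda>n. nrm (f n)) \<longlongrightarrow> nrm u) F"
proof -
  have "((\<lambda>n. nrm (f n) - nrm u) \<longlongrightarrow> 0) F"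
  proof (rule Lim_null_comparison[OF _ assms(3)])
    have "\<bar>nrm (f n) - nrm u\<bar> \<le> nrm (\<lambda>x. f n x - u x)" for n
      using nrm_le_add_diff[OF assms(1)[of n] assms(2)] nrm_le_add_diff[OF assms(2) assms(1)[of n]]
      by (simp add: nrm_diff_commute[of u])
    then show "\<forall>\<^sub>F n in F. norm (nrm (f n) - nrm u) \<le> nrm (\<lambda>x. f n x - u x)" by simp
  qed
  then show ?thesis by (simp add: LIM_zero_iff)
qed

lemma ip_tendsto:
  assumes "\<And>n. f n \<in> LL" "u \<in> LL" "\<And>n. g n \<in> LL" "v \<in> LL"
    "((\<lambda>n. nrm (\<lambda>x. f n x - u x)) \<longlongrightarrow> 0) F" "((\<lambda>n. nrm (\<lambda>x. g n x - v x)) \<longlongrightarrow> 0) F"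
  shows "((\<lambda>n. ip (f n) (g n)) \<longlongrightarrow> ip u v) F"
proof -
  have 1: "((\<lambda>n. ip (f n) (\<lambda>x. g n x - v x)) \<longlongrightarrow> 0) F"
  proof (rule Lim_null_comparison)
    show "\<forall>\<^sub>F n in F. norm (ip (f n) (\<lambda>x. g n x - v x)) \<le> nrm (f n) * nrm (\<lambda>x. g n x - v x)"
      using Cauchy_Schwarz_ip[OF assms(1) L2_diff[OF assms(3,4)]] by simp
    show "((\<lambda>n. nrm (f n) * nrm (\<lambda>x. g n x - v x)) \<longlongrightarrow> 0) F"
      using tendsto_mult[OF nrm_tendsto[OF assms(1,2,5)] assms(6)] by simp
  qed
  have "((\<lambda>n. ip (f n) (\<lambda>x. g n x - v x) + ip (f n) v) \<longlongrightarrow> 0 + ip u v) F"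
    by (intro tendsto_add 1 ip_tendsto_left assms)
  then show ?thesis by (simp add: ip_diff_right assms)
qed

end

section \<open>Iterated integrals\<close>

lemma vector3_eq_axis: "(vector [a, b, c] :: real^3) = a *\<^sub>R axis 1 1 + b *\<^sub>R axis 2 1 + c *\<^sub>R axis 3 1"
  by (simp add: vec_eq_iff forall_3 axis_def)

lemma vector3_measurable [measurable (raw)]:
  assumes [measurable]: "f \<in> borel_measurable N" "g \<in> borel_measurable N" "k \<in> borel_measurable N"
  shows "(\<lambda>x. vector [f x, g x, k x] :: real^3) \<in> borel_measurable N"
  unfolding vector3_eq_axis by measurable

lemma sigma_finite_lborel_pair: "sigma_finite_measure (lborel \<Otimes>\<^sub>M lborel :: (real \<times> real) measure)"
  by (simp add: lborel_prod sigma_finite_lborel)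

text \<open>Boxes have the same measure on both sides, and they generate the Borel sets.\<close>

lemma lborel_eq_distr_vector3:
  "(lborel :: (real^3) measure) = distr (lborel \<Otimes>\<^sub>M (lborel \<Otimes>\<^sub>M lborel)) borel (\<lambda>(a, b, c). vector [a, b, c])"
proof (rule lborel_eqI)
  fix l u :: "real^3"
  assume le: "\<And>b. b \<in> Basis \<Longrightarrow> l \<bullet> b \<le> u \<bullet> b"
  have le': "l $ i \<le> u $ i" for i using le[of "axis i 1"] by (simp add: inner_axis axis_in_Basis_iff)
  have m: "(\<lambda>(a, b, c). vector [a, b, c] :: real^3) \<in> lborel \<Otimes>\<^sub>M lborel \<Otimes>\<^sub>M lborel \<rightarrow>\<^sub>M borel"
    by measurable
  have "(\<lambda>(a, b, c). vector [a, b, c] :: real^3) -` box l u \<inter> space (lborel \<Otimes>\<^sub>M lborel \<Otimes>\<^sub>M lborel)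
      = {l$1<..<u$1} \<times> ({l$2<..<u$2} \<times> {l$3<..<u$3})"
    by (auto simp: mem_box_cart forall_3 space_pair_measure)
  then have "emeasure (distr (lborel \<Otimes>\<^sub>M (lborel \<Otimes>\<^sub>M lborel)) borel (\<lambda>(a, b, c). vector [a, b, c])) (box l u)
      = emeasure (lborel \<Otimes>\<^sub>M lborel \<Otimes>\<^sub>M lborel) ({l$1<..<u$1} \<times> ({l$2<..<u$2} \<times> {l$3<..<u$3}))"
    using m by (subst emeasure_distr) auto
  also have "\<dots> = ennreal (u$1 - l$1) * (ennreal (u$2 - l$2) * ennreal (u$3 - l$3))"
    by (subst sigma_finite_measure.emeasure_pair_measure_Times[OF sigma_finite_lborel_pair])
       (auto simp: lborel.emeasure_pair_measure_Times le')
  also have "\<dots> = ennreal (\<Prod>i\<in>UNIV. u$i - l$i)"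
  proof -
    have "(\<Prod>i\<in>UNIV. u$i - l$i) = (u$1 - l$1) * ((u$2 - l$2) * (u$3 - l$3))"
      unfolding UNIV_3 by simp
    then show ?thesis using le' by (simp add: ennreal_mult)
  qed
  also have "(\<Prod>i\<in>UNIV. u$i - l$i) = (\<Prod>b\<in>Basis. (u - l) \<bullet> b)"
  proof -
    have B: "Basis = range (\<lambda>i::3. axis i (1::real))" by (auto simp: Basis_vec_def)
    have "inj (\<lambda>i::3. axis i (1::real))" by (auto simp: inj_on_def axis_eq_axis)
    then show ?thesis by (subst B, subst prod.reindex) (auto simp: inner_axis)
  qed
  finally show "emeasure (distr (lborel \<Otimes>\<^sub>M (lborel \<Otimes>\<^sub>M lborel)) borel (\<lambda>(a, b, c). vector [a, b, c])) (box l u)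
      = ennreal (\<Prod>b\<in>Basis. (u - l) \<bullet> b)" .
qed simp

lemma nn_integral_vector3:
  fixes f :: "real^3 \<Rightarrow> ennreal"
  assumes [measurable]: "f \<in> borel_measurable borel"
  shows nn_integral_xyz: "(\<integral>\<^sup>+v. f v \<partial>lborel) = (\<integral>\<^sup>+a. \<integral>\<^sup>+b. \<integral>\<^sup>+c. f (vector [a, b, c]) \<partial>lborel \<partial>lborel \<partial>lborel)"
    and nn_integral_zxy: "(\<integral>\<^sup>+v. f v \<partial>lborel) = (\<integral>\<^sup>+c. \<integral>\<^sup>+a. \<integral>\<^sup>+b. f (vector [a, b, c]) \<partial>lborel \<partial>lborel \<partial>lborel)"
    and nn_integral_zyx: "(\<integral>\<^sup>+v. f v \<partial>lborel) = (\<integral>\<^sup>+c. \<integral>\<^sup>+b. \<integral>\<^sup>+a. f (vector [a, b, c]) \<partial>lborel \<partial>lborel \<partial>lborel)"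
proof -
  have "(\<integral>\<^sup>+v. f v \<partial>lborel) = (\<integral>\<^sup>+p. f (case p of (a, b, c) \<Rightarrow> vector [a, b, c]) \<partial>(lborel \<Otimes>\<^sub>M (lborel \<Otimes>\<^sub>M lborel)))"
    by (subst lborel_eq_distr_vector3, subst nn_integral_distr) auto
  also have "\<dots> = (\<integral>\<^sup>+a. \<integral>\<^sup>+p. f (case p of (b, c) \<Rightarrow> vector [a, b, c]) \<partial>(lborel \<Otimes>\<^sub>M lborel) \<partial>lborel)"
    by (subst sigma_finite_measure.nn_integral_fst[OF sigma_finite_lborel_pair, symmetric]) (auto simp: case_prod_beta)
  also have "\<dots> = (\<integral>\<^sup>+a. \<integral>\<^sup>+b. \<integral>\<^sup>+c. f (vector [a, b, c]) \<partial>lborel \<partial>lborel \<partial>lborel)"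
    by (subst lborel.nn_integral_fst[symmetric]) auto
  finally show xyz: "(\<integral>\<^sup>+v. f v \<partial>lborel) = (\<integral>\<^sup>+a. \<integral>\<^sup>+b. \<integral>\<^sup>+c. f (vector [a, b, c]) \<partial>lborel \<partial>lborel \<partial>lborel)" .
  also have "\<dots> = (\<integral>\<^sup>+a. \<integral>\<^sup>+c. \<integral>\<^sup>+b. f (vector [a, b, c]) \<partial>lborel \<partial>lborel \<partial>lborel)"
    by (intro nn_integral_cong lborel_pair.Fubini') simp
  also have "\<dots> = (\<integral>\<^sup>+c. \<integral>\<^sup>+a. \<integral>\<^sup>+b. f (vector [a, b, c]) \<partial>lborel \<partial>lborel \<partial>lborel)"
    by (rule lborel_pair.Fubini') simp
  finally show "(\<integral>\<^sup>+v. f v \<partial>lborel) = (\<integral>\<^sup>+c. \<integral>\<^sup>+a. \<integral>\<^sup>+b. f (vector [a, b, c]) \<partial>lborel \<partial>lborel \<partial>lborel)" .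
  also have "\<dots> = (\<integral>\<^sup>+c. \<integral>\<^sup>+b. \<integral>\<^sup>+a. f (vector [a, b, c]) \<partial>lborel \<partial>lborel \<partial>lborel)"
    by (intro nn_integral_cong lborel_pair.Fubini') simp
  finally show "(\<integral>\<^sup>+v. f v \<partial>lborel) = (\<integral>\<^sup>+c. \<integral>\<^sup>+b. \<integral>\<^sup>+a. f (vector [a, b, c]) \<partial>lborel \<partial>lborel \<partial>lborel)" .
qed

definition subst_coord :: "3 \<Rightarrow> point \<Rightarrow> real \<Rightarrow> point" where
  "subst_coord i x t = (\<chi> j. if j = i then t else x $ j)"

lemma subst_coord_nth [simp]: "subst_coord i x t $ j = (if j = i then t else x $ j)"
  by (simp add: subst_coord_def)

lemma subst_coord_subst_coord [simp]: "subst_coord i (subst_coord i x s) t = subst_coord i x t"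
  by (simp add: vec_eq_iff)

lemma subst_coord_self [simp]: "subst_coord i x (x $ i) = x"
  by (simp add: vec_eq_iff)

lemma subst_coord_alt: "subst_coord i x t = x + (t - x $ i) *\<^sub>R axis i 1"
  by (simp add: vec_eq_iff axis_def)

lemma continuous_subst_coord [continuous_intros]:
  "continuous_on S f \<Longrightarrow> continuous_on S (\<lambda>t. subst_coord i x (f t))"
  unfolding subst_coord_alt by (intro continuous_intros)

text \<open>Tonelli's theorem in the form used below: an integral over space is determined by its integrals over the lines in any one coordinate direction.\<close>

lemma nn_integral_cong_lines:
  fixes f g :: "real^3 \<Rightarrow> ennreal"
  assumes [measurable]: "f \<in> borel_measurable borel" "g \<in> borel_measurable borel"
    and eq: "\<And>x. (\<integral>\<^sup>+t. f (subst_coord i x t) \<partial>lborel) = (\<integral>\<^sup>+t. g (subst_coord i x t) \<partial>lborel)"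
  shows "(\<integral>\<^sup>+v. f v \<partial>lborel) = (\<integral>\<^sup>+v. g v \<partial>lborel)"
proof -
  consider "i = 1" | "i = 2" | "i = 3" using exhaust_3 by blast
  then show ?thesis
  proof cases
    case 1
    have s: "subst_coord 1 (vector [0, b, c]) a = vector [a, b, c]" for a b c
      by (simp add: vec_eq_iff forall_3)
    have "(\<integral>\<^sup>+a. f (vector [a, b, c]) \<partial>lborel) = (\<integral>\<^sup>+a. g (vector [a, b, c]) \<partial>lborel)" for b c
      using eq[of "vector [0, b, c]"] unfolding 1 s .
    then show ?thesis by (simp add: nn_integral_zyx)
  next
    case 2
    have s: "subst_coord 2 (vector [a, 0, c]) b = vector [a, b, c]" for a b c
      by (simp add: vec_eq_iff forall_3)
    have "(\<integral>\<^sup>+b. f (vector [a, b, c]) \<partial>lborel) = (\<integral>\<^sup>+b. g (vector [a, b, c]) \<partial>lborel)" for a c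
      using eq[of "vector [a, 0, c]"] unfolding 2 s .
    then show ?thesis by (simp add: nn_integral_zxy)
  next
    case 3
    have s: "subst_coord 3 (vector [a, b, 0]) c = vector [a, b, c]" for a b c
      by (simp add: vec_eq_iff forall_3)
    have "(\<integral>\<^sup>+c. f (vector [a, b, c]) \<partial>lborel) = (\<integral>\<^sup>+c. g (vector [a, b, c]) \<partial>lborel)" for a b
      using eq[of "vector [a, b, 0]"] unfolding 3 s .
    then show ?thesis by (simp add: nn_integral_xyz)
  qed
qed

lemma integral_zero_on_lines:
  fixes f :: "real^3 \<Rightarrow> real"
  assumes f: "integrable lborel f"
    and line: "\<And>x. integrable lborel (\<lambda>t. f (subst_coord i x t))"
      "\<And>x. (LINT t|lborel. f (subst_coord i x t)) = 0"
  shows "(LINT x|lborel. f x) = 0"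
proof -
  have [measurable]: "f \<in> borel_measurable borel" using f by auto
  have "(\<integral>\<^sup>+x. ennreal (f x) \<partial>lborel) = (\<integral>\<^sup>+x. ennreal (- f x) \<partial>lborel)"
  proof (rule nn_integral_cong_lines[of _ _ i])
    fix x
    have "enn2real (\<integral>\<^sup>+t. ennreal (f (subst_coord i x t)) \<partial>lborel)
        = enn2real (\<integral>\<^sup>+t. ennreal (- f (subst_coord i x t)) \<partial>lborel)"
      using line(2)[of x] by (simp add: real_lebesgue_integral_def[OF line(1)])
    moreover have "(\<integral>\<^sup>+t. ennreal (f (subst_coord i x t)) \<partial>lborel) \<noteq> \<infinity>"
      "(\<integral>\<^sup>+t. ennreal (- f (subst_coord i x t)) \<partial>lborel) \<noteq> \<infinity>"
      using line(1)[of x] unfolding real_integrable_def by auto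
    ultimately show "(\<integral>\<^sup>+t. ennreal (f (subst_coord i x t)) \<partial>lborel)
        = (\<integral>\<^sup>+t. ennreal (- f (subst_coord i x t)) \<partial>lborel)"
      by (metis ennreal_enn2real_if infinity_ennreal_def)
  qed auto
  then show ?thesis by (simp add: real_lebesgue_integral_def[OF f])
qed

section \<open>Partial derivatives along coordinate lines\<close>

text \<open>Partial derivatives are derivatives of the restrictions to coordinate lines, which reduces their calculus to one variable.\<close>

lemma pd_line:
  fixes f :: "point \<Rightarrow> 'a::real_normed_vector"
  assumes "f differentiable (at (subst_coord i x t))"
  shows "((\<lambda>t. f (subst_coord i x t)) has_vector_derivative pd i f (subst_coord i x t)) (at t within S)"
proof -
  let ?D = "frechet_derivative f (at (subst_coord i x t))"
  have D: "(f has_derivative ?D) (at (subst_coord i x t))"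
    using assms by (simp add: frechet_derivative_works)
  have "((\<lambda>t. subst_coord i x t) has_derivative (\<lambda>s. s *\<^sub>R axis i 1)) (at t within S)"
    unfolding subst_coord_alt by (auto intro!: derivative_eq_intros)
  from has_derivative_in_compose[OF this has_derivative_at_withinI[OF D]]
  have "((\<lambda>t. f (subst_coord i x t)) has_derivative (\<lambda>s. ?D (s *\<^sub>R axis i 1))) (at t within S)" .
  then show ?thesis
    using linear_scale[OF has_derivative_linear[OF D]] by (simp add: has_vector_derivative_def pd_def)
qed

lemma pd_eqI:
  fixes f :: "point \<Rightarrow> 'a::real_normed_vector"
  assumes "f differentiable (at x)" "((\<lambda>t. f (subst_coord i x t)) has_vector_derivative d) (at (x $ i))"
  shows "pd i f x = d"
  using pd_line[of f i x "x $ i" UNIV] assms vector_derivative_unique_at by force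

definition C1 :: "(point \<Rightarrow> 'a::real_normed_vector) \<Rightarrow> bool" where
  "C1 f \<longleftrightarrow> (\<forall>x. f differentiable (at x)) \<and> (\<forall>i. continuous_on UNIV (pd i f))"

lemma smooth_on_pd: "smooth_on S f \<Longrightarrow> smooth_on S (pd i f)"
  unfolding smooth_on_def using Ck_on.simps(2) by blast

lemma smooth_on_imp_C1: "smooth_on UNIV f \<Longrightarrow> C1 f"
  unfolding smooth_on_def C1_def by (metis Ck_on.simps(1) Ck_on.simps(2) UNIV_I)

lemma C1_differentiable: "C1 f \<Longrightarrow> f differentiable (at x)"
  by (simp add: C1_def)

lemma C1_continuous: "C1 f \<Longrightarrow> continuous_on UNIV f"
  by (simp add: C1_def continuous_at_imp_continuous_on differentiable_imp_continuous_within)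

lemma C1_continuous_pd: "C1 f \<Longrightarrow> continuous_on UNIV (pd i f)"
  by (simp add: C1_def)

lemma C1_measurable: "C1 (f :: point \<Rightarrow> 'a::{real_normed_vector,second_countable_topology}) \<Longrightarrow> f \<in> borel_measurable borel"
  by (simp add: C1_continuous borel_measurable_continuous_onI)

lemma C1_measurable_pd: "C1 (f :: point \<Rightarrow> 'a::{real_normed_vector,second_countable_topology}) \<Longrightarrow> pd i f \<in> borel_measurable borel"
  by (simp add: C1_continuous_pd borel_measurable_continuous_onI)

section \<open>Test functions and the fundamental lemma\<close>

text \<open>Products of a polynomial in \<open>1/t\<close> with \<open>exp (- 1/t)\<close>, continued by \<open>0\<close>. The class is closed under differentiation (\<open>flat_deriv\<close> is the effect on the polynomial), which makes smoothness a single induction.\<close>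

definition flatexp :: "real poly \<Rightarrow> real \<Rightarrow> real" where
  "flatexp p t = (if t > 0 then poly p (1/t) * exp (- (1/t)) else 0)"

definition flat_deriv :: "real poly \<Rightarrow> real poly" where
  "flat_deriv p = [:0, 0, 1:] * (p - pderiv p)"

lemma poly_times_exp_tendsto_0: "((\<lambda>s::real. poly p s * exp (- s)) \<longlongrightarrow> 0) at_top"
proof (induction p)
  case (pCons a p)
  have *: "((\<lambda>s. poly q s * s * exp (-s)) \<longlongrightarrow> 0) at_top" for q :: "real poly"
  proof -
    have "((\<lambda>s. \<Sum>i\<le>degree q. coeff q i * (s ^ Suc i / exp s)) \<longlongrightarrow> (\<Sum>i\<le>degree q. coeff q i * 0)) at_top"
      by (intro tendsto_sum tendsto_mult tendsto_const tendsto_power_div_exp_0)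
    moreover have "(\<Sum>i\<le>degree q. coeff q i * (s ^ Suc i / exp s)) = poly q s * s * exp (-s)" for s
      by (simp add: poly_altdef sum_distrib_right exp_minus field_simps sum_distrib_left)
    ultimately show ?thesis by simp
  qed
  have "((\<lambda>s. a * (s ^ 0 / exp s) + poly p s * s * exp (-s)) \<longlongrightarrow> a * 0 + 0) at_top"
    by (intro tendsto_intros * tendsto_power_div_exp_0)
  moreover have "a * (s ^ 0 / exp s) + poly p s * s * exp (-s) = poly (pCons a p) s * exp (-s)" for s
    by (simp add: exp_minus field_simps)
  ultimately show ?case by simp
qed simp

lemma flatexp_has_derivative: "(flatexp p has_real_derivative flatexp (flat_deriv p) t) (at t)"
proof -
  consider "t > 0" | "t < 0" | "t = 0" by linarith
  then show ?thesis
  proof cases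
    case 1
    have "((\<lambda>t. poly p (1/t) * exp (- (1/t))) has_real_derivative flatexp (flat_deriv p) t) (at t)"
    proof -
      have "flatexp (flat_deriv p) t = (poly p (1/t) - poly (pderiv p) (1/t)) * exp (- (1/t)) / (t * t)"
        using 1 by (simp add: flatexp_def flat_deriv_def)
      then show ?thesis using 1
        by (auto intro!: derivative_eq_intros simp: field_simps)
    qed
    moreover have "eventually (\<lambda>s. flatexp p s = poly p (1/s) * exp (- (1/s))) (nhds t)"
      using eventually_nhds_in_open[of "{0<..}" t] 1 by (auto elim!: eventually_mono simp: flatexp_def)
    ultimately show ?thesis by (subst DERIV_cong_ev[OF refl _ refl]) auto
  next
    case 2
    have "eventually (\<lambda>s. flatexp p s = 0) (nhds t)"
      using eventually_nhds_in_open[of "{..<0}" t] 2 by (auto elim!: eventually_mono simp: flatexp_def)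
    then show ?thesis using 2 by (subst DERIV_cong_ev[OF refl _ refl]) (auto simp: flatexp_def)
  next
    case 3
    have "((\<lambda>s. flatexp p s / s) \<longlongrightarrow> 0) (at_right 0)"
    proof -
      have "((\<lambda>s::real. poly (pCons 0 p) (inverse s) * exp (- inverse s)) \<longlongrightarrow> 0) (at_right 0)"
        by (rule filterlim_compose[OF poly_times_exp_tendsto_0 filterlim_inverse_at_top_right])
      moreover have "eventually (\<lambda>s. poly (pCons 0 p) (inverse s) * exp (- inverse s) = flatexp p s / s) (at_right (0::real))"
        by (rule eventually_at_right_less[THEN eventually_mono]) (auto simp: flatexp_def field_simps)
      ultimately show ?thesis by (rule Lim_transform_eventually)
    qed
    moreover have "((\<lambda>s. flatexp p s / s) \<longlongrightarrow> 0) (at_left 0)"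
    proof (rule tendsto_eventually)
      show "eventually (\<lambda>s. flatexp p s / s = 0) (at_left (0::real))"
        by (auto simp: eventually_at_filter flatexp_def)
    qed
    ultimately have "((\<lambda>s. flatexp p s / s) \<longlongrightarrow> 0) (at 0)" by (intro filterlim_split_at)
    then show ?thesis using 3 by (simp add: DERIV_def flatexp_def)
  qed
qed

text \<open>The smallest class that contains the bumps on boxes and is closed under partial derivatives: each coordinate carries one flat factor for either end of its interval.\<close>

inductive flat_comb :: "(point \<Rightarrow> real) \<Rightarrow> bool" where
  prod: "flat_comb (\<lambda>x. \<Prod>i\<in>UNIV. flatexp (p i) (a i * x $ i + b i) * flatexp (q i) (c i * x $ i + d i))"
| add: "flat_comb f \<Longrightarrow> flat_comb g \<Longrightarrow> flat_comb (\<lambda>x. f x + g x)"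
| scale: "flat_comb f \<Longrightarrow> flat_comb (\<lambda>x. r * f x)"

lemma flat_comb_pd: "flat_comb f \<Longrightarrow> (\<forall>x. f differentiable (at x)) \<and> (\<forall>i. flat_comb (pd i f))"
proof (induction rule: flat_comb.induct)
  case (prod p a b q c d)
  let ?f = "\<lambda>x::point. \<Prod>i\<in>UNIV. flatexp (p i) (a i * x $ i + b i) * flatexp (q i) (c i * x $ i + d i)"
  have fl: "(\<lambda>x. flatexp p (a * x $ i + b)) differentiable (at x)" for p a b i and x :: point
  proof -
    have "((\<lambda>x::point. a * x $ i + b) has_derivative (\<lambda>x. a * x $ i)) (at x)"
      by (auto intro!: derivative_eq_intros bounded_linear.has_derivative[OF bounded_linear_vec_nth])
    from has_derivative_compose[OF this flatexp_has_derivative[of p "a * x $ i + b", unfolded has_field_derivative_def]]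
    show ?thesis by (auto simp: differentiable_def)
  qed
  have 1: "?f differentiable (at x)" for x
    unfolding UNIV_3 by (simp, intro differentiable_mult fl)
  moreover have "flat_comb (pd i ?f)" for i
  proof -
    define F where "F p' q' = (\<lambda>x::point. \<Prod>j\<in>UNIV. flatexp (p' j) (a j * x $ j + b j) * flatexp (q' j) (c j * x $ j + d j))" for p' q'
    define p' where "p' = p(i := flat_deriv (p i))"
    define q' where "q' = q(i := flat_deriv (q i))"
    have "pd i ?f x = a i * F p' q x + c i * F p q' x" for x
    proof (rule pd_eqI[OF 1])
      define R where "R = (\<Prod>j\<in>UNIV - {i}. flatexp (p j) (a j * x $ j + b j) * flatexp (q j) (c j * x $ j + d j))"
      have split: "(\<Prod>j\<in>UNIV. k j) = k i * (\<Prod>j\<in>UNIV - {i}. k j)" for k :: "3 \<Rightarrow> real"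
        by (simp add: prod.remove)
      have "(\<lambda>t. ?f (subst_coord i x t)) = (\<lambda>t. flatexp (p i) (a i * t + b i) * flatexp (q i) (c i * t + d i) * R)"
        by (simp add: split R_def)
      moreover have "((\<lambda>t. flatexp p (a * t + b)) has_real_derivative a * flatexp (flat_deriv p) (a * t + b)) (at t)" for p a b t
        by (rule DERIV_chain2[where f = "flatexp p" and g = "\<lambda>t. a * t + b", THEN DERIV_cong])
          (rule flatexp_has_derivative, auto intro!: derivative_eq_intros)
      note this[derivative_intros]
      have "((\<lambda>t. flatexp (p i) (a i * t + b i) * flatexp (q i) (c i * t + d i) * R) has_real_derivative
          a i * F p' q x + c i * F p q' x) (at (x $ i))"
        by (rule derivative_eq_intros refl)+
           (simp add: F_def p'_def q'_def split[of "\<lambda>j. _ j * _ j"] R_def algebra_simps)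
      ultimately show "((\<lambda>t. ?f (subst_coord i x t)) has_vector_derivative a i * F p' q x + c i * F p q' x) (at (x $ i))"
        by (simp add: has_real_derivative_iff_has_vector_derivative)
    qed
    moreover have "flat_comb (\<lambda>x. a i * F p' q x + c i * F p q' x)"
      unfolding F_def by (intro flat_comb.intros)
    ultimately show ?thesis by presburger
  qed
  ultimately show ?case by blast
next
  case (add f g)
  have "pd i (\<lambda>x. f x + g x) = (\<lambda>x. pd i f x + pd i g x)" for i
  proof
    fix x
    show "pd i (\<lambda>x. f x + g x) x = pd i f x + pd i g x"
      using add.IH pd_line[of f i x "x $ i" UNIV] pd_line[of g i x "x $ i" UNIV]
      by (intro pd_eqI) (auto intro!: derivative_intros)
  qed
  then show ?case using add.IH by (auto intro: flat_comb.add)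
next
  case (scale f r)
  have "pd i (\<lambda>x. r * f x) = (\<lambda>x. r * pd i f x)" for i
  proof
    fix x
    show "pd i (\<lambda>x. r * f x) x = r * pd i f x"
      using scale.IH pd_line[of f i x "x $ i" UNIV]
      by (intro pd_eqI) (auto intro!: derivative_intros simp flip: has_real_derivative_iff_has_vector_derivative
           intro: DERIV_cmult)
  qed
  then show ?case using scale.IH by (auto intro: flat_comb.scale)
qed

lemma flat_comb_smooth: "flat_comb f \<Longrightarrow> smooth_on UNIV f"
proof -
  have "flat_comb f \<Longrightarrow> Ck_on n UNIV f" for n
  proof (induction n arbitrary: f)
    case 0
    then show ?case using flat_comb_pd[of f]
      by (auto simp: continuous_at_imp_continuous_on differentiable_imp_continuous_within)
  qed (use flat_comb_pd in auto)
  then show "flat_comb f \<Longrightarrow> smooth_on UNIV f" by (simp add: smooth_on_def)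
qed

text \<open>Bumps whose two flat transitions per coordinate, starting at distance \<open>1/n\<close> from the faces, are sharpened with \<open>n\<close>.\<close>

lemma test_function_box_approx:
  fixes a b :: point
  assumes "box a b \<subseteq> S"
  obtains \<phi> where "\<And>n. test_function S (\<phi> n)" "\<And>n x. \<bar>\<phi> n x\<bar> \<le> 1"
    "\<And>x. (\<lambda>n. \<phi> n x) \<longlonglongrightarrow> indicator (box a b) x"
proof
  define \<phi> where "\<phi> n x = (\<Prod>i\<in>UNIV. flatexp 1 (real (Suc n) * x $ i + (- real (Suc n) * a $ i - 1)) *
      flatexp 1 (- real (Suc n) * x $ i + (real (Suc n) * b $ i - 1)))" for n :: nat and x :: point
  have fl: "0 \<le> flatexp 1 t" "flatexp 1 t \<le> 1" for t by (auto simp: flatexp_def)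
  have cl: "flatexp 1 (real (Suc n) * x $ i + (- real (Suc n) * a $ i - 1)) = 0" if "x $ i < a $ i + 1 / Suc n" for n i and x :: point
  proof -
    have "real (Suc n) * (x $ i - a $ i) < real (Suc n) * (1 / Suc n)" using that by (intro mult_strict_left_mono) auto
    then show ?thesis by (simp add: flatexp_def algebra_simps)
  qed
  have cr: "flatexp 1 (- real (Suc n) * x $ i + (real (Suc n) * b $ i - 1)) = 0" if "x $ i > b $ i - 1 / Suc n" for n i and x :: point
  proof -
    have "real (Suc n) * (b $ i - x $ i) < real (Suc n) * (1 / Suc n)" using that by (intro mult_strict_left_mono) auto
    then show ?thesis by (simp add: flatexp_def algebra_simps)
  qed
  show "test_function S (\<phi> n)" for n
    unfolding test_function_def
  proof
    show "smooth_on UNIV (\<phi> n)"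
      unfolding \<phi>_def using flat_comb_smooth[OF flat_comb.prod] .
    let ?K = "cbox (\<chi> i. a $ i + 1 / Suc n) (\<chi> i. b $ i - 1 / Suc n)"
    have "?K \<subseteq> box a b"
    proof
      fix x assume "x \<in> ?K"
      then have *: "a $ i + 1 / Suc n \<le> x $ i \<and> x $ i \<le> b $ i - 1 / Suc n" for i by (auto simp: mem_box_cart)
      have "0 < 1 / real (Suc n)" by simp
      then have "a $ i < x $ i \<and> x $ i < b $ i" for i using *[of i] by linarith
      then show "x \<in> box a b" by (auto simp: mem_box_cart)
    qed
    moreover have "\<phi> n x = 0" if "x \<notin> ?K" for x
    proof -
      have "\<exists>i. x $ i < a $ i + 1 / Suc n \<or> x $ i > b $ i - 1 / Suc n"
        using that by (auto simp: mem_box_cart not_le)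
      then obtain i where "x $ i < a $ i + 1 / Suc n \<or> x $ i > b $ i - 1 / Suc n" ..
      then show ?thesis using cl[where x = x and i = i and n = n] cr[where x = x and i = i and n = n] unfolding \<phi>_def by (intro prod_zero) auto
    qed
    ultimately show "\<exists>K. compact K \<and> K \<subseteq> S \<and> (\<forall>x. x \<notin> K \<longrightarrow> \<phi> n x = 0)"
      using assms by (intro exI[of _ ?K]) auto
  qed
  show "\<bar>\<phi> n x\<bar> \<le> 1" for n x
    unfolding \<phi>_def abs_prod using fl
    by (intro prod_le_1) (auto simp: abs_mult intro!: mult_le_one)
  have lim: "(\<lambda>n. flatexp 1 (real (Suc n) * s - 1)) \<longlonglongrightarrow> (if s > 0 then 1 else 0)" for s
  proof (cases "s > 0")
    case True
    have f: "filterlim (\<lambda>n. real (Suc n) * s - 1) at_top sequentially"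
      using True by real_asymp
    have "(\<lambda>n. exp (- (1 / (real (Suc n) * s - 1)))) \<longlonglongrightarrow> exp (- 0)"
      by (intro tendsto_intros tendsto_divide_0[OF tendsto_const] filterlim_at_top_imp_at_infinity f)
    moreover have "eventually (\<lambda>n. exp (- (1 / (real (Suc n) * s - 1))) = flatexp 1 (real (Suc n) * s - 1)) sequentially"
      using filterlim_at_top_dense[THEN iffD1, OF f, rule_format, of 0] by eventually_elim (simp add: flatexp_def)
    ultimately show ?thesis using True by (auto intro: Lim_transform_eventually)
  next
    case False
    have "flatexp 1 (real (Suc n) * s - 1) = 0" for n
    proof -
      have "real (Suc n) * s \<le> 0" using False mult_nonneg_nonpos[of "real (Suc n)" s] by simp
      then show ?thesis by (simp add: flatexp_def)
    qed
    then show ?thesis using False by simp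
  qed
  show "(\<lambda>n. \<phi> n x) \<longlonglongrightarrow> indicator (box a b) x" for x
  proof -
    have "\<phi> n x = (\<Prod>i\<in>UNIV. flatexp 1 (real (Suc n) * (x $ i - a $ i) - 1) * flatexp 1 (real (Suc n) * (b $ i - x $ i) - 1))" for n
      unfolding \<phi>_def by (simp add: algebra_simps)
    moreover have "(\<lambda>n. \<Prod>i\<in>UNIV. flatexp 1 (real (Suc n) * (x $ i - a $ i) - 1) * flatexp 1 (real (Suc n) * (b $ i - x $ i) - 1))
       \<longlonglongrightarrow> (\<Prod>i\<in>UNIV. (if x $ i - a $ i > 0 then 1 else 0) * (if b $ i - x $ i > 0 then 1 else 0))"
      by (intro tendsto_prod tendsto_mult lim)
    moreover have "(\<Prod>i\<in>UNIV. (if x $ i - a $ i > 0 then 1 else 0) * (if b $ i - x $ i > 0 then 1 else 0)) = (indicator (box a b) x :: real)"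
    proof -
      have "x \<in> box a b \<longleftrightarrow> (a$1 < x$1 \<and> x$1 < b$1) \<and> (a$2 < x$2 \<and> x$2 < b$2) \<and> (a$3 < x$3 \<and> x$3 < b$3)"
        by (simp add: mem_box_cart forall_3)
      then show ?thesis unfolding UNIV_3 by (simp add: indicator_def)
    qed
    ultimately show ?thesis by simp
  qed
qed

context cell
begin

lemma lebesgue_integral_M:
  fixes f :: "point \<Rightarrow> 'a::{banach, second_countable_topology}"
  assumes "(\<lambda>x. indicator Om x *\<^sub>R f x) \<in> borel_measurable borel"
  shows "(LINT x|M. f x) = (LINT x|lborel. indicator Om x *\<^sub>R f x)"
  using assms by (simp add: integral_restrict_space integral_completion)

lemma integrable_M_iff:
  fixes f :: "point \<Rightarrow> 'a::{banach, second_countable_topology}"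
  assumes "(\<lambda>x. indicator Om x *\<^sub>R f x) \<in> borel_measurable borel"
  shows "integrable M f \<longleftrightarrow> integrable lborel (\<lambda>x. indicator Om x *\<^sub>R f x)"
  using assms by (simp add: integrable_restrict_space integrable_completion)

lemma borel_measurable_M:
  fixes f :: "point \<Rightarrow> 'a::{real_normed_vector, second_countable_topology}"
  assumes "f \<in> borel_measurable borel" shows "f \<in> borel_measurable M"
  using assms by (intro measurable_restrict_space1) (simp add: measurable_completion)

lemma borel_measurable_M':
  fixes f :: "point \<Rightarrow> 'a::{real_normed_vector, second_countable_topology}"
  assumes "(\<lambda>x. indicator Om x *\<^sub>R f x) \<in> borel_measurable borel" shows "f \<in> borel_measurable M"
  using borel_measurable_M[OF assms] by (rule measurable_cong[THEN iffD1, rotated]) simp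

text \<open>The cell is the product of the intervals \<open>(lo i, hi i)\<close>, so that statements for one direction cover all three.\<close>

definition lo :: "3 \<Rightarrow> real" where "lo i = (if i = 3 then - h/2 else 0)"
definition hi :: "3 \<Rightarrow> real" where "hi i = (if i = 1 then Lx else if i = 2 then Ly else h/2)"

lemma lo_less_hi: "lo i < hi i"
  using Lx_pos Ly_pos h_pos by (auto simp: lo_def hi_def)

lemma in_Omega_iff: "x \<in> Om \<longleftrightarrow> (\<forall>i. lo i < x $ i \<and> x $ i < hi i)"
  by (auto simp: Omega_def lo_def hi_def forall_3)

text \<open>On each line the integral of the derivative is the difference of the boundary values.\<close>

lemma integral_derivative_zero:
  fixes g g' :: "point \<Rightarrow> real"
  assumes meas: "(\<lambda>x. indicator Om x * g' x) \<in> borel_measurable borel"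
    and int: "integrable M g'"
    and deriv: "\<And>x t. x \<in> Om \<Longrightarrow> t \<in> {lo i..hi i} \<Longrightarrow>
      ((\<lambda>t. g (subst_coord i x t)) has_real_derivative g' (subst_coord i x t)) (at t within {lo i..hi i})"
    and cont: "\<And>x. x \<in> Om \<Longrightarrow> continuous_on {lo i..hi i} (\<lambda>t. g' (subst_coord i x t))"
    and ends: "\<And>x. x \<in> Om \<Longrightarrow> g (subst_coord i x (lo i)) = g (subst_coord i x (hi i))"
  shows "(LINT x|M. g' x) = 0"
proof -
  have "(LINT x|lborel. indicator Om x * g' x) = 0"
  proof (rule integral_zero_on_lines[of _ i])
    show "integrable lborel (\<lambda>x. indicator Om x * g' x)" using integrable_M_iff[of g'] meas int by simp
    fix x
    have "integrable lborel (\<lambda>t. indicator Om (subst_coord i x t) * g' (subst_coord i x t)) \<and>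
      (LINT t|lborel. indicator Om (subst_coord i x t) * g' (subst_coord i x t)) = 0"
    proof (cases "\<exists>t. subst_coord i x t \<in> Om")
      case False
      then show ?thesis by simp
    next
      case True
      then obtain s where s: "subst_coord i x s \<in> Om" by blast
      define y where "y = subst_coord i x s"
      have y: "y \<in> Om" "\<And>t. subst_coord i x t = subst_coord i y t" using s by (auto simp: y_def)
      have ind: "indicator Om (subst_coord i y t) = (indicator {lo i<..<hi i} t :: real)" for t
        using y(1) by (auto simp: in_Omega_iff indicator_def)
      have 1: "integrable lborel (\<lambda>t. indicator {lo i..hi i} t *\<^sub>R g' (subst_coord i y t))"
        using borel_integrable_compact[OF compact_Icc cont[OF y(1)]] by simp
      have ae: "AE t in lborel. indicator {lo i..hi i} t *\<^sub>R g' (subst_coord i y t) = indicator {lo i<..<hi i} t * g' (subst_coord i y t)"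
        using AE_lborel_singleton[of "lo i"] AE_lborel_singleton[of "hi i"]
        by eventually_elim (auto simp: indicator_def)
      have [measurable]: "(\<lambda>t. indicator {lo i<..<hi i} t * g' (subst_coord i y t)) \<in> borel_measurable lborel"
      proof -
        have "(\<lambda>t. indicator {lo i<..<hi i} t * (indicator {lo i..hi i} t *\<^sub>R g' (subst_coord i y t))) \<in> borel_measurable lborel"
          using 1 by measurable
        also have "(\<lambda>t. indicator {lo i<..<hi i} t * (indicator {lo i..hi i} t *\<^sub>R g' (subst_coord i y t)))
            = (\<lambda>t. indicator {lo i<..<hi i} t * g' (subst_coord i y t))"
          by (auto simp: indicator_def)
        finally show ?thesis .
      qed
      have "(LINT t|lborel. indicator {lo i..hi i} t *\<^sub>R g' (subst_coord i y t)) = g (subst_coord i y (hi i)) - g (subst_coord i y (lo i))"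
        using lo_less_hi[of i] deriv[OF y(1)] cont[OF y(1)]
        by (intro integral_FTC_Icc) (auto simp: has_real_derivative_iff_has_vector_derivative)
      then have 2: "(LINT t|lborel. indicator {lo i..hi i} t *\<^sub>R g' (subst_coord i y t)) = 0" using ends[OF y(1)] by simp
      have "integrable lborel (\<lambda>t. indicator {lo i<..<hi i} t * g' (subst_coord i y t))"
        using integrable_cong_AE[THEN iffD1, OF _ _ ae 1] 1 by simp
      moreover have "(LINT t|lborel. indicator {lo i<..<hi i} t * g' (subst_coord i y t)) = 0"
        using integral_cong_AE[OF _ _ ae] 1 2 by simp
      ultimately show ?thesis by (simp add: y(2) ind)
    qed
    then show "integrable lborel (\<lambda>t. indicator Om (subst_coord i x t) * g' (subst_coord i x t))"
      "(LINT t|lborel. indicator Om (subst_coord i x t) * g' (subst_coord i x t)) = 0" by auto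
  qed
  then show ?thesis using lebesgue_integral_M[of g'] meas by simp
qed

lemma bounded_on_Omega:
  fixes f :: "point \<Rightarrow> 'a::real_normed_vector"
  assumes "continuous_on UNIV f"
  obtains C where "C > 0" "\<And>x. x \<in> Om \<Longrightarrow> norm (f x) \<le> C"
proof -
  let ?K = "cbox (vector [0, 0, - h/2] :: point) (vector [Lx, Ly, h/2])"
  have "bounded (f ` ?K)"
    by (intro compact_imp_bounded compact_continuous_image continuous_on_subset[OF assms]) auto
  then obtain C where "C > 0" "\<forall>y \<in> f ` ?K. norm y \<le> C" unfolding bounded_pos by blast
  moreover have "Om \<subseteq> ?K" unfolding Omega_eq_box by (rule box_subset_cbox)
  ultimately show ?thesis using that by blast
qed

lemma continuous_integrable_M:
  fixes f :: "point \<Rightarrow> 'a::{banach, second_countable_topology}"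
  assumes "continuous_on UNIV f"
  shows "integrable M f"
proof -
  obtain C where "\<And>x. x \<in> Om \<Longrightarrow> norm (f x) \<le> C" using bounded_on_Omega[OF assms] by blast
  then show ?thesis
    using borel_measurable_M[OF borel_measurable_continuous_onI[OF assms]]
    by (intro integrable_const_bound[of _ C]) auto
qed

lemma continuous_L2: "continuous_on UNIV (f :: field) \<Longrightarrow> f \<in> LL"
  using bounded_on_Omega[of f] borel_measurable_M[OF borel_measurable_continuous_onI, of f]
  by (metis L2_bounded)

lemma test_functionD:
  assumes "test_function S \<phi>"
  shows "C1 \<phi>" "\<And>x. x \<notin> S \<Longrightarrow> \<phi> x = 0" "smooth_on UNIV \<phi>"
  using assms by (auto simp: test_function_def smooth_on_imp_C1)

lemma C1_mult_line_derivative: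
  fixes \<phi> :: "point \<Rightarrow> real" and f :: "point \<Rightarrow> 'a::real_normed_vector"
  assumes "C1 \<phi>" "C1 f"
  shows "((\<lambda>t. \<phi> (subst_coord i x t) *\<^sub>R f (subst_coord i x t)) has_vector_derivative
    (\<phi> (subst_coord i x t) *\<^sub>R pd i f (subst_coord i x t) + pd i \<phi> (subst_coord i x t) *\<^sub>R f (subst_coord i x t))) (at t within S)"
  using pd_line[OF C1_differentiable[OF assms(1)], where i = i and x = x and t = t and S = S] pd_line[OF C1_differentiable[OF assms(2)], where i = i and x = x and t = t and S = S]
  by (intro has_vector_derivative_scaleR) (simp_all add: has_real_derivative_iff_has_vector_derivative)

lemma integral_vec_nth:
  fixes f :: "'b \<Rightarrow> real^3"
  assumes "integrable N f" shows "(LINT x|N. f x) $ i = (LINT x|N. f x $ i)"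
  using integral_bounded_linear[OF bounded_linear_vec_nth assms, of i] by simp

text \<open>The product of the field with a test function vanishes at both ends of each line through the cell.\<close>

lemma C1_weak_pd:
  assumes f: "C1 (f :: field)" shows "wpd i f (pd i f)"
  unfolding weak_pd_def
proof (intro allI impI)
  fix \<phi> assume "tst \<phi>"
  then have \<phi>: "C1 \<phi>" "\<And>x. x \<notin> Om \<Longrightarrow> \<phi> x = 0" using test_functionD by blast+
  note cont = C1_continuous[OF f] C1_continuous[OF \<phi>(1)] C1_continuous_pd[OF f, of i] C1_continuous_pd[OF \<phi>(1), of i]
  have int: "integrable M (\<lambda>x. pd i \<phi> x *\<^sub>R f x)" "integrable M (\<lambda>x. \<phi> x *\<^sub>R pd i f x)"
    by (intro continuous_integrable_M continuous_intros cont)+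
  have "(LINT x|M. (\<phi> x *\<^sub>R pd i f x + pd i \<phi> x *\<^sub>R f x) $ j) = 0" for j
  proof (rule integral_derivative_zero[where g = "\<lambda>x. (\<phi> x *\<^sub>R f x) $ j" and i = i])
    have c: "continuous_on UNIV (\<lambda>x. (\<phi> x *\<^sub>R pd i f x + pd i \<phi> x *\<^sub>R f x) $ j)"
      by (intro continuous_intros cont)
    show "(\<lambda>x. indicator Om x * (\<phi> x *\<^sub>R pd i f x + pd i \<phi> x *\<^sub>R f x) $ j) \<in> borel_measurable borel"
      using borel_measurable_continuous_onI[OF c] by measurable
    show "integrable M (\<lambda>x. (\<phi> x *\<^sub>R pd i f x + pd i \<phi> x *\<^sub>R f x) $ j)"
      by (rule continuous_integrable_M[OF c])
    show "((\<lambda>t. (\<phi> (subst_coord i x t) *\<^sub>R f (subst_coord i x t)) $ j) has_real_derivative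
      (\<phi> (subst_coord i x t) *\<^sub>R pd i f (subst_coord i x t) + pd i \<phi> (subst_coord i x t) *\<^sub>R f (subst_coord i x t)) $ j) (at t within {lo i..hi i})" for x t
      using bounded_linear.has_vector_derivative[OF bounded_linear_vec_nth[of j] C1_mult_line_derivative[OF \<phi>(1) f, where i = i and x = x and t = t and S = "{lo i..hi i}"]]
      by (simp add: has_real_derivative_iff_has_vector_derivative)
    show "continuous_on {lo i..hi i} (\<lambda>t. (\<phi> (subst_coord i x t) *\<^sub>R pd i f (subst_coord i x t) +
        pd i \<phi> (subst_coord i x t) *\<^sub>R f (subst_coord i x t)) $ j)" for x
      by (rule continuous_on_compose2[OF c]) (auto intro!: continuous_intros)
    show "(\<phi> (subst_coord i x (lo i)) *\<^sub>R f (subst_coord i x (lo i))) $ j = (\<phi> (subst_coord i x (hi i)) *\<^sub>R f (subst_coord i x (hi i))) $ j" for x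
    proof -
      have "subst_coord i x (lo i) \<notin> Om" "subst_coord i x (hi i) \<notin> Om" by (auto simp: in_Omega_iff intro!: exI[of _ i])
      then show ?thesis by (simp add: \<phi>(2))
    qed
  qed
  then have "(LINT x|M. \<phi> x *\<^sub>R pd i f x + pd i \<phi> x *\<^sub>R f x) = 0"
    unfolding vec_eq_iff integral_vec_nth[OF Bochner_Integration.integrable_add[OF int(2,1)]] by simp
  then have "(LINT x|M. \<phi> x *\<^sub>R pd i f x) + (LINT x|M. pd i \<phi> x *\<^sub>R f x) = 0"
    using int by simp
  then show "(LINT x|M. pd i \<phi> x *\<^sub>R f x) = - (LINT x|M. \<phi> x *\<^sub>R pd i f x)"
    by (simp add: eq_neg_iff_add_eq_0 add.commute)
qed

lemma nn_integral_pos_neg_eq: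
  fixes f :: "'b \<Rightarrow> real"
  assumes f: "integrable N f" and zero: "(LINT x|N. f x) = 0"
  shows "(\<integral>\<^sup>+x. ennreal (f x) \<partial>N) = (\<integral>\<^sup>+x. ennreal (- f x) \<partial>N)"
proof -
  have fin: "(\<integral>\<^sup>+x. ennreal (f x) \<partial>N) < top" "(\<integral>\<^sup>+x. ennreal (- f x) \<partial>N) < top"
    using f unfolding real_integrable_def by (auto simp: top.not_eq_extremum)
  have "enn2real (\<integral>\<^sup>+x. ennreal (f x) \<partial>N) = enn2real (\<integral>\<^sup>+x. ennreal (- f x) \<partial>N)"
    using zero by (simp add: real_lebesgue_integral_def[OF f])
  then have "ennreal (enn2real (\<integral>\<^sup>+x. ennreal (f x) \<partial>N)) = ennreal (enn2real (\<integral>\<^sup>+x. ennreal (- f x) \<partial>N))"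
    by simp
  then show ?thesis using fin by simp
qed

text \<open>Boxes form an intersection-stable generator, so the positive and the negative part of \<open>f\<close> are densities of the same measure.\<close>

lemma integral_boxes_zero_imp_AE_zero:
  fixes f :: "point \<Rightarrow> real"
  assumes f: "integrable lborel f" and box: "\<And>a b. (LINT x|lborel. indicator (box a b) x * f x) = 0"
  shows "AE x in lborel. f x = 0"
proof -
  have [measurable]: "f \<in> borel_measurable borel" using f by auto
  define N1 where "N1 = density lborel (\<lambda>x. ennreal (f x))"
  define N2 where "N2 = density lborel (\<lambda>x. ennreal (- f x))"
  have fin: "(\<integral>\<^sup>+x. ennreal (f x) \<partial>lborel) < \<infinity>" "(\<integral>\<^sup>+x. ennreal (- f x) \<partial>lborel) < \<infinity>"
    using f unfolding real_integrable_def by (auto simp: top.not_eq_extremum)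
  have sets_borel: "sets (borel :: point measure) = sigma_sets UNIV (range (\<lambda>(a, b). box a b))"
    by (subst borel_eq_box) (simp add: sets_measure_of)
  have "N1 = N2"
  proof (rule measure_eqI_generator_eq[where E = "range (\<lambda>(a, b). box a b)" and \<Omega> = UNIV and A = "\<lambda>n::nat. box (- real n *\<^sub>R One) (real n *\<^sub>R One)"])
    show "Int_stable (range (\<lambda>(a, b). box a b :: point set))"
      by (auto simp: Int_stable_def box_Int_box)
    show "emeasure N1 X = emeasure N2 X" if X: "X \<in> range (\<lambda>(a, b). box a b)" for X
    proof -
      obtain a b where X: "X = box a b" using X by auto
      let ?k = "\<lambda>x. indicator X x * f x"
      have k: "integrable lborel ?k" using integrable_mult_indicator[OF _ f, of X] X by simp
      have "(\<integral>\<^sup>+x. ennreal (?k x) \<partial>lborel) = (\<integral>\<^sup>+x. ennreal (- ?k x) \<partial>lborel)"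
        by (rule nn_integral_pos_neg_eq[OF k]) (use box[of a b] X in simp)
      moreover have "ennreal (?k x) = ennreal (f x) * indicator X x" "ennreal (- ?k x) = ennreal (- f x) * indicator X x" for x
        by (auto simp: indicator_def)
      ultimately show ?thesis unfolding N1_def N2_def by (simp add: emeasure_density X)
    qed
    show "sets N1 = sigma_sets UNIV (range (\<lambda>(a, b). box a b))" "sets N2 = sigma_sets UNIV (range (\<lambda>(a, b). box a b))"
      using sets_borel by (simp_all add: N1_def N2_def)
    show "range (\<lambda>n::nat. box (- real n *\<^sub>R One) (real n *\<^sub>R One :: point)) \<subseteq> range (\<lambda>(a, b). box a b)" by auto
    show "(\<Union>n::nat. box (- real n *\<^sub>R One) (real n *\<^sub>R One :: point)) = UNIV"
      using UN_box_eq_UNIV by (simp add: )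
    show "emeasure N1 (box (- real n *\<^sub>R One) (real n *\<^sub>R One)) \<noteq> \<infinity>" for n
    proof -
      have "emeasure N1 (box (- real n *\<^sub>R One) (real n *\<^sub>R One)) \<le> emeasure N1 UNIV"
        by (intro emeasure_mono) (auto simp: N1_def)
      also have "\<dots> < \<infinity>" using fin by (simp add: N1_def emeasure_density)
      finally show ?thesis by simp
    qed
  qed auto
  then have "AE x in lborel. ennreal (f x) = ennreal (- f x)"
    unfolding N1_def N2_def
    by (rule sigma_finite_measure.density_unique_iff[OF sigma_finite_lborel, THEN iffD1, rotated 2]) auto
  then show ?thesis
  proof eventually_elim
    case (elim x)
    then show ?case by (cases "f x \<ge> 0") (auto simp: ennreal_neg ennreal_eq_0_iff)
  qed
qed

text \<open>Test functions approximate indicators of boxes.\<close>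

lemma fundamental_lemma:
  assumes f: "integrable M (f :: point \<Rightarrow> real)" and *: "\<And>\<phi>. tst \<phi> \<Longrightarrow> (LINT x|M. \<phi> x * f x) = 0"
  shows "AE x in M. f x = 0"
proof -
  define F where "F x = indicator Om x * f x" for x
  have F: "integrable lebesgue F"
    unfolding F_def using f by (simp add: integrable_restrict_space)
  then obtain G where G: "G \<in> borel_measurable lborel" "AE x in lborel. F x = G x"
    using completion_ex_borel_measurable_real[of F lborel] by auto
  note [measurable] = G(1)
  have ae: "AE x in lebesgue. F x = G x" using G(2) by (rule AE_completion)
  have G': "integrable lborel G"
    using integrable_cong_AE[THEN iffD1, OF _ _ ae F] F G(1) integrable_completion[of G lborel]
    by (auto simp: measurable_completion)
  have key: "(LINT x|lborel. indicator (box a b) x * G x) = 0" for a b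
  proof -
    have "\<exists>c d. box a b \<inter> Om = box c d"
      unfolding Omega_eq_box box_Int_box by blast
    then obtain c d where cd: "box a b \<inter> Om = box c d" by blast
    obtain \<phi> where \<phi>: "\<And>n. test_function Om (\<phi> n)" "\<And>n x. \<bar>\<phi> n x\<bar> \<le> 1"
      "\<And>x. (\<lambda>n. \<phi> n x) \<longlonglongrightarrow> indicator (box c d) x"
      using test_function_box_approx[of c d Om] cd by blast
    have \<phi>m[measurable]: "\<phi> n \<in> borel_measurable borel" for n
      using C1_measurable test_functionD(1)[OF \<phi>(1)] by blast
    have "(\<lambda>n. LINT x|lborel. \<phi> n x * G x) \<longlonglongrightarrow> (LINT x|lborel. indicator (box c d) x * G x)"
    proof (rule integral_dominated_convergence[where w = "\<lambda>x. \<bar>G x\<bar>"])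
      show "AE x in lborel. (\<lambda>n. \<phi> n x * G x) \<longlonglongrightarrow> indicator (box c d) x * G x"
        by (intro AE_I2 tendsto_mult \<phi> tendsto_const)
      show "AE x in lborel. norm (\<phi> n x * G x) \<le> \<bar>G x\<bar>" for n
        using \<phi>(2) by (intro AE_I2) (auto simp: abs_mult intro: mult_left_le_one_le)
    qed (use G' in auto)
    moreover have "(LINT x|lborel. \<phi> n x * G x) = 0" for n
    proof -
      have "(LINT x|lborel. \<phi> n x * G x) = (LINT x|lebesgue. \<phi> n x * G x)"
        by (simp add: integral_completion)
      also have "\<dots> = (LINT x|lebesgue. \<phi> n x * F x)"
      proof (rule integral_cong_AE)
        have [measurable]: "\<phi> n \<in> borel_measurable lebesgue" "F \<in> borel_measurable lebesgue" "G \<in> borel_measurable lebesgue"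
          using F by (auto simp: measurable_completion)
        show "(\<lambda>x. \<phi> n x * G x) \<in> borel_measurable lebesgue" "(\<lambda>x. \<phi> n x * F x) \<in> borel_measurable lebesgue"
          by measurable
        show "AE x in lebesgue. \<phi> n x * G x = \<phi> n x * F x" using ae by eventually_elim simp
      qed
      also have "\<dots> = (LINT x|M. \<phi> n x * f x)"
        by (simp add: integral_restrict_space F_def ac_simps)
      finally show ?thesis using *[OF \<phi>(1)] by simp
    qed
    ultimately have "(LINT x|lborel. indicator (box c d) x * G x) = 0"
      by (simp add: LIMSEQ_const_iff)
    moreover have "(LINT x|lborel. indicator (box a b) x * G x) = (LINT x|lborel. indicator (box c d) x * G x)"
      using G(2) by (intro integral_cong_AE) (auto elim!: eventually_mono simp: F_def cd[symmetric] indicator_def split: if_splits)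
    ultimately show ?thesis by simp
  qed
  have "AE x in lebesgue. G x = 0"
    using integral_boxes_zero_imp_AE_zero[OF G' key] by (rule AE_completion)
  with ae have "AE x in lebesgue. F x = 0" by eventually_elim simp
  then show ?thesis by (simp add: AE_restrict_space_iff F_def indicator_def)
qed

lemma fundamental_lemma_field:
  assumes f: "f \<in> LL" and *: "\<And>\<phi>. tst \<phi> \<Longrightarrow> (LINT x|M. \<phi> x *\<^sub>R f x) = 0"
  shows "AE x in M. f x = 0"
proof -
  have "AE x in M. f x $ i = 0" for i
  proof (rule fundamental_lemma)
    show "integrable M (\<lambda>x. f x $ i)"
      using integrable_bounded_linear[OF bounded_linear_vec_nth L2_integrable[OF f]] by simp
    fix \<phi> assume \<phi>: "tst \<phi>"
    obtain C where C: "\<And>x. x \<in> Om \<Longrightarrow> \<bar>\<phi> x\<bar> \<le> C"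
      using bounded_on_Omega[OF C1_continuous[OF test_functionD(1)[OF \<phi>]]] by (metis real_norm_def)
    have "integrable M (\<lambda>x. \<phi> x *\<^sub>R f x)"
      by (rule L2_integrable[OF L2_mult_bounded[OF f _ C]])
         (use borel_measurable_M C1_measurable test_functionD(1)[OF \<phi>] in blast)+
    from integral_vec_nth[OF this, of i] *[OF \<phi>] show "(LINT x|M. \<phi> x * f x $ i) = 0" by simp
  qed
  then have "AE x in M. \<forall>i. f x $ i = 0" by (simp add: AE_all_countable)
  then show ?thesis by eventually_elim (simp add: vec_eq_iff)
qed

section \<open>Weak derivatives\<close>

lemma test_mult_L2:
  assumes "tst \<phi>" "u \<in> LL"
  shows "(\<lambda>x. \<phi> x *\<^sub>R u x) \<in> LL" "(\<lambda>x. pd i \<phi> x *\<^sub>R u x) \<in> LL"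
proof -
  note \<phi> = test_functionD(1)[OF assms(1)]
  obtain C where "\<And>x. x \<in> Om \<Longrightarrow> \<bar>\<phi> x\<bar> \<le> C"
    using bounded_on_Omega[OF C1_continuous[OF \<phi>]] by (metis real_norm_def)
  then show "(\<lambda>x. \<phi> x *\<^sub>R u x) \<in> LL"
    by (intro L2_mult_bounded[OF assms(2)] borel_measurable_M C1_measurable[OF \<phi>])
  obtain C where "\<And>x. x \<in> Om \<Longrightarrow> \<bar>pd i \<phi> x\<bar> \<le> C"
    using bounded_on_Omega[OF C1_continuous_pd[OF \<phi>]] by (metis real_norm_def)
  then show "(\<lambda>x. pd i \<phi> x *\<^sub>R u x) \<in> LL"
    by (intro L2_mult_bounded[OF assms(2)] borel_measurable_M C1_measurable_pd[OF \<phi>])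
qed

lemma weak_pdD: "wpd i u g \<Longrightarrow> tst \<phi> \<Longrightarrow> (LINT x|M. pd i \<phi> x *\<^sub>R u x) = - (LINT x|M. \<phi> x *\<^sub>R g x)"
  by (simp add: weak_pd_def)

lemma weak_pd_unique:
  assumes "g \<in> LL" "g' \<in> LL" "wpd i u g" "wpd i u g'"
  shows "AE x in M. g x = g' x"
proof -
  have "AE x in M. g x - g' x = 0"
  proof (rule fundamental_lemma_field[OF L2_diff[OF assms(1,2)]])
    fix \<phi> assume \<phi>: "tst \<phi>"
    note int = L2_integrable[OF test_mult_L2(1)[OF \<phi> assms(1)]] L2_integrable[OF test_mult_L2(1)[OF \<phi> assms(2)]]
    have "- (LINT x|M. \<phi> x *\<^sub>R g x) = - (LINT x|M. \<phi> x *\<^sub>R g' x)"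
      using weak_pdD[OF assms(3) \<phi>] weak_pdD[OF assms(4) \<phi>] by simp
    then show "(LINT x|M. \<phi> x *\<^sub>R (g x - g' x)) = 0"
      using int by (simp add: scaleR_diff_right)
  qed
  then show ?thesis by simp
qed

lemma wd_works: "g \<in> LL \<Longrightarrow> wpd i u g \<Longrightarrow> D i u \<in> LL \<and> wpd i u (D i u)"
  unfolding wd_def by (rule someI[of "\<lambda>g. g \<in> LL \<and> wpd i u g"]) simp

lemma wd_eq_AE: "g \<in> LL \<Longrightarrow> wpd i u g \<Longrightarrow> AE x in M. D i u x = g x"
  using wd_works weak_pd_unique by blast

definition differentiable_dir :: "3 \<Rightarrow> field \<Rightarrow> bool" where
  "differentiable_dir i u \<longleftrightarrow> (\<exists>g\<in>LL. wpd i u g)"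

lemma differentiable_dir_wd: "differentiable_dir i u \<Longrightarrow> D i u \<in> LL" "differentiable_dir i u \<Longrightarrow> wpd i u (D i u)"
  using wd_works by (auto simp: differentiable_dir_def)

lemma Sob_iff: "u \<in> Sob \<longleftrightarrow> u \<in> LL \<and> (\<forall>i. differentiable_dir i u)"
  by (auto simp: H1_def differentiable_dir_def)

lemma SobD: "u \<in> Sob \<Longrightarrow> u \<in> LL" "u \<in> Sob \<Longrightarrow> D i u \<in> LL" "u \<in> Sob \<Longrightarrow> wpd i u (D i u)"
  "u \<in> Sob \<Longrightarrow> differentiable_dir i u"
  using differentiable_dir_wd by (auto simp: Sob_iff)

lemma weak_pd_add:
  assumes "u \<in> LL" "v \<in> LL" "g \<in> LL" "k \<in> LL" "wpd i u g" "wpd i v k"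
  shows "wpd i (\<lambda>x. u x + v x) (\<lambda>x. g x + k x)"
  unfolding weak_pd_def
proof (intro allI impI)
  fix \<phi> assume \<phi>: "tst \<phi>"
  have "(LINT x|M. pd i \<phi> x *\<^sub>R u x) = - (LINT x|M. \<phi> x *\<^sub>R g x)" "(LINT x|M. pd i \<phi> x *\<^sub>R v x) = - (LINT x|M. \<phi> x *\<^sub>R k x)"
    using assms by (auto intro: weak_pdD[OF _ \<phi>])
  then show "(LINT x|M. pd i \<phi> x *\<^sub>R (u x + v x)) = - (LINT x|M. \<phi> x *\<^sub>R (g x + k x))"
    using assms test_mult_L2[OF \<phi>] by (simp add: scaleR_add_right L2_integrable)
qed

lemma weak_pd_scale:
  assumes "wpd i u g"
  shows "wpd i (\<lambda>x. c *\<^sub>R u x) (\<lambda>x. c *\<^sub>R g x)"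
  unfolding weak_pd_def
proof (intro allI impI)
  fix \<phi> assume \<phi>: "tst \<phi>"
  have "(LINT x|M. pd i \<phi> x *\<^sub>R u x) = - (LINT x|M. \<phi> x *\<^sub>R g x)"
    by (rule weak_pdD[OF assms \<phi>])
  then have "c *\<^sub>R (LINT x|M. pd i \<phi> x *\<^sub>R u x) = - (c *\<^sub>R (LINT x|M. \<phi> x *\<^sub>R g x))" by simp
  then show "(LINT x|M. pd i \<phi> x *\<^sub>R c *\<^sub>R u x) = - (LINT x|M. \<phi> x *\<^sub>R c *\<^sub>R g x)"
    by (simp only: scaleR_left_commute[of _ c] integral_scaleR_right)
qed

lemma weak_pd_diff:
  assumes "u \<in> LL" "v \<in> LL" "g \<in> LL" "k \<in> LL" "wpd i u g" "wpd i v k"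
  shows "wpd i (\<lambda>x. u x - v x) (\<lambda>x. g x - k x)"
  using weak_pd_add[of u "\<lambda>x. (-1) *\<^sub>R v x" g "\<lambda>x. (-1) *\<^sub>R k x" i] weak_pd_scale[of i v k "-1"]
    L2_scale[of v "-1"] L2_scale[of k "-1"] assms by simp

lemma weak_pd_zero: "wpd i (\<lambda>x. 0) (\<lambda>x. 0)"
  by (simp add: weak_pd_def)

lemma weak_pd_sum:
  assumes "\<And>m. m \<in> F \<Longrightarrow> u m \<in> LL" "\<And>m. m \<in> F \<Longrightarrow> g m \<in> LL" "\<And>m. m \<in> F \<Longrightarrow> wpd i (u m) (g m)"
  shows "wpd i (\<lambda>x. \<Sum>m\<in>F. u m x) (\<lambda>x. \<Sum>m\<in>F. g m x)"
  using assms
proof (induction F rule: infinite_finite_induct)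
  case (insert m F)
  then show ?case using weak_pd_add[of "u m" "\<lambda>x. \<Sum>m\<in>F. u m x" "g m" "\<lambda>x. \<Sum>m\<in>F. g m x" i]
    by (simp add: L2_sum)
qed (auto simp: weak_pd_zero)

lemma weak_pd_cong_AE:
  assumes "wpd i u g" "AE x in M. u x = u' x" "AE x in M. g x = g' x"
    "u \<in> borel_measurable M" "u' \<in> borel_measurable M" "g \<in> borel_measurable M" "g' \<in> borel_measurable M"
  shows "wpd i u' g'"
  unfolding weak_pd_def
proof (intro allI impI)
  fix \<phi> assume \<phi>: "tst \<phi>"
  have [measurable]: "\<phi> \<in> borel_measurable M" "pd i \<phi> \<in> borel_measurable M"
    using borel_measurable_M C1_measurable C1_measurable_pd test_functionD(1)[OF \<phi>] by blast+
  have "(LINT x|M. pd i \<phi> x *\<^sub>R u x) = (LINT x|M. pd i \<phi> x *\<^sub>R u' x)"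
  proof (rule integral_cong_AE)
    show "AE x in M. pd i \<phi> x *\<^sub>R u x = pd i \<phi> x *\<^sub>R u' x" using assms(2) by eventually_elim simp
  qed (use assms in measurable)
  moreover have "(LINT x|M. \<phi> x *\<^sub>R g x) = (LINT x|M. \<phi> x *\<^sub>R g' x)"
  proof (rule integral_cong_AE)
    show "AE x in M. \<phi> x *\<^sub>R g x = \<phi> x *\<^sub>R g' x" using assms(3) by eventually_elim simp
  qed (use assms in measurable)
  ultimately show "(LINT x|M. pd i \<phi> x *\<^sub>R u' x) = - (LINT x|M. \<phi> x *\<^sub>R g' x)"
    using weak_pdD[OF assms(1) \<phi>] by simp
qed

lemma L2_limit_integral:
  assumes "\<And>n. f n \<in> LL" "u \<in> LL" "(\<lambda>n. nrm (\<lambda>x. f n x - u x)) \<longlonglongrightarrow> 0"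
  shows "(\<lambda>n. LINT x|M. f n x) \<longlonglongrightarrow> (LINT x|M. u x)"
proof (rule vec_tendstoI)
  fix i
  have c: "(\<lambda>x. axis i 1 :: real^3) \<in> LL" by (rule continuous_L2) simp
  have "(LINT x|M. f x) $ i = ip f (\<lambda>x. axis i 1)" if "f \<in> LL" for f
    unfolding integral_vec_nth[OF L2_integrable[OF that]] by (simp add: l2inner_def inner_axis)
  then show "(\<lambda>n. (LINT x|M. f n x) $ i) \<longlonglongrightarrow> (LINT x|M. u x) $ i"
    using ip_tendsto_left[OF assms(1,2) c assms(3)] assms(1,2) by simp
qed

lemma nrm_mult_bounded:
  fixes T :: "point \<Rightarrow> real"
  assumes "u \<in> LL" "T \<in> borel_measurable M" "\<And>x. x \<in> Om \<Longrightarrow> \<bar>T x\<bar> \<le> C"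
  shows "nrm (\<lambda>x. T x *\<^sub>R u x) \<le> \<bar>C\<bar> * nrm u"
proof (rule power2_le_imp_le)
  have "\<bar>T x\<bar> \<le> \<bar>C\<bar>" if "x \<in> Om" for x using assms(3)[OF that] by simp
  then have T2: "(T x)\<^sup>2 \<le> C\<^sup>2" if "x \<in> Om" for x using that by (simp flip: abs_le_square_iff)
  have "(nrm (\<lambda>x. T x *\<^sub>R u x))\<^sup>2 = (LINT x|M. (norm (T x *\<^sub>R u x))\<^sup>2)"
    by (simp add: nrm_sq ip_self)
  also have "\<dots> \<le> (LINT x|M. C\<^sup>2 * (norm (u x))\<^sup>2)"
    using L2D(2)[OF L2_mult_bounded[OF assms]] L2D(2)[OF assms(1)] T2
    by (intro integral_mono) (auto simp: power_mult_distrib mult_right_mono)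
  also have "\<dots> = (\<bar>C\<bar> * nrm u)\<^sup>2"
    by (simp add: nrm_sq ip_self power_mult_distrib)
  finally show "(nrm (\<lambda>x. T x *\<^sub>R u x))\<^sup>2 \<le> (\<bar>C\<bar> * nrm u)\<^sup>2" .
qed simp

text \<open>Both sides of the defining identity are continuous in \<open>L\<^sup>2\<close>.\<close>

lemma weak_pd_closed:
  assumes "\<And>n. f n \<in> LL" "u \<in> LL" "(\<lambda>n. nrm (\<lambda>x. f n x - u x)) \<longlonglongrightarrow> 0"
    "\<And>n. g n \<in> LL" "k \<in> LL" "(\<lambda>n. nrm (\<lambda>x. g n x - k x)) \<longlonglongrightarrow> 0" "\<And>n. wpd i (f n) (g n)"
  shows "wpd i u k"
  unfolding weak_pd_def
proof (intro allI impI)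
  fix \<phi> assume \<phi>: "tst \<phi>"
  have lim: "(\<lambda>n. LINT x|M. T x *\<^sub>R a n x) \<longlonglongrightarrow> (LINT x|M. T x *\<^sub>R b x)"
    if T: "T \<in> borel_measurable M" "\<And>x. x \<in> Om \<Longrightarrow> \<bar>T x\<bar> \<le> C" and a: "\<And>n. a n \<in> LL" "b \<in> LL" "(\<lambda>n. nrm (\<lambda>x. a n x - b x)) \<longlonglongrightarrow> 0"
    for T :: "point \<Rightarrow> real" and a b C
  proof (rule L2_limit_integral)
    show m: "(\<lambda>x. T x *\<^sub>R a n x) \<in> LL" "(\<lambda>x. T x *\<^sub>R b x) \<in> LL" for n
      using L2_mult_bounded[OF _ T] a by auto
    have le: "nrm (\<lambda>x. T x *\<^sub>R a n x - T x *\<^sub>R b x) \<le> \<bar>C\<bar> * nrm (\<lambda>x. a n x - b x)" for n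
      using nrm_mult_bounded[OF L2_diff[OF a(1,2)] T, of n] by (simp add: scaleR_diff_right)
    show "(\<lambda>n. nrm (\<lambda>x. T x *\<^sub>R a n x - T x *\<^sub>R b x)) \<longlonglongrightarrow> 0"
    proof (rule Lim_null_comparison)
      show "\<forall>\<^sub>F n in sequentially. norm (nrm (\<lambda>x. T x *\<^sub>R a n x - T x *\<^sub>R b x)) \<le> \<bar>C\<bar> * nrm (\<lambda>x. a n x - b x)"
        using le by simp
      show "(\<lambda>n. \<bar>C\<bar> * nrm (\<lambda>x. a n x - b x)) \<longlonglongrightarrow> 0"
        using tendsto_mult_left[OF a(3), of "\<bar>C\<bar>"] by simp
    qed
  qed
  note \<phi>1 = test_functionD(1)[OF \<phi>]
  obtain C1 where C1: "\<And>x. x \<in> Om \<Longrightarrow> \<bar>\<phi> x\<bar> \<le> C1"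
    using bounded_on_Omega[OF C1_continuous[OF \<phi>1]] by (metis real_norm_def)
  obtain C2 where C2: "\<And>x. x \<in> Om \<Longrightarrow> \<bar>pd i \<phi> x\<bar> \<le> C2"
    using bounded_on_Omega[OF C1_continuous_pd[OF \<phi>1]] by (metis real_norm_def)
  have 1: "(\<lambda>n. LINT x|M. pd i \<phi> x *\<^sub>R f n x) \<longlonglongrightarrow> (LINT x|M. pd i \<phi> x *\<^sub>R u x)"
    by (rule lim[OF _ C2 assms(1-3)]) (intro borel_measurable_M C1_measurable_pd[OF \<phi>1])
  have 2: "(\<lambda>n. - (LINT x|M. \<phi> x *\<^sub>R g n x)) \<longlonglongrightarrow> - (LINT x|M. \<phi> x *\<^sub>R k x)"
    by (intro tendsto_minus, rule lim[OF _ C1 assms(4-6)]) (intro borel_measurable_M C1_measurable[OF \<phi>1])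
  have "(LINT x|M. pd i \<phi> x *\<^sub>R f n x) = - (LINT x|M. \<phi> x *\<^sub>R g n x)" for n
    by (rule weak_pdD[OF assms(7) \<phi>])
  with 1 2 show "(LINT x|M. pd i \<phi> x *\<^sub>R u x) = - (LINT x|M. \<phi> x *\<^sub>R k x)"
    using LIMSEQ_unique by auto
qed

section \<open>Lower semicontinuity of weak derivatives\<close>

lemma nrm_midpoint:
  assumes "k \<in> LL" "l \<in> LL" "g \<in> LL"
  shows "(nrm (\<lambda>x. k x - l x))\<^sup>2 = 2 * (nrm (\<lambda>x. k x - g x))\<^sup>2 + 2 * (nrm (\<lambda>x. l x - g x))\<^sup>2
    - 4 * (nrm (\<lambda>x. (1/2) *\<^sub>R (k x + l x) - g x))\<^sup>2"
proof -
  let ?k = "\<lambda>x. k x - g x" and ?l = "\<lambda>x. l x - g x"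
  have kl: "?k \<in> LL" "?l \<in> LL" using assms by auto
  have 1: "(\<lambda>x. k x - l x) = (\<lambda>x. ?k x - ?l x)" by auto
  have 2: "(\<lambda>x. (1/2) *\<^sub>R (k x + l x) - g x) = (\<lambda>x. (1/2) *\<^sub>R (?k x + ?l x))"
  proof
    fix x
    have "g x = (1/2) *\<^sub>R g x + (1/2) *\<^sub>R g x" by (simp flip: scaleR_left_distrib)
    then show "(1/2) *\<^sub>R (k x + l x) - g x = (1/2) *\<^sub>R (?k x + ?l x)"
      by (simp add: algebra_simps)
  qed
  show ?thesis unfolding 1 2 nrm_scale power_mult_distrib nrm_sq_diff[OF kl] nrm_sq_add[OF kl] by (simp add: power2_eq_square field_simps)
qed

text \<open>The reflexivity argument for lower semicontinuity, made elementary. Among the admissible derivatives of fields within \<open>1/n\<close> of \<open>u\<close> consider the infimum of the distance to \<open>g\<close>. Near-minimisers are Cauchy by the parallelogram identity, because midpoints stay admissible; closedness of the derivative applies to their limit.\<close>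

lemma weak_pd_lsc:
  assumes u: "u \<in> LL" and g: "g \<in> LL" and C: "0 \<le> C"
    and approx: "\<And>e. e > 0 \<Longrightarrow> \<exists>v k. v \<in> LL \<and> k \<in> LL \<and> wpd i v k \<and> nrm (\<lambda>x. v x - u x) \<le> e \<and> nrm (\<lambda>x. k x - g x) \<le> C"
  obtains k where "k \<in> LL" "wpd i u k" "nrm (\<lambda>x. k x - g x) \<le> C"
proof -
  define S where "S n = {k. k \<in> LL \<and> nrm (\<lambda>x. k x - g x) \<le> C \<and>
      (\<exists>v\<in>LL. wpd i v k \<and> nrm (\<lambda>x. v x - u x) \<le> 1 / Suc n)}" for n :: nat
  define d where "d n = (INF k\<in>S n. (nrm (\<lambda>x. k x - g x))\<^sup>2)" for n
  have ne: "S n \<noteq> {}" for n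
  proof -
    obtain v k where "v \<in> LL" "k \<in> LL" "wpd i v k" "nrm (\<lambda>x. v x - u x) \<le> 1 / Suc n" "nrm (\<lambda>x. k x - g x) \<le> C"
      using approx[of "1 / Suc n"] by auto
    then have "k \<in> S n" unfolding S_def by blast
    then show ?thesis by blast
  qed
  have bdd: "bdd_below ((\<lambda>k. (nrm (\<lambda>x. k x - g x))\<^sup>2) ` S n)" for n
    by (rule bdd_belowI[of _ 0]) auto
  \<comment> \<open>The constraints tighten with \<open>n\<close>, so the infima increase; they converge because \<open>C\<^sup>2\<close> bounds them.\<close>
  have anti: "S m \<subseteq> S n" if "n \<le> m" for n m
  proof -
    have "1 / real (Suc m) \<le> 1 / real (Suc n)" using that by (simp add: frac_le)
    then show ?thesis unfolding S_def by (auto intro: order_trans)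
  qed
  have d_mono: "d n \<le> d m" if "n \<le> m" for n m
    unfolding d_def by (rule cINF_superset_mono[OF ne bdd anti[OF that]]) simp
  have d_le: "d n \<le> C\<^sup>2" for n
  proof -
    obtain k where k: "k \<in> S n" using ne by blast
    have "d n \<le> (nrm (\<lambda>x. k x - g x))\<^sup>2" unfolding d_def by (rule cINF_lower[OF bdd k])
    also have "\<dots> \<le> C\<^sup>2" using k by (intro power_mono) (auto simp: S_def)
    finally show ?thesis .
  qed
  have "\<exists>k. k \<in> S n \<and> (nrm (\<lambda>x. k x - g x))\<^sup>2 \<le> d n + 1 / Suc n" for n
  proof -
    have "d n < d n + 1 / Suc n" by simp
    then obtain k where "k \<in> S n" "(nrm (\<lambda>x. k x - g x))\<^sup>2 < d n + 1 / Suc n"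
      unfolding d_def using cINF_less_iff[OF ne bdd] by blast
    then show ?thesis by (auto intro: less_imp_le)
  qed
  then obtain k where k: "\<And>n. k n \<in> S n" "\<And>n. (nrm (\<lambda>x. k n x - g x))\<^sup>2 \<le> d n + 1 / Suc n"
    by metis
  then have "\<forall>n. \<exists>v. v \<in> LL \<and> wpd i v (k n) \<and> nrm (\<lambda>x. v x - u x) \<le> 1 / Suc n"
    unfolding S_def by blast
  then obtain v where v: "\<And>n. v n \<in> LL" "\<And>n. wpd i (v n) (k n)" "\<And>n. nrm (\<lambda>x. v n x - u x) \<le> 1 / Suc n"
    by metis
  have kL: "k n \<in> LL" and kC: "nrm (\<lambda>x. k n x - g x) \<le> C" for n using k(1)[of n] by (auto simp: S_def)
  \<comment> \<open>Midpoints stay admissible, so near-minimisers are close to each other.\<close>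
  have close: "(nrm (\<lambda>x. k m x - k n x))\<^sup>2 \<le> 2 * (d m - d n) + 4 / Suc n" if "n \<le> m" for n m
  proof -
    define mid where "mid x = (1/2) *\<^sub>R (k m x + k n x)" for x
    define vmid where "vmid x = (1/2) *\<^sub>R (v m x + v n x)" for x
    have half: "(1/2) *\<^sub>R (a + b) - c = (1/2) *\<^sub>R ((a - c) + (b - c))" for a b c :: point
    proof -
      have "c = (1/2) *\<^sub>R c + (1/2) *\<^sub>R c" by (simp flip: scaleR_left_distrib)
      then show ?thesis by (simp add: algebra_simps)
    qed
    have avg: "nrm (\<lambda>x. (1/2) *\<^sub>R (a x + b x) - c x) \<le> e"
      if "a \<in> LL" "b \<in> LL" "c \<in> LL" "nrm (\<lambda>x. a x - c x) \<le> e" "nrm (\<lambda>x. b x - c x) \<le> e" for a b c e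
    proof -
      have "nrm (\<lambda>x. (1/2) *\<^sub>R (a x + b x) - c x) = (1/2) * nrm (\<lambda>x. (a x - c x) + (b x - c x))"
        unfolding half nrm_scale by simp
      also have "\<dots> \<le> (1/2) * (nrm (\<lambda>x. a x - c x) + nrm (\<lambda>x. b x - c x))"
        using nrm_triangle[of "\<lambda>x. a x - c x" "\<lambda>x. b x - c x"] that by (simp add: L2_diff)
      finally show ?thesis using that by simp
    qed
    have "1 / real (Suc m) \<le> 1 / real (Suc n)" using that by (simp add: frac_le)
    then have vm: "nrm (\<lambda>x. v m x - u x) \<le> 1 / Suc n" using v(3)[of m] by linarith
    have "mid \<in> S n"
      unfolding S_def mem_Collect_eq
    proof (intro conjI bexI[of _ vmid])
      show "mid \<in> LL" "vmid \<in> LL" unfolding mid_def vmid_def using kL v by (auto intro!: L2_scale L2_add)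
      show "nrm (\<lambda>x. mid x - g x) \<le> C" unfolding mid_def by (rule avg[OF kL kL g kC kC])
      show "nrm (\<lambda>x. vmid x - u x) \<le> 1 / Suc n" unfolding vmid_def by (rule avg[OF v(1) v(1) u vm v(3)])
      show "wpd i vmid mid" unfolding mid_def vmid_def by (intro weak_pd_scale weak_pd_add v kL)
    qed
    then have "d n \<le> (nrm (\<lambda>x. mid x - g x))\<^sup>2" unfolding d_def by (rule cINF_lower[OF bdd])
    moreover have "(nrm (\<lambda>x. k m x - k n x))\<^sup>2 = 2 * (nrm (\<lambda>x. k m x - g x))\<^sup>2 + 2 * (nrm (\<lambda>x. k n x - g x))\<^sup>2
        - 4 * (nrm (\<lambda>x. mid x - g x))\<^sup>2"
      unfolding mid_def by (rule nrm_midpoint[OF kL kL g])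
    moreover have "(nrm (\<lambda>x. k m x - g x))\<^sup>2 \<le> d m + 1 / Suc n"
      using k(2)[of m] \<open>1 / real (Suc m) \<le> 1 / real (Suc n)\<close> by linarith
    ultimately show ?thesis using k(2)[of n] by simp
  qed
  obtain L where "d \<longlonglongrightarrow> L"
    by (rule incseq_convergent[of d "C\<^sup>2"]) (use d_mono d_le in \<open>auto simp: incseq_def\<close>)
  then have dC: "Cauchy d" by (rule LIMSEQ_imp_Cauchy)
  have cauchy: "\<exists>N. \<forall>m\<ge>N. \<forall>n\<ge>N. nrm (\<lambda>x. k m x - k n x) < e" if e: "e > 0" for e
  proof -
    have e2: "e\<^sup>2 / 8 > 0" using e by simp
    obtain N1 where N1: "\<And>m n. m \<ge> N1 \<Longrightarrow> n \<ge> N1 \<Longrightarrow> \<bar>d m - d n\<bar> < e\<^sup>2 / 8"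
      using dC e2 unfolding Cauchy_def dist_real_def by meson
    obtain N2 where N2: "inverse (real (Suc N2)) < e\<^sup>2 / 8" using reals_Archimedean[OF e2] by blast
    have main: "nrm (\<lambda>x. k m x - k n x) < e" if "n \<ge> max N1 N2" "n \<le> m" for m n
    proof (rule power2_less_imp_less)
      have "1 / real (Suc n) \<le> 1 / real (Suc N2)" using that by (simp add: frac_le)
      then have "4 / real (Suc n) < e\<^sup>2 / 2" using N2 by (simp add: inverse_eq_divide)
      moreover have "\<bar>d m - d n\<bar> < e\<^sup>2 / 8" using N1[of m n] that by auto
      then have "d m - d n < e\<^sup>2 / 8" by linarith
      ultimately have *: "4 / real (Suc n) < e\<^sup>2 / 2" "2 * (d m - d n) < e\<^sup>2 / 4" by simp_all
      have "(nrm (\<lambda>x. k m x - k n x))\<^sup>2 \<le> 2 * (d m - d n) + 4 / real (Suc n)" by (rule close[OF that(2)])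
      also have "\<dots> < e\<^sup>2 / 4 + e\<^sup>2 / 2" by (rule add_strict_mono[OF *(2,1)])
      also have "\<dots> \<le> e\<^sup>2" by simp
      finally show "(nrm (\<lambda>x. k m x - k n x))\<^sup>2 < e\<^sup>2" .
    qed (use e in simp)
    show ?thesis
    proof (intro exI[of _ "max N1 N2"] allI impI)
      fix m n assume "m \<ge> max N1 N2" "n \<ge> max N1 N2"
      then show "nrm (\<lambda>x. k m x - k n x) < e"
        using main[of n m] main[of m n] nrm_diff_commute[of "k m" "k n"] by (cases "n \<le> m") auto
    qed
  qed
  obtain l where l: "l \<in> LL" "(\<lambda>n. nrm (\<lambda>x. k n x - l x)) \<longlonglongrightarrow> 0"
    using L2_complete[OF kL cauchy] by blast
  have vlim: "(\<lambda>n. nrm (\<lambda>x. v n x - u x)) \<longlonglongrightarrow> 0"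
  proof (rule Lim_null_comparison)
    show "\<forall>\<^sub>F n in sequentially. norm (nrm (\<lambda>x. v n x - u x)) \<le> 1 / Suc n" using v(3) by simp
    show "(\<lambda>n. 1 / real (Suc n)) \<longlonglongrightarrow> 0" using LIMSEQ_Suc[OF lim_1_over_n] by simp
  qed
  have "wpd i u l" by (rule weak_pd_closed[OF v(1) u vlim kL l v(2)])
  moreover have "nrm (\<lambda>x. l x - g x) \<le> C"
  proof (rule LIMSEQ_le_const2)
    have "(\<lambda>n. nrm (\<lambda>x. (k n x - g x) - (l x - g x))) \<longlonglongrightarrow> 0" using l(2) by simp
    from nrm_tendsto[OF L2_diff[OF kL g] L2_diff[OF l(1) g] this]
    show "(\<lambda>n. nrm (\<lambda>x. k n x - g x)) \<longlonglongrightarrow> nrm (\<lambda>x. l x - g x)" .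
    show "\<exists>N. \<forall>n\<ge>N. nrm (\<lambda>x. k n x - g x) \<le> C" using kC by blast
  qed
  ultimately show ?thesis using that l(1) by blast
qed

section \<open>Anisotropic Sobolev inequalities for smooth fields\<close>

text \<open>One constant for all directions: the reciprocal of a side length enters whenever a supremum along a line is bounded by integrals.\<close>

definition cell_const :: real where "cell_const = 1 + (\<Sum>i\<in>UNIV. 1 / (hi i - lo i))"

lemma cell_const: "1 / (hi i - lo i) \<le> cell_const" "1 \<le> cell_const"
proof -
  have p: "0 \<le> 1 / (hi j - lo j)" for j using lo_less_hi[of j] by simp
  show "1 \<le> cell_const" unfolding cell_const_def using p by (simp add: sum_nonneg)
  have "1 / (hi i - lo i) \<le> (\<Sum>i\<in>UNIV. 1 / (hi i - lo i))" using p by (intro member_le_sum) auto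
  then show "1 / (hi i - lo i) \<le> cell_const" by (simp add: cell_const_def)
qed

text \<open>An upper bound for the integrand in the one-dimensional inequality \<open>sup q \<le> (1/L) \<integral> q + \<integral> |q'|\<close> for \<open>q = |f|\<^sup>2\<close>.\<close>

definition line_energy :: "3 \<Rightarrow> field \<Rightarrow> point \<Rightarrow> real" where
  "line_energy i f x = 2 * cell_const * (norm (f x) * (norm (f x) + norm (pd i f x)))"

lemma line_energy_nonneg: "0 \<le> line_energy i f x"
  using cell_const(2) by (simp add: line_energy_def)

lemma line_energy_le: "line_energy i f x \<le> 4 * cell_const * ((norm (f x))\<^sup>2 + (norm (pd i f x))\<^sup>2)"
proof -
  let ?a = "norm (f x)" and ?b = "norm (pd i f x)"
  have "0 \<le> (?a - ?b)\<^sup>2" by simp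
  then have "2 * (?a * ?b) \<le> ?a * ?a + ?b * ?b" by (simp add: power2_eq_square algebra_simps)
  moreover have "0 \<le> ?a * ?a" "0 \<le> ?b * ?b" by auto
  ultimately have "?a * (?a + ?b) \<le> 2 * (?a\<^sup>2 + ?b\<^sup>2)"
    unfolding power2_eq_square distrib_left by linarith
  then show ?thesis using mult_left_mono[of "?a * (?a + ?b)" "2 * (?a\<^sup>2 + ?b\<^sup>2)" "2 * cell_const"] cell_const(2)
    by (simp add: line_energy_def)
qed

lemma line_energy_continuous: "C1 f \<Longrightarrow> continuous_on UNIV (line_energy i f)"
  unfolding line_energy_def using C1_continuous C1_continuous_pd by (intro continuous_intros) auto

abbreviation ind :: "3 \<Rightarrow> real \<Rightarrow> ennreal" where "ind i \<equiv> indicator {lo i<..<hi i}"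

text \<open>Average \<open>q(t) = q(s) + \<integral> q'\<close> over \<open>s\<close>, for \<open>q = |f|\<^sup>2\<close> on the line.\<close>

lemma line_sup:
  assumes f: "C1 f" and t: "t \<in> {lo i<..<hi i}"
  shows "ennreal ((norm (f (subst_coord i x t)))\<^sup>2) \<le> (\<integral>\<^sup>+s. ennreal (line_energy i f (subst_coord i x s)) * ind i s \<partial>lborel)"
proof -
  define q where "q s = (norm (f (subst_coord i x s)))\<^sup>2" for s
  define q' where "q' s = 2 * (f (subst_coord i x s) \<bullet> pd i f (subst_coord i x s))" for s
  define r where "r s = 2 * (norm (f (subst_coord i x s)) * norm (pd i f (subst_coord i x s)))" for s
  let ?I = "{lo i..hi i}"
  have c1: "continuous_on A (\<lambda>s. f (subst_coord i x s))" for A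
    by (rule continuous_on_compose2[OF C1_continuous[OF f]]) (auto intro!: continuous_intros)
  have c2: "continuous_on A (\<lambda>s. pd i f (subst_coord i x s))" for A
    by (rule continuous_on_compose2[OF C1_continuous_pd[OF f]]) (auto intro!: continuous_intros)
  have cq: "continuous_on A q" and cr: "continuous_on A r" for A
    unfolding q_def r_def by (intro continuous_intros c1 c2)+
  have der: "(q has_vector_derivative q' s) (at s within A)" for s A
  proof -
    have "((\<lambda>s. f (subst_coord i x s) \<bullet> f (subst_coord i x s)) has_vector_derivative
      (f (subst_coord i x s) \<bullet> pd i f (subst_coord i x s) + pd i f (subst_coord i x s) \<bullet> f (subst_coord i x s))) (at s within A)"
      using pd_line[OF C1_differentiable[OF f]] by (intro bounded_bilinear.has_vector_derivative[OF bounded_bilinear_inner])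
    then show ?thesis unfolding q_def q'_def by (simp add: power2_norm_eq_inner inner_commute)
  qed
  have abs_q': "\<bar>q' s\<bar> \<le> r s" for s
    unfolding q'_def r_def using Cauchy_Schwarz_ineq2[of "f (subst_coord i x s)" "pd i f (subst_coord i x s)"] by (simp add: abs_mult)
  have r0: "0 \<le> r s" for s unfolding r_def by simp
  have int_r: "r integrable_on {a..b}" for a b by (intro integrable_continuous_real cr)
  have var: "\<bar>q b - q a\<bar> \<le> integral ?I r" if "a \<le> b" "lo i \<le> a" "b \<le> hi i" for a b
  proof -
    have 1: "(q' has_integral (q b - q a)) {a..b}"
      using that der by (intro fundamental_theorem_of_calculus) auto
    have "norm (integral {a..b} q') \<le> integral {a..b} r"
      using 1 int_r abs_q' by (intro integral_norm_bound_integral) auto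
    also have "\<dots> \<le> integral ?I r" using that r0 int_r by (intro integral_subset_le) auto
    finally show ?thesis using integral_unique[OF 1] by simp
  qed
  have qle: "q t \<le> q s + integral ?I r" if "s \<in> ?I" for s
    using var[of s t] var[of t s] that t by (cases "s \<le> t") auto
  have "integral ?I (\<lambda>s. q t) \<le> integral ?I (\<lambda>s. q s + integral ?I r)"
    using qle cq by (intro integral_le integrable_continuous_real continuous_intros) auto
  also have "\<dots> = integral ?I q + (hi i - lo i) * integral ?I r"
    using lo_less_hi[of i] cq by (subst Henstock_Kurzweil_Integration.integral_add) (auto intro!: integrable_continuous_real)
  finally have "(hi i - lo i) * q t \<le> integral ?I q + (hi i - lo i) * integral ?I r"
    using lo_less_hi[of i] by simp
  then have "q t \<le> 1 / (hi i - lo i) * integral ?I q + integral ?I r"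
    using lo_less_hi[of i] by (simp add: field_simps)
  also have "\<dots> \<le> cell_const * integral ?I q + cell_const * integral ?I r"
  proof (intro add_mono)
    have "0 \<le> integral ?I q" by (intro integral_nonneg integrable_continuous_real cq) (auto simp: q_def)
    then show "1 / (hi i - lo i) * integral ?I q \<le> cell_const * integral ?I q" using cell_const(1) by (rule mult_right_mono[rotated])
    have "0 \<le> integral ?I r" by (intro integral_nonneg int_r r0)
    then show "integral ?I r \<le> cell_const * integral ?I r" using mult_right_mono[OF cell_const(2)] by simp
  qed
  also have "\<dots> = integral ?I (\<lambda>s. cell_const * q s + cell_const * r s)"
    using cq cr by (subst Henstock_Kurzweil_Integration.integral_add) (auto intro!: integrable_continuous_real continuous_intros)
  also have "\<dots> \<le> integral ?I (\<lambda>s. line_energy i f (subst_coord i x s))"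
  proof (intro integral_le integrable_continuous_real continuous_intros cq cr)
    show "continuous_on ?I (\<lambda>s. line_energy i f (subst_coord i x s))"
      by (rule continuous_on_compose2[OF line_energy_continuous[OF f]]) (auto intro!: continuous_intros)
    show "cell_const * q s + cell_const * r s \<le> line_energy i f (subst_coord i x s)" for s
      using cell_const(2) zero_le_power2[of "norm (f (subst_coord i x s))"] mult_nonneg_nonneg[of cell_const "q s"]
      unfolding line_energy_def q_def r_def by (simp add: power2_eq_square algebra_simps)
  qed
  finally have le: "q t \<le> integral ?I (\<lambda>s. line_energy i f (subst_coord i x s))" .
  let ?w = "\<lambda>s. line_energy i f (subst_coord i x s)"
  have cw: "continuous_on A ?w" for A
    by (rule continuous_on_compose2[OF line_energy_continuous[OF f]]) (auto intro!: continuous_intros)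
  have wm[measurable]: "?w \<in> borel_measurable borel" by (intro borel_measurable_continuous_onI cw)
  have "ennreal (integral ?I ?w) = (\<integral>\<^sup>+s. ennreal (indicator ?I s * ?w s) \<partial>lborel)"
  proof (rule nn_integral_has_integral_lborel[symmetric])
    have e: "(\<lambda>s. indicator ?I s * ?w s) = (\<lambda>s. if s \<in> ?I then ?w s else 0)" by (auto simp: indicator_def)
    show "((\<lambda>s. indicator ?I s * ?w s) has_integral integral ?I ?w) UNIV"
      unfolding e has_integral_restrict_UNIV
      by (rule integrable_integral[OF integrable_continuous_real[OF cw]])
  qed (use line_energy_nonneg in auto)
  also have "\<dots> = (\<integral>\<^sup>+s. ennreal (?w s) * ind i s \<partial>lborel)"
  proof (rule nn_integral_cong_AE)
    show "AE s in lborel. ennreal (indicator ?I s * ?w s) = ennreal (?w s) * ind i s"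
      using AE_lborel_singleton[of "lo i"] AE_lborel_singleton[of "hi i"]
      by eventually_elim (auto simp: indicator_def)
  qed
  finally show ?thesis using ennreal_leI[OF le] by (simp add: q_def)
qed

abbreviation vec3 :: "real \<Rightarrow> real \<Rightarrow> real \<Rightarrow> point" where "vec3 a b c \<equiv> vector [a, b, c]"

lemma subst_coord_vec3 [simp]:
  "subst_coord 1 (vec3 a b c) s = vec3 s b c" "subst_coord 2 (vec3 a b c) s = vec3 a s c" "subst_coord 3 (vec3 a b c) s = vec3 a b s"
  by (simp_all add: vec_eq_iff forall_3)

definition section_integral :: "(point \<Rightarrow> ennreal) \<Rightarrow> real \<Rightarrow> ennreal" where
  "section_integral f c = (\<integral>\<^sup>+b. (\<integral>\<^sup>+a. f (vec3 a b c) * ind 1 a \<partial>lborel) * ind 2 b \<partial>lborel)"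

lemma section_integral_measurable [measurable]:
  assumes [measurable]: "f \<in> borel_measurable borel"
  shows "section_integral f \<in> borel_measurable borel"
  unfolding section_integral_def by measurable

lemma section_integral_mono:
  assumes "\<And>a b. a \<in> {lo 1<..<hi 1} \<Longrightarrow> b \<in> {lo 2<..<hi 2} \<Longrightarrow> f (vec3 a b c) \<le> g (vec3 a b c)"
  shows "section_integral f c \<le> section_integral g c"
  unfolding section_integral_def
proof (rule nn_integral_mono)
  fix b :: real
  have "(\<integral>\<^sup>+a. f (vec3 a b c) * ind 1 a \<partial>lborel) \<le> (\<integral>\<^sup>+a. g (vec3 a b c) * ind 1 a \<partial>lborel)" if "b \<in> {lo 2<..<hi 2}"
    using assms that by (intro nn_integral_mono) (auto simp: indicator_def)
  then show "(\<integral>\<^sup>+a. f (vec3 a b c) * ind 1 a \<partial>lborel) * ind 2 b \<le> (\<integral>\<^sup>+a. g (vec3 a b c) * ind 1 a \<partial>lborel) * ind 2 b"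
    by (auto simp: indicator_def)
qed

lemma section_integral_cmult:
  assumes [measurable]: "f \<in> borel_measurable borel"
  shows "section_integral (\<lambda>x. k * f x) c = k * section_integral f c"
  unfolding section_integral_def
  by (simp add: mult.assoc nn_integral_cmult)

lemma section_integral_swap:
  assumes [measurable]: "f \<in> borel_measurable borel"
  shows "section_integral f c = (\<integral>\<^sup>+a. (\<integral>\<^sup>+b. f (vec3 a b c) * ind 2 b \<partial>lborel) * ind 1 a \<partial>lborel)"
proof -
  have "section_integral f c = (\<integral>\<^sup>+b. \<integral>\<^sup>+a. f (vec3 a b c) * ind 1 a * ind 2 b \<partial>lborel \<partial>lborel)"
    unfolding section_integral_def by (simp add: nn_integral_multc)
  also have "\<dots> = (\<integral>\<^sup>+a. \<integral>\<^sup>+b. f (vec3 a b c) * ind 1 a * ind 2 b \<partial>lborel \<partial>lborel)"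
    by (rule lborel_pair.Fubini') simp
  also have "\<dots> = (\<integral>\<^sup>+a. \<integral>\<^sup>+b. f (vec3 a b c) * ind 2 b * ind 1 a \<partial>lborel \<partial>lborel)"
    by (simp add: ac_simps)
  also have "\<dots> = (\<integral>\<^sup>+a. (\<integral>\<^sup>+b. f (vec3 a b c) * ind 2 b \<partial>lborel) * ind 1 a \<partial>lborel)"
    by (simp add: nn_integral_multc)
  finally show ?thesis .
qed

lemma section_integral_Cauchy_Schwarz:
  assumes [measurable]: "f \<in> borel_measurable borel" "g \<in> borel_measurable borel"
  shows "(section_integral (\<lambda>x. f x * g x) c)\<^sup>2 \<le> section_integral (\<lambda>x. (f x)\<^sup>2) c * section_integral (\<lambda>x. (g x)\<^sup>2) c"
proof -
  let ?N = "lborel \<Otimes>\<^sub>M lborel :: (real \<times> real) measure"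
  let ?w = "\<lambda>p. ind 1 (snd p) * ind 2 (fst p)"
  have eq: "section_integral k c = (\<integral>\<^sup>+p. k (vec3 (snd p) (fst p) c) * ?w p \<partial>?N)"
    if [measurable]: "k \<in> borel_measurable borel" for k
    unfolding section_integral_def
    by (subst lborel.nn_integral_fst[symmetric]) (simp_all add: nn_integral_multc[symmetric] mult.assoc)
  have "(\<integral>\<^sup>+p. (f (vec3 (snd p) (fst p) c) * ?w p) * (g (vec3 (snd p) (fst p) c) * ?w p) \<partial>?N)\<^sup>2
    \<le> (\<integral>\<^sup>+p. (f (vec3 (snd p) (fst p) c) * ?w p)\<^sup>2 \<partial>?N) * (\<integral>\<^sup>+p. (g (vec3 (snd p) (fst p) c) * ?w p)\<^sup>2 \<partial>?N)"
    by (rule Cauchy_Schwarz_nn_integral) measurable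
  moreover have "(\<integral>\<^sup>+p. (f (vec3 (snd p) (fst p) c) * ?w p) * (g (vec3 (snd p) (fst p) c) * ?w p) \<partial>?N) = section_integral (\<lambda>x. f x * g x) c"
    by (subst eq, simp) (rule nn_integral_cong, auto simp: indicator_def)
  moreover have "(\<integral>\<^sup>+p. (k (vec3 (snd p) (fst p) c) * ?w p)\<^sup>2 \<partial>?N) = section_integral (\<lambda>x. (k x)\<^sup>2) c"
    if [measurable]: "k \<in> borel_measurable borel" for k
    by (subst eq, simp) (rule nn_integral_cong, auto simp: indicator_def)
  ultimately show ?thesis using assms by simp
qed

lemma indicator_Omega_vec3: "indicator Om (vec3 a b c) = (ind 1 a * ind 2 b * ind 3 c :: ennreal)"
  by (auto simp: indicator_def in_Omega_iff forall_3)

lemma nn_integral_M_sections: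
  assumes [measurable]: "f \<in> borel_measurable borel"
  shows "(\<integral>\<^sup>+x. f x \<partial>M) = (\<integral>\<^sup>+c. section_integral f c * ind 3 c \<partial>lborel)"
    and "(\<integral>\<^sup>+x. f x \<partial>M) = (\<integral>\<^sup>+b. (\<integral>\<^sup>+a. (\<integral>\<^sup>+c. f (vec3 a b c) * ind 3 c \<partial>lborel) * ind 1 a \<partial>lborel) * ind 2 b \<partial>lborel)"
proof -
  have M: "(\<integral>\<^sup>+x. f x \<partial>M) = (\<integral>\<^sup>+x. f x * indicator Om x \<partial>lborel)"
    by (subst nn_integral_restrict_space) (simp_all add: nn_integral_completion)
  also have "\<dots> = (\<integral>\<^sup>+c. \<integral>\<^sup>+b. \<integral>\<^sup>+a. f (vec3 a b c) * ind 1 a * ind 2 b * ind 3 c \<partial>lborel \<partial>lborel \<partial>lborel)"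
    by (subst nn_integral_zyx) (simp_all add: indicator_Omega_vec3 mult.assoc)
  also have "\<dots> = (\<integral>\<^sup>+c. section_integral f c * ind 3 c \<partial>lborel)"
    unfolding section_integral_def by (simp add: nn_integral_multc)
  finally show "(\<integral>\<^sup>+x. f x \<partial>M) = (\<integral>\<^sup>+c. section_integral f c * ind 3 c \<partial>lborel)" .
  have "(\<integral>\<^sup>+x. f x \<partial>M) = (\<integral>\<^sup>+a. \<integral>\<^sup>+b. \<integral>\<^sup>+c. f (vec3 a b c) * ind 3 c * ind 1 a * ind 2 b \<partial>lborel \<partial>lborel \<partial>lborel)"
    unfolding M by (subst nn_integral_xyz) (simp_all add: indicator_Omega_vec3 ac_simps)
  also have "\<dots> = (\<integral>\<^sup>+b. \<integral>\<^sup>+a. \<integral>\<^sup>+c. f (vec3 a b c) * ind 3 c * ind 1 a * ind 2 b \<partial>lborel \<partial>lborel \<partial>lborel)"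
    by (rule lborel_pair.Fubini') simp
  also have "\<dots> = (\<integral>\<^sup>+b. (\<integral>\<^sup>+a. (\<integral>\<^sup>+c. f (vec3 a b c) * ind 3 c \<partial>lborel) * ind 1 a \<partial>lborel) * ind 2 b \<partial>lborel)"
    by (simp add: nn_integral_multc)
  finally show "(\<integral>\<^sup>+x. f x \<partial>M) = (\<integral>\<^sup>+b. (\<integral>\<^sup>+a. (\<integral>\<^sup>+c. f (vec3 a b c) * ind 3 c \<partial>lborel) * ind 1 a \<partial>lborel) * ind 2 b \<partial>lborel)" .
qed

lemma line_energy_measurable: "C1 f \<Longrightarrow> (\<lambda>x. ennreal (line_energy i f x)) \<in> borel_measurable borel"
  using borel_measurable_continuous_onI[OF line_energy_continuous, of f i] by measurable

text \<open>The one-dimensional supremum bound in the vertical direction, integrated over the section: the energy in every horizontal section is bounded uniformly in its height.\<close>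

lemma section_energy_le:
  assumes f: "C1 f" and c: "c \<in> {lo 3<..<hi 3}"
  shows "section_integral (\<lambda>x. ennreal ((norm (f x))\<^sup>2)) c \<le> (\<integral>\<^sup>+x. ennreal (line_energy 3 f x) \<partial>M)"
  unfolding nn_integral_M_sections(2)[OF line_energy_measurable[OF f]] section_integral_def
  using line_sup[OF f c, of "vec3 _ _ 0"] by (intro nn_integral_mono mult_right_mono) auto

lemma nn_integral_line_energy:
  assumes f: "C1 f"
  shows "(\<integral>\<^sup>+x. ennreal (line_energy i f x) \<partial>M) \<le> ennreal (4 * cell_const * ((nrm f)\<^sup>2 + (nrm (pd i f))\<^sup>2))"
proof -
  have L: "f \<in> LL" "pd i f \<in> LL" using continuous_L2 C1_continuous C1_continuous_pd f by blast+
  have "(\<integral>\<^sup>+x. ennreal (line_energy i f x) \<partial>M) \<le> (\<integral>\<^sup>+x. ennreal (4 * cell_const * ((norm (f x))\<^sup>2 + (norm (pd i f x))\<^sup>2)) \<partial>M)"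
    by (intro nn_integral_mono ennreal_leI line_energy_le)
  also have "\<dots> = ennreal (LINT x|M. 4 * cell_const * ((norm (f x))\<^sup>2 + (norm (pd i f x))\<^sup>2))"
    using L cell_const(2) by (intro nn_integral_eq_integral) (auto simp: L2D)
  also have "(LINT x|M. 4 * cell_const * ((norm (f x))\<^sup>2 + (norm (pd i f x))\<^sup>2)) = 4 * cell_const * ((nrm f)\<^sup>2 + (nrm (pd i f))\<^sup>2)"
    using L by (simp add: nrm_sq ip_self L2D)
  finally show ?thesis .
qed

lemma ennreal_mult3: "0 \<le> a \<Longrightarrow> 0 \<le> b \<Longrightarrow> 0 \<le> c \<Longrightarrow> ennreal a * (ennreal b * ennreal c) = ennreal (a * (b * c))"
  by (simp add: ennreal_mult)

text \<open>In a horizontal section, \<open>|f|\<^sup>4 \<le> sup\<^sub>x |f|\<^sup>2 \<cdot> sup\<^sub>y |f|\<^sup>2\<close>, and the integral of this product factorises into two line integrals, each bounded by \<open>\<integral> |f| G\<close> with \<open>G = |f| + |\<partial>\<^sub>x f| + |\<partial>\<^sub>y f|\<close>. Cauchy--Schwarz leaves \<open>\<integral> |f|\<^sup>2\<close> over the section, bounded uniformly in the height, times \<open>\<integral> G\<^sup>2\<close>, which is integrated over the height.\<close>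

lemma Ladyzhenskaya_C1:
  assumes f: "C1 f"
  shows "(\<integral>\<^sup>+x. ennreal ((norm (f x))^4) \<partial>M) \<le> ennreal (96 * cell_const ^ 3 * ((nrm f)\<^sup>2 + (\<Sum>i\<in>UNIV. (nrm (pd i f))\<^sup>2))\<^sup>2)"
proof -
  define G where "G x = norm (f x) + norm (pd 1 f x) + norm (pd 2 f x)" for x
  let ?h = "(nrm f)\<^sup>2 + (\<Sum>i\<in>UNIV. (nrm (pd i f))\<^sup>2)"
  define W where "W i x = ennreal (line_energy i f x)" for i x
  have [measurable]: "f \<in> borel_measurable borel" "pd i f \<in> borel_measurable borel" for i
    using C1_measurable[OF f] C1_measurable_pd[OF f] by auto
  have [measurable]: "W i \<in> borel_measurable borel" for i
    unfolding W_def by (rule line_energy_measurable[OF f])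
  have [measurable]: "G \<in> borel_measurable borel" unfolding G_def by measurable
  have G0: "0 \<le> G x" for x by (simp add: G_def)
  have WG: "W i x \<le> ennreal (2 * cell_const) * (ennreal (norm (f x)) * ennreal (G x))" if "i = 1 \<or> i = 2" for i x
  proof -
    have "line_energy i f x \<le> 2 * cell_const * (norm (f x) * G x)"
      unfolding line_energy_def G_def using that cell_const(2) by (intro mult_left_mono) auto
    then show ?thesis unfolding W_def using cell_const(2) G0 by (simp flip: ennreal_mult add: ennreal_leI)
  qed
  have sec: "section_integral (\<lambda>x. ennreal ((norm (f x))^4)) c \<le>
      ennreal ((2 * cell_const)\<^sup>2) * ((\<integral>\<^sup>+x. W 3 x \<partial>M) * section_integral (\<lambda>x. (ennreal (G x))\<^sup>2) c)"
    if c: "c \<in> {lo 3<..<hi 3}" for c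
  proof -
    let ?A1 = "\<lambda>b. \<integral>\<^sup>+s. W 1 (vec3 s b c) * ind 1 s \<partial>lborel" and ?A2 = "\<lambda>a. \<integral>\<^sup>+s. W 2 (vec3 a s c) * ind 2 s \<partial>lborel"
    have "section_integral (\<lambda>x. ennreal ((norm (f x))^4)) c \<le> (\<integral>\<^sup>+b. (\<integral>\<^sup>+a. (?A1 b * ?A2 a) * ind 1 a \<partial>lborel) * ind 2 b \<partial>lborel)"
      unfolding section_integral_def
    proof (intro nn_integral_mono)
      fix b :: real
      have "ennreal ((norm (f (vec3 a b c)))^4) * ind 1 a \<le> (?A1 b * ?A2 a) * ind 1 a" if b: "b \<in> {lo 2<..<hi 2}" for a
      proof (cases "a \<in> {lo 1<..<hi 1}")
        case True
        have "ennreal ((norm (f (vec3 a b c)))^4) = ennreal ((norm (f (vec3 a b c)))\<^sup>2) * ennreal ((norm (f (vec3 a b c)))\<^sup>2)"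
          by (simp flip: ennreal_mult power_add)
        also have "\<dots> \<le> ?A1 b * ?A2 a"
          using line_sup[OF f True, of "vec3 0 b c"] line_sup[OF f b, of "vec3 a 0 c"] unfolding W_def
          by (intro mult_mono) auto
        finally show ?thesis using True by simp
      qed simp
      then have "(\<integral>\<^sup>+a. ennreal ((norm (f (vec3 a b c)))^4) * ind 1 a \<partial>lborel) \<le> (\<integral>\<^sup>+a. (?A1 b * ?A2 a) * ind 1 a \<partial>lborel)"
        if "b \<in> {lo 2<..<hi 2}" using that by (intro nn_integral_mono) auto
      then show "(\<integral>\<^sup>+a. ennreal ((norm (f (vec3 a b c)))^4) * ind 1 a \<partial>lborel) * ind 2 b \<le> (\<integral>\<^sup>+a. (?A1 b * ?A2 a) * ind 1 a \<partial>lborel) * ind 2 b"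
        by (cases "b \<in> {lo 2<..<hi 2}") auto
    qed
    also have "\<dots> = (\<integral>\<^sup>+b. ?A1 b * ind 2 b * (\<integral>\<^sup>+a. ?A2 a * ind 1 a \<partial>lborel) \<partial>lborel)"
      by (simp add: mult.assoc nn_integral_cmult) (simp add: ac_simps)
    also have "\<dots> = (\<integral>\<^sup>+b. ?A1 b * ind 2 b \<partial>lborel) * (\<integral>\<^sup>+a. ?A2 a * ind 1 a \<partial>lborel)"
      by (rule nn_integral_multc) simp
    also have "\<dots> = section_integral (W 1) c * section_integral (W 2) c"
      unfolding section_integral_swap[of "W 2" c, simplified] by (simp add: section_integral_def)
    also have "\<dots> \<le> (ennreal (2 * cell_const) * section_integral (\<lambda>x. ennreal (norm (f x)) * ennreal (G x)) c)\<^sup>2"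
      unfolding power2_eq_square
      by (intro mult_mono order_trans[OF section_integral_mono[OF WG]] ) (auto simp: section_integral_cmult)
    also have "\<dots> = ennreal ((2 * cell_const)\<^sup>2) * (section_integral (\<lambda>x. ennreal (norm (f x)) * ennreal (G x)) c)\<^sup>2"
      using cell_const(2) by (simp add: power_mult_distrib ennreal_power)
    also have "\<dots> \<le> ennreal ((2 * cell_const)\<^sup>2) * (section_integral (\<lambda>x. (ennreal (norm (f x)))\<^sup>2) c * section_integral (\<lambda>x. (ennreal (G x))\<^sup>2) c)"
      by (intro mult_left_mono section_integral_Cauchy_Schwarz) auto
    also have "\<dots> \<le> ennreal ((2 * cell_const)\<^sup>2) * ((\<integral>\<^sup>+x. W 3 x \<partial>M) * section_integral (\<lambda>x. (ennreal (G x))\<^sup>2) c)"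
      using section_energy_le[OF f c] unfolding W_def
      by (intro mult_left_mono mult_right_mono) (auto simp: ennreal_power)
    finally show ?thesis .
  qed
  have "(\<integral>\<^sup>+x. ennreal ((norm (f x))^4) \<partial>M) = (\<integral>\<^sup>+c. section_integral (\<lambda>x. ennreal ((norm (f x))^4)) c * ind 3 c \<partial>lborel)"
    by (rule nn_integral_M_sections) simp
  also have "\<dots> \<le> (\<integral>\<^sup>+c. ennreal ((2 * cell_const)\<^sup>2) * ((\<integral>\<^sup>+x. W 3 x \<partial>M) * section_integral (\<lambda>x. (ennreal (G x))\<^sup>2) c) * ind 3 c \<partial>lborel)"
  proof (rule nn_integral_mono)
    fix c :: real
    show "section_integral (\<lambda>x. ennreal ((norm (f x))^4)) c * ind 3 c \<le>
        ennreal ((2 * cell_const)\<^sup>2) * ((\<integral>\<^sup>+x. W 3 x \<partial>M) * section_integral (\<lambda>x. (ennreal (G x))\<^sup>2) c) * ind 3 c"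
      using sec by (cases "c \<in> {lo 3<..<hi 3}") auto
  qed
  also have "\<dots> = ennreal ((2 * cell_const)\<^sup>2) * ((\<integral>\<^sup>+x. W 3 x \<partial>M) * (\<integral>\<^sup>+c. section_integral (\<lambda>x. (ennreal (G x))\<^sup>2) c * ind 3 c \<partial>lborel))"
    by (simp add: mult.assoc nn_integral_cmult)
  also have "(\<integral>\<^sup>+c. section_integral (\<lambda>x. (ennreal (G x))\<^sup>2) c * ind 3 c \<partial>lborel) = (\<integral>\<^sup>+x. (ennreal (G x))\<^sup>2 \<partial>M)"
    by (rule nn_integral_M_sections(1)[symmetric]) simp
  also have "\<dots> \<le> ennreal (6 * ?h)"
  proof -
    have L: "f \<in> LL" "pd i f \<in> LL" for i using continuous_L2 C1_continuous C1_continuous_pd f by blast+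
    have "(\<integral>\<^sup>+x. (ennreal (G x))\<^sup>2 \<partial>M) \<le> (\<integral>\<^sup>+x. ennreal (3 * ((norm (f x))\<^sup>2 + (norm (pd 1 f x))\<^sup>2 + (norm (pd 2 f x))\<^sup>2)) \<partial>M)"
    proof (rule nn_integral_mono)
      fix x
      have "(a + b + c)\<^sup>2 \<le> 3 * (a\<^sup>2 + b\<^sup>2 + c\<^sup>2)" for a b c :: real
        using sum_squares_bound[of a b] sum_squares_bound[of a c] sum_squares_bound[of b c]
        by (simp add: power2_eq_square algebra_simps)
      then show "(ennreal (G x))\<^sup>2 \<le> ennreal (3 * ((norm (f x))\<^sup>2 + (norm (pd 1 f x))\<^sup>2 + (norm (pd 2 f x))\<^sup>2))"
        unfolding ennreal_power[OF G0] by (intro ennreal_leI) (simp add: G_def)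
    qed
    also have "\<dots> = ennreal (LINT x|M. 3 * ((norm (f x))\<^sup>2 + (norm (pd 1 f x))\<^sup>2 + (norm (pd 2 f x))\<^sup>2))"
      using L by (intro nn_integral_eq_integral) (auto simp: L2D)
    also have "(LINT x|M. 3 * ((norm (f x))\<^sup>2 + (norm (pd 1 f x))\<^sup>2 + (norm (pd 2 f x))\<^sup>2)) = 3 * ((nrm f)\<^sup>2 + (nrm (pd 1 f))\<^sup>2 + (nrm (pd 2 f))\<^sup>2)"
      using L by (simp add: nrm_sq ip_self L2D)
    also have "\<dots> \<le> 6 * ?h" by (simp add: sum_3)
    finally show ?thesis by (simp add: ennreal_leI)
  qed
  also have "(\<integral>\<^sup>+x. W 3 x \<partial>M) \<le> ennreal (4 * cell_const * ?h)"
    unfolding W_def using cell_const(2)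
    by (intro order_trans[OF nn_integral_line_energy[OF f]] ennreal_leI mult_left_mono) (auto simp: sum_3)
  finally have "(\<integral>\<^sup>+x. ennreal ((norm (f x))^4) \<partial>M) \<le> ennreal ((2 * cell_const)\<^sup>2) * (ennreal (4 * cell_const * ?h) * ennreal (6 * ?h))"
    by (simp add: mult_left_mono mult_right_mono)
  also have "\<dots> = ennreal (96 * cell_const ^ 3 * ?h\<^sup>2)"
  proof -
    have H: "0 \<le> ?h" by (intro add_nonneg_nonneg sum_nonneg) auto
    have E: "(2 * cell_const)\<^sup>2 * ((4 * cell_const * H) * (6 * H)) = 96 * cell_const ^ 3 * H\<^sup>2" for H
      by (simp add: power2_eq_square power3_eq_cube)
    have k: "0 \<le> 4 * cell_const * ?h" "0 \<le> 6 * ?h" "0 \<le> (2 * cell_const)\<^sup>2" using H cell_const(2) by (intro mult_nonneg_nonneg, auto)+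
    show ?thesis by (simp only: ennreal_mult3[OF k(3,1,2)] E)
  qed
  finally show ?thesis .
qed

text \<open>The norm that bounds, by the supremum inequality in \<open>x\<close> and then in \<open>y\<close>, the integral over \<open>z\<close> of the supremum of \<open>|v|\<^sup>2\<close> over horizontal sections.\<close>

definition horizontal_energy :: "field \<Rightarrow> real" where
  "horizontal_energy v = (nrm v)\<^sup>2 + (nrm (pd 1 v))\<^sup>2 + (nrm (pd 2 v))\<^sup>2 + (nrm (pd 1 (pd 2 v)))\<^sup>2"

text \<open>Bound \<open>|v|\<^sup>2\<close> by its supremum over the horizontal section and \<open>|f|\<^sup>2\<close> by its integral over the section, whose supremum over the height is an \<open>H\<^sup>1\<close> quantity. Only horizontal derivatives of \<open>v\<close> enter, and these are harmless for fields with bounded horizontal wavenumbers.\<close>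

lemma anisotropic_product_C1:
  assumes f: "C1 f" and v: "C1 v" "C1 (pd 2 v)"
  shows "(\<integral>\<^sup>+x. ennreal ((norm (f x))\<^sup>2 * (norm (v x))\<^sup>2) \<partial>M) \<le>
    ennreal (64 * cell_const ^ 3 * (((nrm f)\<^sup>2 + (\<Sum>i\<in>UNIV. (nrm (pd i f))\<^sup>2)) * horizontal_energy v))"
proof -
  let ?h = "(nrm f)\<^sup>2 + (\<Sum>i\<in>UNIV. (nrm (pd i f))\<^sup>2)"
  define E where "E x = ennreal (16 * cell_const\<^sup>2 * ((norm (v x))\<^sup>2 + (norm (pd 1 v x))\<^sup>2 + (norm (pd 2 v x))\<^sup>2 + (norm (pd 1 (pd 2 v) x))\<^sup>2))" for x
  have [measurable]: "f \<in> borel_measurable borel" "v \<in> borel_measurable borel" "pd i v \<in> borel_measurable borel"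
     "pd i (pd 2 v) \<in> borel_measurable borel" for i
    using C1_measurable C1_measurable_pd f v by blast+
  have [measurable]: "E \<in> borel_measurable borel" unfolding E_def by measurable
  have lm[measurable]: "(\<lambda>x. ennreal (line_energy i k x)) \<in> borel_measurable borel" if "C1 k" for i k
    by (rule line_energy_measurable[OF that])
  have sup: "ennreal ((norm (v (vec3 a b c)))\<^sup>2) \<le> section_integral E c"
    if a: "a \<in> {lo 1<..<hi 1}" and b: "b \<in> {lo 2<..<hi 2}" for a b c
  proof -
    have "ennreal ((norm (v (vec3 a b c)))\<^sup>2) \<le> (\<integral>\<^sup>+s. ennreal (line_energy 2 v (vec3 a s c)) * ind 2 s \<partial>lborel)"
      using line_sup[OF v(1) b, of "vec3 a b c"] by simp
    also have "\<dots> \<le> (\<integral>\<^sup>+s. (\<integral>\<^sup>+r. E (vec3 r s c) * ind 1 r \<partial>lborel) * ind 2 s \<partial>lborel)"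
    proof (intro nn_integral_mono mult_right_mono)
      fix s :: real
      have k4: "0 \<le> 4 * cell_const" using cell_const(2) by simp
      have "ennreal (line_energy 2 v (vec3 a s c)) \<le> ennreal (4 * cell_const) * (ennreal ((norm (v (vec3 a s c)))\<^sup>2) + ennreal ((norm (pd 2 v (vec3 a s c)))\<^sup>2))"
        using line_energy_le[of 2 v "vec3 a s c"] k4 by (simp flip: ennreal_mult ennreal_plus add: ennreal_leI)
      also have "\<dots> \<le> ennreal (4 * cell_const) * ((\<integral>\<^sup>+r. ennreal (line_energy 1 v (vec3 r s c)) * ind 1 r \<partial>lborel)
           + (\<integral>\<^sup>+r. ennreal (line_energy 1 (pd 2 v) (vec3 r s c)) * ind 1 r \<partial>lborel))"
        using line_sup[OF v(1) a, of "vec3 a s c"] line_sup[OF v(2) a, of "vec3 a s c"]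
        by (intro mult_left_mono add_mono) auto
      also have "\<dots> = (\<integral>\<^sup>+r. ennreal (4 * cell_const) * (ennreal (line_energy 1 v (vec3 r s c)) + ennreal (line_energy 1 (pd 2 v) (vec3 r s c))) * ind 1 r \<partial>lborel)"
        using lm[OF v(1)] lm[OF v(2)]
        by (simp add: nn_integral_add[symmetric] nn_integral_cmult[symmetric] distrib_left distrib_right mult.assoc)
      also have "\<dots> \<le> (\<integral>\<^sup>+r. E (vec3 r s c) * ind 1 r \<partial>lborel)"
      proof (intro nn_integral_mono mult_right_mono)
        fix r :: real
        let ?x = "vec3 r s c"
        have "4 * cell_const * (line_energy 1 v ?x + line_energy 1 (pd 2 v) ?x) \<le>
          4 * cell_const * (4 * cell_const * ((norm (v ?x))\<^sup>2 + (norm (pd 1 v ?x))\<^sup>2) + 4 * cell_const * ((norm (pd 2 v ?x))\<^sup>2 + (norm (pd 1 (pd 2 v) ?x))\<^sup>2))"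
          by (intro mult_left_mono add_mono line_energy_le k4)
        also have "\<dots> = 16 * cell_const\<^sup>2 * ((norm (v ?x))\<^sup>2 + (norm (pd 1 v ?x))\<^sup>2 + (norm (pd 2 v ?x))\<^sup>2 + (norm (pd 1 (pd 2 v) ?x))\<^sup>2)"
          by (simp add: power2_eq_square algebra_simps)
        finally show "ennreal (4 * cell_const) * (ennreal (line_energy 1 v ?x) + ennreal (line_energy 1 (pd 2 v) ?x)) \<le> E ?x"
          unfolding E_def using k4 line_energy_nonneg by (simp flip: ennreal_mult ennreal_plus add: ennreal_leI)
      qed simp
      finally show "ennreal (line_energy 2 v (vec3 a s c)) \<le> (\<integral>\<^sup>+r. E (vec3 r s c) * ind 1 r \<partial>lborel)" .
    qed simp
    also have "\<dots> = section_integral E c" by (simp add: section_integral_def)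
    finally show ?thesis .
  qed
  let ?W = "\<integral>\<^sup>+x. ennreal (line_energy 3 f x) \<partial>M"
  have sec: "section_integral (\<lambda>x. ennreal ((norm (f x))\<^sup>2 * (norm (v x))\<^sup>2)) c \<le> ?W * section_integral E c"
    if c: "c \<in> {lo 3<..<hi 3}" for c
  proof -
    have "section_integral (\<lambda>x. ennreal ((norm (f x))\<^sup>2 * (norm (v x))\<^sup>2)) c \<le> section_integral (\<lambda>x. section_integral E c * ennreal ((norm (f x))\<^sup>2)) c"
    proof (rule section_integral_mono)
      fix a b assume ab: "a \<in> {lo 1<..<hi 1}" "b \<in> {lo 2<..<hi 2}"
      have "ennreal ((norm (f (vec3 a b c)))\<^sup>2 * (norm (v (vec3 a b c)))\<^sup>2) = ennreal ((norm (v (vec3 a b c)))\<^sup>2) * ennreal ((norm (f (vec3 a b c)))\<^sup>2)"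
        by (simp flip: ennreal_mult add: mult.commute)
      also have "\<dots> \<le> section_integral E c * ennreal ((norm (f (vec3 a b c)))\<^sup>2)"
        by (intro mult_right_mono sup ab) simp
      finally show "ennreal ((norm (f (vec3 a b c)))\<^sup>2 * (norm (v (vec3 a b c)))\<^sup>2) \<le> section_integral E c * ennreal ((norm (f (vec3 a b c)))\<^sup>2)" .
    qed
    also have "\<dots> = section_integral E c * section_integral (\<lambda>x. ennreal ((norm (f x))\<^sup>2)) c"
      by (rule section_integral_cmult) simp
    also have "\<dots> \<le> section_integral E c * ?W" by (intro mult_left_mono section_energy_le[OF f c]) simp
    finally show ?thesis by (simp add: mult.commute)
  qed
  have "(\<integral>\<^sup>+x. ennreal ((norm (f x))\<^sup>2 * (norm (v x))\<^sup>2) \<partial>M) = (\<integral>\<^sup>+c. section_integral (\<lambda>x. ennreal ((norm (f x))\<^sup>2 * (norm (v x))\<^sup>2)) c * ind 3 c \<partial>lborel)"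
    by (rule nn_integral_M_sections) simp
  also have "\<dots> \<le> (\<integral>\<^sup>+c. ?W * section_integral E c * ind 3 c \<partial>lborel)"
  proof (rule nn_integral_mono)
    fix c :: real
    show "section_integral (\<lambda>x. ennreal ((norm (f x))\<^sup>2 * (norm (v x))\<^sup>2)) c * ind 3 c \<le> ?W * section_integral E c * ind 3 c"
      using sec by (cases "c \<in> {lo 3<..<hi 3}") auto
  qed
  also have "\<dots> = ?W * (\<integral>\<^sup>+c. section_integral E c * ind 3 c \<partial>lborel)"
    by (simp add: mult.assoc nn_integral_cmult)
  also have "(\<integral>\<^sup>+c. section_integral E c * ind 3 c \<partial>lborel) = (\<integral>\<^sup>+x. E x \<partial>M)"
    by (rule nn_integral_M_sections(1)[symmetric]) simp
  also have "\<dots> = ennreal (16 * cell_const\<^sup>2 * horizontal_energy v)"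
  proof -
    have L: "v \<in> LL" "pd i v \<in> LL" "pd i (pd 2 v) \<in> LL" for i using continuous_L2 C1_continuous C1_continuous_pd v by blast+
    have "(\<integral>\<^sup>+x. E x \<partial>M) = ennreal (LINT x|M. 16 * cell_const\<^sup>2 * ((norm (v x))\<^sup>2 + (norm (pd 1 v x))\<^sup>2 + (norm (pd 2 v x))\<^sup>2 + (norm (pd 1 (pd 2 v) x))\<^sup>2))"
      unfolding E_def using L by (intro nn_integral_eq_integral) (auto simp: L2D)
    also have "(LINT x|M. 16 * cell_const\<^sup>2 * ((norm (v x))\<^sup>2 + (norm (pd 1 v x))\<^sup>2 + (norm (pd 2 v x))\<^sup>2 + (norm (pd 1 (pd 2 v) x))\<^sup>2)) = 16 * cell_const\<^sup>2 * horizontal_energy v"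
      using L by (simp add: nrm_sq ip_self L2D horizontal_energy_def)
    finally show ?thesis .
  qed
  also have "?W \<le> ennreal (4 * cell_const * ?h)"
    using cell_const(2)
    by (intro order_trans[OF nn_integral_line_energy[OF f]] ennreal_leI mult_left_mono) (auto simp: sum_3)
  finally have "(\<integral>\<^sup>+x. ennreal ((norm (f x))\<^sup>2 * (norm (v x))\<^sup>2) \<partial>M) \<le> ennreal (4 * cell_const * ?h) * ennreal (16 * cell_const\<^sup>2 * horizontal_energy v)"
    by (simp add: mult_right_mono)
  also have "\<dots> = ennreal (64 * cell_const ^ 3 * (?h * horizontal_energy v))"
  proof -
    have H: "0 \<le> ?h" "0 \<le> horizontal_energy v" unfolding horizontal_energy_def by (intro add_nonneg_nonneg sum_nonneg, auto)+
    have k: "0 \<le> 4 * cell_const * ?h" "0 \<le> 16 * cell_const\<^sup>2 * horizontal_energy v" using H cell_const(2) by (intro mult_nonneg_nonneg, auto)+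
    have E: "(4 * cell_const * H) * (16 * cell_const\<^sup>2 * E) = 64 * cell_const ^ 3 * (H * E)" for H E
      by (simp add: power2_eq_square power3_eq_cube)
    show ?thesis by (simp only: ennreal_mult[OF k, symmetric] E)
  qed
  finally show ?thesis .
qed

section \<open>The spaces \<open>H\<^sup>1\<close> and \<open>V\<close>\<close>

abbreviation "VVs \<equiv> VV Lx Ly h"
abbreviation "Vs \<equiv> V Lx Ly h"
abbreviation "gsq \<equiv> grad_sq Lx Ly h"
abbreviation "Hd \<equiv> Hdot Lx Ly h"

lemma Hd_L2: "u \<in> Hd \<Longrightarrow> u \<in> LL"
  by (auto simp: Hdot_def HH_def)

lemma grad_sq_eq: "gsq u = (\<Sum>i\<in>UNIV. (nrm (D i u))\<^sup>2)"
  by (simp add: grad_sq_def grad_inner_def nrm_sq)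

lemma gsq_nonneg [simp]: "0 \<le> gsq u"
  by (simp add: grad_sq_eq sum_nonneg)

lemma nrm_wd_le: "nrm (D i u) \<le> sqrt (gsq u)"
proof (rule real_le_rsqrt)
  show "(nrm (D i u))\<^sup>2 \<le> gsq u" unfolding grad_sq_eq by (rule member_le_sum) auto
qed

lemma SobI: "u \<in> LL \<Longrightarrow> (\<And>i. g i \<in> LL) \<Longrightarrow> (\<And>i. wpd i u (g i)) \<Longrightarrow> u \<in> Sob"
  by (auto simp: H1_def)

lemma nrm_wd_eq: "g \<in> LL \<Longrightarrow> wpd i u g \<Longrightarrow> nrm (D i u) = nrm g"
  using wd_eq_AE wd_works by (intro nrm_cong_AE L2D) auto

lemma Sob_diff_wd:
  assumes "u \<in> Sob" "v \<in> Sob"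
  shows "(\<lambda>x. u x - v x) \<in> Sob" "nrm (D i (\<lambda>x. u x - v x)) = nrm (\<lambda>x. D i u x - D i v x)"
proof -
  have w: "wpd i (\<lambda>x. u x - v x) (\<lambda>x. D i u x - D i v x)" for i
    using assms by (intro weak_pd_diff SobD) auto
  show "(\<lambda>x. u x - v x) \<in> Sob" by (rule SobI[OF _ _ w]) (use assms SobD in auto)
  show "nrm (D i (\<lambda>x. u x - v x)) = nrm (\<lambda>x. D i u x - D i v x)"
    by (rule nrm_wd_eq[OF _ w]) (use assms SobD in auto)
qed

lemma VV_D:
  assumes "\<phi> \<in> VVs"
  shows "C1 \<phi>" "C1 (pd i \<phi>)" "\<phi> \<in> LL" "pd i \<phi> \<in> LL" "\<phi> \<in> Sob" "smooth_on UNIV \<phi>"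
    "\<And>x. \<phi> (subst_coord 1 x Lx) = \<phi> (subst_coord 1 x 0)" "\<And>x. \<phi> (subst_coord 2 x Ly) = \<phi> (subst_coord 2 x 0)"
proof -
  have s: "smooth_on UNIV \<phi>" and p: "\<phi> (x + axis 1 Lx) = \<phi> x" "\<phi> (x + axis 2 Ly) = \<phi> x" for x
    using assms unfolding VV_def by auto
  show "smooth_on UNIV \<phi>" by fact
  show C: "C1 \<phi>" "C1 (pd i \<phi>)" for i using s smooth_on_imp_C1 smooth_on_pd by blast+
  show L: "\<phi> \<in> LL" "pd i \<phi> \<in> LL" for i using C continuous_L2 C1_continuous by blast+
  show "\<phi> \<in> Sob" by (rule SobI[OF L C1_weak_pd[OF C(1)]])
  have "subst_coord 1 x Lx = subst_coord 1 x 0 + axis 1 Lx" "subst_coord 2 x Ly = subst_coord 2 x 0 + axis 2 Ly" for x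
    by (auto simp: vec_eq_iff axis_def)
  then show "\<phi> (subst_coord 1 x Lx) = \<phi> (subst_coord 1 x 0)" "\<phi> (subst_coord 2 x Ly) = \<phi> (subst_coord 2 x 0)" for x
    using p by simp_all
qed

lemma V_D: "u \<in> Vs \<Longrightarrow> u \<in> Sob" "u \<in> Vs \<Longrightarrow> u \<in> LL" "u \<in> Vs \<Longrightarrow> D i u \<in> LL" "u \<in> Vs \<Longrightarrow> wpd i u (D i u)"
  using SobD by (auto simp: V_def)

lemma h1norm_sq: "(h1norm Lx Ly h u)\<^sup>2 = (nrm u)\<^sup>2 + gsq u"
  by (simp add: h1norm_def)

lemma V_approx:
  assumes u: "u \<in> Vs"
  obtains \<phi> where "\<And>n. \<phi> n \<in> VVs" "(\<lambda>n. nrm (\<lambda>x. \<phi> n x - u x)) \<longlonglongrightarrow> 0"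
    "\<And>i. (\<lambda>n. nrm (\<lambda>x. pd i (\<phi> n) x - D i u x)) \<longlonglongrightarrow> 0"
proof -
  have "\<forall>n. \<exists>\<phi>\<in>VVs. h1norm Lx Ly h (\<lambda>x. u x - \<phi> x) < 1 / Suc n"
    using u unfolding V_def by simp
  then obtain \<phi> where \<phi>: "\<And>n. \<phi> n \<in> VVs" "\<And>n. h1norm Lx Ly h (\<lambda>x. u x - \<phi> n x) < 1 / Suc n" by metis
  have S: "u \<in> Sob" "\<phi> n \<in> Sob" for n using u \<phi>(1) V_D VV_D by auto
  have lim: "(\<lambda>n. 1 / real (Suc n)) \<longlonglongrightarrow> 0" using LIMSEQ_Suc[OF lim_1_over_n] by simp
  have le1: "nrm (\<lambda>x. \<phi> n x - u x) \<le> 1 / Suc n" for n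
  proof -
    have "nrm (\<lambda>x. u x - \<phi> n x) \<le> h1norm Lx Ly h (\<lambda>x. u x - \<phi> n x)" unfolding h1norm_def by (rule real_le_rsqrt) simp
    then show ?thesis using \<phi>(2)[of n] by (simp add: nrm_diff_commute[of "\<phi> n"])
  qed
  have le2: "nrm (\<lambda>x. pd i (\<phi> n) x - D i u x) \<le> 1 / Suc n" for n i
  proof -
    have "wpd i (\<lambda>x. u x - \<phi> n x) (\<lambda>x. D i u x - pd i (\<phi> n) x)"
      using SobD[OF S(1)] VV_D[OF \<phi>(1)] by (intro weak_pd_diff C1_weak_pd) auto
    then have "nrm (\<lambda>x. D i u x - pd i (\<phi> n) x) = nrm (D i (\<lambda>x. u x - \<phi> n x))"
      using SobD[OF S(1)] VV_D[OF \<phi>(1)] by (intro nrm_wd_eq[symmetric]) auto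
    also have "\<dots> \<le> sqrt (gsq (\<lambda>x. u x - \<phi> n x))" by (rule nrm_wd_le)
    also have "\<dots> \<le> h1norm Lx Ly h (\<lambda>x. u x - \<phi> n x)" unfolding h1norm_def by simp
    finally show ?thesis using \<phi>(2)[of n] by (simp add: nrm_diff_commute[of "pd i (\<phi> n)"])
  qed
  show ?thesis
  proof (rule that[OF \<phi>(1)])
    show "(\<lambda>n. nrm (\<lambda>x. \<phi> n x - u x)) \<longlonglongrightarrow> 0"
      by (rule Lim_null_comparison[OF _ lim]) (use le1 in simp)
    show "(\<lambda>n. nrm (\<lambda>x. pd i (\<phi> n) x - D i u x)) \<longlonglongrightarrow> 0" for i
      by (rule Lim_null_comparison[OF _ lim]) (use le2 in simp)
  qed
qed

lemma pd_add: "C1 f \<Longrightarrow> C1 g \<Longrightarrow> pd i (\<lambda>x. f x + g x) = (\<lambda>x. pd i f x + pd i g x)"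
proof
  fix x assume f: "C1 f" "C1 g"
  show "pd i (\<lambda>x. f x + g x) x = pd i f x + pd i g x"
    using f pd_line[of f i x "x $ i" UNIV] pd_line[of g i x "x $ i" UNIV]
    by (intro pd_eqI) (auto intro!: derivative_intros simp: C1_differentiable)
qed

lemma pd_scaleR: "C1 f \<Longrightarrow> pd i (\<lambda>x. c *\<^sub>R f x) = (\<lambda>x. c *\<^sub>R pd i f x)"
proof
  fix x assume f: "C1 f"
  show "pd i (\<lambda>x. c *\<^sub>R f x) x = c *\<^sub>R pd i f x"
    using f pd_line[of f i x "x $ i" UNIV]
    by (intro pd_eqI bounded_linear.has_vector_derivative[OF bounded_linear_scaleR_right]) (auto intro!: derivative_intros simp: C1_differentiable)
qed

lemma C1_add: "C1 f \<Longrightarrow> C1 g \<Longrightarrow> C1 (\<lambda>x. f x + g x)"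
  unfolding C1_def[of "\<lambda>x. f x + g x"] by (auto simp: pd_add C1_differentiable C1_continuous_pd intro!: continuous_intros)

lemma C1_scaleR: "C1 f \<Longrightarrow> C1 (\<lambda>x. c *\<^sub>R f x)"
  unfolding C1_def[of "\<lambda>x. c *\<^sub>R f x"] by (auto simp: pd_scaleR C1_differentiable C1_continuous_pd intro!: continuous_intros)

lemma smooth_add_scale:
  "smooth_on UNIV f \<Longrightarrow> smooth_on UNIV g \<Longrightarrow> smooth_on UNIV (\<lambda>x. a *\<^sub>R f x + g x)"
proof -
  have "smooth_on UNIV f \<Longrightarrow> smooth_on UNIV g \<Longrightarrow> Ck_on n UNIV (\<lambda>x. a *\<^sub>R f x + g x)" for n
  proof (induction n arbitrary: f g)
    case 0
    then show ?case using smooth_on_imp_C1[THEN C1_continuous] by (auto intro!: continuous_intros)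
  next
    case (Suc n)
    have C: "C1 f" "C1 g" using Suc.prems smooth_on_imp_C1 by auto
    have "pd i (\<lambda>x. a *\<^sub>R f x + g x) = (\<lambda>x. a *\<^sub>R pd i f x + pd i g x)" for i
      using C by (simp add: pd_add C1_scaleR pd_scaleR)
    then show ?case
      using Suc.IH[OF smooth_on_pd[OF Suc.prems(1)] smooth_on_pd[OF Suc.prems(2)]]
        C1_differentiable[OF C1_add[OF C1_scaleR[OF C(1)] C(2)]] by simp
  qed
  then show "smooth_on UNIV f \<Longrightarrow> smooth_on UNIV g \<Longrightarrow> smooth_on UNIV (\<lambda>x. a *\<^sub>R f x + g x)"
    by (simp add: smooth_on_def)
qed

lemma VV_add_scale:
  assumes "\<phi> \<in> VVs" "\<psi> \<in> VVs"
  shows "(\<lambda>x. a *\<^sub>R \<phi> x + \<psi> x) \<in> VVs"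
proof -
  have pd: "pd i (\<lambda>x. a *\<^sub>R \<phi> x + \<psi> x) = (\<lambda>x. a *\<^sub>R pd i \<phi> x + pd i \<psi> x)" for i
    using VV_D[OF assms(1)] VV_D[OF assms(2)] by (simp add: pd_add C1_scaleR pd_scaleR)
  show ?thesis
    using assms smooth_add_scale[OF VV_D(6)[OF assms(1)] VV_D(6)[OF assms(2)]] unfolding VV_def mem_Collect_eq pd
    by (simp add: sum.distrib flip: sum_distrib_left)
qed

lemma zero_VV: "(\<lambda>x. 0) \<in> VVs"
proof -
  have pd0: "pd i (\<lambda>x::point. 0 :: point) = (\<lambda>x. 0)" for i by (simp add: pd_def fun_eq_iff)
  have "Ck_on n UNIV (\<lambda>x::point. 0 :: point)" for n by (induction n) (auto simp: pd0)
  then show ?thesis by (simp add: VV_def smooth_on_def pd0)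
qed

lemma V_add_scale:
  assumes u: "u \<in> Vs" and v: "v \<in> Vs"
  shows "(\<lambda>x. a *\<^sub>R u x + v x) \<in> Vs"
  unfolding V_def mem_Collect_eq
proof (intro conjI allI impI)
  have w: "wpd i (\<lambda>x. a *\<^sub>R u x + v x) (\<lambda>x. a *\<^sub>R D i u x + D i v x)" for i
    using u v by (intro weak_pd_add weak_pd_scale V_D L2_scale) auto
  show "(\<lambda>x. a *\<^sub>R u x + v x) \<in> Sob"
    by (rule SobI[OF _ _ w]) (intro L2_add L2_scale V_D(2,3) u v)+
  fix e :: real assume e: "e > 0"
  obtain \<phi> where \<phi>: "\<And>n. \<phi> n \<in> VVs" "(\<lambda>n. nrm (\<lambda>x. \<phi> n x - u x)) \<longlonglongrightarrow> 0"
    "\<And>i. (\<lambda>n. nrm (\<lambda>x. pd i (\<phi> n) x - D i u x)) \<longlonglongrightarrow> 0" using V_approx[OF u] by blast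
  obtain \<psi> where \<psi>: "\<And>n. \<psi> n \<in> VVs" "(\<lambda>n. nrm (\<lambda>x. \<psi> n x - v x)) \<longlonglongrightarrow> 0"
    "\<And>i. (\<lambda>n. nrm (\<lambda>x. pd i (\<psi> n) x - D i v x)) \<longlonglongrightarrow> 0" using V_approx[OF v] by blast
  define s where "s n = (\<lambda>x. a *\<^sub>R \<phi> n x + \<psi> n x)" for n
  have s: "s n \<in> VVs" for n unfolding s_def by (rule VV_add_scale[OF \<phi>(1) \<psi>(1)])
  have pds: "pd i (s n) = (\<lambda>x. a *\<^sub>R pd i (\<phi> n) x + pd i (\<psi> n) x)" for i n
    unfolding s_def using VV_D[OF \<phi>(1)] VV_D[OF \<psi>(1)] by (simp add: pd_add C1_scaleR pd_scaleR)
  have lin: "(\<lambda>n. nrm (\<lambda>x. (a *\<^sub>R p x + q x) - (a *\<^sub>R p' n x + q' n x))) \<longlonglongrightarrow> 0"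
    if L: "p \<in> LL" "q \<in> LL" "\<And>n. p' n \<in> LL" "\<And>n. q' n \<in> LL"
      and l: "(\<lambda>n. nrm (\<lambda>x. p' n x - p x)) \<longlonglongrightarrow> 0" "(\<lambda>n. nrm (\<lambda>x. q' n x - q x)) \<longlonglongrightarrow> 0" for p q p' q'
  proof (rule Lim_null_comparison)
    have "nrm (\<lambda>x. (a *\<^sub>R p x + q x) - (a *\<^sub>R p' n x + q' n x)) \<le> \<bar>a\<bar> * nrm (\<lambda>x. p' n x - p x) + nrm (\<lambda>x. q' n x - q x)" for n
    proof -
      have "(\<lambda>x. (a *\<^sub>R p x + q x) - (a *\<^sub>R p' n x + q' n x)) = (\<lambda>x. a *\<^sub>R (p x - p' n x) + (q x - q' n x))"
        by (auto simp: algebra_simps)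
      then have "nrm (\<lambda>x. (a *\<^sub>R p x + q x) - (a *\<^sub>R p' n x + q' n x)) \<le> nrm (\<lambda>x. a *\<^sub>R (p x - p' n x)) + nrm (\<lambda>x. q x - q' n x)"
        using nrm_triangle[of "\<lambda>x. a *\<^sub>R (p x - p' n x)" "\<lambda>x. q x - q' n x"] L by (simp add: L2_scale L2_diff)
      then show ?thesis by (simp add: nrm_diff_commute[of p] nrm_diff_commute[of q])
    qed
    then show "\<forall>\<^sub>F n in sequentially. norm (nrm (\<lambda>x. (a *\<^sub>R p x + q x) - (a *\<^sub>R p' n x + q' n x))) \<le> \<bar>a\<bar> * nrm (\<lambda>x. p' n x - p x) + nrm (\<lambda>x. q' n x - q x)"
      by simp
    have "(\<lambda>n. \<bar>a\<bar> * nrm (\<lambda>x. p' n x - p x) + nrm (\<lambda>x. q' n x - q x)) \<longlonglongrightarrow> \<bar>a\<bar> * 0 + 0"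
      by (intro tendsto_intros l)
    then show "(\<lambda>n. \<bar>a\<bar> * nrm (\<lambda>x. p' n x - p x) + nrm (\<lambda>x. q' n x - q x)) \<longlonglongrightarrow> 0" by simp
  qed
  have eq: "(h1norm Lx Ly h (\<lambda>x. (a *\<^sub>R u x + v x) - s n x))\<^sup>2 =
     (nrm (\<lambda>x. (a *\<^sub>R u x + v x) - s n x))\<^sup>2 + (\<Sum>i\<in>UNIV. (nrm (\<lambda>x. (a *\<^sub>R D i u x + D i v x) - pd i (s n) x))\<^sup>2)" for n
  proof -
    have "wpd i (\<lambda>x. (a *\<^sub>R u x + v x) - s n x) (\<lambda>x. (a *\<^sub>R D i u x + D i v x) - pd i (s n) x)" for i
      using V_D(2,3)[OF u] V_D(2,3)[OF v] VV_D[OF s] by (intro weak_pd_diff w C1_weak_pd L2_add L2_scale) auto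
    then have "nrm (D i (\<lambda>x. (a *\<^sub>R u x + v x) - s n x)) = nrm (\<lambda>x. (a *\<^sub>R D i u x + D i v x) - pd i (s n) x)" for i
      using V_D(2,3)[OF u] V_D(2,3)[OF v] VV_D[OF s] by (intro nrm_wd_eq L2_diff L2_add L2_scale) auto
    then show ?thesis by (simp add: h1norm_sq grad_sq_eq)
  qed
  have "(\<lambda>n. (h1norm Lx Ly h (\<lambda>x. (a *\<^sub>R u x + v x) - s n x))\<^sup>2) \<longlonglongrightarrow> 0\<^sup>2 + (\<Sum>i\<in>(UNIV::3 set). 0\<^sup>2)"
    unfolding eq unfolding pds unfolding s_def
    using V_D[OF u] V_D[OF v] VV_D[OF \<phi>(1)] VV_D[OF \<psi>(1)]
    by (intro tendsto_add tendsto_sum tendsto_power lin \<phi> \<psi>) auto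
  then have "eventually (\<lambda>n. (h1norm Lx Ly h (\<lambda>x. (a *\<^sub>R u x + v x) - s n x))\<^sup>2 < e\<^sup>2) sequentially"
    by (rule order_tendstoD(2)) (use e in simp)
  then obtain n where "(h1norm Lx Ly h (\<lambda>x. (a *\<^sub>R u x + v x) - s n x))\<^sup>2 < e\<^sup>2"
    unfolding eventually_sequentially by blast
  then have "h1norm Lx Ly h (\<lambda>x. (a *\<^sub>R u x + v x) - s n x) < e" by (rule power2_less_imp_less) (rule less_imp_le[OF e])
  then show "\<exists>\<phi>\<in>VVs. h1norm Lx Ly h (\<lambda>x. a *\<^sub>R u x + v x - \<phi> x) < e" using s by blast
qed

lemma V_zero: "(\<lambda>x. 0) \<in> Vs"
proof -
  have "(\<lambda>x. 0) \<in> Sob" using VV_D(5)[OF zero_VV] .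
  moreover have "h1norm Lx Ly h (\<lambda>x. 0) = 0"
  proof -
    have "nrm (D i (\<lambda>x. 0)) = 0" for i using nrm_wd_eq[OF L2_zero weak_pd_zero] by (simp add: l2norm_def l2inner_def)
    then show ?thesis by (simp add: h1norm_def grad_sq_eq l2norm_def l2inner_def)
  qed
  ultimately show ?thesis using zero_VV unfolding V_def by (auto intro!: bexI[of _ "\<lambda>x. 0"])
qed

lemma V_sum: "finite F \<Longrightarrow> (\<And>m. m \<in> F \<Longrightarrow> f m \<in> Vs) \<Longrightarrow> (\<lambda>x. \<Sum>m\<in>F. c m *\<^sub>R f m x) \<in> Vs"
  by (induction F rule: finite_induct) (auto simp: V_zero V_add_scale)

lemma V_diff: "u \<in> Vs \<Longrightarrow> v \<in> Vs \<Longrightarrow> (\<lambda>x. u x - v x) \<in> Vs"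
  using V_add_scale[of v u "-1"] by simp

definition h1sq :: "field \<Rightarrow> real" where "h1sq u = (nrm u)\<^sup>2 + gsq u"

lemma h1sq_nonneg [simp]: "0 \<le> h1sq u" by (simp add: h1sq_def)

text \<open>Transfers inequalities from the generating smooth fields: along an approximating sequence the right-hand sides converge and the left-hand sides obey Fatou's lemma.\<close>

lemma V_Fatou:
  assumes u: "u \<in> Vs"
    and k: "\<And>x. continuous_on UNIV (k x)" "\<And>f. f \<in> borel_measurable M \<Longrightarrow> (\<lambda>x. k x (f x)) \<in> borel_measurable M"
    and B: "continuous_on UNIV B"
    and le: "\<And>\<phi>. \<phi> \<in> VVs \<Longrightarrow> (\<integral>\<^sup>+x. ennreal (k x (\<phi> x)) \<partial>M) \<le> ennreal (B ((nrm \<phi>)\<^sup>2 + (\<Sum>i\<in>UNIV. (nrm (pd i \<phi>))\<^sup>2)))"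
  shows "(\<integral>\<^sup>+x. ennreal (k x (u x)) \<partial>M) \<le> ennreal (B (h1sq u))"
proof -
  obtain \<phi> where \<phi>: "\<And>n. \<phi> n \<in> VVs" "(\<lambda>n. nrm (\<lambda>x. \<phi> n x - u x)) \<longlonglongrightarrow> 0"
    "\<And>i. (\<lambda>n. nrm (\<lambda>x. pd i (\<phi> n) x - D i u x)) \<longlonglongrightarrow> 0" using V_approx[OF u] by blast
  note L = VV_D(3,4)[OF \<phi>(1)] V_D(2,3)[OF u]
  obtain r where r: "strict_mono r" "AE x in M. (\<lambda>n. \<phi> (r n) x) \<longlonglongrightarrow> u x"
    using L2_limit_AE_subseq[OF L(1,3) \<phi>(2)] by blast
  let ?b = "\<lambda>n. B ((nrm (\<phi> n))\<^sup>2 + (\<Sum>i\<in>UNIV. (nrm (pd i (\<phi> n)))\<^sup>2))"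
  have "?b \<longlonglongrightarrow> B (h1sq u)"
    unfolding h1sq_def grad_sq_eq
    by (intro continuous_on_tendsto_compose[OF B] tendsto_add tendsto_power tendsto_sum nrm_tendsto L \<phi>) auto
  then have lim: "(\<lambda>n. ennreal (?b (r n))) \<longlonglongrightarrow> ennreal (B (h1sq u))"
    using LIMSEQ_subseq_LIMSEQ[OF _ r(1), of ?b] by (intro tendsto_ennrealI) (simp add: o_def)
  have "(\<integral>\<^sup>+x. ennreal (k x (u x)) \<partial>M) = (\<integral>\<^sup>+x. liminf (\<lambda>n. ennreal (k x (\<phi> (r n) x))) \<partial>M)"
  proof (rule nn_integral_cong_AE, use r(2) in eventually_elim)
    fix x assume "(\<lambda>n. \<phi> (r n) x) \<longlonglongrightarrow> u x"
    then have "(\<lambda>n. ennreal (k x (\<phi> (r n) x))) \<longlonglongrightarrow> ennreal (k x (u x))"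
      by (intro tendsto_ennrealI continuous_on_tendsto_compose[OF k(1)]) auto
    from lim_imp_Liminf[OF _ this] show "ennreal (k x (u x)) = liminf (\<lambda>n. ennreal (k x (\<phi> (r n) x)))" by simp
  qed
  also have "\<dots> \<le> liminf (\<lambda>n. \<integral>\<^sup>+x. ennreal (k x (\<phi> (r n) x)) \<partial>M)"
    using k(2)[OF L2D(1)[OF L(1)]] by (intro nn_integral_liminf) measurable
  also have "\<dots> \<le> liminf (\<lambda>n. ennreal (?b (r n)))"
    by (intro Liminf_mono always_eventually allI le \<phi>)
  also have "\<dots> = ennreal (B (h1sq u))" using lim_imp_Liminf[OF _ lim] by simp
  finally show ?thesis .
qed

text \<open>Used to make \<open>((u \<cdot>\<nabla>)u, b)\<close> meaningful and continuous in \<open>b \<in> V\<close>.\<close>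

lemma V_L4:
  assumes "u \<in> Vs"
  shows "(\<integral>\<^sup>+x. ennreal ((norm (u x))^4) \<partial>M) \<le> ennreal (96 * cell_const ^ 3 * (h1sq u)\<^sup>2)"
  by (rule V_Fatou[OF assms, of "\<lambda>x y. (norm y)^4" "\<lambda>s. 96 * cell_const ^ 3 * s\<^sup>2"])
     (auto intro!: continuous_intros Ladyzhenskaya_C1 VV_D)

lemma V_anisotropic:
  assumes "u \<in> Vs" "C1 v" "C1 (pd 2 v)"
  shows "(\<integral>\<^sup>+x. ennreal ((norm (u x))\<^sup>2 * (norm (v x))\<^sup>2) \<partial>M) \<le> ennreal (64 * cell_const ^ 3 * (h1sq u * horizontal_energy v))"
proof (rule V_Fatou[OF assms(1), of "\<lambda>x y. (norm y)\<^sup>2 * (norm (v x))\<^sup>2" "\<lambda>s. 64 * cell_const ^ 3 * (s * horizontal_energy v)"])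
  show "(\<lambda>x. (norm (f x))\<^sup>2 * (norm (v x))\<^sup>2) \<in> borel_measurable M" if [measurable]: "f \<in> borel_measurable M" for f
  proof -
    have [measurable]: "v \<in> borel_measurable M" using borel_measurable_M[OF C1_measurable[OF assms(2)]] .
    show ?thesis by measurable
  qed
qed (auto intro!: continuous_intros anisotropic_product_C1 VV_D assms)

lemma ennreal_square_le:
  assumes "x\<^sup>2 \<le> (ennreal r)\<^sup>2" "0 \<le> r"
  shows "x \<le> ennreal r"
proof (cases x rule: ennreal_cases)
  case (real s)
  then have "s\<^sup>2 \<le> r\<^sup>2" using assms by (simp add: ennreal_power)
  then show ?thesis using real assms by (auto intro: ennreal_leI power2_le_imp_le)
next
  case top
  then show ?thesis using assms by (simp add: ennreal_power power2_eq_square ennreal_top_mult top_unique ennreal_mult_eq_top_iff)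
qed

lemma V_L4_product:
  assumes u: "u \<in> Vs" and v: "v \<in> Vs"
  shows "(\<integral>\<^sup>+x. ennreal ((norm (u x))\<^sup>2 * (norm (v x))\<^sup>2) \<partial>M) \<le> ennreal (96 * cell_const ^ 3 * (h1sq u * h1sq v))"
proof -
  let ?I = "\<integral>\<^sup>+x. ennreal ((norm (u x))\<^sup>2 * (norm (v x))\<^sup>2) \<partial>M" and ?K = "96 * cell_const ^ 3"
  have [measurable]: "u \<in> borel_measurable M" "v \<in> borel_measurable M" using L2D(1) V_D u v by auto
  have K: "0 \<le> ?K" using cell_const(2) by simp
  have "?I\<^sup>2 = (\<integral>\<^sup>+x. ennreal ((norm (u x))\<^sup>2) * ennreal ((norm (v x))\<^sup>2) \<partial>M)\<^sup>2"
    by (simp add: ennreal_mult)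
  also have "\<dots> \<le> (\<integral>\<^sup>+x. (ennreal ((norm (u x))\<^sup>2))\<^sup>2 \<partial>M) * (\<integral>\<^sup>+x. (ennreal ((norm (v x))\<^sup>2))\<^sup>2 \<partial>M)"
    by (rule Cauchy_Schwarz_nn_integral) measurable
  also have "\<dots> = (\<integral>\<^sup>+x. ennreal ((norm (u x))^4) \<partial>M) * (\<integral>\<^sup>+x. ennreal ((norm (v x))^4) \<partial>M)"
    by (simp add: ennreal_power flip: power_mult)
  also have "\<dots> \<le> ennreal (?K * (h1sq u)\<^sup>2) * ennreal (?K * (h1sq v)\<^sup>2)"
    by (intro mult_mono V_L4 u v) auto
  also have "\<dots> = (ennreal (?K * (h1sq u * h1sq v)))\<^sup>2"
  proof -
    have "(?K * (h1sq u)\<^sup>2) * (?K * (h1sq v)\<^sup>2) = (?K * (h1sq u * h1sq v))\<^sup>2"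
      by (simp only: power_mult_distrib) (simp only: power2_eq_square ac_simps)
    moreover have "0 \<le> ?K * (h1sq u)\<^sup>2" "0 \<le> ?K * (h1sq v)\<^sup>2" "0 \<le> ?K * (h1sq u * h1sq v)"
      using K by (intro mult_nonneg_nonneg, auto)+
    ultimately show ?thesis by (simp only: ennreal_mult[symmetric] ennreal_power)
  qed
  finally have *: "?I\<^sup>2 \<le> (ennreal (?K * (h1sq u * h1sq v)))\<^sup>2" .
  show ?thesis by (rule ennreal_square_le[OF *]) (use K in auto)
qed

lemma vec_nth_measurable [measurable (raw)]:
  fixes f :: "'b \<Rightarrow> real^3"
  assumes "f \<in> borel_measurable N" shows "(\<lambda>x. f x $ i) \<in> borel_measurable N"
  by (rule measurable_compose[OF assms]) (intro borel_measurable_continuous_onI continuous_intros)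

text \<open>Cauchy--Schwarz against \<open>\<nabla>v\<close> leaves the square integral of \<open>|a| |b|\<close>, which is all that the two Sobolev inequalities are needed for.\<close>

lemma conv_bound:
  assumes v: "v \<in> Sob" and m: "a \<in> borel_measurable M" "b \<in> borel_measurable M"
    and ab: "(\<integral>\<^sup>+x. ennreal ((norm (a x))\<^sup>2 * (norm (b x))\<^sup>2) \<partial>M) \<le> ennreal (K\<^sup>2)" "0 \<le> K"
  shows "integrable M (\<lambda>x. conv Lx Ly h a v x \<bullet> b x)" "\<bar>ip (conv Lx Ly h a v) b\<bar> \<le> K * (\<Sum>i\<in>UNIV. nrm (D i v))"
proof -
  note [measurable] = m
  have Dm[measurable]: "D i v \<in> borel_measurable M" for i using L2D(1) SobD(2)[OF v] by blast
  define s where "s x = (norm (a x) * norm (b x)) *\<^sub>R (axis 1 1 :: point)" for x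
  have ns: "norm (s x) = norm (a x) * norm (b x)" for x by (simp add: s_def norm_axis_1 abs_mult)
  have "s \<in> borel_measurable M" unfolding s_def by measurable
  then have s: "s \<in> LL" "nrm s \<le> K" using L2_nnI[of s K] ab by (simp_all add: ns power_mult_distrib)
  have int: "integrable M (\<lambda>x. norm (s x) * norm (D i v x))" for i
    by (rule L2_norm_mult_integrable[OF s(1) SobD(2)[OF v]])
  have le: "\<bar>conv Lx Ly h a v x \<bullet> b x\<bar> \<le> (\<Sum>i\<in>UNIV. norm (s x) * norm (D i v x))" for x
  proof -
    have "\<bar>conv Lx Ly h a v x \<bullet> b x\<bar> \<le> (\<Sum>i\<in>UNIV. \<bar>a x $ i * (D i v x \<bullet> b x)\<bar>)"
      unfolding conv_def inner_sum_left inner_scaleR_left by (rule sum_abs)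
    also have "\<dots> \<le> (\<Sum>i\<in>UNIV. norm (a x) * (norm (D i v x) * norm (b x)))"
      unfolding abs_mult by (intro sum_mono mult_mono component_le_norm_cart Cauchy_Schwarz_ineq2) auto
    finally show ?thesis by (simp add: ns ac_simps)
  qed
  show I: "integrable M (\<lambda>x. conv Lx Ly h a v x \<bullet> b x)"
  proof (rule Bochner_Integration.integrable_bound[OF Bochner_Integration.integrable_sum[OF int]])
    show "(\<lambda>x. conv Lx Ly h a v x \<bullet> b x) \<in> borel_measurable M" unfolding conv_def by measurable
    show "AE x in M. norm (conv Lx Ly h a v x \<bullet> b x) \<le> norm (\<Sum>i\<in>UNIV. norm (s x) * norm (D i v x))"
      using order_trans[OF le abs_ge_self] by (intro AE_I2) simp
  qed
  have "\<bar>ip (conv Lx Ly h a v) b\<bar> \<le> (LINT x|M. (\<Sum>i\<in>UNIV. norm (s x) * norm (D i v x)))"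
    unfolding l2inner_def using I int le by (intro order_trans[OF integral_abs_bound] integral_mono integrable_abs) auto
  also have "\<dots> = (\<Sum>i\<in>UNIV. LINT x|M. norm (s x) * norm (D i v x))" using int by simp
  also have "\<dots> \<le> (\<Sum>i\<in>UNIV. K * nrm (D i v))"
    by (intro sum_mono order_trans[OF Cauchy_Schwarz_integral] mult_right_mono s SobD v) auto
  finally show "\<bar>ip (conv Lx Ly h a v) b\<bar> \<le> K * (\<Sum>i\<in>UNIV. nrm (D i v))" by (simp add: sum_distrib_left)
qed

lemma sum_nrm_wd_le: "(\<Sum>i\<in>(UNIV::3 set). nrm (D i v)) \<le> 3 * sqrt (gsq v)"
  using sum_mono[of UNIV "\<lambda>i. nrm (D i v)" "\<lambda>_. sqrt (gsq v)", OF nrm_wd_le] by simp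

lemma conv_V_bound:
  assumes "u \<in> Vs" "v \<in> Vs" "b \<in> Vs"
  shows "integrable M (\<lambda>x. conv Lx Ly h u v x \<bullet> b x)"
    "\<bar>ip (conv Lx Ly h u v) b\<bar> \<le> sqrt (96 * cell_const ^ 3 * (h1sq u * h1sq b)) * (3 * sqrt (gsq v))"
proof -
  let ?K = "sqrt (96 * cell_const ^ 3 * (h1sq u * h1sq b))"
  have K: "0 \<le> 96 * cell_const ^ 3 * (h1sq u * h1sq b)" using cell_const(2) by simp
  have 1: "(\<integral>\<^sup>+x. ennreal ((norm (u x))\<^sup>2 * (norm (b x))\<^sup>2) \<partial>M) \<le> ennreal (?K\<^sup>2)"
    using V_L4_product[OF assms(1,3)] K by simp
  note m = L2D(1)[OF V_D(2)[OF assms(1)]] L2D(1)[OF V_D(2)[OF assms(3)]]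
  show "integrable M (\<lambda>x. conv Lx Ly h u v x \<bullet> b x)" by (rule conv_bound(1)[OF V_D(1)[OF assms(2)] m 1]) (use K in simp)
  have "\<bar>ip (conv Lx Ly h u v) b\<bar> \<le> ?K * (\<Sum>i\<in>UNIV. nrm (D i v))"
    by (rule conv_bound(2)[OF V_D(1)[OF assms(2)] m 1]) (use K in simp)
  also have "\<dots> \<le> ?K * (3 * sqrt (gsq v))" using K by (intro mult_left_mono sum_nrm_wd_le) auto
  finally show "\<bar>ip (conv Lx Ly h u v) b\<bar> \<le> ?K * (3 * sqrt (gsq v))" .
qed

section \<open>Trigonometric fields\<close>

text \<open>The family of cosine and sine, with \<open>sgt\<close> the sign of the derivative, so that products of the two need no case distinction.\<close>

definition trg :: "bool \<Rightarrow> real \<Rightarrow> real" where "trg b = (if b then cos else sin)"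
definition sgt :: "bool \<Rightarrow> real" where "sgt b = (if b then - 1 else 1)"

lemma trg_deriv: "((\<lambda>t. trg b (k * t + r)) has_real_derivative (sgt b * k) * trg (\<not> b) (k * t + r)) (at t)"
  by (cases b) (auto simp: trg_def sgt_def intro!: derivative_eq_intros)

lemma trg_deriv0: "((\<lambda>t. trg b (k * t)) has_real_derivative (sgt b * k) * trg (\<not> b) (k * t)) (at t)"
  using trg_deriv[of b k 0 t] by simp

lemma trg_continuous [continuous_intros]:
  fixes S :: "'a::t2_space set"
  assumes "continuous_on S f" shows "continuous_on S (\<lambda>x. trg b (f x))"
  using assms by (cases b) (auto simp: trg_def intro: continuous_on_cos continuous_on_sin)

lemma trg_period: "trg b (2 * pi * of_int j) = trg b 0"
  by (cases b) (auto simp: trg_def cos_int_2pin sin_int_2pin)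

context
  fixes \<alpha> \<beta> \<gamma> :: real
begin

text \<open>A product of a cosine or sine in each coordinate, with fixed frequencies \<open>\<alpha>, \<beta>, \<gamma>\<close> and phase \<open>h/2\<close> in \<open>z\<close>, times a constant vector.\<close>

definition trig_base :: "bool \<Rightarrow> bool \<Rightarrow> bool \<Rightarrow> point \<Rightarrow> field" where
  "trig_base a b z c = (\<lambda>x. (trg a (\<alpha> * x $ 1) * trg b (\<beta> * x $ 2) * trg z (\<gamma> * (x $ 3 + h/2))) *\<^sub>R c)"

inductive trig :: "field \<Rightarrow> bool" where
  base: "trig (trig_base a b z c)"
| add: "trig F \<Longrightarrow> trig G \<Longrightarrow> trig (\<lambda>x. F x + G x)"

lemma trig_base_differentiable: "trig_base a b z c differentiable (at x)"
proof -
  have fl: "(\<lambda>x. trg b (k * x $ i + r)) differentiable (at x)" for b k i r and x :: point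
  proof -
    have "((\<lambda>x::point. k * x $ i + r) has_derivative (\<lambda>x. k * x $ i)) (at x)"
      by (auto intro!: derivative_eq_intros bounded_linear.has_derivative[OF bounded_linear_vec_nth])
    moreover have "(trg b has_real_derivative sgt b * trg (\<not> b) t) (at t)" for t
      using trg_deriv0[of b 1 t] by simp
    then have "(trg b has_derivative (*) (sgt b * trg (\<not> b) (k * x $ i + r))) (at (k * x $ i + r))"
      by (simp add: has_field_derivative_def)
    ultimately show ?thesis using has_derivative_compose by (blast intro: differentiableI)
  qed
  have "(\<lambda>x. trg a (\<alpha> * x $ 1) * trg b (\<beta> * x $ 2) * trg z (\<gamma> * (x $ 3 + h/2))) differentiable (at x)"
    using fl[of a \<alpha> 1 0 x] fl[of b \<beta> 2 0 x] fl[of z \<gamma> 3 "\<gamma> * (h/2)" x]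
    by (intro differentiable_mult) (simp_all add: distrib_left)
  then show ?thesis unfolding trig_base_def by (intro differentiable_scaleR) simp_all
qed

lemma pd_trig_base:
  "pd 1 (trig_base a b z c) = trig_base (\<not> a) b z ((sgt a * \<alpha>) *\<^sub>R c)"
  "pd 2 (trig_base a b z c) = trig_base a (\<not> b) z ((sgt b * \<beta>) *\<^sub>R c)"
  "pd 3 (trig_base a b z c) = trig_base a b (\<not> z) ((sgt z * \<gamma>) *\<^sub>R c)"
proof -
  have key: "((\<lambda>t. (trg b (k * t + r) * p) *\<^sub>R c) has_vector_derivative (trg (\<not> b) (k * t + r) * p) *\<^sub>R ((sgt b * k) *\<^sub>R c)) (at t)" for b k r p and c :: point and t
  proof -
    have "((\<lambda>t. trg b (k * t + r) * p) has_real_derivative ((sgt b * k) * trg (\<not> b) (k * t + r)) * p) (at t)"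
      by (intro DERIV_cmult_right trg_deriv)
    from has_vector_derivative_scaleR[OF this has_vector_derivative_const[of c]]
    show ?thesis by (simp add: ac_simps)
  qed
  show "pd 1 (trig_base a b z c) = trig_base (\<not> a) b z ((sgt a * \<alpha>) *\<^sub>R c)"
  proof
    fix x
    show "pd 1 (trig_base a b z c) x = trig_base (\<not> a) b z ((sgt a * \<alpha>) *\<^sub>R c) x"
      using key[of a \<alpha> 0 "trg b (\<beta> * x $ 2) * trg z (\<gamma> * (x $ 3 + h/2))" c "x $ 1"]
      by (intro pd_eqI trig_base_differentiable) (simp add: trig_base_def mult.assoc)
  qed
  show "pd 2 (trig_base a b z c) = trig_base a (\<not> b) z ((sgt b * \<beta>) *\<^sub>R c)"
  proof
    fix x
    show "pd 2 (trig_base a b z c) x = trig_base a (\<not> b) z ((sgt b * \<beta>) *\<^sub>R c) x"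
      using key[of b \<beta> 0 "trg a (\<alpha> * x $ 1) * trg z (\<gamma> * (x $ 3 + h/2))" c "x $ 2"]
      by (intro pd_eqI trig_base_differentiable) (simp add: trig_base_def mult.assoc mult.left_commute)
  qed
  show "pd 3 (trig_base a b z c) = trig_base a b (\<not> z) ((sgt z * \<gamma>) *\<^sub>R c)"
  proof
    fix x
    show "pd 3 (trig_base a b z c) x = trig_base a b (\<not> z) ((sgt z * \<gamma>) *\<^sub>R c) x"
      using key[of z \<gamma> "\<gamma> * (h/2)" "trg a (\<alpha> * x $ 1) * trg b (\<beta> * x $ 2)" c "x $ 3"]
      by (intro pd_eqI trig_base_differentiable) (simp add: trig_base_def distrib_left mult.commute[of "trg _ _ * trg _ _"])
  qed
qed

lemma trig_base_linear: "bounded_linear R \<Longrightarrow> (\<lambda>x. R (trig_base a b z c x)) = trig_base a b z (R c)"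
  by (simp add: trig_base_def linear_simps)

lemma trig_linear: "trig F \<Longrightarrow> bounded_linear R \<Longrightarrow> trig (\<lambda>x. R (F x))"
  by (induction rule: trig.induct) (auto simp: trig_base_linear linear_simps intro: trig.intros)

lemma trig_scale: "trig F \<Longrightarrow> trig (\<lambda>x. r *\<^sub>R F x)"
  using trig_linear[OF _ bounded_linear_scaleR_right] .

lemma pd_trig_base_trig: "trig (pd i (trig_base a b z c))"
  using exhaust_3[of i] by (auto simp: pd_trig_base intro: trig.base)

lemma trig_differentiable_pd: "trig F \<Longrightarrow> (\<forall>x. F differentiable (at x)) \<and> (\<forall>i. trig (pd i F))"
proof (induction rule: trig.induct)
  case (base a b z c)
  then show ?case using trig_base_differentiable pd_trig_base_trig by blast
next
  case (add F G)
  have "pd i (\<lambda>x. F x + G x) = (\<lambda>x. pd i F x + pd i G x)" for i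
  proof
    fix x
    show "pd i (\<lambda>x. F x + G x) x = pd i F x + pd i G x"
      using add.IH pd_line[of F i x "x $ i" UNIV] pd_line[of G i x "x $ i" UNIV]
      by (intro pd_eqI) (auto intro!: derivative_intros)
  qed
  then show ?case using add.IH by (auto intro: trig.add)
qed

lemma trig_pd: "trig F \<Longrightarrow> trig (pd i F)"
  using trig_differentiable_pd by blast

lemma trig_C1: "trig F \<Longrightarrow> C1 F"
  unfolding C1_def using trig_differentiable_pd[of F] trig_differentiable_pd[of "pd _ F"]
  by (auto intro!: continuous_at_imp_continuous_on differentiable_imp_continuous_within)

text \<open>Twofold horizontal derivatives act as multiplication by \<open>- \<alpha>\<^sup>2\<close> and \<open>- \<beta>\<^sup>2\<close>. All that is used below about the horizontal structure of the modes comes from this.\<close>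

lemma trig_pd_pd:
  assumes "trig F"
  shows "pd 1 (pd 1 F) = (\<lambda>x. - (\<alpha>\<^sup>2) *\<^sub>R F x) \<and> pd 2 (pd 2 F) = (\<lambda>x. - (\<beta>\<^sup>2) *\<^sub>R F x)"
  using assms
proof (induction rule: trig.induct)
  case (base a b z c)
  have e: "(sgt (\<not> a) * k) *\<^sub>R ((sgt a * k) *\<^sub>R c) = (- (k\<^sup>2)) *\<^sub>R c" for a k and c :: point
    by (cases a) (simp_all add: sgt_def power2_eq_square)
  have sc: "trig_base a b z (r *\<^sub>R c) = (\<lambda>x. r *\<^sub>R trig_base a b z c x)" for r
    using trig_base_linear[OF bounded_linear_scaleR_right, of r a b z c] by simp
  show ?case unfolding pd_trig_base e not_not sc by simp
next
  case (add F G)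
  then show ?case using trig_pd trig_C1 by (simp add: pd_add scaleR_right_distrib fun_eq_iff)
qed

lemma trig_periodic:
  assumes "trig F"
  shows "\<alpha> * Lx = 2 * pi * of_int j \<Longrightarrow> F (subst_coord 1 x 0) = F (subst_coord 1 x Lx)"
    "\<beta> * Ly = 2 * pi * of_int l \<Longrightarrow> F (subst_coord 2 x 0) = F (subst_coord 2 x Ly)"
  using assms by (induction rule: trig.induct) (auto simp: trig_base_def trg_period)

end

lemma trig_L2: "trig \<alpha> \<beta> \<gamma> F \<Longrightarrow> F \<in> LL"
  by (intro continuous_L2 C1_continuous trig_C1)

section \<open>Integration by parts in the horizontal directions\<close>

definition periodic_dir :: "3 \<Rightarrow> field \<Rightarrow> bool" where
  "periodic_dir i F \<longleftrightarrow> (\<forall>x. F (subst_coord i x (lo i)) = F (subst_coord i x (hi i)))"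

text \<open>The class of factors \<open>\<rho>(z)\<close> that are applied to fields: \<open>1\<close>, \<open>U\<close> and \<open>U'\<close>.\<close>

definition weight :: "(real \<Rightarrow> real) \<Rightarrow> bool" where
  "weight \<rho> \<longleftrightarrow> continuous_on {- h/2<..<h/2} \<rho> \<and> (\<exists>C. \<forall>z\<in>{- h/2<..<h/2}. \<bar>\<rho> z\<bar> \<le> C)"

lemma weight_one [simp]: "weight (\<lambda>_. 1)"
  by (auto simp: weight_def intro!: exI[of _ 1])

lemma Omega_z: "x \<in> Om \<Longrightarrow> x $ 3 \<in> {- h/2<..<h/2}"
  by (simp add: Omega_def)

lemma weight_borel: "weight \<rho> \<Longrightarrow> (\<lambda>x. indicator Om x * \<rho> (x $ 3)) \<in> borel_measurable borel"
proof -
  assume "weight \<rho>"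
  then have c: "continuous_on {- h/2<..<h/2} \<rho>" by (simp add: weight_def)
  have "continuous_on Om (\<lambda>x. \<rho> (x $ 3))"
  proof (rule continuous_on_compose2[OF c])
    show "continuous_on Om (\<lambda>x. x $ 3)" by (intro continuous_intros)
    show "(\<lambda>x. x $ 3) ` Om \<subseteq> {- h/2<..<h/2}" using Omega_z by blast
  qed
  from borel_measurable_continuous_on_indicator[OF Omega_borel this] show ?thesis by simp
qed

lemma weight_measurable: "weight \<rho> \<Longrightarrow> (\<lambda>x. \<rho> (x $ 3)) \<in> borel_measurable M"
  using borel_measurable_M'[of "\<lambda>x. \<rho> (x $ 3)"] weight_borel[of \<rho>] by simp

lemma weight_bound:
  assumes "weight \<rho>" obtains C where "C \<ge> 0" "\<And>x. x \<in> Om \<Longrightarrow> \<bar>\<rho> (x $ 3)\<bar> \<le> C"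
proof -
  obtain C where C: "\<forall>z\<in>{- h/2<..<h/2}. \<bar>\<rho> z\<bar> \<le> C" using assms unfolding weight_def by blast
  have "\<bar>\<rho> 0\<bar> \<le> C" using C h_pos by auto
  then have "C \<ge> 0" by linarith
  moreover have "\<bar>\<rho> (x $ 3)\<bar> \<le> C" if "x \<in> Om" for x using C Omega_z[OF that] by blast
  ultimately show ?thesis using that by blast
qed

lemma L2_weight:
  assumes "weight \<rho>" "u \<in> LL" shows "(\<lambda>x. \<rho> (x $ 3) *\<^sub>R u x) \<in> LL"
proof -
  obtain C where C: "\<And>x. x \<in> Om \<Longrightarrow> \<bar>\<rho> (x $ 3)\<bar> \<le> C" using weight_bound[OF assms(1)] by blast
  show ?thesis by (rule L2_mult_bounded[OF assms(2) weight_measurable[OF assms(1)] C])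
qed

lemma nrm_weight_tendsto:
  assumes "weight \<rho>" "\<And>n. f n \<in> LL" "u \<in> LL" "((\<lambda>n. nrm (\<lambda>x. f n x - u x)) \<longlongrightarrow> 0) F"
  shows "((\<lambda>n. nrm (\<lambda>x. \<rho> (x $ 3) *\<^sub>R f n x - \<rho> (x $ 3) *\<^sub>R u x)) \<longlongrightarrow> 0) F"
proof -
  obtain C where C: "\<And>x. x \<in> Om \<Longrightarrow> \<bar>\<rho> (x $ 3)\<bar> \<le> C" using weight_bound[OF assms(1)] by blast
  show ?thesis
  proof (rule Lim_null_comparison)
    have "nrm (\<lambda>x. \<rho> (x $ 3) *\<^sub>R f n x - \<rho> (x $ 3) *\<^sub>R u x) \<le> \<bar>C\<bar> * nrm (\<lambda>x. f n x - u x)" for n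
      using nrm_mult_bounded[OF L2_diff[OF assms(2,3)] weight_measurable[OF assms(1)] C, of n]
      by (simp add: scaleR_diff_right)
    then show "\<forall>\<^sub>F n in F. norm (nrm (\<lambda>x. \<rho> (x $ 3) *\<^sub>R f n x - \<rho> (x $ 3) *\<^sub>R u x)) \<le> \<bar>C\<bar> * nrm (\<lambda>x. f n x - u x)"
      by simp
    show "((\<lambda>n. \<bar>C\<bar> * nrm (\<lambda>x. f n x - u x)) \<longlongrightarrow> 0) F"
      using tendsto_mult_left[OF assms(4), of "\<bar>C\<bar>"] by simp
  qed
qed

lemma ip_weight_commute: "ip (\<lambda>x. \<rho> x *\<^sub>R u x) v = ip u (\<lambda>x. \<rho> x *\<^sub>R v x)"
  by (simp add: l2inner_def)

text \<open>A factor that depends on \<open>z\<close> only is constant along horizontal lines, and periodicity cancels the boundary terms.\<close>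

lemma integration_by_parts:
  assumes i: "i \<noteq> 3" and F: "C1 F" "periodic_dir i F" and G: "C1 G" "periodic_dir i G" and \<rho>: "weight \<rho>"
  shows "ip (\<lambda>x. \<rho> (x $ 3) *\<^sub>R pd i F x) G = - ip (\<lambda>x. \<rho> (x $ 3) *\<^sub>R F x) (pd i G)"
proof -
  have L: "F \<in> LL" "G \<in> LL" "pd i F \<in> LL" "pd i G \<in> LL"
    using continuous_L2 C1_continuous C1_continuous_pd F G by blast+
  note I1 = L2_inner_integrable[OF L2_weight[OF \<rho> L(1)] L(4)] and I2 = L2_inner_integrable[OF L2_weight[OF \<rho> L(3)] L(2)]
  let ?k = "\<lambda>x. F x \<bullet> pd i G x + pd i F x \<bullet> G x"
  have ck: "continuous_on UNIV ?k"
    using C1_continuous C1_continuous_pd F G by (intro continuous_intros) auto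
  have zs: "subst_coord i x t $ 3 = x $ 3" for x t using i by simp
  have "(LINT x|M. \<rho> (x $ 3) * ?k x) = 0"
  proof (rule integral_derivative_zero[where g = "\<lambda>x. \<rho> (x $ 3) * (F x \<bullet> G x)" and i = i])
    have "(\<lambda>x. (indicator Om x * \<rho> (x $ 3)) * ?k x) \<in> borel_measurable borel"
      using weight_borel[OF \<rho>] borel_measurable_continuous_onI[OF ck] by measurable
    then show "(\<lambda>x. indicator Om x * (\<rho> (x $ 3) * ?k x)) \<in> borel_measurable borel" by (simp add: mult.assoc)
    show "integrable M (\<lambda>x. \<rho> (x $ 3) * ?k x)"
      using Bochner_Integration.integrable_add[OF I1 I2] by (simp add: distrib_left)
    fix x assume x: "x \<in> Om"
    show "((\<lambda>t. \<rho> (subst_coord i x t $ 3) * (F (subst_coord i x t) \<bullet> G (subst_coord i x t))) has_real_derivative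
        \<rho> (subst_coord i x t $ 3) * ?k (subst_coord i x t)) (at t within {lo i..hi i})" for t
      unfolding zs
      using bounded_bilinear.has_vector_derivative[OF bounded_bilinear_inner pd_line[OF C1_differentiable[OF F(1)], where i = i and x = x and t = t and S = "{lo i..hi i}"]
        pd_line[OF C1_differentiable[OF G(1)], where i = i and x = x and t = t and S = "{lo i..hi i}"]]
      by (intro DERIV_cmult) (simp add: has_real_derivative_iff_has_vector_derivative)
    show "continuous_on {lo i..hi i} (\<lambda>t. \<rho> (subst_coord i x t $ 3) * ?k (subst_coord i x t))"
      unfolding zs by (intro continuous_on_mult continuous_on_const continuous_on_compose2[OF ck] continuous_intros) auto
    show "\<rho> (subst_coord i x (lo i) $ 3) * (F (subst_coord i x (lo i)) \<bullet> G (subst_coord i x (lo i))) =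
      \<rho> (subst_coord i x (hi i) $ 3) * (F (subst_coord i x (hi i)) \<bullet> G (subst_coord i x (hi i)))"
      unfolding zs using F(2) G(2) unfolding periodic_dir_def by simp
  qed
  then have "(LINT x|M. (\<rho> (x $ 3) *\<^sub>R F x) \<bullet> pd i G x + (\<rho> (x $ 3) *\<^sub>R pd i F x) \<bullet> G x) = 0"
    by (simp add: distrib_left)
  then show ?thesis using Bochner_Integration.integral_add[OF I1 I2] unfolding l2inner_def by linarith
qed

lemma VV_periodic: "\<phi> \<in> VVs \<Longrightarrow> i \<noteq> 3 \<Longrightarrow> periodic_dir i \<phi>"
  using exhaust_3[of i] VV_D(7,8)[of \<phi>] by (auto simp: periodic_dir_def lo_def hi_def)

lemma integration_by_parts_V:
  assumes i: "i \<noteq> 3" and u: "u \<in> Vs" and G: "C1 G" "periodic_dir i G" and \<rho>: "weight \<rho>"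
  shows "ip (\<lambda>x. \<rho> (x $ 3) *\<^sub>R D i u x) G = - ip (\<lambda>x. \<rho> (x $ 3) *\<^sub>R u x) (pd i G)"
proof -
  obtain \<phi> where \<phi>: "\<And>n. \<phi> n \<in> VVs" "(\<lambda>n. nrm (\<lambda>x. \<phi> n x - u x)) \<longlonglongrightarrow> 0"
    "\<And>i. (\<lambda>n. nrm (\<lambda>x. pd i (\<phi> n) x - D i u x)) \<longlonglongrightarrow> 0" using V_approx[OF u] by blast
  have L: "G \<in> LL" "pd i G \<in> LL" using continuous_L2 C1_continuous C1_continuous_pd G by blast+
  note P = VV_D(3,4)[OF \<phi>(1)] V_D(2,3)[OF u]
  have eq: "ip (\<lambda>x. \<rho> (x $ 3) *\<^sub>R pd i (\<phi> n) x) G = - ip (\<lambda>x. \<rho> (x $ 3) *\<^sub>R \<phi> n x) (pd i G)" for n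
    by (rule integration_by_parts[OF i VV_D(1)[OF \<phi>(1)] VV_periodic[OF \<phi>(1) i] G \<rho>])
  have "(\<lambda>n. ip (\<lambda>x. \<rho> (x $ 3) *\<^sub>R pd i (\<phi> n) x) G) \<longlonglongrightarrow> ip (\<lambda>x. \<rho> (x $ 3) *\<^sub>R D i u x) G"
    by (intro ip_tendsto_left L2_weight[OF \<rho>] P L nrm_weight_tendsto[OF \<rho>] \<phi>)
  moreover have "(\<lambda>n. - ip (\<lambda>x. \<rho> (x $ 3) *\<^sub>R \<phi> n x) (pd i G)) \<longlonglongrightarrow> - ip (\<lambda>x. \<rho> (x $ 3) *\<^sub>R u x) (pd i G)"
    by (intro tendsto_minus ip_tendsto_left L2_weight[OF \<rho>] P L nrm_weight_tendsto[OF \<rho>] \<phi>)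
  ultimately show ?thesis unfolding eq by (rule LIMSEQ_unique)
qed

lemma trig_periodic_dir:
  assumes "trig \<alpha> \<beta> \<gamma> F" "\<alpha> * Lx = 2 * pi * of_int j" "\<beta> * Ly = 2 * pi * of_int l" "i \<noteq> 3"
  shows "periodic_dir i F"
  using exhaust_3[of i] assms(4) trig_periodic(1)[OF assms(1,2)] trig_periodic(2)[OF assms(1,3)]
  by (auto simp: periodic_dir_def lo_def hi_def)

text \<open>Multiplication by \<open>\<rho>(z)\<close> commutes with the symmetric operator \<open>\<partial>\<^sub>i\<^sup>2\<close>, \<open>i\<close> horizontal, of which \<open>F\<close> and \<open>G\<close> are eigenfunctions with different eigenvalues for at least one \<open>i\<close>.\<close>

lemma trig_orthogonal:
  assumes F: "trig \<alpha> \<beta> \<gamma> F" "\<alpha> * Lx = 2 * pi * of_int j" "\<beta> * Ly = 2 * pi * of_int l"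
    and G: "trig \<alpha>' \<beta>' \<gamma>' G" "\<alpha>' * Lx = 2 * pi * of_int j'" "\<beta>' * Ly = 2 * pi * of_int l'"
    and ne: "\<alpha>\<^sup>2 \<noteq> \<alpha>'\<^sup>2 \<or> \<beta>\<^sup>2 \<noteq> \<beta>'\<^sup>2" and \<rho>: "weight \<rho>"
  shows "ip (\<lambda>x. \<rho> (x $ 3) *\<^sub>R F x) G = 0"
proof -
  have key: "ip (\<lambda>x. \<rho> (x $ 3) *\<^sub>R pd i (pd i F) x) G = ip (\<lambda>x. \<rho> (x $ 3) *\<^sub>R F x) (pd i (pd i G))" if "i \<noteq> 3" for i
  proof -
    note tF = F(1) trig_pd[OF F(1), of i] and tG = G(1) trig_pd[OF G(1), of i]
    have "ip (\<lambda>x. \<rho> (x $ 3) *\<^sub>R pd i (pd i F) x) G = - ip (\<lambda>x. \<rho> (x $ 3) *\<^sub>R pd i F x) (pd i G)"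
      by (rule integration_by_parts[OF that trig_C1[OF tF(2)] trig_periodic_dir[OF tF(2) F(2,3) that]
        trig_C1[OF tG(1)] trig_periodic_dir[OF tG(1) G(2,3) that] \<rho>])
    moreover have "ip (\<lambda>x. \<rho> (x $ 3) *\<^sub>R pd i F x) (pd i G) = - ip (\<lambda>x. \<rho> (x $ 3) *\<^sub>R F x) (pd i (pd i G))"
      by (rule integration_by_parts[OF that trig_C1[OF tF(1)] trig_periodic_dir[OF tF(1) F(2,3) that]
        trig_C1[OF tG(2)] trig_periodic_dir[OF tG(2) G(2,3) that] \<rho>])
    ultimately show ?thesis by simp
  qed
  have sc: "ip (\<lambda>x. \<rho> (x $ 3) *\<^sub>R (r *\<^sub>R F x)) G = r * ip (\<lambda>x. \<rho> (x $ 3) *\<^sub>R F x) G" for r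
    unfolding scaleR_left_commute[of _ r] by (rule ip_scale_left)
  have 1: "\<alpha>\<^sup>2 * ip (\<lambda>x. \<rho> (x $ 3) *\<^sub>R F x) G = \<alpha>'\<^sup>2 * ip (\<lambda>x. \<rho> (x $ 3) *\<^sub>R F x) G"
    using key[of 1]
    unfolding trig_pd_pd[OF F(1), THEN conjunct1] trig_pd_pd[OF G(1), THEN conjunct1] sc ip_scale_right by simp
  have 2: "\<beta>\<^sup>2 * ip (\<lambda>x. \<rho> (x $ 3) *\<^sub>R F x) G = \<beta>'\<^sup>2 * ip (\<lambda>x. \<rho> (x $ 3) *\<^sub>R F x) G"
    using key[of 2]
    unfolding trig_pd_pd[OF F(1), THEN conjunct2] trig_pd_pd[OF G(1), THEN conjunct2] sc ip_scale_right by simp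
  show ?thesis using 1 2 ne by auto
qed

section \<open>Shape of the modes\<close>

text \<open>The frequencies of a mode in \<open>x\<close>, \<open>y\<close> and \<open>z\<close>.\<close>

definition al :: "mode \<Rightarrow> real" where "al = (\<lambda>(j, l, k, \<iota>). 2 * pi * of_int j / Lx)"
definition be :: "mode \<Rightarrow> real" where "be = (\<lambda>(j, l, k, \<iota>). 2 * pi * of_int l / Ly)"
definition ga :: "mode \<Rightarrow> real" where "ga = (\<lambda>(j, l, k, \<iota>). of_nat k * pi / h)"

lemma al_period: "al m * Lx = 2 * pi * of_int (fst m)" and be_period: "be m * Ly = 2 * pi * of_int (fst (snd m))"
  using Lx_pos Ly_pos by (auto simp: al_def be_def split: prod.splits)

lemma kbar_sq: "(kbar Lx Ly m)\<^sup>2 = (al m)\<^sup>2 + (be m)\<^sup>2"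
proof -
  have "0 \<le> 4 * pi\<^sup>2 * (of_int j)\<^sup>2 / Lx\<^sup>2 + 4 * pi\<^sup>2 * (of_int l)\<^sup>2 / Ly\<^sup>2" for j l :: int by simp
  then show ?thesis by (auto simp: kbar_def al_def be_def power_divide power_mult_distrib split: prod.splits)
qed

lemma trig_xy_trig:
  assumes "trig_xy Lx Ly j l f"
  shows "trig (2 * pi * of_int j / Lx) (2 * pi * of_int l / Ly) \<gamma> (\<lambda>x. (f (x $ 1) (x $ 2) * trg z (\<gamma> * (x $ 3 + h/2))) *\<^sub>R c)"
proof -
  let ?\<alpha> = "2 * pi * of_int j / Lx" and ?\<beta> = "2 * pi * of_int l / Ly"
  obtain a1 a2 a3 a4 where f: "\<And>x y. f x y = a1 * cos (2 * pi * of_int j * x / Lx) * cos (2 * pi * of_int l * y / Ly)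
      + a2 * cos (2 * pi * of_int j * x / Lx) * sin (2 * pi * of_int l * y / Ly)
      + a3 * sin (2 * pi * of_int j * x / Lx) * cos (2 * pi * of_int l * y / Ly)
      + a4 * sin (2 * pi * of_int j * x / Lx) * sin (2 * pi * of_int l * y / Ly)"
    using assms unfolding trig_xy_def Let_def by blast
  let ?t = "\<lambda>p q r. trig_base ?\<alpha> ?\<beta> \<gamma> p q z (r *\<^sub>R c)"
  have "trig ?\<alpha> ?\<beta> \<gamma> (\<lambda>x. ?t True True a1 x + (?t True False a2 x + (?t False True a3 x + ?t False False a4 x)))"
    by (intro trig.intros)
  moreover have "(\<lambda>x. ?t True True a1 x + (?t True False a2 x + (?t False True a3 x + ?t False False a4 x)))
      = (\<lambda>x. (f (x $ 1) (x $ 2) * trg z (\<gamma> * (x $ 3 + h/2))) *\<^sub>R c)"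
    by (rule ext) (simp add: f trig_base_def trg_def algebra_simps)
  ultimately show ?thesis by simp
qed

text \<open>A mode is prescribed inside the cell only; \<open>W\<close> is the trigonometric field on the whole space that continues it and has classical derivatives.\<close>

lemma mode_shape_trig:
  assumes "mode_shape Lx Ly h m u"
  obtains W where "trig (al m) (be m) (ga m) W" "\<And>x. x \<in> Om \<Longrightarrow> u x = W x"
proof -
  obtain j l k \<iota> where m: "m = (j, l, k, \<iota>)" by (cases m)
  obtain f g q where fgq: "trig_xy Lx Ly j l f" "trig_xy Lx Ly j l g" "trig_xy Lx Ly j l q"
    "\<forall>x\<in>Om. u x = vector [f (x$1) (x$2) * cos (of_nat k * pi / h * (x$3 + h/2)), g (x$1) (x$2) * cos (of_nat k * pi / h * (x$3 + h/2)),
      q (x$1) (x$2) * sin (of_nat k * pi / h * (x$3 + h/2))]"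
    using assms unfolding m mode_shape_def Let_def by auto
  let ?W = "\<lambda>x. (f (x $ 1) (x $ 2) * trg True (ga m * (x $ 3 + h/2))) *\<^sub>R axis 1 1
     + ((g (x $ 1) (x $ 2) * trg True (ga m * (x $ 3 + h/2))) *\<^sub>R axis 2 1
     + (q (x $ 1) (x $ 2) * trg False (ga m * (x $ 3 + h/2))) *\<^sub>R axis 3 1)"
  have "trig (al m) (be m) (ga m) ?W"
    unfolding al_def be_def m prod.case by (intro trig.add trig_xy_trig fgq)
  moreover have "u x = ?W x" if "x \<in> Om" for x
    using fgq(4) that by (simp add: vector3_eq_axis trg_def ga_def m)
  ultimately show ?thesis using that by blast
qed

section \<open>Horizontal means of trigonometric fields\<close>

lemma integrable_interval:
  fixes f :: "real \<Rightarrow> 'a::euclidean_space"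
  assumes "continuous_on UNIV f"
  shows "integrable (lebesgue_on {0<..<L}) f"
proof -
  have "integrable lborel (\<lambda>x. indicator {0..L} x *\<^sub>R f x)"
    using borel_integrable_compact[OF compact_Icc continuous_on_subset[OF assms]] by simp
  then have "integrable lborel (\<lambda>x. indicator {0<..<L} x *\<^sub>R (indicator {0..L} x *\<^sub>R f x))"
    by (rule integrable_mult_indicator[rotated]) simp
  also have "(\<lambda>x. indicator {0<..<L} x *\<^sub>R (indicator {0..L} x *\<^sub>R f x)) = (\<lambda>x. indicator {0<..<L} x *\<^sub>R f x)"
    by (auto simp: indicator_def)
  finally show ?thesis
    using borel_measurable_continuous_onI[OF assms] by (simp add: integrable_restrict_space integrable_completion)
qed

lemma integral_interval:
  fixes f :: "real \<Rightarrow> 'a::euclidean_space"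
  assumes f: "continuous_on UNIV f" and F: "\<And>t. (F has_vector_derivative f t) (at t)" and L: "0 < L"
  shows "(LINT t|lebesgue_on {0<..<L}. f t) = F L - F 0"
proof -
  have [measurable]: "f \<in> borel_measurable borel" using f by (rule borel_measurable_continuous_onI)
  have "(LINT t|lebesgue_on {0<..<L}. f t) = (LINT t|lborel. indicator {0<..<L} t *\<^sub>R f t)"
    by (simp add: integral_restrict_space integral_completion)
  also have "\<dots> = (LINT t|lborel. indicator {0..L} t *\<^sub>R f t)"
  proof (rule integral_cong_AE)
    show "AE t in lborel. indicator {0<..<L} t *\<^sub>R f t = indicator {0..L} t *\<^sub>R f t"
      using AE_lborel_singleton[of 0] AE_lborel_singleton[of L] by eventually_elim (auto simp: indicator_def)
  qed measurable
  also have "\<dots> = F L - F 0"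
    using L F f by (intro integral_FTC_Icc) (auto intro: has_vector_derivative_at_within continuous_on_subset)
  finally show ?thesis .
qed

lemma trg_mean_zero:
  assumes "k * L = 2 * pi * of_int j" "k \<noteq> 0" "0 < L"
  shows "(LINT t|lebesgue_on {0<..<L}. trg b (k * t) *\<^sub>R (c :: point)) = 0"
proof -
  let ?F = "\<lambda>t. trg (\<not> b) (k * t) *\<^sub>R ((sgt (\<not> b) / k) *\<^sub>R c)"
  have "(?F has_vector_derivative trg b (k * t) *\<^sub>R c) (at t)" for t
  proof -
    have e: "((sgt (\<not> b) * k) * trg (\<not> \<not> b) (k * t)) *\<^sub>R ((sgt (\<not> b) / k) *\<^sub>R c) = trg b (k * t) *\<^sub>R c"
      using assms(2) by (cases b) (simp_all add: sgt_def)
    show ?thesis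
      using has_vector_derivative_scaleR[OF trg_deriv0[of "\<not> b" k t] has_vector_derivative_const[of "(sgt (\<not> b) / k) *\<^sub>R c"]]
      unfolding e scaleR_zero_right add_0 .
  qed
  then have "(LINT t|lebesgue_on {0<..<L}. trg b (k * t) *\<^sub>R c) = ?F L - ?F 0"
    by (intro integral_interval assms continuous_intros)
  then show ?thesis using assms(1) by (simp add: trg_period)
qed

text \<open>The inner one of the two integrals in the horizontal mean at height \<open>z\<close>, taken in the order in which the mean-zero condition iterates them.\<close>

definition mean_profile :: "real \<Rightarrow> field \<Rightarrow> real \<Rightarrow> point" where
  "mean_profile z F a = (LINT b|lebesgue_on {0<..<Ly}. F (vec3 a b z))"

lemma trig_mean_zero:
  assumes "trig \<alpha> \<beta> \<gamma> F" "\<alpha> * Lx = 2 * pi * of_int j" "\<beta> * Ly = 2 * pi * of_int l" "\<alpha> \<noteq> 0 \<or> \<beta> \<noteq> 0"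
  shows "integrable (lebesgue_on {0<..<Ly}) (\<lambda>b. F (vec3 a b z)) \<and> integrable (lebesgue_on {0<..<Lx}) (mean_profile z F)
    \<and> (LINT a|lebesgue_on {0<..<Lx}. mean_profile z F a) = 0"
  using assms(1)
proof (induction arbitrary: a rule: trig.induct)
  case (base p q r c)
  let ?T = "trig_base \<alpha> \<beta> \<gamma> p q r c"
  define C where "C a = (trg p (\<alpha> * a) * trg r (\<gamma> * (z + h/2))) *\<^sub>R c" for a
  define I where "I = (LINT b|lebesgue_on {0<..<Ly}. trg q (\<beta> * b))"
  have T: "?T (vec3 a b z) = trg q (\<beta> * b) *\<^sub>R C a" for a b
    by (simp add: trig_base_def C_def mult.commute mult.left_commute)
  have mp: "mean_profile z ?T a = I *\<^sub>R C a" for a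
    unfolding mean_profile_def T I_def by (intro integral_scaleR_left integrable_interval continuous_intros)
  have mp': "mean_profile z ?T = (\<lambda>a. trg p (\<alpha> * a) *\<^sub>R ((I * trg r (\<gamma> * (z + h/2))) *\<^sub>R c))"
    unfolding mp[abs_def] C_def by (simp add: fun_eq_iff ac_simps)
  have "(LINT a|lebesgue_on {0<..<Lx}. mean_profile z ?T a) = 0"
  proof (cases "\<alpha> = 0")
    case True
    then have b: "\<beta> \<noteq> 0" using assms(4) by simp
    have "I *\<^sub>R axis 1 1 = (LINT b|lebesgue_on {0<..<Ly}. trg q (\<beta> * b) *\<^sub>R (axis 1 1 :: point))"
      unfolding I_def by (intro integral_scaleR_left[symmetric] integrable_interval continuous_intros)
    also have "\<dots> = 0" by (rule trg_mean_zero[OF assms(3) b Ly_pos])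
    finally have "I = 0" by (simp add: axis_eq_0_iff)
    then show ?thesis by (simp add: mp')
  next
    case False
    then show ?thesis unfolding mp' by (rule trg_mean_zero[OF assms(2) _ Lx_pos])
  qed
  moreover have "integrable (lebesgue_on {0<..<Ly}) (\<lambda>b. ?T (vec3 a b z))"
    unfolding T by (intro integrable_interval continuous_intros)
  moreover have "integrable (lebesgue_on {0<..<Lx}) (mean_profile z ?T)"
    unfolding mp' by (intro integrable_interval continuous_intros)
  ultimately show ?case by blast
next
  case (add F G)
  have "mean_profile z (\<lambda>x. F x + G x) = (\<lambda>a. mean_profile z F a + mean_profile z G a)"
    unfolding mean_profile_def using add.IH by (intro ext Bochner_Integration.integral_add) auto
  then show ?case using add.IH by simp
qed

end

section \<open>Expansions in Stokes modes\<close>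

text \<open>An exhaustion by finite sets, so that the unconditional sums over modes can be handled as limits of sequences, as dominated convergence requires.\<close>

definition trunc_set :: "mode set \<Rightarrow> nat \<Rightarrow> mode set" where
  "trunc_set S n = {m \<in> S. to_nat m < n}"

lemma trunc_set: "finite (trunc_set S n)" "trunc_set S n \<subseteq> S"
proof -
  have "trunc_set S n \<subseteq> from_nat ` {..<n}"
    by (auto simp: trunc_set_def intro!: image_eqI[of _ _ "to_nat _"])
  then show "finite (trunc_set S n)" by (rule finite_subset) simp
qed (auto simp: trunc_set_def)

lemma filterlim_trunc_set: "filterlim (trunc_set S) (finite_subsets_at_top S) sequentially"
  unfolding filterlim_finite_subsets_at_top
proof safe
  fix X assume X: "finite X" "X \<subseteq> S"
  have "eventually (\<lambda>n. \<forall>m\<in>X. to_nat m < n) sequentially"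
    using X(1) by (intro eventually_ball_finite) (auto intro: eventually_gt_at_top)
  then show "\<forall>\<^sub>F n in sequentially. finite (trunc_set S n) \<and> X \<subseteq> trunc_set S n \<and> trunc_set S n \<subseteq> S"
    by eventually_elim (use X trunc_set[of S] in \<open>auto simp: trunc_set_def\<close>)
qed

lemma summable_tail:
  fixes f :: "mode \<Rightarrow> real"
  assumes f: "f summable_on S" "\<And>m. m \<in> S \<Longrightarrow> 0 \<le> f m"
  obtains T where "T \<longlonglongrightarrow> 0" "\<And>n F. finite F \<Longrightarrow> F \<subseteq> S \<Longrightarrow> trunc_set S n \<subseteq> F \<Longrightarrow> sum f (F - trunc_set S n) \<le> T n"
proof
  let ?T = "\<lambda>n. infsum f S - sum f (trunc_set S n)"
  have "(f has_sum infsum f S) S" using f(1) by (rule has_sum_infsum)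
  then have "(\<lambda>n. sum f (trunc_set S n)) \<longlonglongrightarrow> infsum f S"
    unfolding has_sum_def using filterlim_compose[OF _ filterlim_trunc_set] by blast
  from tendsto_diff[OF tendsto_const[of "infsum f S"] this] show "?T \<longlonglongrightarrow> 0" by simp
  fix n F assume F: "finite F" "F \<subseteq> S" "trunc_set S n \<subseteq> F"
  have "sum f F \<le> infsum f S" using f F by (intro finite_sum_le_infsum) auto
  moreover have "sum f F = sum f (F - trunc_set S n) + sum f (trunc_set S n)"
    using F by (intro sum.subset_diff) auto
  ultimately show "sum f (F - trunc_set S n) \<le> ?T n" by simp
qed

context cell
begin

text \<open>A net over finite sets that is Cauchy with a tail bound independent of the larger set converges; the limit is found along the exhaustion.\<close>

lemma L2_net_limit:
  assumes g: "\<And>F. finite F \<Longrightarrow> F \<subseteq> S \<Longrightarrow> g F \<in> LL" and T: "T \<longlonglongrightarrow> 0"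
    and tail: "\<And>n F. finite F \<Longrightarrow> F \<subseteq> S \<Longrightarrow> trunc_set S n \<subseteq> F \<Longrightarrow> (nrm (\<lambda>x. g F x - g (trunc_set S n) x))\<^sup>2 \<le> T n"
  obtains r where "r \<in> LL" "((\<lambda>F. nrm (\<lambda>x. g F x - r x)) \<longlongrightarrow> 0) (finite_subsets_at_top S)"
proof -
  define f where "f n = g (trunc_set S n)" for n
  have f: "f n \<in> LL" for n unfolding f_def by (intro g trunc_set)
  have mono: "trunc_set S m \<subseteq> trunc_set S n" if "m \<le> n" for m n using that by (auto simp: trunc_set_def)
  have small: "\<exists>N. \<forall>F. finite F \<longrightarrow> F \<subseteq> S \<longrightarrow> trunc_set S N \<subseteq> F \<longrightarrow> nrm (\<lambda>x. g F x - f N x) < e" if e: "e > 0" for e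
  proof -
    have "eventually (\<lambda>n. T n < e\<^sup>2) sequentially" using e by (intro order_tendstoD(2)[OF T]) simp
    then obtain N where N: "T N < e\<^sup>2" unfolding eventually_sequentially by blast
    have "nrm (\<lambda>x. g F x - f N x) < e" if F: "finite F" "F \<subseteq> S" "trunc_set S N \<subseteq> F" for F
    proof (rule power2_less_imp_less)
      show "(nrm (\<lambda>x. g F x - f N x))\<^sup>2 < e\<^sup>2" using tail[OF F] N unfolding f_def by (rule le_less_trans)
    qed (use e in simp)
    then show ?thesis by blast
  qed
  have "\<exists>N. \<forall>m\<ge>N. \<forall>n\<ge>N. nrm (\<lambda>x. f m x - f n x) < e" if e: "e > 0" for e
  proof -
    obtain N where N: "\<And>F. finite F \<Longrightarrow> F \<subseteq> S \<Longrightarrow> trunc_set S N \<subseteq> F \<Longrightarrow> nrm (\<lambda>x. g F x - f N x) < e/2"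
      using small[of "e/2"] e by auto
    have *: "nrm (\<lambda>x. f m x - f N x) < e/2" if "m \<ge> N" for m
      unfolding f_def[of m] by (rule N[OF trunc_set mono[OF that]])
    have "nrm (\<lambda>x. f m x - f n x) < e" if "m \<ge> N" "n \<ge> N" for m n
      using nrm_triangle_diff[OF f f f, of m n N] *[OF that(1)] *[OF that(2)] nrm_diff_commute[of "f n" "f N"] by simp
    then show ?thesis by blast
  qed
  from L2_complete[OF f this] obtain r where r: "r \<in> LL" "(\<lambda>n. nrm (\<lambda>x. f n x - r x)) \<longlonglongrightarrow> 0" by blast
  have "((\<lambda>F. nrm (\<lambda>x. g F x - r x)) \<longlongrightarrow> 0) (finite_subsets_at_top S)"
  proof (rule tendstoI)
    fix e :: real assume e: "e > 0"
    obtain N where N: "\<And>F. finite F \<Longrightarrow> F \<subseteq> S \<Longrightarrow> trunc_set S N \<subseteq> F \<Longrightarrow> nrm (\<lambda>x. g F x - f N x) < e/4"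
      using small[of "e/4"] e by auto
    have "eventually (\<lambda>n. nrm (\<lambda>x. f n x - r x) < e/4) sequentially" using e by (intro order_tendstoD(2)[OF r(2)]) simp
    then obtain K where K: "\<And>n. n \<ge> K \<Longrightarrow> nrm (\<lambda>x. f n x - r x) < e/4" unfolding eventually_sequentially by blast
    define L where "L = max N K"
    have LN: "nrm (\<lambda>x. f L x - f N x) < e/4" unfolding f_def[of L] by (rule N[OF trunc_set mono]) (simp add: L_def)
    have rN: "nrm (\<lambda>x. f N x - r x) < e/2"
      using nrm_triangle_diff[OF f[of N] f[of L] r(1)] LN K[of L] nrm_diff_commute[of "f N" "f L"] by (simp add: L_def)
    have "nrm (\<lambda>x. g F x - r x) < e" if F: "finite F" "trunc_set S N \<subseteq> F" "F \<subseteq> S" for F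
      using nrm_triangle_diff[OF g[OF F(1,3)] f[of N] r(1)] N[OF F(1,3,2)] rN e by simp
    then show "\<forall>\<^sub>F F in finite_subsets_at_top S. dist (nrm (\<lambda>x. g F x - r x)) 0 < e"
      unfolding eventually_finite_subsets_at_top using trunc_set[of S N]
      by (intro exI[of _ "trunc_set S N"]) auto
  qed
  then show ?thesis using that r(1) by blast
qed

lemma nrm_triangle_sub:
  assumes "u \<in> LL" "v \<in> LL" shows "nrm (\<lambda>x. u x - v x) \<le> nrm u + nrm v"
  using nrm_triangle[OF assms(1) L2_scale[OF assms(2), of "-1"]] nrm_scale[of "-1" v] by simp

abbreviation "has_l2_sum \<equiv> l2_has_sum Lx Ly h"

lemma V_subset_HH: "u \<in> Vs \<Longrightarrow> u \<in> HH Lx Ly h"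
  unfolding HH_def mem_Collect_eq
proof (intro conjI allI impI)
  assume u: "u \<in> Vs"
  show "u \<in> LL" using V_D(2)[OF u] .
  fix e :: real assume "e > 0"
  then obtain \<phi> where \<phi>: "\<phi> \<in> VVs" "h1norm Lx Ly h (\<lambda>x. u x - \<phi> x) < e" using u unfolding V_def by blast
  have "nrm (\<lambda>x. u x - \<phi> x) \<le> h1norm Lx Ly h (\<lambda>x. u x - \<phi> x)" unfolding h1norm_def by (rule real_le_rsqrt) simp
  then show "\<exists>\<phi>\<in>VVs. nrm (\<lambda>x. u x - \<phi> x) < e" using \<phi> by (intro bexI[of _ \<phi>]) auto
qed

text \<open>A smooth field close to a late member of the sequence is close to the limit.\<close>

lemma V_closed:
  assumes f: "\<And>n. f n \<in> Vs" and r: "r \<in> Sob" and lim: "(\<lambda>n. nrm (\<lambda>x. f n x - r x)) \<longlonglongrightarrow> 0"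
    "\<And>i. (\<lambda>n. nrm (\<lambda>x. D i (f n) x - D i r x)) \<longlonglongrightarrow> 0"
  shows "r \<in> Vs"
  unfolding V_def mem_Collect_eq
proof (intro conjI r allI impI)
  fix e :: real assume e: "e > 0"
  have eq: "(h1norm Lx Ly h (\<lambda>x. f n x - r x))\<^sup>2 = (nrm (\<lambda>x. f n x - r x))\<^sup>2 + (\<Sum>i\<in>UNIV. (nrm (\<lambda>x. D i (f n) x - D i r x))\<^sup>2)" for n
    unfolding h1norm_sq grad_sq_eq Sob_diff_wd(2)[OF V_D(1)[OF f] r] ..
  have "(\<lambda>n. (h1norm Lx Ly h (\<lambda>x. f n x - r x))\<^sup>2) \<longlonglongrightarrow> 0\<^sup>2 + (\<Sum>i\<in>(UNIV::3 set). 0\<^sup>2)"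
    unfolding eq by (intro tendsto_add tendsto_power tendsto_sum lim)
  then have "eventually (\<lambda>n. (h1norm Lx Ly h (\<lambda>x. f n x - r x))\<^sup>2 < (e/4)\<^sup>2) sequentially"
    by (rule order_tendstoD(2)) (use e in simp)
  then obtain n where "(h1norm Lx Ly h (\<lambda>x. f n x - r x))\<^sup>2 < (e/4)\<^sup>2" unfolding eventually_sequentially by blast
  then have 1: "h1norm Lx Ly h (\<lambda>x. f n x - r x) < e/4" by (rule power2_less_imp_less) (use e in simp)
  obtain \<phi> where \<phi>: "\<phi> \<in> VVs" "h1norm Lx Ly h (\<lambda>x. f n x - \<phi> x) < e/4"
    using f[of n] e unfolding V_def by (auto dest!: spec[of _ "e/4"])
  have S: "f n \<in> Sob" "\<phi> \<in> Sob" using V_D f VV_D \<phi> by auto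
  have "h1norm Lx Ly h (\<lambda>x. r x - \<phi> x) \<le> e/2"
  proof (rule power2_le_imp_le)
    have tri: "(nrm (\<lambda>x. a x - c x))\<^sup>2 \<le> 2 * (nrm (\<lambda>x. b x - a x))\<^sup>2 + 2 * (nrm (\<lambda>x. b x - c x))\<^sup>2"
      if "a \<in> LL" "b \<in> LL" "c \<in> LL" for a b c
    proof -
      have "(nrm (\<lambda>x. a x - c x))\<^sup>2 \<le> (nrm (\<lambda>x. b x - a x) + nrm (\<lambda>x. b x - c x))\<^sup>2"
        using nrm_triangle_diff[OF that] nrm_diff_commute[of a b] by (intro power_mono) auto
      also have "\<dots> \<le> 2 * (nrm (\<lambda>x. b x - a x))\<^sup>2 + 2 * (nrm (\<lambda>x. b x - c x))\<^sup>2"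
        using sum_squares_bound[of "nrm (\<lambda>x. b x - a x)" "nrm (\<lambda>x. b x - c x)"] by (simp add: power2_sum)
      finally show ?thesis .
    qed
    have "(h1norm Lx Ly h (\<lambda>x. r x - \<phi> x))\<^sup>2 = (nrm (\<lambda>x. r x - \<phi> x))\<^sup>2 + (\<Sum>i\<in>UNIV. (nrm (\<lambda>x. D i r x - D i \<phi> x))\<^sup>2)"
      unfolding h1norm_sq grad_sq_eq Sob_diff_wd(2)[OF r S(2)] ..
    also have "\<dots> \<le> (2 * (nrm (\<lambda>x. f n x - r x))\<^sup>2 + 2 * (nrm (\<lambda>x. f n x - \<phi> x))\<^sup>2) +
       (\<Sum>i\<in>UNIV. 2 * (nrm (\<lambda>x. D i (f n) x - D i r x))\<^sup>2 + 2 * (nrm (\<lambda>x. D i (f n) x - D i \<phi> x))\<^sup>2)"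
      using SobD[OF S(1)] SobD[OF S(2)] SobD[OF r] by (intro add_mono sum_mono tri)
    also have "\<dots> = 2 * (h1norm Lx Ly h (\<lambda>x. f n x - r x))\<^sup>2 + 2 * (h1norm Lx Ly h (\<lambda>x. f n x - \<phi> x))\<^sup>2"
      unfolding h1norm_sq grad_sq_eq Sob_diff_wd(2)[OF S(1) r] Sob_diff_wd(2)[OF S] by (simp add: sum.distrib sum_distrib_left)
    also have "\<dots> \<le> 2 * (e/4)\<^sup>2 + 2 * (e/4)\<^sup>2"
      using 1 \<phi>(2) by (intro add_mono mult_left_mono power_mono) (auto simp: h1norm_def)
    also have "\<dots> = (e/2)\<^sup>2" by (simp add: power2_eq_square)
    finally show "(h1norm Lx Ly h (\<lambda>x. r x - \<phi> x))\<^sup>2 \<le> (e/2)\<^sup>2" .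
  qed (use e in simp)
  then show "\<exists>\<phi>\<in>VVs. h1norm Lx Ly h (\<lambda>x. r x - \<phi> x) < e" using \<phi>(1) e by (intro bexI[of _ \<phi>]) auto
qed

end

locale stokes_modes = cell +
  fixes w W :: "mode \<Rightarrow> field"
  assumes basis: "stokes_basis Lx Ly h w"
    and W_trig: "m \<in> modes \<Longrightarrow> trig (al m) (be m) (ga m) (W m)"
    and w_eq_W: "m \<in> modes \<Longrightarrow> x \<in> Om \<Longrightarrow> w m x = W m x"
begin

abbreviation "lam \<equiv> stokes_eigenvalue Lx Ly h"
abbreviation coef :: "field \<Rightarrow> mode \<Rightarrow> real" where "coef u m \<equiv> ip u (w m)"
abbreviation "Vd \<equiv> Vdot Lx Ly h"
abbreviation "ginner \<equiv> grad_inner Lx Ly h"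

lemma w_facts:
  assumes "m \<in> modes"
  shows "w m \<in> Vd" "w m \<in> Vs" "w m \<in> LL" "w m \<in> Sob"
    and "\<And>v. v \<in> Vd \<Longrightarrow> ginner (w m) v = lam m * ip (w m) v"
proof -
  have "stokes Lx Ly h (w m) (\<lambda>x. lam m *\<^sub>R w m x)" using basis assms unfolding stokes_basis_def by blast
  then show "w m \<in> Vd" "\<And>v. v \<in> Vd \<Longrightarrow> ginner (w m) v = lam m * ip (w m) v" by (auto simp: stokes_def)
  then show "w m \<in> Vs" "w m \<in> LL" "w m \<in> Sob" using V_D by (auto simp: Vdot_def)
qed

lemma w_orthonormal: "m \<in> modes \<Longrightarrow> n \<in> modes \<Longrightarrow> ip (w m) (w n) = (if m = n then 1 else 0)"
  using basis unfolding stokes_basis_def by blast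

lemma W_facts:
  assumes "m \<in> modes"
  shows "W m \<in> LL" "C1 (W m)" "AE x in M. w m x = W m x"
  using trig_L2[OF W_trig[OF assms]] trig_C1[OF W_trig[OF assms]] w_eq_W[OF assms] by auto

lemma lam_eq: "lam m = (kbar Lx Ly m)\<^sup>2 + (ga m)\<^sup>2"
  unfolding kbar_sq by (auto simp: stokes_eigenvalue_def al_def be_def ga_def power_divide power_mult_distrib split: prod.splits)

lemma lam_ge: "(kbar Lx Ly m)\<^sup>2 \<le> lam m"
  by (simp add: lam_eq)

lemma kbar_ge: assumes "m \<in> modes" shows "kbar1 Lx Ly \<le> kbar Lx Ly m"
proof (rule power2_le_imp_le)
  obtain j l k \<iota> where m: "m = (j, l, k, \<iota>)" by (cases m)
  have one: "1 \<le> (real_of_int j)\<^sup>2" if "j \<noteq> 0" for j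
  proof -
    have "1 \<le> \<bar>j\<bar>" using that by simp
    then have "1 \<le> \<bar>real_of_int j\<bar>" by linarith
    then show ?thesis by (metis abs_1 abs_le_square_iff one_power2 abs_abs)
  qed
  have mx: "0 < max Lx Ly" using Lx_pos by simp
  have le: "(2 * pi / max Lx Ly)\<^sup>2 \<le> (2 * pi * of_int j / L)\<^sup>2" if "j \<noteq> 0" "0 < L" "L \<le> max Lx Ly" for j L
  proof -
    have "(2 * pi / max Lx Ly)\<^sup>2 \<le> (2 * pi / L)\<^sup>2" using that mx by (intro power_mono divide_left_mono) auto
    also have "\<dots> \<le> (2 * pi / L)\<^sup>2 * (of_int j)\<^sup>2" using mult_left_mono[OF one[OF that(1)], of "(2 * pi / L)\<^sup>2"] by simp
    finally show ?thesis by (simp add: power_mult_distrib power_divide)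
  qed
  have "j \<noteq> 0 \<or> l \<noteq> 0" using assms unfolding m modes_def by auto
  then have "(2 * pi / max Lx Ly)\<^sup>2 \<le> (al m)\<^sup>2 + (be m)\<^sup>2"
    using le[of j Lx] le[of l Ly] Lx_pos Ly_pos unfolding al_def be_def m
    by (auto intro: order_trans add_increasing add_increasing2)
  then show "(kbar1 Lx Ly)\<^sup>2 \<le> (kbar Lx Ly m)\<^sup>2" unfolding kbar_sq kbar1_def .
  show "0 \<le> kbar Lx Ly m" by (simp add: kbar_def split: prod.splits)
qed

lemma kbar1_pos: "0 < kbar1 Lx Ly"
  using Lx_pos by (simp add: kbar1_def)

lemma lam_ge_kbar1: "m \<in> modes \<Longrightarrow> (kbar1 Lx Ly)\<^sup>2 \<le> lam m"
  using order_trans[OF power_mono[OF kbar_ge] lam_ge, of m] kbar1_pos by simp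

lemma lam_pos: "m \<in> modes \<Longrightarrow> 0 < lam m"
  using lam_ge_kbar1[of m] zero_less_power[OF kbar1_pos, of 2] by linarith

definition comb :: "(mode \<Rightarrow> real) \<Rightarrow> mode set \<Rightarrow> field" where
  "comb c F = (\<lambda>x. \<Sum>m\<in>F. c m *\<^sub>R w m x)"

text \<open>The classically differentiable representative of \<open>comb c F\<close>.\<close>

definition combW :: "(mode \<Rightarrow> real) \<Rightarrow> mode set \<Rightarrow> field" where
  "combW c F = (\<lambda>x. \<Sum>m\<in>F. c m *\<^sub>R W m x)"

lemma comb_eq_combW: "F \<subseteq> modes \<Longrightarrow> x \<in> Om \<Longrightarrow> comb c F x = combW c F x"
  unfolding comb_def combW_def using w_eq_W by (intro sum.cong) auto

lemma comb_facts:
  assumes F: "finite F" "F \<subseteq> modes"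
  shows "comb c F \<in> Vs" "comb c F \<in> LL" "comb c F \<in> Sob"
proof -
  show "comb c F \<in> Vs" unfolding comb_def using F w_facts(2) by (intro V_sum) auto
  then show "comb c F \<in> LL" "comb c F \<in> Sob" using V_D by auto
qed

text \<open>Finite sums of modes are admissible test fields: the horizontal means vanish because every mode has a nonzero horizontal frequency.\<close>

lemma comb_Hdot:
  assumes F: "finite F" "F \<subseteq> modes"
  shows "comb c F \<in> Hd" "comb c F \<in> Vd"
proof -
  have mean: "1 / (Lx * Ly) * (LINT x|lebesgue_on {0<..<Lx}. LINT y|lebesgue_on {0<..<Ly}. comb c F (vec3 x y z) $ i) = 0"
    if z: "z \<in> {- h/2<..<h/2}" for z i
  proof -
    have t: "trig (al m) (be m) (ga m) (\<lambda>x. c m *\<^sub>R W m x)" if "m \<in> F" for m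
      using W_trig[OF subsetD[OF F(2) that]] by (rule trig_scale)
    have ne: "al m \<noteq> 0 \<or> be m \<noteq> 0" if "m \<in> F" for m
    proof -
      have "0 < (kbar Lx Ly m)\<^sup>2" using less_le_trans[OF kbar1_pos kbar_ge[OF subsetD[OF F(2) that]]] by (rule zero_less_power)
      then show ?thesis unfolding kbar_sq by auto
    qed
    have mz: "integrable (lebesgue_on {0<..<Ly}) (\<lambda>b. c m *\<^sub>R W m (vec3 a b z)) \<and>
       integrable (lebesgue_on {0<..<Lx}) (mean_profile z (\<lambda>x. c m *\<^sub>R W m x)) \<and>
       (LINT a|lebesgue_on {0<..<Lx}. mean_profile z (\<lambda>x. c m *\<^sub>R W m x) a) = 0" if "m \<in> F" for m a
      using trig_mean_zero[OF t[OF that] al_period be_period ne[OF that]] .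
    have "(LINT x|lebesgue_on {0<..<Lx}. LINT y|lebesgue_on {0<..<Ly}. comb c F (vec3 x y z) $ i)
      = (LINT x|lebesgue_on {0<..<Lx}. (\<Sum>m\<in>F. mean_profile z (\<lambda>x. c m *\<^sub>R W m x) x) $ i)"
    proof (rule Bochner_Integration.integral_cong[OF refl])
      fix x assume x: "x \<in> space (lebesgue_on {0<..<Lx})"
      have "(LINT y|lebesgue_on {0<..<Ly}. comb c F (vec3 x y z) $ i) = (LINT y|lebesgue_on {0<..<Ly}. (\<Sum>m\<in>F. c m *\<^sub>R W m (vec3 x y z)) $ i)"
      proof (rule Bochner_Integration.integral_cong[OF refl])
        fix y assume "y \<in> space (lebesgue_on {0<..<Ly})"
        then have "vec3 x y z \<in> Om" using x z by (simp add: Omega_def)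
        then show "comb c F (vec3 x y z) $ i = (\<Sum>m\<in>F. c m *\<^sub>R W m (vec3 x y z)) $ i"
          using comb_eq_combW[OF F(2)] by (simp add: combW_def)
      qed
      also have "\<dots> = (LINT y|lebesgue_on {0<..<Ly}. (\<Sum>m\<in>F. c m *\<^sub>R W m (vec3 x y z))) $ i"
        using mz by (intro integral_vec_nth[symmetric] Bochner_Integration.integrable_sum) blast
      also have "(LINT y|lebesgue_on {0<..<Ly}. (\<Sum>m\<in>F. c m *\<^sub>R W m (vec3 x y z))) = (\<Sum>m\<in>F. mean_profile z (\<lambda>x. c m *\<^sub>R W m x) x)"
        unfolding mean_profile_def using mz by (intro Bochner_Integration.integral_sum) blast
      finally show "(LINT y|lebesgue_on {0<..<Ly}. comb c F (vec3 x y z) $ i) = (\<Sum>m\<in>F. mean_profile z (\<lambda>x. c m *\<^sub>R W m x) x) $ i" .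
    qed
    also have "\<dots> = (LINT x|lebesgue_on {0<..<Lx}. (\<Sum>m\<in>F. mean_profile z (\<lambda>x. c m *\<^sub>R W m x) x)) $ i"
      using mz by (intro integral_vec_nth[symmetric] Bochner_Integration.integrable_sum) blast
    also have "(LINT x|lebesgue_on {0<..<Lx}. (\<Sum>m\<in>F. mean_profile z (\<lambda>x. c m *\<^sub>R W m x) x)) = (\<Sum>m\<in>F. LINT x|lebesgue_on {0<..<Lx}. mean_profile z (\<lambda>x. c m *\<^sub>R W m x) x)"
      using mz by (intro Bochner_Integration.integral_sum) blast
    also have "\<dots> = 0" using mz by (intro sum.neutral) blast
    finally show ?thesis by simp
  qed
  show "comb c F \<in> Hd"
    unfolding Hdot_def mem_Collect_eq using V_subset_HH[OF comb_facts(1)[OF F]] mean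
    by (intro conjI AE_I2) auto
  then show "comb c F \<in> Vd" using comb_facts(1)[OF F] by (simp add: Vdot_def)
qed

lemma ip_comb:
  assumes "finite F" "F \<subseteq> modes" "u \<in> LL"
  shows "ip u (comb c F) = (\<Sum>m\<in>F. c m * coef u m)" "ip (comb c F) u = (\<Sum>m\<in>F. c m * coef u m)"
proof -
  show "ip u (comb c F) = (\<Sum>m\<in>F. c m * coef u m)"
  proof -
    have "(\<lambda>x. c m *\<^sub>R w m x) \<in> LL" if "m \<in> F" for m
      by (rule L2_scale[OF w_facts(3)[OF subsetD[OF assms(2) that]]])
    then show ?thesis unfolding comb_def by (subst ip_sum_right[OF _ assms(3)]) simp_all
  qed
  then show "ip (comb c F) u = (\<Sum>m\<in>F. c m * coef u m)" by (simp add: ip_commute)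
qed

lemma coef_comb:
  assumes "finite F" "F \<subseteq> modes" "m \<in> modes"
  shows "coef (comb c F) m = (if m \<in> F then c m else 0)"
proof -
  have "coef (comb c F) m = (\<Sum>n\<in>F. c n * ip (w m) (w n))"
    using ip_comb(2)[OF assms(1,2) w_facts(3)[OF assms(3)]] .
  also have "\<dots> = (\<Sum>n\<in>F. if m = n then c n else 0)"
  proof (rule sum.cong[OF refl])
    fix n assume "n \<in> F"
    then show "c n * ip (w m) (w n) = (if m = n then c n else 0)"
      using w_orthonormal[OF assms(3) subsetD[OF assms(2)]] by simp
  qed
  finally show ?thesis using assms(1) by simp
qed

lemma nrm_comb:
  assumes F: "finite F" "F \<subseteq> modes"
  shows "(nrm (comb c F))\<^sup>2 = (\<Sum>m\<in>F. (c m)\<^sup>2)"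
  unfolding nrm_sq ip_comb(1)[OF F comb_facts(2)[OF F]]
proof (rule sum.cong[OF refl])
  fix m assume m: "m \<in> F"
  show "c m * coef (comb c F) m = (c m)\<^sup>2"
    using coef_comb[OF F subsetD[OF F(2) m], of c] m by (simp add: power2_eq_square)
qed

lemma comb_diff:
  assumes "finite F" "G \<subseteq> F"
  shows "(\<lambda>x. comb c F x - comb c G x) = comb c (F - G)"
  unfolding comb_def using assms by (simp add: sum_diff)

lemma wd_comb:
  assumes "finite F" "F \<subseteq> modes"
  shows "AE x in M. D i (comb c F) x = (\<Sum>m\<in>F. c m *\<^sub>R D i (w m) x)"
proof -
  have S: "w m \<in> Sob" if "m \<in> F" for m using w_facts(4) assms(2) that by blast
  have w: "wpd i (comb c F) (\<lambda>x. \<Sum>m\<in>F. c m *\<^sub>R D i (w m) x)"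
    unfolding comb_def by (intro weak_pd_sum weak_pd_scale L2_scale SobD[OF S])
  show ?thesis by (rule wd_eq_AE[OF _ w]) (intro L2_sum L2_scale SobD(2)[OF S])
qed

text \<open>The weak eigenvalue equation, tested with \<open>u\<close>.\<close>

lemma ginner_comb:
  assumes F: "finite F" "F \<subseteq> modes" and u: "u \<in> Vd"
  shows "ginner u (comb c F) = (\<Sum>m\<in>F. c m * (lam m * coef u m))"
proof -
  have uS: "u \<in> Sob" using u V_D by (auto simp: Vdot_def)
  have S: "w m \<in> Sob" if "m \<in> F" for m using w_facts(4) F(2) that by blast
  have 1: "ip (D i u) (D i (comb c F)) = (\<Sum>m\<in>F. c m * ip (D i u) (D i (w m)))" for i
  proof -
    have "ip (D i u) (D i (comb c F)) = ip (D i u) (\<lambda>x. \<Sum>m\<in>F. c m *\<^sub>R D i (w m) x)"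
      using wd_comb[OF F] L2D(1)[OF SobD(2)[OF uS]] L2D(1)[OF SobD(2)[OF comb_facts(3)[OF F]]]
        L2D(1)[OF L2_sum[OF L2_scale[OF SobD(2)[OF S]], of F]]
      by (intro ip_cong_AE) auto
    also have "\<dots> = (\<Sum>m\<in>F. c m * ip (D i u) (D i (w m)))"
      by (subst ip_sum_right[OF L2_scale[OF SobD(2)[OF S]] SobD(2)[OF uS]]) simp_all
    finally show ?thesis .
  qed
  have "ginner u (comb c F) = (\<Sum>m\<in>F. c m * ginner u (w m))"
    unfolding grad_inner_def 1 by (subst sum.swap) (simp add: sum_distrib_left)
  also have "\<dots> = (\<Sum>m\<in>F. c m * (lam m * coef u m))"
  proof (rule sum.cong[OF refl])
    fix m assume "m \<in> F"
    then have m: "m \<in> modes" using F by blast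
    have "ginner u (w m) = ginner (w m) u" unfolding grad_inner_def by (simp add: ip_commute)
    then show "c m * ginner u (w m) = c m * (lam m * coef u m)" using w_facts(5)[OF m u] by (simp add: ip_commute)
  qed
  finally show ?thesis .
qed

lemma gsq_comb:
  assumes F: "finite F" "F \<subseteq> modes"
  shows "gsq (comb c F) = (\<Sum>m\<in>F. lam m * (c m)\<^sup>2)"
  unfolding grad_sq_def ginner_comb[OF F comb_Hdot(2)[OF F]]
proof (rule sum.cong[OF refl])
  fix m assume m: "m \<in> F"
  show "c m * (lam m * coef (comb c F) m) = lam m * (c m)\<^sup>2"
    using coef_comb[OF F subsetD[OF F(2) m], of c] m by (simp add: power2_eq_square)
qed

lemma Bessel:
  assumes "finite F" "F \<subseteq> modes" "u \<in> LL"
  shows "(nrm (\<lambda>x. u x - comb (coef u) F x))\<^sup>2 = (nrm u)\<^sup>2 - (\<Sum>m\<in>F. (coef u m)\<^sup>2)"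
    "(\<Sum>m\<in>F. (coef u m)\<^sup>2) \<le> (nrm u)\<^sup>2"
proof -
  show 1: "(nrm (\<lambda>x. u x - comb (coef u) F x))\<^sup>2 = (nrm u)\<^sup>2 - (\<Sum>m\<in>F. (coef u m)\<^sup>2)"
    unfolding nrm_sq_diff[OF assms(3) comb_facts(2)[OF assms(1,2)]] nrm_comb[OF assms(1,2)] ip_comb(1)[OF assms]
    by (simp add: power2_eq_square)
  show "(\<Sum>m\<in>F. (coef u m)\<^sup>2) \<le> (nrm u)\<^sup>2" using zero_le_power2[of "nrm (\<lambda>x. u x - comb (coef u) F x)"] unfolding 1 by simp
qed

text \<open>Expand \<open>\<parallel>\<nabla>(u - v)\<parallel>\<^sup>2 \<ge> 0\<close> for the finite sum \<open>v\<close> of modes, using the eigenvalue equation.\<close>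

lemma gradient_Bessel:
  assumes F: "finite F" "F \<subseteq> modes" and u: "u \<in> Vd"
  shows "(\<Sum>m\<in>F. lam m * (coef u m)\<^sup>2) \<le> gsq u"
proof -
  have S: "u \<in> Sob" "comb (coef u) F \<in> Sob" using u V_D comb_facts[OF F] by (auto simp: Vdot_def)
  have "0 \<le> (\<Sum>i\<in>UNIV. (nrm (\<lambda>x. D i u x - D i (comb (coef u) F) x))\<^sup>2)" by (intro sum_nonneg) simp
  also have "\<dots> = gsq u - 2 * ginner u (comb (coef u) F) + gsq (comb (coef u) F)"
    using SobD[OF S(1)] SobD[OF S(2)]
    by (simp add: nrm_sq_diff sum.distrib sum_subtractf grad_sq_eq grad_inner_def sum_distrib_left)
  also have "\<dots> = gsq u - (\<Sum>m\<in>F. lam m * (coef u m)\<^sup>2)"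
    unfolding ginner_comb[OF F u] gsq_comb[OF F] by (simp add: power2_eq_square ac_simps)
  finally show ?thesis by simp
qed

text \<open>The sum of the modes in \<open>S\<close>; for ranges of horizontal wavenumbers it coincides with \<open>band\<close>.\<close>

definition proj :: "mode set \<Rightarrow> field \<Rightarrow> field" where
  "proj S u = (SOME r. has_l2_sum (\<lambda>m x. coef u m *\<^sub>R w m x) S r)"

lemma l2_sum_iff: "has_l2_sum (\<lambda>m x. c m *\<^sub>R w m x) S r \<longleftrightarrow>
    r \<in> LL \<and> ((\<lambda>F. nrm (\<lambda>x. comb c F x - r x)) \<longlongrightarrow> 0) (finite_subsets_at_top S)"
  unfolding l2_has_sum_def comb_def by (subst nrm_diff_commute) rule

lemma coef_sq_summable: "u \<in> LL \<Longrightarrow> S \<subseteq> modes \<Longrightarrow> (\<lambda>m. (coef u m)\<^sup>2) summable_on S"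
  by (rule nonneg_bdd_above_summable_on) (auto intro!: bdd_aboveI[of _ "(nrm u)\<^sup>2"] Bessel(2))

lemma proj:
  assumes u: "u \<in> LL" and S: "S \<subseteq> modes"
  shows "proj S u \<in> LL" "((\<lambda>F. nrm (\<lambda>x. comb (coef u) F x - proj S u x)) \<longlongrightarrow> 0) (finite_subsets_at_top S)"
proof -
  obtain T where T: "T \<longlonglongrightarrow> 0" "\<And>n F. finite F \<Longrightarrow> F \<subseteq> S \<Longrightarrow> trunc_set S n \<subseteq> F \<Longrightarrow> (\<Sum>m\<in>F - trunc_set S n. (coef u m)\<^sup>2) \<le> T n"
    using summable_tail[OF coef_sq_summable[OF u S]] by auto
  obtain r where "r \<in> LL" "((\<lambda>F. nrm (\<lambda>x. comb (coef u) F x - r x)) \<longlongrightarrow> 0) (finite_subsets_at_top S)"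
  proof (rule L2_net_limit[of S "comb (coef u)" T])
    fix F assume F: "finite F" "F \<subseteq> S"
    then show "comb (coef u) F \<in> LL" using S by (intro comb_facts) auto
    fix n assume t: "trunc_set S n \<subseteq> F"
    have "(nrm (\<lambda>x. comb (coef u) F x - comb (coef u) (trunc_set S n) x))\<^sup>2 = (\<Sum>m\<in>F - trunc_set S n. (coef u m)\<^sup>2)"
      unfolding comb_diff[OF F(1) t] using F S by (intro nrm_comb) auto
    then show "(nrm (\<lambda>x. comb (coef u) F x - comb (coef u) (trunc_set S n) x))\<^sup>2 \<le> T n" using T(2)[OF F t] by simp
  qed (use T in blast)+
  then have "has_l2_sum (\<lambda>m x. coef u m *\<^sub>R w m x) S r" unfolding l2_sum_iff by blast
  then have "has_l2_sum (\<lambda>m x. coef u m *\<^sub>R w m x) S (proj S u)" unfolding proj_def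
    by (rule someI[where P = "has_l2_sum (\<lambda>m x. coef u m *\<^sub>R w m x) S"])
  then show "proj S u \<in> LL" "((\<lambda>F. nrm (\<lambda>x. comb (coef u) F x - proj S u x)) \<longlongrightarrow> 0) (finite_subsets_at_top S)"
    unfolding l2_sum_iff by blast+
qed

lemma proj_seq:
  assumes u: "u \<in> LL" and S: "S \<subseteq> modes"
  shows "(\<lambda>n. nrm (\<lambda>x. comb (coef u) (trunc_set S n) x - proj S u x)) \<longlonglongrightarrow> 0"
  using filterlim_compose[OF proj(2)[OF u S] filterlim_trunc_set] .

lemma trunc_modes: "S \<subseteq> modes \<Longrightarrow> finite (trunc_set S n)" "S \<subseteq> modes \<Longrightarrow> trunc_set S n \<subseteq> modes"
  using trunc_set[of S n] by auto

lemma ip_proj_seq: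
  assumes u: "u \<in> LL" and S: "S \<subseteq> modes" and v: "v \<in> LL"
  shows "(\<lambda>n. ip (comb (coef u) (trunc_set S n)) v) \<longlonglongrightarrow> ip (proj S u) v"
  by (intro ip_tendsto_left proj proj_seq u S v comb_facts trunc_modes)

lemma coef_proj:
  assumes u: "u \<in> LL" and S: "S \<subseteq> modes" and m: "m \<in> modes"
  shows "coef (proj S u) m = (if m \<in> S then coef u m else 0)"
proof -
  have lim: "(\<lambda>n. coef (comb (coef u) (trunc_set S n)) m) \<longlonglongrightarrow> coef (proj S u) m"
    by (rule ip_proj_seq[OF u S w_facts(3)[OF m]])
  have "eventually (\<lambda>n. coef (comb (coef u) (trunc_set S n)) m = (if m \<in> S then coef u m else 0)) sequentially"
    using eventually_gt_at_top[of "to_nat m"]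
    by eventually_elim (subst coef_comb[OF trunc_modes[OF S] m], simp add: trunc_set_def)
  from tendsto_eventually[OF this] lim show ?thesis using LIMSEQ_unique by blast
qed

lemma has_sum_imp_trunc: "(f has_sum s) S \<Longrightarrow> (\<lambda>n. sum f (trunc_set S n)) \<longlonglongrightarrow> (s :: real)"
  unfolding has_sum_def using filterlim_compose[OF _ filterlim_trunc_set] by blast

lemma has_sum_from_trunc:
  assumes "f summable_on S" "(\<lambda>n. sum f (trunc_set S n)) \<longlonglongrightarrow> (s :: real)"
  shows "(f has_sum s) S"
  using has_sum_imp_trunc[OF has_sum_infsum[OF assms(1)]] assms has_sum_infsum[OF assms(1)] LIMSEQ_unique by blast

lemma Parseval_proj:
  assumes u: "u \<in> LL" and S: "S \<subseteq> modes"
  shows "((\<lambda>m. (coef u m)\<^sup>2) has_sum (nrm (proj S u))\<^sup>2) S"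
proof (rule has_sum_from_trunc[OF coef_sq_summable[OF u S]])
  have "(\<lambda>n. (nrm (comb (coef u) (trunc_set S n)))\<^sup>2) \<longlonglongrightarrow> (nrm (proj S u))\<^sup>2"
    by (intro tendsto_power nrm_tendsto comb_facts trunc_modes proj proj_seq u S)
  then show "(\<lambda>n. \<Sum>m\<in>trunc_set S n. (coef u m)\<^sup>2) \<longlonglongrightarrow> (nrm (proj S u))\<^sup>2"
    using nrm_comb[OF trunc_modes[OF S]] by simp
qed

text \<open>Completeness of the modes: the expansion over all modes splits along \<open>S\<close> and its complement.\<close>

lemma proj_complement:
  assumes u: "u \<in> Hd" and S: "S \<subseteq> modes"
  shows "AE x in M. u x - proj S u x = proj (modes - S) u x"
proof -
  have uL: "u \<in> LL" using u by (auto simp: Hdot_def HH_def)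
  have "has_l2_sum (\<lambda>m x. coef u m *\<^sub>R w m x) modes u" using basis u unfolding stokes_basis_def by blast
  then have "((\<lambda>F. nrm (\<lambda>x. comb (coef u) F x - u x)) \<longlongrightarrow> 0) (finite_subsets_at_top modes)" unfolding l2_sum_iff by blast
  then have lim: "(\<lambda>n. nrm (\<lambda>x. comb (coef u) (trunc_set modes n) x - u x)) \<longlonglongrightarrow> 0"
    by (rule filterlim_compose[OF _ filterlim_trunc_set])
  let ?S' = "modes - S"
  have S': "?S' \<subseteq> modes" by blast
  note L = proj(1)[OF uL S] proj(1)[OF uL S']
  have split: "comb (coef u) (trunc_set modes n) x = comb (coef u) (trunc_set S n) x + comb (coef u) (trunc_set ?S' n) x" for n x
  proof -
    have "trunc_set modes n = trunc_set S n \<union> trunc_set ?S' n" using S by (auto simp: trunc_set_def)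
    moreover have "trunc_set S n \<inter> trunc_set ?S' n = {}" by (auto simp: trunc_set_def)
    ultimately show ?thesis unfolding comb_def using trunc_set(1) by (simp add: sum.union_disjoint)
  qed
  have "nrm (\<lambda>x. (u x - proj S u x) - proj ?S' u x) \<le> nrm (\<lambda>x. comb (coef u) (trunc_set modes n) x - u x)
     + nrm (\<lambda>x. comb (coef u) (trunc_set S n) x - proj S u x) + nrm (\<lambda>x. comb (coef u) (trunc_set ?S' n) x - proj ?S' u x)" for n
  proof -
    let ?a = "\<lambda>x. comb (coef u) (trunc_set modes n) x - u x" and ?b = "\<lambda>x. comb (coef u) (trunc_set S n) x - proj S u x"
      and ?c = "\<lambda>x. comb (coef u) (trunc_set ?S' n) x - proj ?S' u x"
    have l: "?a \<in> LL" "?b \<in> LL" "?c \<in> LL" using L uL comb_facts(2)[OF trunc_modes] S S' by (intro L2_diff; blast)+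
    have e: "(\<lambda>x. (u x - proj S u x) - proj ?S' u x) = (\<lambda>x. (?b x + ?c x) - ?a x)" by (simp add: split fun_eq_iff)
    have "nrm (\<lambda>x. (u x - proj S u x) - proj ?S' u x) = nrm (\<lambda>x. ?a x - (?b x + ?c x))"
      unfolding e by (rule nrm_diff_commute)
    also have "\<dots> \<le> nrm ?a + nrm (\<lambda>x. ?b x + ?c x)"
      by (rule nrm_triangle_sub[OF l(1) L2_add[OF l(2,3)]])
    also have "nrm (\<lambda>x. ?b x + ?c x) \<le> nrm ?b + nrm ?c" by (rule nrm_triangle[OF l(2,3)])
    finally show ?thesis by simp
  qed
  note le = this
  have lim0: "(\<lambda>n. nrm (\<lambda>x. comb (coef u) (trunc_set modes n) x - u x)
     + nrm (\<lambda>x. comb (coef u) (trunc_set S n) x - proj S u x) + nrm (\<lambda>x. comb (coef u) (trunc_set ?S' n) x - proj ?S' u x)) \<longlonglongrightarrow> 0 + 0 + 0"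
    by (intro tendsto_add lim proj_seq uL S S')
  have "nrm (\<lambda>x. (u x - proj S u x) - proj ?S' u x) \<le> 0 + 0 + 0"
    by (rule LIMSEQ_le_const[OF lim0]) (use le in blast)
  then have "nrm (\<lambda>x. (u x - proj S u x) - proj ?S' u x) = 0"
    using nrm_nonneg[of "\<lambda>x. (u x - proj S u x) - proj ?S' u x"] by linarith
  then have "AE x in M. (u x - proj S u x) - proj ?S' u x = 0"
    using nrm_zero_iff[OF L2_diff[OF L2_diff[OF uL L(1)] L(2)]] by blast
  then show ?thesis by eventually_elim simp
qed

end

context cell
begin

lemma L2_limit_unique:
  assumes f: "\<And>n. f n \<in> LL" and ab: "a \<in> LL" "b \<in> LL"
    and lim: "(\<lambda>n. nrm (\<lambda>x. f n x - a x)) \<longlonglongrightarrow> 0" "(\<lambda>n. nrm (\<lambda>x. f n x - b x)) \<longlonglongrightarrow> 0"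
  shows "AE x in M. a x = b x"
proof -
  have lim0: "(\<lambda>n. nrm (\<lambda>x. f n x - a x) + nrm (\<lambda>x. f n x - b x)) \<longlonglongrightarrow> 0 + 0"
    by (intro tendsto_add lim)
  have le: "nrm (\<lambda>x. a x - b x) \<le> nrm (\<lambda>x. f n x - a x) + nrm (\<lambda>x. f n x - b x)" for n
    using nrm_triangle_diff[OF ab(1) f[of n] ab(2)] nrm_diff_commute[of a "f n"] by simp
  have "nrm (\<lambda>x. a x - b x) \<le> 0 + 0" by (rule LIMSEQ_le_const[OF lim0]) (use le in blast)
  then have "nrm (\<lambda>x. a x - b x) = 0" using nrm_nonneg[of "\<lambda>x. a x - b x"] by linarith
  then have "AE x in M. a x - b x = 0" using nrm_zero_iff[OF L2_diff[OF ab]] by blast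
  then show ?thesis by eventually_elim simp
qed

lemma L2_limit_add:
  assumes f: "\<And>n. f n \<in> LL" "\<And>n. g n \<in> LL" and ab: "a \<in> LL" "b \<in> LL"
    and lim: "(\<lambda>n. nrm (\<lambda>x. f n x - a x)) \<longlonglongrightarrow> 0" "(\<lambda>n. nrm (\<lambda>x. g n x - b x)) \<longlonglongrightarrow> 0"
  shows "(\<lambda>n. nrm (\<lambda>x. (f n x + g n x) - (a x + b x))) \<longlonglongrightarrow> 0"
proof (rule Lim_null_comparison)
  have e: "(\<lambda>x. (f n x + g n x) - (a x + b x)) = (\<lambda>x. (f n x - a x) + (g n x - b x))" for n by auto
  have "nrm (\<lambda>x. (f n x + g n x) - (a x + b x)) \<le> nrm (\<lambda>x. f n x - a x) + nrm (\<lambda>x. g n x - b x)" for n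
    unfolding e by (rule nrm_triangle[OF L2_diff[OF f(1) ab(1)] L2_diff[OF f(2) ab(2)]])
  then show "\<forall>\<^sub>F n in sequentially. norm (nrm (\<lambda>x. (f n x + g n x) - (a x + b x))) \<le> nrm (\<lambda>x. f n x - a x) + nrm (\<lambda>x. g n x - b x)"
    by simp
  show "(\<lambda>n. nrm (\<lambda>x. f n x - a x) + nrm (\<lambda>x. g n x - b x)) \<longlonglongrightarrow> 0"
    using tendsto_add[OF lim] by simp
qed

lemma Sob_cong_AE:
  assumes u: "u \<in> Sob" and v: "v \<in> LL" and eq: "AE x in M. u x = v x"
  shows "v \<in> Sob" "AE x in M. D i v x = D i u x"
proof -
  have w: "wpd i v (D i u)" for i
    using weak_pd_cong_AE[OF SobD(3)[OF u] eq AE_I2 L2D(1) L2D(1)[OF v] L2D(1) L2D(1), of i "D i u"] SobD[OF u] by blast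
  show "v \<in> Sob" by (rule SobI[OF v SobD(2)[OF u] w])
  show "AE x in M. D i v x = D i u x" by (rule wd_eq_AE[OF SobD(2)[OF u] w])
qed

lemma C1_sum:
  assumes "finite F" "\<And>m. m \<in> F \<Longrightarrow> C1 (f m :: field)"
  shows "C1 (\<lambda>x. \<Sum>m\<in>F. c m *\<^sub>R f m x) \<and> pd i (\<lambda>x. \<Sum>m\<in>F. c m *\<^sub>R f m x) = (\<lambda>x. \<Sum>m\<in>F. c m *\<^sub>R pd i (f m) x)"
  using assms
proof (induction F rule: finite_induct)
  case empty
  have "pd i (\<lambda>x::point. 0 :: point) = (\<lambda>x. 0)" for i by (simp add: pd_def fun_eq_iff)
  then show ?case by (simp add: C1_def)
next
  case (insert m F)
  have e: "(\<lambda>x. \<Sum>m\<in>insert m F. c m *\<^sub>R g m x) = (\<lambda>x. c m *\<^sub>R g m x + (\<Sum>m\<in>F. c m *\<^sub>R g m x))" for g :: "'a \<Rightarrow> field"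
    using insert.hyps by simp
  have C: "C1 (f m)" "C1 (\<lambda>x. \<Sum>m\<in>F. c m *\<^sub>R f m x)" using insert by auto
  show ?case unfolding e using insert C by (simp add: C1_add C1_scaleR pd_add pd_scaleR)
qed

text \<open>Used for the fields \<open>W m\<close> and for their horizontal derivatives, which are orthogonal as well.\<close>

lemma nrm_sum_orthogonal:
  assumes F: "finite F" and L: "\<And>m. m \<in> F \<Longrightarrow> f m \<in> LL"
    and orth: "\<And>m n. m \<in> F \<Longrightarrow> n \<in> F \<Longrightarrow> ip (f m) (f n) = (if m = n then q n else 0)"
  shows "(nrm (\<lambda>x. \<Sum>m\<in>F. c m *\<^sub>R f m x))\<^sup>2 = (\<Sum>m\<in>F. (c m)\<^sup>2 * q m)"
proof -
  have s: "(\<lambda>x. \<Sum>m\<in>F. c m *\<^sub>R f m x) \<in> LL" by (intro L2_sum L2_scale L)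
  have "(nrm (\<lambda>x. \<Sum>m\<in>F. c m *\<^sub>R f m x))\<^sup>2 = (\<Sum>m\<in>F. \<Sum>n\<in>F. c m * (c n * ip (f m) (f n)))"
  proof -
    have "ip (\<lambda>x. c m *\<^sub>R f m x) (\<lambda>x. \<Sum>m\<in>F. c m *\<^sub>R f m x) = (\<Sum>n\<in>F. c m * (c n * ip (f m) (f n)))" if "m \<in> F" for m
      unfolding ip_scale_left by (subst ip_sum_right[OF L2_scale[OF L] L[OF that]]) (simp_all add: sum_distrib_left)
    then show ?thesis unfolding nrm_sq by (subst ip_sum_left[OF L2_scale[OF L] s]) simp_all
  qed
  also have "\<dots> = (\<Sum>m\<in>F. \<Sum>n\<in>F. if m = n then (c m)\<^sup>2 * q m else 0)"
  proof (intro sum.cong refl)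
    fix m n assume "m \<in> F" "n \<in> F"
    then show "c m * (c n * ip (f m) (f n)) = (if m = n then (c m)\<^sup>2 * q m else 0)"
      using orth[of m n] by (simp add: power2_eq_square)
  qed
  also have "\<dots> = (\<Sum>m\<in>F. (c m)\<^sup>2 * q m)" using F by (intro sum.cong) simp_all
  finally show ?thesis .
qed

end

context stokes_modes
begin

lemma proj_union:
  assumes u: "u \<in> LL" and AB: "A \<subseteq> modes" "B \<subseteq> modes" "A \<inter> B = {}"
  shows "AE x in M. proj (A \<union> B) u x = proj A u x + proj B u x"
proof -
  have split: "comb (coef u) (trunc_set (A \<union> B) n) = (\<lambda>x. comb (coef u) (trunc_set A n) x + comb (coef u) (trunc_set B n) x)" for n
  proof -
    have "trunc_set (A \<union> B) n = trunc_set A n \<union> trunc_set B n" by (auto simp: trunc_set_def)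
    moreover have "trunc_set A n \<inter> trunc_set B n = {}" using AB by (auto simp: trunc_set_def)
    ultimately show ?thesis unfolding comb_def using trunc_set(1) by (simp add: sum.union_disjoint fun_eq_iff)
  qed
  have un: "A \<union> B \<subseteq> modes" using AB by blast
  show ?thesis
  proof (rule L2_limit_unique)
    show "comb (coef u) (trunc_set (A \<union> B) n) \<in> LL" for n by (intro comb_facts trunc_modes un)
    show "(\<lambda>n. nrm (\<lambda>x. comb (coef u) (trunc_set (A \<union> B) n) x - (proj A u x + proj B u x))) \<longlonglongrightarrow> 0"
      unfolding split by (intro L2_limit_add comb_facts trunc_modes AB proj u proj_seq)
  qed (intro proj_seq proj L2_add u un AB)+
qed

lemma proj_modes:
  assumes u: "u \<in> Hd" shows "AE x in M. proj modes u x = u x"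
proof -
  have uL: "u \<in> LL" using u by (auto simp: Hdot_def HH_def)
  have "((\<lambda>m. (coef u m)\<^sup>2) has_sum (nrm (proj {} u))\<^sup>2) {}" by (rule Parseval_proj[OF uL]) simp
  then have "(nrm (proj {} u))\<^sup>2 = 0" by (rule has_sum_unique[OF _ has_sum_empty])
  then have "AE x in M. proj {} u x = 0" using nrm_zero_iff[OF proj(1)[OF uL]] by simp
  moreover have "AE x in M. u x - proj modes u x = proj {} u x" using proj_complement[OF u subset_refl] by simp
  ultimately show ?thesis by eventually_elim simp
qed

lemma Vd_D: "u \<in> Vd \<Longrightarrow> u \<in> Vs" "u \<in> Vd \<Longrightarrow> u \<in> Hd" "u \<in> Vd \<Longrightarrow> u \<in> LL" "u \<in> Vd \<Longrightarrow> u \<in> Sob"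
  using V_D by (auto simp: Vdot_def)

text \<open>The partial sums are Cauchy in \<open>H\<^sup>1\<close> because \<open>\<parallel>\<nabla> comb c F\<parallel>\<^sup>2 = \<Sum> lam m c\<^sub>m\<^sup>2\<close>; closedness of the weak derivative and of \<open>V\<close> identifies the limit.\<close>

lemma H1_proj:
  assumes u: "u \<in> LL" and S: "S \<subseteq> modes" and sm: "(\<lambda>m. lam m * (coef u m)\<^sup>2) summable_on S"
  shows "proj S u \<in> Vs"
    "\<And>i. (\<lambda>n. nrm (\<lambda>x. D i (comb (coef u) (trunc_set S n)) x - D i (proj S u) x)) \<longlonglongrightarrow> 0"
    "((\<lambda>m. lam m * (coef u m)\<^sup>2) has_sum gsq (proj S u)) S"
proof -
  let ?f = "\<lambda>m. lam m * (coef u m)\<^sup>2" and ?c = "\<lambda>n. comb (coef u) (trunc_set S n)"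
  have f0: "0 \<le> ?f m" if "m \<in> S" for m
    using lam_pos[OF subsetD[OF S that]] by (intro mult_nonneg_nonneg) auto
  obtain T where T: "T \<longlonglongrightarrow> 0" "\<And>n F. finite F \<Longrightarrow> F \<subseteq> S \<Longrightarrow> trunc_set S n \<subseteq> F \<Longrightarrow> sum ?f (F - trunc_set S n) \<le> T n"
    using summable_tail[OF sm f0] by blast
  note c = comb_facts[OF trunc_modes[OF S], of "coef u"]
  have "\<exists>k. k \<in> LL \<and> (\<lambda>n. nrm (\<lambda>x. D i (?c n) x - k x)) \<longlonglongrightarrow> 0" for i
  proof -
    obtain k where "k \<in> LL" "((\<lambda>F. nrm (\<lambda>x. D i (comb (coef u) F) x - k x)) \<longlongrightarrow> 0) (finite_subsets_at_top S)"
    proof (rule L2_net_limit[of S "\<lambda>F. D i (comb (coef u) F)" T])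
      fix F assume F: "finite F" "F \<subseteq> S"
      then have Fm: "F \<subseteq> modes" using S by blast
      show "D i (comb (coef u) F) \<in> LL" by (rule SobD(2)[OF comb_facts(3)[OF F(1) Fm]])
      fix n assume t: "trunc_set S n \<subseteq> F"
      have Fd: "finite (F - trunc_set S n)" "F - trunc_set S n \<subseteq> modes" using F Fm by auto
      have "nrm (\<lambda>x. D i (comb (coef u) F) x - D i (?c n) x) = nrm (D i (\<lambda>x. comb (coef u) F x - ?c n x))"
        by (rule Sob_diff_wd(2)[OF comb_facts(3)[OF F(1) Fm] c(3), symmetric])
      also have "\<dots> \<le> sqrt (gsq (comb (coef u) (F - trunc_set S n)))" unfolding comb_diff[OF F(1) t] by (rule nrm_wd_le)
      finally have "(nrm (\<lambda>x. D i (comb (coef u) F) x - D i (?c n) x))\<^sup>2 \<le> (sqrt (gsq (comb (coef u) (F - trunc_set S n))))\<^sup>2"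
        by (intro power_mono) auto
      also have "\<dots> = sum ?f (F - trunc_set S n)" unfolding gsq_comb[OF Fd, symmetric] by simp
      also have "\<dots> \<le> T n" by (rule T(2)[OF F t])
      finally show "(nrm (\<lambda>x. D i (comb (coef u) F) x - D i (?c n) x))\<^sup>2 \<le> T n" .
    qed (use T in blast)+
    then show ?thesis using filterlim_compose[OF _ filterlim_trunc_set] by blast
  qed
  then have "\<forall>i. \<exists>k. k \<in> LL \<and> (\<lambda>n. nrm (\<lambda>x. D i (?c n) x - k x)) \<longlonglongrightarrow> 0" by blast
  from choice[OF this] obtain k where k: "\<And>i. k i \<in> LL" "\<And>i. (\<lambda>n. nrm (\<lambda>x. D i (?c n) x - k i x)) \<longlonglongrightarrow> 0" by blast
  note r = proj(1)[OF u S]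
  have w: "wpd i (proj S u) (k i)" for i
    by (rule weak_pd_closed[OF c(2) r proj_seq[OF u S] SobD(2)[OF c(3)] k SobD(3)[OF c(3)]])
  have rS: "proj S u \<in> Sob" by (rule SobI[OF r k(1) w])
  show lim: "(\<lambda>n. nrm (\<lambda>x. D i (?c n) x - D i (proj S u) x)) \<longlonglongrightarrow> 0" for i
  proof -
    have "nrm (\<lambda>x. D i (?c n) x - D i (proj S u) x) = nrm (\<lambda>x. D i (?c n) x - k i x)" for n
    proof (rule nrm_cong_AE)
      show "AE x in M. D i (?c n) x - D i (proj S u) x = D i (?c n) x - k i x"
        using wd_eq_AE[OF k(1) w] by eventually_elim simp
    qed (intro L2D L2_diff SobD(2) c rS k)+
    then show ?thesis using k(2)[of i] by simp
  qed
  show "proj S u \<in> Vs" by (rule V_closed[OF c(1) rS proj_seq[OF u S] lim])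
  show "(?f has_sum gsq (proj S u)) S"
  proof (rule has_sum_from_trunc[OF sm])
    have "(\<lambda>n. gsq (?c n)) \<longlonglongrightarrow> gsq (proj S u)"
      unfolding grad_sq_eq by (intro tendsto_sum tendsto_power nrm_tendsto SobD(2) c rS lim)
    then show "(\<lambda>n. sum ?f (trunc_set S n)) \<longlonglongrightarrow> gsq (proj S u)" unfolding gsq_comb[OF trunc_modes[OF S]] .
  qed
qed

lemma gradient_summable:
  assumes u: "u \<in> Vd" and S: "S \<subseteq> modes"
  shows "(\<lambda>m. lam m * (coef u m)\<^sup>2) summable_on S"
proof (rule nonneg_bdd_above_summable_on)
  show "0 \<le> lam m * (coef u m)\<^sup>2" if "m \<in> S" for m
    using lam_pos[OF subsetD[OF S that]] by (intro mult_nonneg_nonneg) auto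
  show "bdd_above (sum (\<lambda>m. lam m * (coef u m)\<^sup>2) ` {F. F \<subseteq> S \<and> finite F})"
    using S by (intro bdd_aboveI[of _ "gsq u"]) (auto intro!: gradient_Bessel u)
qed

lemma Vd_proj:
  assumes u: "u \<in> Vd" and S: "S \<subseteq> modes"
  shows "proj S u \<in> Vs"
    "\<And>i. (\<lambda>n. nrm (\<lambda>x. D i (comb (coef u) (trunc_set S n)) x - D i (proj S u) x)) \<longlonglongrightarrow> 0"
    "((\<lambda>m. lam m * (coef u m)\<^sup>2) has_sum gsq (proj S u)) S"
  using H1_proj[OF Vd_D(3)[OF u] S gradient_summable[OF u S]] by blast+

lemma gsq_proj_modes: assumes u: "u \<in> Vd" shows "gsq (proj modes u) = gsq u"
proof -
  have "nrm (D i u) = nrm (D i (proj modes u))" for i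
    using Sob_cong_AE(2)[OF V_D(1)[OF Vd_proj(1)[OF u subset_refl]] Vd_D(3)[OF u] proj_modes[OF Vd_D(2)[OF u]], of i]
      V_D(3)[OF Vd_proj(1)[OF u subset_refl], of i] V_D(3)[OF Vd_D(1)[OF u], of i]
    by (intro nrm_cong_AE L2D) auto
  then show ?thesis by (simp add: grad_sq_eq)
qed

lemma nrm_proj_modes: assumes u: "u \<in> Hd" shows "nrm (proj modes u) = nrm u"
  by (rule nrm_cong_AE[OF proj_modes[OF u]]) (intro L2D proj Hd_L2 u subset_refl)+

lemma gsq_split:
  assumes u: "u \<in> Vd" and S: "S \<subseteq> modes"
  shows "gsq u = gsq (proj S u) + gsq (proj (modes - S) u)"
proof -
  have "((\<lambda>m. lam m * (coef u m)\<^sup>2) has_sum (gsq (proj S u) + gsq (proj (modes - S) u))) (S \<union> (modes - S))"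
    using S by (intro has_sum_Un_disjoint Vd_proj u) auto
  moreover have "S \<union> (modes - S) = modes" using S by blast
  ultimately show ?thesis
    using has_sum_unique[OF Vd_proj(3)[OF u subset_refl]] gsq_proj_modes[OF u] by simp
qed

lemma gsq_proj_le: "u \<in> Vd \<Longrightarrow> S \<subseteq> modes \<Longrightarrow> gsq (proj S u) \<le> gsq u"
  using gsq_split[of u S] gsq_nonneg[of "proj (modes - S) u"] by simp

lemma nrm_proj_le:
  assumes u: "u \<in> LL" and S: "S \<subseteq> modes" shows "nrm (proj S u) \<le> nrm u"
proof (rule power2_le_imp_le)
  have "(\<lambda>n. (nrm (comb (coef u) (trunc_set S n)))\<^sup>2) \<longlonglongrightarrow> (nrm (proj S u))\<^sup>2"
    by (intro tendsto_power nrm_tendsto comb_facts trunc_modes proj proj_seq u S)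
  then show "(nrm (proj S u))\<^sup>2 \<le> (nrm u)\<^sup>2"
  proof (rule LIMSEQ_le_const2)
    show "\<exists>N. \<forall>n\<ge>N. (nrm (comb (coef u) (trunc_set S n)))\<^sup>2 \<le> (nrm u)\<^sup>2"
      unfolding nrm_comb[OF trunc_modes[OF S]] using Bessel(2)[OF trunc_modes[OF S] u] by blast
  qed
qed simp

text \<open>Every eigenvalue is at least the square of the smallest horizontal wavenumber.\<close>

lemma Poincare:
  assumes u: "u \<in> Vd" shows "(kbar1 Lx Ly)\<^sup>2 * (nrm u)\<^sup>2 \<le> gsq u"
proof -
  have uL: "u \<in> LL" and uH: "u \<in> Hd" using u Vd_D by auto
  have 1: "((\<lambda>m. (kbar1 Lx Ly)\<^sup>2 * (coef u m)\<^sup>2) has_sum ((kbar1 Lx Ly)\<^sup>2 * (nrm (proj modes u))\<^sup>2)) modes"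
    by (intro has_sum_cmult_right Parseval_proj uL subset_refl)
  have "(kbar1 Lx Ly)\<^sup>2 * (nrm (proj modes u))\<^sup>2 \<le> gsq (proj modes u)"
    by (rule has_sum_mono[OF 1 Vd_proj(3)[OF u subset_refl]]) (intro mult_right_mono lam_ge_kbar1, simp_all)
  then show ?thesis by (simp add: gsq_proj_modes[OF u] nrm_proj_modes[OF uH])
qed

text \<open>Bounds the \<open>H\<^sup>1\<close> norm by the gradient on \<open>Vdot\<close>.\<close>

definition poincare_const :: real where "poincare_const = 1 + 1 / (kbar1 Lx Ly)\<^sup>2"

lemma poincare_const: "1 \<le> poincare_const" by (simp add: poincare_const_def)

lemma h1sq_le: assumes u: "u \<in> Vd" shows "h1sq u \<le> poincare_const * gsq u" "(nrm u)\<^sup>2 \<le> poincare_const * gsq u"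
proof -
  have "(nrm u)\<^sup>2 \<le> 1 / (kbar1 Lx Ly)\<^sup>2 * gsq u"
    using Poincare[OF u] kbar1_pos by (simp add: field_simps)
  then show "h1sq u \<le> poincare_const * gsq u" "(nrm u)\<^sup>2 \<le> poincare_const * gsq u"
    using gsq_nonneg[of u] unfolding h1sq_def poincare_const_def distrib_right mult_1 by linarith+
qed

section \<open>Horizontal structure of the modes\<close>

lemma ip_w_W: "m \<in> modes \<Longrightarrow> ip u (w m) = ip u (W m)"
  unfolding l2inner_def using w_eq_W by (intro Bochner_Integration.integral_cong) auto

lemma wd_w: assumes m: "m \<in> modes" shows "AE x in M. D i (w m) x = pd i (W m) x"
proof (rule wd_eq_AE)
  note t = W_trig[OF m]
  show "pd i (W m) \<in> LL" by (rule trig_L2[OF trig_pd[OF t]])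
  show "wpd i (w m) (pd i (W m))"
  proof (rule weak_pd_cong_AE[OF C1_weak_pd[OF trig_C1[OF t]]])
    show "AE x in M. W m x = w m x" using w_eq_W[OF m] by (intro AE_I2) simp
  qed (intro AE_I2 refl L2D(1) trig_L2[OF t] trig_L2[OF trig_pd[OF t]] w_facts(3) m)+
qed

lemma W_periodic: "m \<in> modes \<Longrightarrow> trig (al m) (be m) (ga m) G \<Longrightarrow> i \<noteq> 3 \<Longrightarrow> periodic_dir i G"
  using trig_periodic_dir[OF _ al_period be_period] .

text \<open>Horizontal derivatives of modes are orthogonal like the modes themselves: integrate by parts and use that \<open>G\<close> is an eigenfunction of \<open>\<partial>\<^sub>i\<^sup>2\<close>.\<close>

lemma ip_pd_W:
  assumes m: "m \<in> modes" and n: "n \<in> modes" and i: "i \<noteq> 3"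
    and F: "trig (al m) (be m) (ga m) F" and G: "trig (al n) (be n) (ga n) G"
  shows "ip (pd i F) (pd i G) = (if i = 1 then (al n)\<^sup>2 else (be n)\<^sup>2) * ip F G"
proof -
  have "ip (pd i F) (pd i G) = - ip F (pd i (pd i G))"
    using integration_by_parts[OF i trig_C1[OF F] W_periodic[OF m F i] trig_C1[OF trig_pd[OF G]] W_periodic[OF n trig_pd[OF G] i] weight_one, of i]
    by simp
  also have "\<dots> = (if i = 1 then (al n)\<^sup>2 else (be n)\<^sup>2) * ip F G"
  proof -
    have "i = 1 \<or> i = 2" using i exhaust_3[of i] by blast
    then show ?thesis
    proof
      assume i1: "i = 1"
      show ?thesis unfolding i1 trig_pd_pd[OF G, THEN conjunct1] ip_scale_right by simp
    next
      assume i2: "i = 2"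
      show ?thesis unfolding i2 trig_pd_pd[OF G, THEN conjunct2] ip_scale_right by simp
    qed
  qed
  finally show ?thesis .
qed

lemma ip_W: "m \<in> modes \<Longrightarrow> n \<in> modes \<Longrightarrow> ip (W m) (W n) = (if m = n then 1 else 0)"
  using w_orthonormal[of m n] ip_w_W[of n "w m"] ip_w_W[of m "W n"] by (simp add: ip_commute)

text \<open>Bernstein's inequality: by orthogonality of the derivatives, each horizontal derivative costs at most a factor \<open>K\<close>.\<close>

lemma horizontal_energy_combW:
  assumes F: "finite F" "F \<subseteq> modes" and K: "\<And>m. m \<in> F \<Longrightarrow> kbar Lx Ly m \<le> K"
  shows "C1 (combW c F)" "C1 (pd 2 (combW c F))" "horizontal_energy (combW c F) \<le> (1 + K\<^sup>2)\<^sup>2 * (nrm (comb c F))\<^sup>2"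
proof -
  have m: "m \<in> modes" if "m \<in> F" for m using F that by blast
  note t = W_trig[OF m] and t2 = trig_pd[OF W_trig[OF m]]
  have S1: "C1 (combW c F) \<and> pd i (combW c F) = (\<lambda>x. \<Sum>m\<in>F. c m *\<^sub>R pd i (W m) x)" for i
    unfolding combW_def by (rule C1_sum[OF F(1)]) (rule trig_C1[OF t])
  have pd: "pd i (combW c F) = (\<lambda>x. \<Sum>m\<in>F. c m *\<^sub>R pd i (W m) x)" for i using S1 by blast
  have S2: "C1 (pd 2 (combW c F)) \<and> pd i (pd 2 (combW c F)) = (\<lambda>x. \<Sum>m\<in>F. c m *\<^sub>R pd i (pd 2 (W m)) x)" for i
    unfolding pd by (rule C1_sum[OF F(1)]) (rule trig_C1[OF t2])
  show "C1 (combW c F)" "C1 (pd 2 (combW c F))" using S1 S2 by blast+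
  have pd12: "pd 1 (pd 2 (combW c F)) = (\<lambda>x. \<Sum>m\<in>F. c m *\<^sub>R pd 1 (pd 2 (W m)) x)" using S2 by blast
  have o0: "ip (W m) (W n) = (if m = n then 1 else 0)" if "m \<in> F" "n \<in> F" for m n
    by (rule ip_W[OF m[OF that(1)] m[OF that(2)]])
  have o1: "ip (pd i (W m)) (pd i (W n)) = (if m = n then (if i = 1 then (al n)\<^sup>2 else (be n)\<^sup>2) else 0)"
    if "m \<in> F" "n \<in> F" "i \<noteq> 3" for m n i
    using ip_pd_W[OF m[OF that(1)] m[OF that(2)] that(3) t[OF that(1)] t[OF that(2)]] o0[OF that(1,2)] by simp
  have o12: "ip (pd 1 (pd 2 (W m))) (pd 1 (pd 2 (W n))) = (if m = n then (al n)\<^sup>2 * (be n)\<^sup>2 else 0)"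
    if "m \<in> F" "n \<in> F" for m n
    using ip_pd_W[OF m[OF that(1)] m[OF that(2)] _ t2[OF that(1)] t2[OF that(2)], of 1 2 2] o1[OF that, of 2] by simp
  have n0: "(nrm (combW c F))\<^sup>2 = (\<Sum>m\<in>F. (c m)\<^sup>2 * 1)"
    unfolding combW_def by (rule nrm_sum_orthogonal[OF F(1) _ o0]) (rule trig_L2[OF t])
  have n1: "(nrm (pd 1 (combW c F)))\<^sup>2 = (\<Sum>m\<in>F. (c m)\<^sup>2 * (al m)\<^sup>2)"
    unfolding pd by (rule nrm_sum_orthogonal[OF F(1)]) (erule trig_L2[OF t2], simp add: o1)
  have n2: "(nrm (pd 2 (combW c F)))\<^sup>2 = (\<Sum>m\<in>F. (c m)\<^sup>2 * (be m)\<^sup>2)"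
    unfolding pd by (rule nrm_sum_orthogonal[OF F(1)]) (erule trig_L2[OF t2], simp add: o1)
  have n12: "(nrm (pd 1 (pd 2 (combW c F))))\<^sup>2 = (\<Sum>m\<in>F. (c m)\<^sup>2 * ((al m)\<^sup>2 * (be m)\<^sup>2))"
    unfolding pd12 by (rule nrm_sum_orthogonal[OF F(1)]) (erule trig_L2[OF trig_pd[OF t2]], simp add: o12)
  have "horizontal_energy (combW c F) = (\<Sum>m\<in>F. (c m)\<^sup>2 * ((1 + (al m)\<^sup>2) * (1 + (be m)\<^sup>2)))"
    unfolding horizontal_energy_def n0 n1 n2 n12 by (simp flip: sum.distrib add: algebra_simps)
  also have "\<dots> \<le> (\<Sum>m\<in>F. (c m)\<^sup>2 * (1 + K\<^sup>2)\<^sup>2)"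
  proof (intro sum_mono mult_left_mono)
    fix m assume mF: "m \<in> F"
    have "(kbar Lx Ly m)\<^sup>2 \<le> K\<^sup>2" using K[OF mF] kbar_ge[OF m[OF mF]] kbar1_pos by (intro power_mono) auto
    then have "(al m)\<^sup>2 \<le> K\<^sup>2" "(be m)\<^sup>2 \<le> K\<^sup>2" unfolding kbar_sq using zero_le_power2[of "al m"] zero_le_power2[of "be m"] by linarith+
    then show "(1 + (al m)\<^sup>2) * (1 + (be m)\<^sup>2) \<le> (1 + K\<^sup>2)\<^sup>2" unfolding power2_eq_square[of "1 + K\<^sup>2"] by (intro mult_mono) auto
  qed simp
  also have "\<dots> = (1 + K\<^sup>2)\<^sup>2 * (nrm (comb c F))\<^sup>2" unfolding nrm_comb[OF F] sum_distrib_left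
    by (rule sum.cong[OF refl]) (rule mult.commute)
  finally show "horizontal_energy (combW c F) \<le> (1 + K\<^sup>2)\<^sup>2 * (nrm (comb c F))\<^sup>2" .
qed

text \<open>The constant of the following bound; it grows with the horizontal wavenumber \<open>K\<close> but does not depend on the number of modes, and in particular not on the vertical wavenumbers.\<close>

definition convection_const :: "real \<Rightarrow> real" where "convection_const K = sqrt (64 * cell_const ^ 3 * poincare_const) * (1 + K\<^sup>2) * 3"

lemma convection_const_nonneg: "0 \<le> convection_const K"
  using cell_const(2) poincare_const by (simp add: convection_const_def)

text \<open>The bound is quadratic in the gradient of \<open>u\<close>, where a general test field in \<open>V\<close> would only allow a cubic one. It is uniform in the number of modes, so it dominates the convective term in the limit of infinitely many vertical modes.\<close>

lemma conv_band_limited_bound: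
  assumes u: "u \<in> Vd" and F: "finite F" "F \<subseteq> modes" and K: "\<And>m. m \<in> F \<Longrightarrow> kbar Lx Ly m \<le> K"
  shows "\<bar>ip (conv Lx Ly h u u) (comb c F)\<bar> \<le> convection_const K * nrm (comb c F) * gsq u"
proof -
  let ?n = "nrm (comb c F)"
  let ?Q = "sqrt (64 * cell_const ^ 3 * poincare_const * gsq u) * ((1 + K\<^sup>2) * ?n)"
  note H = horizontal_energy_combW[OF F K, of c]
  have k0: "0 \<le> 64 * cell_const ^ 3" "0 \<le> poincare_const" using cell_const(2) poincare_const by auto
  have Q0: "0 \<le> ?Q" using k0 by (intro mult_nonneg_nonneg) auto
  have "(\<integral>\<^sup>+x. ennreal ((norm (u x))\<^sup>2 * (norm (comb c F x))\<^sup>2) \<partial>M) = (\<integral>\<^sup>+x. ennreal ((norm (u x))\<^sup>2 * (norm (combW c F x))\<^sup>2) \<partial>M)"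
    using comb_eq_combW[OF F(2), of _ c] by (intro nn_integral_cong) simp
  also have "\<dots> \<le> ennreal (64 * cell_const ^ 3 * (h1sq u * horizontal_energy (combW c F)))"
    by (rule V_anisotropic[OF Vd_D(1)[OF u] H(1,2)])
  also have "\<dots> \<le> ennreal (64 * cell_const ^ 3 * ((poincare_const * gsq u) * ((1 + K\<^sup>2)\<^sup>2 * ?n\<^sup>2)))"
    using k0 h1sq_le(1)[OF u] H(3) by (intro ennreal_leI mult_left_mono mult_mono) (auto simp: horizontal_energy_def)
  also have "64 * cell_const ^ 3 * ((poincare_const * gsq u) * ((1 + K\<^sup>2)\<^sup>2 * ?n\<^sup>2)) = ?Q\<^sup>2"
    using k0 by (simp add: power_mult_distrib mult.assoc)
  finally have "\<bar>ip (conv Lx Ly h u u) (comb c F)\<bar> \<le> ?Q * (\<Sum>i\<in>UNIV. nrm (D i u))"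
    using conv_bound(2)[OF Vd_D(4)[OF u] L2D(1)[OF Vd_D(3)[OF u]] L2D(1)[OF comb_facts(2)[OF F]] _ Q0] by blast
  also have "\<dots> \<le> ?Q * (3 * sqrt (gsq u))" by (intro mult_left_mono sum_nrm_wd_le Q0)
  also have "\<dots> = convection_const K * ?n * (sqrt (gsq u) * sqrt (gsq u))"
    by (simp add: convection_const_def real_sqrt_mult ac_simps)
  finally show ?thesis by simp
qed

lemma conv_proj_seq:
  assumes u: "u \<in> Vd" and S: "S \<subseteq> modes"
  shows "(\<lambda>n. ip (conv Lx Ly h u u) (comb (coef u) (trunc_set S n))) \<longlonglongrightarrow> ip (conv Lx Ly h u u) (proj S u)"
proof -
  let ?c = "\<lambda>n. comb (coef u) (trunc_set S n)" and ?r = "proj S u" and ?v = "conv Lx Ly h u u"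
  note uV = Vd_D(1)[OF u] and cV = comb_facts(1)[OF trunc_modes[OF S]] and rV = Vd_proj(1)[OF u S]
  have "(\<lambda>n. ip ?v (?c n) - ip ?v ?r) \<longlonglongrightarrow> 0"
  proof (rule Lim_null_comparison)
    have "ip ?v (?c n) - ip ?v ?r = ip ?v (\<lambda>x. ?c n x - ?r x)" for n
      unfolding l2inner_def inner_diff_right
      by (rule Bochner_Integration.integral_diff[symmetric]) (intro conv_V_bound(1) uV cV rV)+
    then show "\<forall>\<^sub>F n in sequentially. norm (ip ?v (?c n) - ip ?v ?r) \<le> sqrt (96 * cell_const ^ 3 * (h1sq u * h1sq (\<lambda>x. ?c n x - ?r x))) * (3 * sqrt (gsq u))"
      using conv_V_bound(2)[OF uV uV V_diff[OF cV rV]] by simp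
    have "(\<lambda>n. h1sq (\<lambda>x. ?c n x - ?r x)) \<longlonglongrightarrow> 0\<^sup>2 + (\<Sum>i\<in>(UNIV::3 set). 0\<^sup>2)"
      unfolding h1sq_def grad_sq_eq Sob_diff_wd(2)[OF V_D(1)[OF cV] V_D(1)[OF rV]]
      by (intro tendsto_add tendsto_power tendsto_sum Vd_proj(2) proj_seq u S Vd_D)
    then have "(\<lambda>n. sqrt (96 * cell_const ^ 3 * (h1sq u * h1sq (\<lambda>x. ?c n x - ?r x))) * (3 * sqrt (gsq u))) \<longlonglongrightarrow> sqrt (96 * cell_const ^ 3 * (h1sq u * (0\<^sup>2 + (\<Sum>i\<in>(UNIV::3 set). 0\<^sup>2)))) * (3 * sqrt (gsq u))"
      by (intro tendsto_intros)
    then show "(\<lambda>n. sqrt (96 * cell_const ^ 3 * (h1sq u * h1sq (\<lambda>x. ?c n x - ?r x))) * (3 * sqrt (gsq u))) \<longlonglongrightarrow> 0" by simp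
  qed
  then show ?thesis by (simp add: LIM_zero_iff)
qed

text \<open>Each of the three products is integrable on its own, by Ladyzhenskaya's inequality, so the integral splits.\<close>

lemma conv_proj_union:
  assumes u: "u \<in> Vd" and AB: "A \<subseteq> modes" "B \<subseteq> modes" "A \<inter> B = {}"
  shows "ip (conv Lx Ly h u u) (proj (A \<union> B) u) = ip (conv Lx Ly h u u) (proj A u) + ip (conv Lx Ly h u u) (proj B u)"
proof -
  note uV = Vd_D(1)[OF u] and uL = Vd_D(3)[OF u]
  have un: "A \<union> B \<subseteq> modes" using AB by blast
  note I = conv_V_bound(1)[OF uV uV Vd_proj(1)[OF u AB(1)]] conv_V_bound(1)[OF uV uV Vd_proj(1)[OF u AB(2)]] conv_V_bound(1)[OF uV uV Vd_proj(1)[OF u un]]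
  have "ip (conv Lx Ly h u u) (proj (A \<union> B) u) = (LINT x|M. conv Lx Ly h u u x \<bullet> proj A u x + conv Lx Ly h u u x \<bullet> proj B u x)"
    unfolding l2inner_def
  proof (rule integral_cong_AE)
    show "AE x in M. conv Lx Ly h u u x \<bullet> proj (A \<union> B) u x = conv Lx Ly h u u x \<bullet> proj A u x + conv Lx Ly h u u x \<bullet> proj B u x"
      using proj_union[OF uL AB] by eventually_elim (simp add: inner_add_right)
  qed (use I in \<open>auto intro!: borel_measurable_add\<close>)
  then show ?thesis unfolding l2inner_def using I by simp
qed

section \<open>The shear term\<close>

text \<open>The map \<open>(u, v, w) \<mapsto> (w, 0, 0)\<close> of the term \<open>w U' e\<^sub>x\<close>; its adjoint follows.\<close>

definition lift_shear :: "point \<Rightarrow> point" where "lift_shear y = (y $ 3) *\<^sub>R axis 1 1"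
definition lift_shear' :: "point \<Rightarrow> point" where "lift_shear' y = (y $ 1) *\<^sub>R axis 3 1"

lemma lift_shear_adjoint: "lift_shear y \<bullet> z = y \<bullet> lift_shear' z"
  by (simp add: lift_shear_def lift_shear'_def inner_axis inner_axis' mult.commute)

lemma lift_shear_bounded_linear: "bounded_linear lift_shear" "bounded_linear lift_shear'"
  unfolding lift_shear_def lift_shear'_def
  by (intro bounded_linear_scaleR_const bounded_linear_vec_nth)+

lemma norm_lift_shear: "norm (lift_shear y) \<le> norm y"
  using component_le_norm_cart[of y 3] by (simp add: lift_shear_def norm_axis_1)

lemma lift_shear_diff: "lift_shear (a - b) = lift_shear a - lift_shear b"
  by (rule linear_simps[OF lift_shear_bounded_linear(1)])

lemma L2_lift_shear: assumes "u \<in> LL" shows "(\<lambda>x. lift_shear (u x)) \<in> LL"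
proof (rule L2_bounded_by[OF _ L2D(2)[OF assms]])
  show "(\<lambda>x. lift_shear (u x)) \<in> borel_measurable M"
    using L2D(1)[OF assms] unfolding lift_shear_def by measurable
  show "AE x in M. (norm (lift_shear (u x)))\<^sup>2 \<le> (norm (u x))\<^sup>2"
    by (intro AE_I2 power_mono norm_lift_shear) simp
qed

lemma nrm_lift_shear: assumes u: "u \<in> LL" shows "nrm (\<lambda>x. lift_shear (u x)) \<le> nrm u"
proof (rule power2_le_imp_le)
  show "(nrm (\<lambda>x. lift_shear (u x)))\<^sup>2 \<le> (nrm u)\<^sup>2"
    unfolding nrm_sq ip_self by (intro integral_mono L2D L2_lift_shear u power_mono norm_lift_shear) simp
qed simp

text \<open>Sets of modes that are determined by the horizontal frequencies up to sign. Multiplication by \<open>\<rho>(z)\<close>, \<open>\<partial>\<^sub>x\<close> and \<open>lift_shear\<close> preserve the corresponding subspaces and their complements.\<close>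

definition saturated :: "mode set \<Rightarrow> bool" where
  "saturated S \<longleftrightarrow> S \<subseteq> modes \<and> (\<forall>m\<in>S. \<forall>n\<in>modes - S. (al n)\<^sup>2 \<noteq> (al m)\<^sup>2 \<or> (be n)\<^sup>2 \<noteq> (be m)\<^sup>2)"

lemma ip_proj_complement:
  assumes u: "u \<in> LL" and S: "saturated S" and m: "m \<in> S" and G: "trig (al m) (be m) (ga m) G" and \<rho>: "weight \<rho>"
  shows "ip (proj (modes - S) u) (\<lambda>x. \<rho> (x $ 3) *\<^sub>R G x) = 0"
proof -
  have S': "modes - S \<subseteq> modes" by blast
  have v: "(\<lambda>x. \<rho> (x $ 3) *\<^sub>R G x) \<in> LL" by (rule L2_weight[OF \<rho> trig_L2[OF G]])
  have "ip (comb (coef u) (trunc_set (modes - S) k)) (\<lambda>x. \<rho> (x $ 3) *\<^sub>R G x) = 0" for k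
  proof -
    have "ip (\<lambda>x. \<rho> (x $ 3) *\<^sub>R G x) (w n) = 0" if n: "n \<in> trunc_set (modes - S) k" for n
    proof -
      have nm: "n \<in> modes - S" using n trunc_set(2) by blast
      have "(al m)\<^sup>2 \<noteq> (al n)\<^sup>2 \<or> (be m)\<^sup>2 \<noteq> (be n)\<^sup>2" using S m nm unfolding saturated_def by metis
      from trig_orthogonal[OF G al_period be_period W_trig al_period be_period this \<rho>] nm
      show ?thesis using ip_w_W[of n] by simp
    qed
    then show ?thesis unfolding ip_comb(2)[OF trunc_modes[OF S'] v] by (intro sum.neutral ballI) simp
  qed
  then show ?thesis using ip_proj_seq[OF u S' v] by (simp add: LIMSEQ_const_iff)
qed

lemma ip_proj_saturated:
  assumes u: "u \<in> Hd" and S: "saturated S" and m: "m \<in> S" and G: "trig (al m) (be m) (ga m) G" and \<rho>: "weight \<rho>"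
  shows "ip u (\<lambda>x. \<rho> (x $ 3) *\<^sub>R G x) = ip (proj S u) (\<lambda>x. \<rho> (x $ 3) *\<^sub>R G x)"
proof -
  have S1: "S \<subseteq> modes" "modes - S \<subseteq> modes" using S unfolding saturated_def by auto
  have uL: "u \<in> LL" using Hd_L2[OF u] .
  have v: "(\<lambda>x. \<rho> (x $ 3) *\<^sub>R G x) \<in> LL" by (rule L2_weight[OF \<rho> trig_L2[OF G]])
  have "ip (\<lambda>x. u x - proj S u x) (\<lambda>x. \<rho> (x $ 3) *\<^sub>R G x) = ip (proj (modes - S) u) (\<lambda>x. \<rho> (x $ 3) *\<^sub>R G x)"
    by (rule ip_cong_AE[OF proj_complement[OF u S1(1)]]) (intro AE_I2 refl L2D L2_diff uL proj S1 v)+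
  then show ?thesis using ip_proj_complement[OF uL S m G \<rho>] ip_diff_left[OF uL proj(1)[OF uL S1(1)] v] by simp
qed

text \<open>The adjoint of \<open>\<rho> lift_shear\<close> maps a mode to a trigonometric field with the same horizontal frequencies, which does not see the part of \<open>u\<close> outside \<open>S\<close>.\<close>

lemma shear_production_saturated:
  assumes u: "u \<in> Hd" and S: "saturated S" and \<rho>: "weight \<rho>"
  shows "ip (\<lambda>x. \<rho> (x $ 3) *\<^sub>R lift_shear (u x)) (proj S u) = ip (\<lambda>x. \<rho> (x $ 3) *\<^sub>R lift_shear (proj S u x)) (proj S u)"
proof -
  have S1: "S \<subseteq> modes" using S unfolding saturated_def by auto
  have uL: "u \<in> LL" using Hd_L2[OF u] .
  note r = proj(1)[OF uL S1]
  let ?c = "\<lambda>n. comb (coef u) (trunc_set S n)"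
  have adj: "ip (\<lambda>x. \<rho> (x $ 3) *\<^sub>R lift_shear (f x)) (w m) = ip f (\<lambda>x. \<rho> (x $ 3) *\<^sub>R lift_shear' (W m x))" if "m \<in> modes" for f m
    unfolding ip_w_W[OF that] unfolding ip_weight_commute by (simp add: l2inner_def lift_shear_adjoint)
  note L = L2_weight[OF \<rho> L2_lift_shear]
  have lim: "(\<lambda>n. ip (\<lambda>x. \<rho> (x $ 3) *\<^sub>R lift_shear (f x)) (?c n)) \<longlonglongrightarrow> ip (\<lambda>x. \<rho> (x $ 3) *\<^sub>R lift_shear (f x)) (proj S u)" if "f \<in> LL" for f
    using ip_proj_seq[OF uL S1 L[OF that]] by (simp add: ip_commute)
  have eq: "ip (\<lambda>x. \<rho> (x $ 3) *\<^sub>R lift_shear (u x)) (?c n) = ip (\<lambda>x. \<rho> (x $ 3) *\<^sub>R lift_shear (proj S u x)) (?c n)" for n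
    unfolding ip_comb(1)[OF trunc_modes[OF S1] L[OF uL]] ip_comb(1)[OF trunc_modes[OF S1] L[OF r]]
  proof (rule sum.cong[OF refl])
    fix m assume "m \<in> trunc_set S n"
    then have m: "m \<in> S" "m \<in> modes" using trunc_set(2) S1 by blast+
    show "coef u m * coef (\<lambda>x. \<rho> (x $ 3) *\<^sub>R lift_shear (u x)) m = coef u m * coef (\<lambda>x. \<rho> (x $ 3) *\<^sub>R lift_shear (proj S u x)) m"
      unfolding adj[OF m(2)]
      using ip_proj_saturated[OF u S m(1) trig_linear[OF W_trig[OF m(2)] lift_shear_bounded_linear(2)] \<rho>] by simp
  qed
  show ?thesis using LIMSEQ_unique[OF lim[OF uL, unfolded eq] lim[OF r]] .
qed

text \<open>First \<open>u\<close> is replaced by its part \<open>r\<close> in \<open>S\<close>, as above, since \<open>\<rho> \<partial>\<^sub>x\<close> keeps horizontal frequencies. Then \<open>((\<rho> \<partial>\<^sub>x r, r)) = - ((\<rho> r, \<partial>\<^sub>x r))\<close>.\<close>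

lemma advection_saturated:
  assumes u: "u \<in> Vd" and S: "saturated S" and \<rho>: "weight \<rho>"
  shows "ip (\<lambda>x. \<rho> (x $ 3) *\<^sub>R D 1 u x) (proj S u) = 0"
proof -
  have S1: "S \<subseteq> modes" using S unfolding saturated_def by auto
  have uL: "u \<in> LL" and uH: "u \<in> Hd" and uV: "u \<in> Vs" using Vd_D u by auto
  let ?r = "proj S u" and ?c = "\<lambda>n. comb (coef u) (trunc_set S n)"
  have rV: "?r \<in> Vs" by (rule Vd_proj(1)[OF u S1])
  note L = L2_weight[OF \<rho> V_D(3)] L2_weight[OF \<rho> V_D(2)]
  have ibp: "ip (\<lambda>x. \<rho> (x $ 3) *\<^sub>R D 1 v x) (w m) = - ip v (\<lambda>x. \<rho> (x $ 3) *\<^sub>R pd 1 (W m) x)" if v: "v \<in> Vs" and m: "m \<in> modes" for v m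
  proof -
    have "ip (\<lambda>x. \<rho> (x $ 3) *\<^sub>R D 1 v x) (W m) = - ip (\<lambda>x. \<rho> (x $ 3) *\<^sub>R v x) (pd 1 (W m))"
      using integration_by_parts_V[OF _ v trig_C1[OF W_trig[OF m]] W_periodic[OF m W_trig[OF m]] \<rho>, where i = 1] by simp
    then show ?thesis unfolding ip_w_W[OF m] by (simp only: ip_weight_commute[of _ v])
  qed
  have lim: "(\<lambda>n. ip (\<lambda>x. \<rho> (x $ 3) *\<^sub>R D 1 v x) (?c n)) \<longlonglongrightarrow> ip (\<lambda>x. \<rho> (x $ 3) *\<^sub>R D 1 v x) ?r" if "v \<in> Vs" for v
    using ip_proj_seq[OF uL S1 L(1)[OF that]] by (simp add: ip_commute)
  have eq: "ip (\<lambda>x. \<rho> (x $ 3) *\<^sub>R D 1 u x) (?c n) = ip (\<lambda>x. \<rho> (x $ 3) *\<^sub>R D 1 ?r x) (?c n)" for n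
    unfolding ip_comb(1)[OF trunc_modes[OF S1] L(1)[OF uV]] ip_comb(1)[OF trunc_modes[OF S1] L(1)[OF rV]]
  proof (rule sum.cong[OF refl])
    fix m assume "m \<in> trunc_set S n"
    then have m: "m \<in> S" "m \<in> modes" using trunc_set(2) S1 by blast+
    show "coef u m * coef (\<lambda>x. \<rho> (x $ 3) *\<^sub>R D 1 u x) m = coef u m * coef (\<lambda>x. \<rho> (x $ 3) *\<^sub>R D 1 ?r x) m"
      unfolding ibp[OF uV m(2)] ibp[OF rV m(2)] ip_proj_saturated[OF uH S m(1) trig_pd[OF W_trig[OF m(2)]] \<rho>] ..
  qed
  have eq1: "ip (\<lambda>x. \<rho> (x $ 3) *\<^sub>R D 1 u x) ?r = ip (\<lambda>x. \<rho> (x $ 3) *\<^sub>R D 1 ?r x) ?r"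
    using LIMSEQ_unique[OF lim[OF uV, unfolded eq] lim[OF rV]] .
  \<comment> \<open>Integrating by parts once more, the quadratic expression equals its negative.\<close>
  have eq2: "ip (\<lambda>x. \<rho> (x $ 3) *\<^sub>R D 1 ?r x) (?c n) = - ip (\<lambda>x. \<rho> (x $ 3) *\<^sub>R ?r x) (D 1 (?c n))" for n
  proof -
    have "ip (\<lambda>x. \<rho> (x $ 3) *\<^sub>R ?r x) (D 1 (?c n)) = ip (\<lambda>x. \<rho> (x $ 3) *\<^sub>R ?r x) (\<lambda>x. \<Sum>m\<in>trunc_set S n. coef u m *\<^sub>R D 1 (w m) x)"
      by (rule ip_cong_AE[OF _ wd_comb[OF trunc_modes[OF S1]]])
         (intro AE_I2 refl L2D(1) L(2)[OF rV] V_D(3) comb_facts(1) trunc_modes S1 L2_sum L2_scale w_facts(2) subsetD[OF trunc_modes(2)[OF S1]])+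
    also have "\<dots> = (\<Sum>m\<in>trunc_set S n. coef u m * ip (\<lambda>x. \<rho> (x $ 3) *\<^sub>R ?r x) (D 1 (w m)))"
      using L(2)[OF rV]
      by (subst ip_sum_right) (auto simp del: split_paired_All intro!: L2_scale V_D(3) w_facts(2) subsetD[OF trunc_modes(2)[OF S1]])
    also have "\<dots> = (\<Sum>m\<in>trunc_set S n. coef u m * - coef (\<lambda>x. \<rho> (x $ 3) *\<^sub>R D 1 ?r x) m)"
    proof (rule sum.cong[OF refl])
      fix m assume "m \<in> trunc_set S n"
      then have m: "m \<in> modes" using trunc_set(2) S1 by blast
      have "ip (\<lambda>x. \<rho> (x $ 3) *\<^sub>R ?r x) (D 1 (w m)) = ip (\<lambda>x. \<rho> (x $ 3) *\<^sub>R ?r x) (pd 1 (W m))"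
        by (rule ip_cong_AE[OF _ wd_w[OF m]]) (intro AE_I2 refl L2D L(2)[OF rV] V_D(3) w_facts(2) m trig_L2[OF trig_pd[OF W_trig[OF m]]])+
      then show "coef u m * ip (\<lambda>x. \<rho> (x $ 3) *\<^sub>R ?r x) (D 1 (w m)) = coef u m * - coef (\<lambda>x. \<rho> (x $ 3) *\<^sub>R D 1 ?r x) m"
        by (simp only: ibp[OF rV m] ip_weight_commute[of _ ?r "pd 1 (W m)"] minus_minus)
    qed
    finally show ?thesis unfolding ip_comb(1)[OF trunc_modes[OF S1] L(1)[OF rV]] by (simp add: sum_negf)
  qed
  have "(\<lambda>n. - ip (D 1 (?c n)) (\<lambda>x. \<rho> (x $ 3) *\<^sub>R ?r x)) \<longlonglongrightarrow> - ip (D 1 ?r) (\<lambda>x. \<rho> (x $ 3) *\<^sub>R ?r x)"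
    by (intro tendsto_minus ip_tendsto_left V_D(3) comb_facts trunc_modes S1 rV L(2) Vd_proj(2) u)
  then have "(\<lambda>n. ip (\<lambda>x. \<rho> (x $ 3) *\<^sub>R D 1 ?r x) (?c n)) \<longlonglongrightarrow> - ip (\<lambda>x. \<rho> (x $ 3) *\<^sub>R D 1 ?r x) ?r"
  proof -
    have "ip (D 1 (?c n)) (\<lambda>x. \<rho> (x $ 3) *\<^sub>R ?r x) = ip (\<lambda>x. \<rho> (x $ 3) *\<^sub>R ?r x) (D 1 (?c n))" for n by (rule ip_commute)
    moreover have "ip (D 1 ?r) (\<lambda>x. \<rho> (x $ 3) *\<^sub>R ?r x) = ip (\<lambda>x. \<rho> (x $ 3) *\<^sub>R D 1 ?r x) ?r" by (rule ip_weight_commute[symmetric])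
    moreover assume "(\<lambda>n. - ip (D 1 (?c n)) (\<lambda>x. \<rho> (x $ 3) *\<^sub>R ?r x)) \<longlonglongrightarrow> - ip (D 1 ?r) (\<lambda>x. \<rho> (x $ 3) *\<^sub>R ?r x)"
    ultimately show ?thesis by (simp only: eq2)
  qed
  from LIMSEQ_unique[OF this lim[OF rV]] show ?thesis unfolding eq1 by simp
qed

text \<open>Coefficientwise: \<open>(\<alpha>\<^sup>2 + \<beta>\<^sup>2) ((r, w)) = 0\<close> for every mode, with a nonzero factor. It rules out the case that the Taylor wavenumber of a nonzero field vanishes.\<close>

lemma zero_horizontal_gradient:
  assumes u: "u \<in> Vd" and S: "S \<subseteq> modes" and zero: "nrm (D 1 (proj S u)) = 0" "nrm (D 2 (proj S u)) = 0"
  shows "nrm (proj S u) = 0"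
proof -
  let ?r = "proj S u"
  have uL: "u \<in> LL" using Vd_D u by auto
  have rV: "?r \<in> Vs" by (rule Vd_proj(1)[OF u S])
  have "coef u m = 0" if mS: "m \<in> S" for m
  proof -
    have m: "m \<in> modes" using S mS by blast
    note t = W_trig[OF m]
    have key: "ip ?r (pd i (pd i (W m))) = 0" if "i = 1 \<or> i = 2" for i
    proof -
      have i: "i \<noteq> 3" "nrm (D i ?r) = 0" using that zero by auto
      have "ip (D i ?r) (pd i (W m)) = - ip ?r (pd i (pd i (W m)))"
        using integration_by_parts_V[OF i(1) rV trig_C1[OF trig_pd[OF t]] W_periodic[OF m trig_pd[OF t] i(1)] weight_one, of i] by simp
      moreover have "\<bar>ip (D i ?r) (pd i (W m))\<bar> \<le> nrm (D i ?r) * nrm (pd i (W m))"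
        by (intro Cauchy_Schwarz_ip V_D(3) rV trig_L2[OF trig_pd[OF t]])
      ultimately show ?thesis using i(2) by simp
    qed
    have "(al m)\<^sup>2 * ip ?r (W m) = 0" "(be m)\<^sup>2 * ip ?r (W m) = 0"
      using key[of 1] key[of 2] unfolding trig_pd_pd[OF t, THEN conjunct1] trig_pd_pd[OF t, THEN conjunct2] ip_scale_right by simp_all
    then have "((al m)\<^sup>2 + (be m)\<^sup>2) * ip ?r (W m) = 0" unfolding distrib_right by linarith
    moreover have "0 < (al m)\<^sup>2 + (be m)\<^sup>2"
      using zero_less_power[OF less_le_trans[OF kbar1_pos kbar_ge[OF m]], of 2] unfolding kbar_sq .
    ultimately have "ip ?r (W m) = 0" by (metis less_irrefl mult_eq_0_iff)
    then show ?thesis using coef_proj[OF uL S m] mS ip_w_W[OF m] by simp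
  qed
  then have "((\<lambda>m. (coef u m)\<^sup>2) has_sum 0) S" by (intro has_sum_0) simp
  from has_sum_unique[OF Parseval_proj[OF uL S] this] show ?thesis by simp
qed

end

context cell
begin

text \<open>Limits in the sense of \<open>L\<^sup>2\<close> only determine the integrand almost everywhere; the measure is complete.\<close>

lemma AE_limit_measurable:
  fixes f :: "nat \<Rightarrow> point \<Rightarrow> real"
  assumes f: "\<And>n. f n \<in> borel_measurable M" and lim: "AE x in M. (\<lambda>n. f n x) \<longlonglongrightarrow> g x"
  shows "g \<in> borel_measurable M"
proof -
  note [measurable] = f
  define g' where "g' x = lim (\<lambda>n. f n x)" for x
  have g'[measurable]: "g' \<in> borel_measurable M" unfolding g'_def by measurable
  have "AE x in M. g' x = g x" using lim by eventually_elim (simp add: g'_def limI)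
  then obtain N0 where N0: "{x \<in> space M. \<not> g' x = g x} \<subseteq> N0" "N0 \<in> null_sets M"
    by (auto elim!: AE_E simp: null_sets_def)
  have "N0 \<in> null_sets lebesgue" using N0(2) by (simp add: null_sets_restrict_space)
  show ?thesis
  proof (rule measurableI)
    fix A :: "real set" assume A: "A \<in> sets borel"
    have eq: "g -` A \<inter> space M = (g' -` A \<inter> space M - N0) \<union> (g -` A \<inter> space M \<inter> N0)" using N0(1) by auto
    have "g' -` A \<inter> space M - N0 \<in> sets M" using measurable_sets[OF g' A] N0(2) by auto
    moreover have "g -` A \<inter> space M \<inter> N0 \<in> sets M"
    proof -
      have "g -` A \<inter> space M \<inter> N0 \<in> null_sets lebesgue"
        by (rule completion.complete2[OF _ \<open>N0 \<in> null_sets lebesgue\<close>]) auto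
      then show ?thesis by (auto simp: sets_restrict_space null_sets_def intro!: image_eqI[of _ _ "g -` A \<inter> space M \<inter> N0"])
    qed
    ultimately show "g -` A \<inter> space M \<in> sets M" by (subst eq) (rule sets.Un)
  qed simp
qed

section \<open>Borel functions on the phase space\<close>

abbreviation "NN \<equiv> borel_Hdot Lx Ly h"

lemma space_NN: "space NN = Hd"
  unfolding borel_Hdot_def by (intro space_measure_of) auto

definition tends :: "(nat \<Rightarrow> field) \<Rightarrow> field \<Rightarrow> bool" where
  "tends f u \<longleftrightarrow> (\<forall>n. f n \<in> Hd) \<and> u \<in> Hd \<and> (\<lambda>n. nrm (\<lambda>x. f n x - u x)) \<longlonglongrightarrow> 0"

lemma tends_D: "tends f u \<Longrightarrow> f n \<in> Hd" "tends f u \<Longrightarrow> u \<in> Hd" "tends f u \<Longrightarrow> f n \<in> LL" "tends f u \<Longrightarrow> u \<in> LL"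
  "tends f u \<Longrightarrow> (\<lambda>n. nrm (\<lambda>x. f n x - u x)) \<longlonglongrightarrow> 0"
  using Hd_L2 by (auto simp: tends_def)

text \<open>The topology comes from a seminorm, so sequences suffice.\<close>

lemma sequentially_closed_sets:
  assumes C: "C \<subseteq> Hd" and closed: "\<And>f u. tends f u \<Longrightarrow> (\<And>n. f n \<in> C) \<Longrightarrow> u \<in> C"
  shows "C \<in> sets NN"
proof -
  let ?G = "{G. G \<subseteq> Hd \<and> (\<forall>u\<in>G. \<exists>r>0. \<forall>v\<in>Hd. nrm (\<lambda>x. v x - u x) < r \<longrightarrow> v \<in> G)}"
  have "Hd - C \<in> ?G"
  proof (intro CollectI conjI ballI)
    fix u assume u: "u \<in> Hd - C"
    show "\<exists>r>0. \<forall>v\<in>Hd. nrm (\<lambda>x. v x - u x) < r \<longrightarrow> v \<in> Hd - C"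
    proof (rule ccontr)
      assume *: "\<not> (\<exists>r>0. \<forall>v\<in>Hd. nrm (\<lambda>x. v x - u x) < r \<longrightarrow> v \<in> Hd - C)"
      have "\<forall>n. \<exists>v. v \<in> C \<and> nrm (\<lambda>x. v x - u x) < 1 / real (Suc n)"
      proof
        fix n
        have "0 < 1 / real (Suc n)" by simp
        then show "\<exists>v. v \<in> C \<and> nrm (\<lambda>x. v x - u x) < 1 / real (Suc n)" using * by blast
      qed
      from choice[OF this] obtain f where f: "\<And>n. f n \<in> C" "\<And>n. nrm (\<lambda>x. f n x - u x) < 1 / real (Suc n)" by blast
      have "(\<lambda>n. nrm (\<lambda>x. f n x - u x)) \<longlonglongrightarrow> 0"
      proof (rule Lim_null_comparison)
        show "\<forall>\<^sub>F n in sequentially. norm (nrm (\<lambda>x. f n x - u x)) \<le> 1 / real (Suc n)"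
          using less_imp_le[OF f(2)] by simp
        show "(\<lambda>n. 1 / real (Suc n)) \<longlonglongrightarrow> 0" using LIMSEQ_Suc[OF lim_1_over_n] by simp
      qed
      then have "tends f u" using f(1) C u unfolding tends_def by blast
      then show False using closed f(1) u by blast
    qed
  qed auto
  then have "Hd - C \<in> sets NN" unfolding borel_Hdot_def by (subst sets_measure_of) auto
  then have "space NN - (Hd - C) \<in> sets NN" by (rule sets.compl_sets)
  moreover have "space NN - (Hd - C) = C" using C by (auto simp: space_NN)
  ultimately show ?thesis by simp
qed

lemma sequentially_continuous_measurable:
  fixes g :: "field \<Rightarrow> real"
  assumes "\<And>f u. tends f u \<Longrightarrow> (\<lambda>n. g (f n)) \<longlonglongrightarrow> g u"
  shows "g \<in> borel_measurable NN"
proof (rule borel_measurableI_le)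
  fix c
  show "{u \<in> space NN. g u \<le> c} \<in> sets NN"
  proof (rule sequentially_closed_sets)
    fix f u assume t: "tends f u" and le: "\<And>n. f n \<in> {u \<in> space NN. g u \<le> c}"
    have "g u \<le> c" by (rule LIMSEQ_le_const2[OF assms[OF t]]) (use le in blast)
    then show "u \<in> {u \<in> space NN. g u \<le> c}" using tends_D(2)[OF t] by (simp add: space_NN)
  qed (simp add: space_NN)
qed

text \<open>Sequential continuity from the phase space to \<open>L\<^sup>2\<close>, in terms of representatives.\<close>

definition L2cont :: "(field \<Rightarrow> field) \<Rightarrow> bool" where
  "L2cont \<psi> \<longleftrightarrow> (\<forall>u\<in>Hd. \<psi> u \<in> LL) \<and> (\<forall>f u. tends f u \<longrightarrow> (\<lambda>n. nrm (\<lambda>x. \<psi> (f n) x - \<psi> u x)) \<longlonglongrightarrow> 0)"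

lemma L2contD: "L2cont \<psi> \<Longrightarrow> u \<in> Hd \<Longrightarrow> \<psi> u \<in> LL"
  "L2cont \<psi> \<Longrightarrow> tends f u \<Longrightarrow> (\<lambda>n. nrm (\<lambda>x. \<psi> (f n) x - \<psi> u x)) \<longlonglongrightarrow> 0"
  by (auto simp: L2cont_def)

lemma L2cont_id: "L2cont (\<lambda>u. u)"
  by (auto simp: L2cont_def Hd_L2 tends_def)

lemma L2cont_zero: "L2cont (\<lambda>u x. 0)"
  by (auto simp: L2cont_def l2norm_def l2inner_def)

lemma L2cont_add: assumes "L2cont a" "L2cont b" shows "L2cont (\<lambda>u x. a u x + b u x)"
  unfolding L2cont_def
proof (intro conjI ballI allI impI)
  show "(\<lambda>x. a u x + b u x) \<in> LL" if "u \<in> Hd" for u using L2contD(1)[OF assms(1) that] L2contD(1)[OF assms(2) that] by (rule L2_add)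
  fix f u assume t: "tends f u"
  show "(\<lambda>n. nrm (\<lambda>x. (a (f n) x + b (f n) x) - (a u x + b u x))) \<longlonglongrightarrow> 0"
  proof (rule Lim_null_comparison)
    have e: "(\<lambda>x. (a (f n) x + b (f n) x) - (a u x + b u x)) = (\<lambda>x. (a (f n) x - a u x) + (b (f n) x - b u x))" for n by auto
    have "nrm (\<lambda>x. (a (f n) x + b (f n) x) - (a u x + b u x)) \<le> nrm (\<lambda>x. a (f n) x - a u x) + nrm (\<lambda>x. b (f n) x - b u x)" for n
      unfolding e by (intro nrm_triangle L2_diff L2contD(1)[OF assms(1)] L2contD(1)[OF assms(2)] tends_D(1,2)[OF t])
    then show "\<forall>\<^sub>F n in sequentially. norm (nrm (\<lambda>x. (a (f n) x + b (f n) x) - (a u x + b u x))) \<le> nrm (\<lambda>x. a (f n) x - a u x) + nrm (\<lambda>x. b (f n) x - b u x)"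
      by simp
    show "(\<lambda>n. nrm (\<lambda>x. a (f n) x - a u x) + nrm (\<lambda>x. b (f n) x - b u x)) \<longlonglongrightarrow> 0"
      using tendsto_add[OF L2contD(2)[OF assms(1) t] L2contD(2)[OF assms(2) t]] by simp
  qed
qed

lemma L2cont_sum: "finite I \<Longrightarrow> (\<And>i. i \<in> I \<Longrightarrow> L2cont (a i)) \<Longrightarrow> L2cont (\<lambda>u x. \<Sum>i\<in>I. a i u x)"
  by (induction I rule: finite_induct) (auto simp: L2cont_zero L2cont_add)

lemma L2cont_lipschitz:
  assumes "\<And>u. u \<in> Hd \<Longrightarrow> \<psi> u \<in> LL" and le: "\<And>u v. u \<in> Hd \<Longrightarrow> v \<in> Hd \<Longrightarrow> nrm (\<lambda>x. \<psi> u x - \<psi> v x) \<le> C * nrm (\<lambda>x. u x - v x)"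
  shows "L2cont \<psi>"
  unfolding L2cont_def
proof (intro conjI ballI allI impI assms(1))
  fix f u assume t: "tends f u"
  show "(\<lambda>n. nrm (\<lambda>x. \<psi> (f n) x - \<psi> u x)) \<longlonglongrightarrow> 0"
  proof (rule Lim_null_comparison)
    show "\<forall>\<^sub>F n in sequentially. norm (nrm (\<lambda>x. \<psi> (f n) x - \<psi> u x)) \<le> C * nrm (\<lambda>x. f n x - u x)"
      using le[OF tends_D(1,2)[OF t]] by simp
    show "(\<lambda>n. C * nrm (\<lambda>x. f n x - u x)) \<longlonglongrightarrow> 0" using tendsto_mult_left[OF tends_D(5)[OF t], of C] by simp
  qed
qed

lemma L2cont_weight:
  assumes \<rho>: "weight \<rho>" and a: "L2cont a" shows "L2cont (\<lambda>u x. \<rho> (x $ 3) *\<^sub>R a u x)"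
  unfolding L2cont_def
proof (intro conjI ballI allI impI)
  show "(\<lambda>x. \<rho> (x $ 3) *\<^sub>R a u x) \<in> LL" if "u \<in> Hd" for u by (rule L2_weight[OF \<rho> L2contD(1)[OF a that]])
  fix f u assume t: "tends f u"
  show "(\<lambda>n. nrm (\<lambda>x. \<rho> (x $ 3) *\<^sub>R a (f n) x - \<rho> (x $ 3) *\<^sub>R a u x)) \<longlonglongrightarrow> 0"
    by (intro nrm_weight_tendsto[OF \<rho>] L2contD[OF a] tends_D(1,2)[OF t] t)
qed

lemma L2cont_ip_measurable:
  assumes "L2cont a" "L2cont b" shows "(\<lambda>u. ip (a u) (b u)) \<in> borel_measurable NN"
proof (rule sequentially_continuous_measurable)
  fix f u assume t: "tends f u"
  show "(\<lambda>n. ip (a (f n)) (b (f n))) \<longlonglongrightarrow> ip (a u) (b u)"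
    by (intro ip_tendsto L2contD(1)[OF assms(1)] L2contD(1)[OF assms(2)] L2contD(2)[OF assms(1) t] L2contD(2)[OF assms(2) t] tends_D(1,2)[OF t])
qed

text \<open>Lower semicontinuity of the distance between the weak derivative and \<open>g\<close>, including the existence of the derivative at the limit.\<close>

lemma differentiable_sublevel_closed:
  assumes \<psi>: "L2cont \<psi>" and g: "L2cont g" and C: "0 \<le> C"
  shows "{u \<in> Hd. differentiable_dir i (\<psi> u) \<and> nrm (\<lambda>x. D i (\<psi> u) x - g u x) \<le> C} \<in> sets NN" (is "?S \<in> _")
proof (rule sequentially_closed_sets)
  fix f u assume t: "tends f u" and S: "\<And>n. f n \<in> ?S"
  note uH = tends_D(2)[OF t]
  note L = L2contD(1)[OF \<psi>] L2contD(1)[OF g]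
  have approx: "\<exists>k. k \<in> LL \<and> wpd i (\<psi> u) k \<and> nrm (\<lambda>x. k x - g u x) \<le> C + e" if e: "e > 0" for e
  proof -
    have "\<exists>v k. v \<in> LL \<and> k \<in> LL \<and> wpd i v k \<and> nrm (\<lambda>x. v x - \<psi> u x) \<le> d \<and> nrm (\<lambda>x. k x - g u x) \<le> C + e" if d: "d > 0" for d
    proof -
      have "eventually (\<lambda>n. nrm (\<lambda>x. \<psi> (f n) x - \<psi> u x) < d \<and> nrm (\<lambda>x. g (f n) x - g u x) < e) sequentially"
        using order_tendstoD(2)[OF L2contD(2)[OF \<psi> t] d] order_tendstoD(2)[OF L2contD(2)[OF g t] e] by eventually_elim simp
      then obtain n where n: "nrm (\<lambda>x. \<psi> (f n) x - \<psi> u x) < d" "nrm (\<lambda>x. g (f n) x - g u x) < e"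
        unfolding eventually_sequentially by blast
      have dd: "differentiable_dir i (\<psi> (f n))" and le: "nrm (\<lambda>x. D i (\<psi> (f n)) x - g (f n) x) \<le> C" using S[of n] by auto
      have "nrm (\<lambda>x. D i (\<psi> (f n)) x - g u x) \<le> C + e"
        using nrm_triangle_diff[OF differentiable_dir_wd(1)[OF dd] L(2)[OF tends_D(1)[OF t]] L(2)[OF uH]] le n(2)
        by (meson add_mono less_imp_le order_trans)
      then show ?thesis
        using n(1) L(1)[OF tends_D(1)[OF t]] differentiable_dir_wd[OF dd] by (meson less_imp_le)
    qed
    moreover have "0 \<le> C + e" using C e by simp
    ultimately obtain k where "k \<in> LL" "wpd i (\<psi> u) k" "nrm (\<lambda>x. k x - g u x) \<le> C + e"
      using weak_pd_lsc[OF L[OF uH], where C = "C + e" and i = i] by blast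
    then show ?thesis by blast
  qed
  obtain k where k: "k \<in> LL" "wpd i (\<psi> u) k" using approx[of 1] by auto
  then have dd: "differentiable_dir i (\<psi> u)" unfolding differentiable_dir_def by blast
  have "nrm (\<lambda>x. D i (\<psi> u) x - g u x) \<le> C + e" if e: "e > 0" for e
  proof -
    obtain k where k: "k \<in> LL" "wpd i (\<psi> u) k" "nrm (\<lambda>x. k x - g u x) \<le> C + e" using approx[OF e] by blast
    have "nrm (\<lambda>x. D i (\<psi> u) x - g u x) = nrm (\<lambda>x. k x - g u x)"
    proof (rule nrm_cong_AE)
      show "AE x in M. D i (\<psi> u) x - g u x = k x - g u x" using wd_eq_AE[OF k(1,2)] by eventually_elim simp
    qed (intro L2D L2_diff differentiable_dir_wd(1) dd L uH k)+
    then show ?thesis using k(3) by simp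
  qed
  then have "nrm (\<lambda>x. D i (\<psi> u) x - g u x) \<le> C" by (rule field_le_epsilon)
  then show "u \<in> ?S" using uH dd by simp
qed auto

lemma differentiable_sets:
  assumes \<psi>: "L2cont \<psi>" shows "{u \<in> Hd. differentiable_dir i (\<psi> u)} \<in> sets NN"
proof -
  have "{u \<in> Hd. differentiable_dir i (\<psi> u)} = (\<Union>n::nat. {u \<in> Hd. differentiable_dir i (\<psi> u) \<and> nrm (\<lambda>x. D i (\<psi> u) x - 0) \<le> real n})"
    using real_arch_simple by auto
  also have "\<dots> \<in> sets NN"
    using differentiable_sublevel_closed[OF \<psi> L2cont_zero] by (intro sets.countable_UN) auto
  finally show ?thesis .
qed

text \<open>Sublevel sets for nonnegative levels suffice, because the function vanishes off \<open>E\<close>.\<close>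

lemma borel_measurable_on_set:
  fixes g :: "'b \<Rightarrow> real"
  assumes E: "E \<in> sets N" and lev: "\<And>c. 0 \<le> c \<Longrightarrow> {u \<in> E. g u \<le> c} \<in> sets N" and pos: "\<And>u. u \<in> E \<Longrightarrow> 0 \<le> g u"
  shows "(\<lambda>u. if u \<in> E then g u else 0) \<in> borel_measurable N"
proof (rule borel_measurableI_le)
  fix c
  show "{u \<in> space N. (if u \<in> E then g u else 0) \<le> c} \<in> sets N"
  proof (cases "0 \<le> c")
    case True
    then have "{u \<in> space N. (if u \<in> E then g u else 0) \<le> c} = {u \<in> E. g u \<le> c} \<union> (space N - E)"
      using sets.sets_into_space[OF E] by auto
    then show ?thesis using lev[OF True] E by auto
  next
    case False
    have "\<not> (if u \<in> E then g u else 0) \<le> c" for u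
    proof
      assume "(if u \<in> E then g u else 0) \<le> c"
      moreover have "0 \<le> (if u \<in> E then g u else 0)" using pos by simp
      ultimately show False using False by linarith
    qed
    then have "{u \<in> space N. (if u \<in> E then g u else 0) \<le> c} = {}" by blast
    then show ?thesis by (simp only: sets.empty_sets)
  qed
qed

lemma wd_distance_measurable:
  assumes \<psi>: "L2cont \<psi>" and g: "L2cont g"
  shows "(\<lambda>u. if u \<in> {u \<in> Hd. differentiable_dir i (\<psi> u)} then nrm (\<lambda>x. D i (\<psi> u) x - g u x) else 0) \<in> borel_measurable NN"
proof (rule borel_measurable_on_set[OF differentiable_sets[OF \<psi>]])
  fix c :: real assume "0 \<le> c"
  from differentiable_sublevel_closed[OF \<psi> g this, of i]
  show "{u \<in> {u \<in> Hd. differentiable_dir i (\<psi> u)}. nrm (\<lambda>x. D i (\<psi> u) x - g u x) \<le> c} \<in> sets NN" by (simp add: conj_assoc)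
qed simp

text \<open>Polarisation: \<open>2 ((a, g)) = \<parallel>a\<parallel>\<^sup>2 + \<parallel>g\<parallel>\<^sup>2 - \<parallel>a - g\<parallel>\<^sup>2\<close>, and each term on the right is a Borel function.\<close>

lemma wd_ip_measurable:
  assumes \<psi>: "L2cont \<psi>" and g: "L2cont g"
  shows "(\<lambda>u. if u \<in> {u \<in> Hd. differentiable_dir i (\<psi> u)} then ip (D i (\<psi> u)) (g u) else 0) \<in> borel_measurable NN" (is "?F \<in> _")
proof -
  let ?E = "{u \<in> Hd. differentiable_dir i (\<psi> u)}"
  let ?G = "\<lambda>u. 1/2 * ((if u \<in> ?E then nrm (\<lambda>x. D i (\<psi> u) x - 0) else 0)\<^sup>2 + (if u \<in> ?E then ip (g u) (g u) else 0)
      - (if u \<in> ?E then nrm (\<lambda>x. D i (\<psi> u) x - g u x) else 0)\<^sup>2)"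
  have [measurable]: "(\<lambda>u. ip (g u) (g u)) \<in> borel_measurable NN" by (rule L2cont_ip_measurable[OF g g])
  have [measurable]: "?E \<in> sets NN" by (rule differentiable_sets[OF \<psi>])
  have "?G \<in> borel_measurable NN"
    using wd_distance_measurable[OF \<psi> L2cont_zero, of i] wd_distance_measurable[OF \<psi> g, of i] by measurable
  moreover have "?F = ?G"
  proof
    fix u
    have "ip (D i (\<psi> u)) (g u) = 1/2 * ((nrm (D i (\<psi> u)))\<^sup>2 + ip (g u) (g u) - (nrm (\<lambda>x. D i (\<psi> u) x - g u x))\<^sup>2)" if "u \<in> ?E"
      using nrm_sq_diff[OF differentiable_dir_wd(1) L2contD(1)[OF g], of i "\<psi> u" u] that nrm_sq[of "g u"] by simp
    then show "?F u = ?G u" by simp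
  qed
  ultimately show ?thesis by simp
qed

text \<open>The value of \<open>wd i u\<close> when \<open>u\<close> has no weak derivative in direction \<open>i\<close>. It is the same field for all such \<open>u\<close> and \<open>i\<close>, possibly not measurable.\<close>

definition unspecified_field :: field where "unspecified_field = (SOME g. False)"

lemma wd_unspecified: assumes "\<not> differentiable_dir i u" shows "D i u = unspecified_field"
proof -
  have "(\<lambda>g. g \<in> LL \<and> wpd i u g) = (\<lambda>g. False)" using assms by (auto simp: differentiable_dir_def)
  then show ?thesis unfolding wd_def unspecified_field_def by simp
qed

lemma wd_sq_measurable:
  assumes \<psi>: "L2cont \<psi>"
  shows "(\<lambda>u. ip (D i (\<psi> u)) (D i (\<psi> u))) \<in> borel_measurable NN"
proof -
  let ?E = "{u \<in> Hd. differentiable_dir i (\<psi> u)}"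
  let ?G = "\<lambda>u. if u \<in> ?E then (if u \<in> ?E then nrm (\<lambda>x. D i (\<psi> u) x - 0) else 0)\<^sup>2 else ip unspecified_field unspecified_field"
  have [measurable]: "?E \<in> sets NN" by (rule differentiable_sets[OF \<psi>])
  have "?G \<in> borel_measurable NN"
    using wd_distance_measurable[OF \<psi> L2cont_zero, of i] by measurable
  moreover have "ip (D i (\<psi> u)) (D i (\<psi> u)) = ?G u" if "u \<in> space NN" for u
    using that wd_unspecified[of i "\<psi> u"] by (auto simp: space_NN nrm_sq)
  ultimately show ?thesis using measurable_cong[of NN "\<lambda>u. ip (D i (\<psi> u)) (D i (\<psi> u))" ?G borel] by blast
qed

text \<open>Nothing is known about \<open>p\<close>, so \<open>p \<cdot> s u\<close> may fail to be measurable or integrable. The conditions are nevertheless closed under limits, by Fatou's lemma along an almost everywhere convergent subsequence.\<close>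

lemma unspecified_part_closed:
  assumes s: "L2cont s"
  shows "{u \<in> Hd. (\<lambda>x. p x \<bullet> s u x) \<in> borel_measurable M \<and> (\<integral>\<^sup>+x. ennreal (\<sigma> * (p x \<bullet> s u x)) \<partial>M) \<le> ennreal c} \<in> sets NN" (is "?S \<in> _")
proof (rule sequentially_closed_sets)
  fix f u assume t: "tends f u" and S: "\<And>n. f n \<in> ?S"
  obtain r where r: "strict_mono r" "AE x in M. (\<lambda>n. s (f (r n)) x) \<longlonglongrightarrow> s u x"
    using L2_limit_AE_subseq[OF L2contD(1)[OF s tends_D(1)[OF t]] L2contD(1)[OF s tends_D(2)[OF t]] L2contD(2)[OF s t]] by blast
  have m: "(\<lambda>x. p x \<bullet> s (f n) x) \<in> borel_measurable M" and le: "(\<integral>\<^sup>+x. ennreal (\<sigma> * (p x \<bullet> s (f n) x)) \<partial>M) \<le> ennreal c" for n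
    using S[of n] by auto
  have lim: "AE x in M. (\<lambda>n. p x \<bullet> s (f (r n)) x) \<longlonglongrightarrow> p x \<bullet> s u x"
    using r(2) by eventually_elim (intro tendsto_intros)
  have mu: "(\<lambda>x. p x \<bullet> s u x) \<in> borel_measurable M" by (rule AE_limit_measurable[OF m lim])
  have "(\<integral>\<^sup>+x. ennreal (\<sigma> * (p x \<bullet> s u x)) \<partial>M) = (\<integral>\<^sup>+x. liminf (\<lambda>n. ennreal (\<sigma> * (p x \<bullet> s (f (r n)) x))) \<partial>M)"
  proof (rule nn_integral_cong_AE, use lim in eventually_elim)
    fix x assume "(\<lambda>n. p x \<bullet> s (f (r n)) x) \<longlonglongrightarrow> p x \<bullet> s u x"
    then have "(\<lambda>n. ennreal (\<sigma> * (p x \<bullet> s (f (r n)) x))) \<longlonglongrightarrow> ennreal (\<sigma> * (p x \<bullet> s u x))"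
      by (intro tendsto_ennrealI tendsto_mult_left)
    from lim_imp_Liminf[OF _ this] show "ennreal (\<sigma> * (p x \<bullet> s u x)) = liminf (\<lambda>n. ennreal (\<sigma> * (p x \<bullet> s (f (r n)) x)))" by simp
  qed
  also have "\<dots> \<le> liminf (\<lambda>n. \<integral>\<^sup>+x. ennreal (\<sigma> * (p x \<bullet> s (f (r n)) x)) \<partial>M)"
  proof (rule nn_integral_liminf)
    show "(\<lambda>x. ennreal (\<sigma> * (p x \<bullet> s (f (r n)) x))) \<in> borel_measurable M" for n
      by (rule measurable_compose[OF m]) measurable
  qed
  also have "\<dots> \<le> liminf (\<lambda>n. ennreal c)" by (intro Liminf_mono always_eventually allI le)
  finally show "u \<in> ?S" using mu tends_D(2)[OF t] by (simp add: Liminf_const)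
qed auto

lemma unspecified_part_measurable:
  assumes s: "L2cont s"
  shows "{u \<in> Hd. integrable M (\<lambda>x. p x \<bullet> s u x)} \<in> sets NN"
    and "(\<lambda>u. LINT x|M. p x \<bullet> s u x) \<in> borel_measurable NN"
proof -
  let ?q = "\<lambda>u x. p x \<bullet> s u x"
  let ?C = "\<lambda>\<sigma> c. {u \<in> Hd. ?q u \<in> borel_measurable M \<and> (\<integral>\<^sup>+x. ennreal (\<sigma> * ?q u x) \<partial>M) \<le> ennreal c}"
  let ?E = "{u \<in> Hd. integrable M (?q u)}"
  have fin: "I < top \<longleftrightarrow> (\<exists>n::nat. I \<le> ennreal (real n))" for I :: ennreal
  proof (cases I rule: ennreal_cases)
    case (real r)
    then show ?thesis using real_arch_simple[of r] by (auto intro: ennreal_leI)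
  qed (auto simp: top_unique)
  have "?E = (\<Union>n::nat. ?C 1 (real n)) \<inter> (\<Union>n::nat. ?C (-1) (real n))"
    unfolding real_integrable_def using fin by (auto simp: top.not_eq_extremum)
  also have "\<dots> \<in> sets NN"
    by (intro sets.Int sets.countable_UN image_subsetI unspecified_part_closed[OF s])
  finally show E: "?E \<in> sets NN" .
  \<comment> \<open>Positive and negative part separately, each with closed sublevel sets.\<close>
  have part: "(\<lambda>u. if u \<in> ?E then enn2real (\<integral>\<^sup>+x. ennreal (\<sigma> * ?q u x) \<partial>M) else 0) \<in> borel_measurable NN" if \<sigma>: "\<sigma> = 1 \<or> \<sigma> = -1" for \<sigma>
  proof (rule borel_measurable_on_set[OF E])
    fix c :: real assume c: "0 \<le> c"
    have "enn2real (\<integral>\<^sup>+x. ennreal (\<sigma> * ?q u x) \<partial>M) \<le> c \<longleftrightarrow> (\<integral>\<^sup>+x. ennreal (\<sigma> * ?q u x) \<partial>M) \<le> ennreal c" if "u \<in> ?E" for u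
    proof -
      have "(\<integral>\<^sup>+x. ennreal (\<sigma> * ?q u x) \<partial>M) < top" using that \<sigma> unfolding real_integrable_def by (auto simp: top.not_eq_extremum)
      then show ?thesis using c by (cases "\<integral>\<^sup>+x. ennreal (\<sigma> * ?q u x) \<partial>M" rule: ennreal_cases) auto
    qed
    then have "{u \<in> ?E. enn2real (\<integral>\<^sup>+x. ennreal (\<sigma> * ?q u x) \<partial>M) \<le> c} = ?E \<inter> ?C \<sigma> c"
      by (auto dest: borel_measurable_integrable)
    then show "{u \<in> ?E. enn2real (\<integral>\<^sup>+x. ennreal (\<sigma> * ?q u x) \<partial>M) \<le> c} \<in> sets NN"
      using E unspecified_part_closed[OF s, of p \<sigma> c] by simp
  qed simp
  have eq: "(LINT x|M. ?q u x) = (if u \<in> ?E then enn2real (\<integral>\<^sup>+x. ennreal (1 * ?q u x) \<partial>M) else 0)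
      - (if u \<in> ?E then enn2real (\<integral>\<^sup>+x. ennreal (- 1 * ?q u x) \<partial>M) else 0)" if "u \<in> space NN" for u
  proof (cases "u \<in> ?E")
    case True
    then show ?thesis using real_lebesgue_integral_def[of M "?q u"] by simp
  next
    case False
    then have "\<not> integrable M (?q u)" using that by (simp add: space_NN)
    then have "(LINT x|M. ?q u x) = 0" by (rule not_integrable_integral_eq)
    then show ?thesis unfolding if_not_P[OF False] by simp
  qed
  have "(\<lambda>u. (if u \<in> ?E then enn2real (\<integral>\<^sup>+x. ennreal (1 * ?q u x) \<partial>M) else 0)
      - (if u \<in> ?E then enn2real (\<integral>\<^sup>+x. ennreal (- 1 * ?q u x) \<partial>M) else 0)) \<in> borel_measurable NN"
    by (intro borel_measurable_diff part) auto
  moreover have "(\<lambda>u. LINT x|M. ?q u x) \<in> borel_measurable NN \<longleftrightarrow>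
      (\<lambda>u. (if u \<in> ?E then enn2real (\<integral>\<^sup>+x. ennreal (1 * ?q u x) \<partial>M) else 0)
      - (if u \<in> ?E then enn2real (\<integral>\<^sup>+x. ennreal (- 1 * ?q u x) \<partial>M) else 0)) \<in> borel_measurable NN"
    by (rule measurable_cong) (rule eq)
  ultimately show "(\<lambda>u. LINT x|M. ?q u x) \<in> borel_measurable NN" by (rule iffD2[rotated])
qed

text \<open>Split the phase space by the set \<open>J\<close> of directions in which \<open>u\<close> is weakly differentiable. On each piece the integrand is an \<open>L\<^sup>2\<close> product plus the product of \<open>unspecified_field\<close> with a continuous field; if the latter is not integrable then neither is the sum, and the integral is \<open>0\<close>.\<close>

lemma pairing_measurable:
  assumes \<psi>: "\<And>i. L2cont (\<psi> i)" and ab: "L2cont a" "L2cont b"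
  shows "(\<lambda>u. LINT x|M. (\<Sum>i\<in>UNIV. D i u x \<bullet> \<psi> i u x) + a u x \<bullet> b u x) \<in> borel_measurable NN" (is "?f \<in> _")
proof -
  let ?E = "\<lambda>i. {u \<in> Hd. differentiable_dir i u}"
  have E: "?E i \<in> sets NN" for i by (rule differentiable_sets[OF L2cont_id])
  define EJ where "EJ J = {u \<in> Hd. {i. differentiable_dir i u} = J}" for J
  define s where "s J u x = (\<Sum>i\<in>-J. \<psi> i u x)" for J u x
  have s: "L2cont (s J)" for J unfolding s_def by (rule L2cont_sum[OF finite \<psi>])
  have EJ: "EJ J \<in> sets NN" for J
  proof -
    have B: "{u \<in> Hd. differentiable_dir i u \<longleftrightarrow> i \<in> J} \<in> sets NN" for i
    proof (cases "i \<in> J")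
      case False
      then have "{u \<in> Hd. differentiable_dir i u \<longleftrightarrow> i \<in> J} = space NN - ?E i" by (auto simp: space_NN)
      then show ?thesis using E by auto
    qed (use E in simp)
    have "EJ J = (\<Inter>i\<in>UNIV. {u \<in> Hd. differentiable_dir i u \<longleftrightarrow> i \<in> J})"
      by (auto simp: EJ_def)
    also have "\<dots> \<in> sets NN" using B by (intro sets.finite_INT) auto
    finally show ?thesis .
  qed
  define P where "P J u = (\<Sum>i\<in>J. if u \<in> ?E i then ip (D i u) (\<psi> i u) else 0) + ip (a u) (b u)" for J u
  have P: "P J \<in> borel_measurable NN" for J
    unfolding P_def by (intro borel_measurable_add borel_measurable_sum wd_ip_measurable[OF L2cont_id] \<psi> L2cont_ip_measurable ab)
  define Q where "Q J u = (if u \<in> {u \<in> Hd. integrable M (\<lambda>x. unspecified_field x \<bullet> s J u x)} then P J u + (LINT x|M. unspecified_field x \<bullet> s J u x) else 0)" for J u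
  have Q: "Q J \<in> borel_measurable NN" for J
    unfolding Q_def using unspecified_part_measurable[OF s, where p = unspecified_field] P by measurable
  have eq: "?f u = (\<Sum>J\<in>UNIV. indicator (EJ J) u * Q J u)" if u: "u \<in> space NN" for u
  proof -
    define J where "J = {i. differentiable_dir i u}"
    have uH: "u \<in> Hd" using u by (simp add: space_NN)
    have "(\<Sum>J\<in>UNIV. indicator (EJ J) u * Q J u) = (\<Sum>K\<in>UNIV. if K = J then Q J u else 0)"
      using uH by (intro sum.cong) (auto simp: EJ_def J_def indicator_def)
    also have "\<dots> = Q J u" by simp
    also have "\<dots> = ?f u"
    proof -
      let ?A = "\<lambda>x. (\<Sum>i\<in>J. D i u x \<bullet> \<psi> i u x) + a u x \<bullet> b u x"
      have "(\<Sum>i\<in>UNIV. D i u x \<bullet> \<psi> i u x) = (\<Sum>i\<in>J. D i u x \<bullet> \<psi> i u x) + (\<Sum>i\<in>-J. D i u x \<bullet> \<psi> i u x)" for x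
        using sum.union_disjoint[of J "-J" "\<lambda>i. D i u x \<bullet> \<psi> i u x"] by (simp add: Compl_partition)
      moreover have "(\<Sum>i\<in>-J. D i u x \<bullet> \<psi> i u x) = unspecified_field x \<bullet> s J u x" for x
        unfolding s_def inner_sum_right using wd_unspecified[of _ u] by (intro sum.cong) (auto simp: J_def)
      ultimately have split: "(\<Sum>i\<in>UNIV. D i u x \<bullet> \<psi> i u x) + a u x \<bullet> b u x = ?A x + unspecified_field x \<bullet> s J u x" for x by simp
      have Ii: "integrable M (\<lambda>x. D i u x \<bullet> \<psi> i u x)" if "i \<in> J" for i
        using that by (intro L2_inner_integrable differentiable_dir_wd(1) L2contD(1)[OF \<psi> uH]) (simp add: J_def)
      have Iab: "integrable M (\<lambda>x. a u x \<bullet> b u x)" by (intro L2_inner_integrable L2contD(1)[OF ab(1) uH] L2contD(1)[OF ab(2) uH])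
      have IA: "integrable M ?A" using Ii Iab by (intro Bochner_Integration.integrable_add Bochner_Integration.integrable_sum)
      have "(LINT x|M. ?A x) = (\<Sum>i\<in>J. ip (D i u) (\<psi> i u)) + ip (a u) (b u)"
        unfolding l2inner_def using Ii Iab by (subst Bochner_Integration.integral_add) (auto intro!: Bochner_Integration.integrable_sum Bochner_Integration.integral_sum)
      also have "\<dots> = P J u" unfolding P_def using uH by (auto simp: J_def intro!: sum.cong)
      finally have LA: "(LINT x|M. ?A x) = P J u" .
      show ?thesis
      proof (cases "integrable M (\<lambda>x. unspecified_field x \<bullet> s J u x)")
        case True
        then show ?thesis unfolding split Q_def using uH LA Bochner_Integration.integral_add[OF IA True] by simp
      next
        case False
        have "\<not> integrable M (\<lambda>x. ?A x + unspecified_field x \<bullet> s J u x)"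
        proof
          assume "integrable M (\<lambda>x. ?A x + unspecified_field x \<bullet> s J u x)"
          from Bochner_Integration.integrable_diff[OF this IA] show False using False by simp
        qed
        then have "(LINT x|M. ?A x + unspecified_field x \<bullet> s J u x) = 0" by (rule not_integrable_integral_eq)
        then show ?thesis unfolding split Q_def using False by simp
      qed
    qed
    finally show ?thesis ..
  qed
  have "(\<lambda>u. \<Sum>J\<in>UNIV. indicator (EJ J) u * Q J u) \<in> borel_measurable NN"
    using EJ Q by (intro borel_measurable_sum borel_measurable_times borel_measurable_indicator) auto
  moreover have "?f \<in> borel_measurable NN \<longleftrightarrow> (\<lambda>u. \<Sum>J\<in>UNIV. indicator (EJ J) u * Q J u) \<in> borel_measurable NN"
    by (rule measurable_cong) (rule eq)
  ultimately show ?thesis by (rule iffD2[rotated])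
qed

end

section \<open>The cutoff\<close>

text \<open>\<open>(1/2) t\<close> near \<open>0\<close>, but supported in \<open>t \<le> R\<^sup>2\<close>. Applied to \<open>t = |x|\<^sup>2\<close> its gradient is \<open>cutoff R t\<close> times \<open>x\<close>.\<close>

definition cutoff_energy :: "real \<Rightarrow> real \<Rightarrow> real" where
  "cutoff_energy R t = R\<^sup>2 / 2 * (t / R\<^sup>2) * (max 0 (1 - t / R\<^sup>2))\<^sup>2"

definition cutoff :: "real \<Rightarrow> real \<Rightarrow> real" where
  "cutoff R t = max 0 (1 - t / R\<^sup>2) * (max 0 (1 - t / R\<^sup>2) - 2 * (t / R\<^sup>2))"

lemma max_zero_sq_deriv: "((\<lambda>y::real. (max 0 y)\<^sup>2) has_real_derivative 2 * max 0 y) (at y)"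
proof -
  consider "y > 0" | "y < 0" | "y = 0" by linarith
  then show ?thesis
  proof cases
    case 1
    have "((\<lambda>y. y\<^sup>2) has_real_derivative 2 * max 0 y) (at y)" using 1 by (auto intro!: derivative_eq_intros)
    moreover have "eventually (\<lambda>s. (max 0 s)\<^sup>2 = s\<^sup>2) (nhds y)"
      using eventually_nhds_in_open[of "{0<..}" y] 1 by (auto elim!: eventually_mono)
    ultimately show ?thesis by (subst DERIV_cong_ev[OF refl _ refl]) auto
  next
    case 2
    have "eventually (\<lambda>s. (max 0 s)\<^sup>2 = 0) (nhds y)"
      using eventually_nhds_in_open[of "{..<0}" y] 2 by (auto elim!: eventually_mono)
    then have "eventually (\<lambda>s. (max 0 s)\<^sup>2 = (\<lambda>_. 0) s) (nhds y)" by simp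
    from DERIV_cong_ev[OF refl this refl] show ?thesis using 2 by simp
  next
    case 3
    have "((\<lambda>h. (max 0 h)\<^sup>2 / h) \<longlongrightarrow> 0) (at (0::real))"
    proof (rule Lim_null_comparison)
      show "\<forall>\<^sub>F h in at (0::real). norm ((max 0 h)\<^sup>2 / h) \<le> \<bar>h\<bar>"
        by (intro always_eventually allI) (auto simp: max_def power2_eq_square)
      show "((\<lambda>h. \<bar>h\<bar>) \<longlongrightarrow> 0) (at (0::real))" using tendsto_rabs_zero[OF tendsto_ident_at] by simp
    qed
    then show ?thesis using 3 by (simp add: DERIV_def)
  qed
qed

lemma cutoff_energy_deriv:
  assumes R: "R > 0" shows "(cutoff_energy R has_real_derivative cutoff R t / 2) (at t)"
proof -
  have l: "((\<lambda>t. 1 - t / R\<^sup>2) has_real_derivative - (1 / R\<^sup>2)) (at t)"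
    using DERIV_diff[OF DERIV_const[of 1] DERIV_cdivide[OF DERIV_ident, of "R\<^sup>2"], of t UNIV] by simp
  have m: "((\<lambda>t. (max 0 (1 - t / R\<^sup>2))\<^sup>2) has_real_derivative 2 * max 0 (1 - t / R\<^sup>2) * - (1 / R\<^sup>2)) (at t)"
    by (rule DERIV_chain2[OF max_zero_sq_deriv l])
  have f: "((\<lambda>t. R\<^sup>2 / 2 * (t / R\<^sup>2)) has_real_derivative 1 / 2) (at t)"
  proof -
    have e: "(\<lambda>t. R\<^sup>2 / 2 * (t / R\<^sup>2)) = (\<lambda>t. t / 2)" using R by (simp add: fun_eq_iff)
    show ?thesis unfolding e by (auto intro!: derivative_eq_intros)
  qed
  have "(cutoff_energy R has_real_derivative (1 / 2) * (max 0 (1 - t / R\<^sup>2))\<^sup>2 + (2 * max 0 (1 - t / R\<^sup>2) * - (1 / R\<^sup>2)) * (R\<^sup>2 / 2 * (t / R\<^sup>2))) (at t)"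
    unfolding cutoff_energy_def by (rule DERIV_mult[OF f m])
  then show ?thesis
  proof (rule DERIV_cong)
    show "(1 / 2) * (max 0 (1 - t / R\<^sup>2))\<^sup>2 + (2 * max 0 (1 - t / R\<^sup>2) * - (1 / R\<^sup>2)) * (R\<^sup>2 / 2 * (t / R\<^sup>2)) = cutoff R t / 2"
    proof -
      have key: "(1 / 2) * a\<^sup>2 + (2 * a * - (1 / q)) * (q / 2 * s) = a * (a - 2 * s) / 2" if "q \<noteq> 0" for a q s :: real
        using that by (simp add: power2_eq_square field_simps)
      show ?thesis unfolding cutoff_def by (rule key) (use R in simp)
    qed
  qed
qed

lemma cutoff_continuous [continuous_intros]:
  assumes "R > 0" "continuous_on S f" shows "continuous_on S (\<lambda>x. cutoff R (f x))"
  unfolding cutoff_def using assms by (intro continuous_intros continuous_on_max) auto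

lemma cutoff_tendsto: "R > 0 \<Longrightarrow> (f \<longlongrightarrow> l) F \<Longrightarrow> ((\<lambda>x. cutoff R (f x)) \<longlongrightarrow> cutoff R l) F"
  unfolding cutoff_def by (intro tendsto_intros tendsto_max) auto

text \<open>The bound \<open>2\<close> does not depend on \<open>R\<close>, which serves for domination as \<open>R\<close> grows; the support gives the bound \<open>R\<close> on the low modes while \<open>R\<close> is fixed.\<close>

lemma cutoff_bound:
  assumes "R > 0" "0 \<le> t"
  shows "\<bar>cutoff R t\<bar> \<le> 2" "cutoff R t \<noteq> 0 \<Longrightarrow> t < R\<^sup>2" "R\<^sup>2 \<le> t \<Longrightarrow> cutoff_energy R t = 0"
proof -
  have s: "0 \<le> t / R\<^sup>2" using assms by simp
  show "\<bar>cutoff R t\<bar> \<le> 2"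
  proof (cases "t / R\<^sup>2 \<le> 1")
    case True
    have "\<bar>1 - t / R\<^sup>2\<bar> * \<bar>1 - t / R\<^sup>2 - 2 * (t / R\<^sup>2)\<bar> \<le> 1 * 2"
      using s True by (intro mult_mono) (auto simp: abs_le_iff)
    then show ?thesis using True by (simp add: cutoff_def abs_mult)
  qed (simp add: cutoff_def)
  have big: "max 0 (1 - t / R\<^sup>2) = 0" if "R\<^sup>2 \<le> t" using that assms by simp
  show "t < R\<^sup>2" if "cutoff R t \<noteq> 0" using that big by (fastforce simp: cutoff_def not_less[symmetric])
  show "R\<^sup>2 \<le> t \<Longrightarrow> cutoff_energy R t = 0" using big by (simp add: cutoff_energy_def)
qed

lemma cutoff_tendsto_1: "(\<lambda>n. cutoff (real (Suc n)) t) \<longlonglongrightarrow> 1"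
proof -
  have f: "filterlim (\<lambda>n. (real (Suc n))\<^sup>2) at_top sequentially"
    by (intro filterlim_pow_at_top filterlim_compose[OF filterlim_real_sequentially filterlim_Suc]) simp
  have "(\<lambda>n. t / (real (Suc n))\<^sup>2) \<longlonglongrightarrow> 0"
    by (intro tendsto_divide_0[OF tendsto_const] filterlim_at_top_imp_at_infinity f)
  then have "(\<lambda>n. cutoff (real (Suc n)) t) \<longlonglongrightarrow> max 0 (1 - 0) * (max 0 (1 - 0) - 2 * 0)"
    unfolding cutoff_def by (intro tendsto_intros tendsto_max)
  then show ?thesis by simp
qed

text \<open>Tychonoff's theorem, as tuples are embedded in the space of all sequences.\<close>

lemma compact_box_tuples: "compact {x :: nat \<Rightarrow> real. \<forall>i. x i \<in> (if i < k then {- R..R} else {0})}"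
proof -
  have "compactin (product_topology (\<lambda>i::nat. euclidean :: real topology) UNIV) (PiE UNIV (\<lambda>i. if i < k then {- R..R} else {0}))"
    unfolding compactin_PiE by simp
  moreover have "PiE UNIV (\<lambda>i. if i < k then {- R..R} else {0}) = {x :: nat \<Rightarrow> real. \<forall>i. x i \<in> (if i < k then {- R..R} else {0})}"
    by (auto simp: PiE_def Pi_def extensional_def)
  ultimately show ?thesis by (simp add: euclidean_product_topology compactin_euclidean_iff)
qed

lemma C1_compact_support_cutoff_energy:
  assumes R: "R > 0"
  shows "C1_compact_support k (\<lambda>x. cutoff_energy R (\<Sum>j<k. (x j)\<^sup>2))"
  unfolding C1_compact_support_def
proof (intro conjI exI[of _ "\<lambda>i x. cutoff R (\<Sum>j<k. (x j)\<^sup>2) * x i"] allI impI ballI)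
  have coord: "continuous_on A (\<lambda>x :: nat \<Rightarrow> real. x j)" for A j
    by (rule continuous_on_subset[OF continuous_on_product_coordinates]) simp
  fix i assume i: "i < k"
  show "continuous_on (tuples k) (\<lambda>x. cutoff R (\<Sum>j<k. (x j)\<^sup>2) * x i)"
    by (intro continuous_intros coord R)
  show "((\<lambda>t. cutoff_energy R (\<Sum>j<k. ((x(i := t)) j)\<^sup>2)) has_real_derivative cutoff R (\<Sum>j<k. (x j)\<^sup>2) * x i) (at (x i))" for x
  proof -
    define c where "c = (\<Sum>j\<in>{..<k} - {i}. (x j)\<^sup>2)"
    have split: "(\<Sum>j<k. ((x(i := t)) j)\<^sup>2) = t\<^sup>2 + c" for t
      using i by (simp add: sum.remove[of "{..<k}" i] c_def)
    have sp: "(\<Sum>j<k. (x j)\<^sup>2) = (x i)\<^sup>2 + c" using split[of "x i"] by simp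
    have d: "((\<lambda>t. t\<^sup>2 + c) has_real_derivative 2 * x i) (at (x i))" by (auto intro!: derivative_eq_intros)
    from DERIV_chain2[OF cutoff_energy_deriv[OF R, of "(x i)\<^sup>2 + c"] d]
    show ?thesis unfolding split sp by simp
  qed
next
  let ?S = "{x \<in> tuples k. cutoff_energy R (\<Sum>j<k. (x j)\<^sup>2) \<noteq> 0}"
  let ?K = "{x :: nat \<Rightarrow> real. \<forall>i. x i \<in> (if i < k then {- R..R} else {0})}"
  have "?S \<subseteq> ?K"
  proof (intro subsetI CollectI allI)
    fix x i assume x: "x \<in> ?S"
    show "x i \<in> (if i < k then {- R..R} else {0})"
    proof (cases "i < k")
      case True
      have "(\<Sum>j<k. (x j)\<^sup>2) < R\<^sup>2"
        using x cutoff_bound(3)[OF R, of "\<Sum>j<k. (x j)\<^sup>2"] by (auto simp: sum_nonneg not_le[symmetric])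
      moreover have "(x i)\<^sup>2 \<le> (\<Sum>j<k. (x j)\<^sup>2)" using True by (intro member_le_sum) auto
      ultimately have "(x i)\<^sup>2 \<le> R\<^sup>2" by simp
      then have "\<bar>x i\<bar> \<le> R" using R by (simp flip: abs_le_square_iff)
      then show ?thesis using True by (simp add: abs_le_iff)
    next
      case False
      then show ?thesis using x by (simp add: tuples_def)
    qed
  qed
  then have "closure ?S \<subseteq> ?K" by (intro closure_minimal compact_imp_closed compact_box_tuples)
  then have "closure ?S = ?K \<inter> closure ?S" by blast
  moreover have "compact (?K \<inter> closure ?S)" by (intro compact_Int_closed compact_box_tuples) simp
  ultimately show "compact (closure ?S)" by simp
qed

context cell
begin

text \<open>Only \<open>U'\<close> is bounded by hypothesis; \<open>U\<close> then is bounded on the bounded interval by the mean value theorem.\<close>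

lemma shear_profile_weights:
  assumes U: "shear_profile h U"
  shows "weight U" "weight (deriv U)" "continuous_on {- h/2<..<h/2} (deriv U)"
proof -
  let ?I = "{- h/2<..<h/2}"
  have d0: "U differentiable (at z)" if "z \<in> ?I" for z
    using U that unfolding shear_profile_def by (auto dest!: spec[of _ 0])
  have d1: "deriv U differentiable (at z)" if "z \<in> ?I" for z
    using U that unfolding shear_profile_def by (auto dest!: spec[of _ 1])
  have "bounded (deriv U ` ?I)" using U unfolding shear_profile_def by blast
  then obtain C where "\<forall>y\<in>deriv U ` ?I. norm y \<le> C" unfolding bounded_iff by blast
  then have C: "\<bar>deriv U z\<bar> \<le> C" if "z \<in> ?I" for z using that by simp
  show c1: "continuous_on ?I (deriv U)"
    using d1 by (intro continuous_at_imp_continuous_on ballI differentiable_imp_continuous_within) auto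
  have c0: "continuous_on ?I U"
    using d0 by (intro continuous_at_imp_continuous_on ballI differentiable_imp_continuous_within) auto
  show "weight (deriv U)" unfolding weight_def using c1 C by blast
  have "\<bar>U z\<bar> \<le> \<bar>U 0\<bar> + C * h" if z: "z \<in> ?I" for z
  proof -
    have z0: "0 \<in> ?I" using h_pos by simp
    have "norm (U z - U 0) \<le> C * norm (z - 0)"
    proof (rule field_differentiable_bound[of ?I U "deriv U"])
      show "convex ?I" by (rule convex_real_interval)
      show "(U has_field_derivative deriv U y) (at y within ?I)" if "y \<in> ?I" for y
        using d0[OF that] by (metis DERIV_deriv_iff_real_differentiable has_field_derivative_at_within)
      show "norm (deriv U y) \<le> C" if "y \<in> ?I" for y using C[OF that] by simp
    qed (use z z0 in auto)
    moreover have "C * norm (z - 0) \<le> C * h"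
      using z C[OF z0] by (intro mult_left_mono) auto
    ultimately have "\<bar>U z - U 0\<bar> \<le> C * h" by simp
    then show ?thesis by linarith
  qed
  then show "weight U" unfolding weight_def using c0 by blast
qed

end

context stokes_modes
begin

section \<open>Continuity of the test fields\<close>

lemma coef_tendsto: "tends f u \<Longrightarrow> m \<in> modes \<Longrightarrow> (\<lambda>n. coef (f n) m) \<longlonglongrightarrow> coef u m"
  by (intro ip_tendsto_left tends_D w_facts(3))

lemma comb_minus: "(\<lambda>x. comb a F x - comb b F x) = comb (\<lambda>m. a m - b m) F"
  unfolding comb_def by (simp add: sum_subtractf scaleR_diff_left)

text \<open>Bessel's inequality for the partial sums makes the projection a contraction.\<close>

lemma L2cont_proj:
  assumes S: "S \<subseteq> modes" shows "L2cont (proj S)"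
proof (rule L2cont_lipschitz[where C = 1])
  show "proj S u \<in> LL" if "u \<in> Hd" for u by (rule proj(1)[OF Hd_L2[OF that] S])
  fix u v assume uv: "u \<in> Hd" "v \<in> Hd"
  note L = Hd_L2[OF uv(1)] Hd_L2[OF uv(2)]
  let ?a = "\<lambda>n. comb (coef u) (trunc_set S n)" and ?b = "\<lambda>n. comb (coef v) (trunc_set S n)"
  have le: "nrm (\<lambda>x. ?a n x - ?b n x) \<le> nrm (\<lambda>x. u x - v x)" for n
  proof (rule power2_le_imp_le)
    have "(nrm (\<lambda>x. ?a n x - ?b n x))\<^sup>2 = (\<Sum>m\<in>trunc_set S n. (coef (\<lambda>x. u x - v x) m)\<^sup>2)"
      unfolding comb_minus nrm_comb[OF trunc_modes[OF S]]
    proof (rule sum.cong[OF refl])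
      fix m assume "m \<in> trunc_set S n"
      then have "m \<in> modes" using trunc_modes(2)[OF S] by blast
      then show "(coef u m - coef v m)\<^sup>2 = (coef (\<lambda>x. u x - v x) m)\<^sup>2" using ip_diff_left[OF L w_facts(3)] by simp
    qed
    also have "\<dots> \<le> (nrm (\<lambda>x. u x - v x))\<^sup>2" by (rule Bessel(2)[OF trunc_modes[OF S] L2_diff[OF L]])
    finally show "(nrm (\<lambda>x. ?a n x - ?b n x))\<^sup>2 \<le> (nrm (\<lambda>x. u x - v x))\<^sup>2" .
  qed simp
  have cl: "?a n \<in> LL" "?b n \<in> LL" for n by (intro comb_facts trunc_modes S)+
  have "(\<lambda>n. nrm (\<lambda>x. (?a n x - ?b n x) - (proj S u x - proj S v x))) \<longlonglongrightarrow> 0"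
  proof (rule Lim_null_comparison)
    have e: "(\<lambda>x. (?a n x - ?b n x) - (proj S u x - proj S v x)) = (\<lambda>x. (?a n x - proj S u x) - (?b n x - proj S v x))" for n by auto
    have "nrm (\<lambda>x. (?a n x - ?b n x) - (proj S u x - proj S v x)) \<le> nrm (\<lambda>x. ?a n x - proj S u x) + nrm (\<lambda>x. ?b n x - proj S v x)" for n
      unfolding e by (intro nrm_triangle_sub L2_diff cl proj L S)
    then show "\<forall>\<^sub>F n in sequentially. norm (nrm (\<lambda>x. (?a n x - ?b n x) - (proj S u x - proj S v x))) \<le> nrm (\<lambda>x. ?a n x - proj S u x) + nrm (\<lambda>x. ?b n x - proj S v x)"
      by simp
    show "(\<lambda>n. nrm (\<lambda>x. ?a n x - proj S u x) + nrm (\<lambda>x. ?b n x - proj S v x)) \<longlonglongrightarrow> 0"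
      using tendsto_add[OF proj_seq[OF L(1) S] proj_seq[OF L(2) S]] by simp
  qed
  from nrm_tendsto[OF L2_diff[OF cl] L2_diff[OF proj(1)[OF L(1) S] proj(1)[OF L(2) S]] this]
  show "nrm (\<lambda>x. proj S u x - proj S v x) \<le> 1 * nrm (\<lambda>x. u x - v x)"
    unfolding mult_1 by (rule LIMSEQ_le_const2) (use le in blast)
qed

text \<open>Coefficients that depend continuously on \<open>u\<close>, the form of the gradients of cylindrical functions of finitely many modes.\<close>

definition continuous_coef :: "(mode \<Rightarrow> field \<Rightarrow> real) \<Rightarrow> mode set \<Rightarrow> bool" where
  "continuous_coef c F \<longleftrightarrow> (\<forall>f u. tends f u \<longrightarrow> (\<forall>m\<in>F. (\<lambda>n. c m (f n)) \<longlonglongrightarrow> c m u))"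

abbreviation "cfield c F \<equiv> (\<lambda>u. comb (\<lambda>m. c m u) F)"

lemma weighted_sum_tendsto_zero:
  assumes c: "continuous_coef c F" and t: "tends f u"
  shows "(\<lambda>n. \<Sum>m\<in>F. q m * (c m (f n) - c m u)\<^sup>2) \<longlonglongrightarrow> 0"
proof -
  have "(\<lambda>n. \<Sum>m\<in>F. q m * (c m (f n) - c m u)\<^sup>2) \<longlonglongrightarrow> (\<Sum>m\<in>F. q m * (c m u - c m u)\<^sup>2)"
    using c t unfolding continuous_coef_def by (intro tendsto_intros) blast
  then show ?thesis by simp
qed

lemma L2cont_cfield:
  assumes F: "finite F" "F \<subseteq> modes" and c: "continuous_coef c F"
  shows "L2cont (cfield c F)" "L2cont (\<lambda>u. D i (cfield c F u))"
proof -
  show "L2cont (cfield c F)"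
    unfolding L2cont_def
  proof (intro conjI ballI allI impI comb_facts(2)[OF F])
    fix f u assume t: "tends f u"
    have "(\<lambda>n. sqrt ((nrm (\<lambda>x. cfield c F (f n) x - cfield c F u x))\<^sup>2)) \<longlonglongrightarrow> sqrt 0"
      unfolding comb_minus nrm_comb[OF F]
      using weighted_sum_tendsto_zero[OF c t, of "\<lambda>_. 1"] by (intro tendsto_real_sqrt) simp
    then show "(\<lambda>n. nrm (\<lambda>x. cfield c F (f n) x - cfield c F u x)) \<longlonglongrightarrow> 0" by simp
  qed
  show "L2cont (\<lambda>u. D i (cfield c F u))"
    unfolding L2cont_def
  proof (intro conjI ballI allI impI SobD(2) comb_facts(3)[OF F])
    fix f u assume t: "tends f u"
    show "(\<lambda>n. nrm (\<lambda>x. D i (cfield c F (f n)) x - D i (cfield c F u) x)) \<longlonglongrightarrow> 0"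
    proof (rule Lim_null_comparison)
      have "nrm (\<lambda>x. D i (cfield c F (f n)) x - D i (cfield c F u) x) \<le> sqrt (\<Sum>m\<in>F. lam m * (c m (f n) - c m u)\<^sup>2)" for n
        unfolding Sob_diff_wd(2)[OF comb_facts(3)[OF F] comb_facts(3)[OF F], symmetric] comb_minus gsq_comb[OF F, symmetric]
        by (rule nrm_wd_le)
      then show "\<forall>\<^sub>F n in sequentially. norm (nrm (\<lambda>x. D i (cfield c F (f n)) x - D i (cfield c F u) x)) \<le> sqrt (\<Sum>m\<in>F. lam m * (c m (f n) - c m u)\<^sup>2)"
        by simp
      show "(\<lambda>n. sqrt (\<Sum>m\<in>F. lam m * (c m (f n) - c m u)\<^sup>2)) \<longlonglongrightarrow> 0"
        using tendsto_real_sqrt[OF weighted_sum_tendsto_zero[OF c t, of lam]] by simp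
    qed
  qed
qed

lemma nrm_component_mult:
  assumes a: "a \<in> LL" and b: "b \<in> borel_measurable M" and C: "\<And>x. x \<in> Om \<Longrightarrow> norm (b x) \<le> C"
  shows "(\<lambda>x. (a x $ i) *\<^sub>R b x) \<in> LL" "nrm (\<lambda>x. (a x $ i) *\<^sub>R b x) \<le> \<bar>C\<bar> * nrm a"
proof -
  have [measurable]: "a \<in> borel_measurable M" "b \<in> borel_measurable M" using L2D(1)[OF a] b by auto
  have le: "(norm ((a x $ i) *\<^sub>R b x))\<^sup>2 \<le> C\<^sup>2 * (norm (a x))\<^sup>2" if "x \<in> Om" for x
  proof -
    have "norm ((a x $ i) *\<^sub>R b x) \<le> norm (a x) * \<bar>C\<bar>"
      unfolding norm_scaleR using component_le_norm_cart[of "a x" i] C[OF that] by (intro mult_mono) auto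
    then have "(norm ((a x $ i) *\<^sub>R b x))\<^sup>2 \<le> (norm (a x) * \<bar>C\<bar>)\<^sup>2" by (intro power_mono) auto
    then show ?thesis by (simp add: power_mult_distrib mult.commute)
  qed
  show L: "(\<lambda>x. (a x $ i) *\<^sub>R b x) \<in> LL"
  proof (rule L2_bounded_by)
    show "integrable M (\<lambda>x. C\<^sup>2 * (norm (a x))\<^sup>2)" using L2D(2)[OF a] by simp
    show "AE x in M. (norm ((a x $ i) *\<^sub>R b x))\<^sup>2 \<le> C\<^sup>2 * (norm (a x))\<^sup>2" using le by (intro AE_I2) simp
  qed measurable
  show "nrm (\<lambda>x. (a x $ i) *\<^sub>R b x) \<le> \<bar>C\<bar> * nrm a"
  proof (rule power2_le_imp_le)
    have "(nrm (\<lambda>x. (a x $ i) *\<^sub>R b x))\<^sup>2 \<le> (LINT x|M. C\<^sup>2 * (norm (a x))\<^sup>2)"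
      unfolding nrm_sq ip_self using L2D(2)[OF L] L2D(2)[OF a] le by (intro integral_mono) auto
    then show "(nrm (\<lambda>x. (a x $ i) *\<^sub>R b x))\<^sup>2 \<le> (\<bar>C\<bar> * nrm a)\<^sup>2"
      by (simp add: nrm_sq ip_self power_mult_distrib)
  qed simp
qed

lemma modes_bounded:
  assumes F: "finite F" "F \<subseteq> modes"
  obtains B where "0 \<le> B" "\<And>m x. m \<in> F \<Longrightarrow> x \<in> Om \<Longrightarrow> norm (w m x) \<le> B"
proof -
  have "\<exists>B. \<forall>x\<in>Om. norm (w m x) \<le> B" if "m \<in> F" for m
  proof -
    have m: "m \<in> modes" using F that by blast
    obtain C where "\<And>x. x \<in> Om \<Longrightarrow> norm (W m x) \<le> C" using bounded_on_Omega[OF C1_continuous[OF W_facts(2)[OF m]]] by blast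
    then show ?thesis using w_eq_W[OF m] by auto
  qed
  then have "\<forall>m. \<exists>B. m \<in> F \<longrightarrow> (\<forall>x\<in>Om. norm (w m x) \<le> B)" by blast
  from choice[OF this] obtain B where B: "\<And>m x. m \<in> F \<Longrightarrow> x \<in> Om \<Longrightarrow> norm (w m x) \<le> B m" by blast
  show ?thesis
  proof (rule that[of "\<Sum>m\<in>F. \<bar>B m\<bar>"])
    fix m x assume mx: "m \<in> F" "x \<in> Om"
    have "norm (w m x) \<le> \<bar>B m\<bar>" using B[OF mx] by linarith
    also have "\<dots> \<le> (\<Sum>m\<in>F. \<bar>B m\<bar>)" using F mx(1) by (intro member_le_sum) auto
    finally show "norm (w m x) \<le> (\<Sum>m\<in>F. \<bar>B m\<bar>)" .
  qed (simp add: sum_nonneg)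
qed

text \<open>For the convective term, rewritten as \<open>\<Sum>\<^sub>i ((\<partial>\<^sub>i u, u\<^sub>i g))\<close>. Finite sums of modes are bounded, so \<open>u\<^sub>i g\<close> is continuous in \<open>u\<close> although \<open>u\<close> is only square integrable.\<close>

lemma L2cont_component_mult:
  assumes F: "finite F" "F \<subseteq> modes" and c: "continuous_coef c F"
  shows "L2cont (\<lambda>u x. (u x $ i) *\<^sub>R cfield c F u x)"
proof -
  obtain B where B: "0 \<le> B" "\<And>m x. m \<in> F \<Longrightarrow> x \<in> Om \<Longrightarrow> norm (w m x) \<le> B" using modes_bounded[OF F] by blast
  have bd: "norm (comb a F x) \<le> (\<Sum>m\<in>F. \<bar>a m\<bar>) * B" if "x \<in> Om" for a x
  proof -
    have "norm (comb a F x) \<le> (\<Sum>m\<in>F. norm (a m *\<^sub>R w m x))" unfolding comb_def by (rule norm_sum)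
    also have "\<dots> \<le> (\<Sum>m\<in>F. \<bar>a m\<bar> * B)" using B(2)[OF _ that] by (intro sum_mono) (simp add: mult_left_mono)
    finally show ?thesis by (simp add: sum_distrib_right)
  qed
  have meas: "comb a F \<in> borel_measurable M" for a by (rule L2D(1)[OF comb_facts(2)[OF F]])
  note P = nrm_component_mult[OF _ meas bd]
  show ?thesis
    unfolding L2cont_def
  proof (intro conjI ballI allI impI)
    show "(\<lambda>x. (u x $ i) *\<^sub>R cfield c F u x) \<in> LL" if "u \<in> Hd" for u by (rule P(1)[OF Hd_L2[OF that]])
    fix f u assume t: "tends f u"
    let ?d = "\<lambda>n. nrm (\<lambda>x. f n x - u x)"
    let ?A = "\<lambda>n. \<bar>(\<Sum>m\<in>F. \<bar>c m (f n)\<bar>) * B\<bar>" and ?E = "\<lambda>n. \<bar>(\<Sum>m\<in>F. \<bar>c m (f n) - c m u\<bar>) * B\<bar>"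
    show "(\<lambda>n. nrm (\<lambda>x. (f n x $ i) *\<^sub>R cfield c F (f n) x - (u x $ i) *\<^sub>R cfield c F u x)) \<longlonglongrightarrow> 0"
    proof (rule Lim_null_comparison)
      have "nrm (\<lambda>x. (f n x $ i) *\<^sub>R cfield c F (f n) x - (u x $ i) *\<^sub>R cfield c F u x) \<le> ?A n * ?d n + ?E n * nrm u" for n
      proof -
        have e: "(\<lambda>x. (f n x $ i) *\<^sub>R cfield c F (f n) x - (u x $ i) *\<^sub>R cfield c F u x)
          = (\<lambda>x. ((f n x - u x) $ i) *\<^sub>R cfield c F (f n) x + (u x $ i) *\<^sub>R comb (\<lambda>m. c m (f n) - c m u) F x)"
          unfolding comb_minus[symmetric] by (simp add: fun_eq_iff algebra_simps)
        note uL = tends_D(4)[OF t] and dL = L2_diff[OF tends_D(3)[OF t, of n] tends_D(4)[OF t]]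
        show ?thesis unfolding e
          by (rule order_trans[OF nrm_triangle[OF P(1)[OF dL] P(1)[OF uL]] add_mono[OF P(2)[OF dL] P(2)[OF uL]]])
      qed
      then show "\<forall>\<^sub>F n in sequentially. norm (nrm (\<lambda>x. (f n x $ i) *\<^sub>R cfield c F (f n) x - (u x $ i) *\<^sub>R cfield c F u x)) \<le> ?A n * ?d n + ?E n * nrm u"
        by simp
      have cm: "(\<lambda>n. c m (f n)) \<longlonglongrightarrow> c m u" if "m \<in> F" for m using c t that unfolding continuous_coef_def by blast
      have "(\<lambda>n. ?A n * ?d n + ?E n * nrm u) \<longlonglongrightarrow> \<bar>(\<Sum>m\<in>F. \<bar>c m u\<bar>) * B\<bar> * 0 + \<bar>(\<Sum>m\<in>F. \<bar>c m u - c m u\<bar>) * B\<bar> * nrm u"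
        by (intro tendsto_intros tends_D(5)[OF t] cm)
      then show "(\<lambda>n. ?A n * ?d n + ?E n * nrm u) \<longlonglongrightarrow> 0" by simp
    qed
  qed
qed

text \<open>Each of the three terms pairs the weak derivatives of \<open>u\<close> with continuous fields.\<close>

lemma F_pairing_measurable:
  assumes U: "shear_profile h U" and F: "finite F" "F \<subseteq> modes" and c: "continuous_coef c F"
  shows "(\<lambda>u. F_pairing Lx Ly h \<nu> U u (cfield c F u)) \<in> borel_measurable NN"
proof -
  let ?G = "cfield c F"
  note w = shear_profile_weights[OF U] and G = L2cont_cfield[OF F c] and GU = L2cont_component_mult[OF F c]
  have lift: "L2cont (\<lambda>u x. lift_shear (u x))"
  proof (rule L2cont_lipschitz[where C = 1])
    show "(\<lambda>x. lift_shear (u x)) \<in> LL" if "u \<in> Hd" for u by (rule L2_lift_shear[OF Hd_L2[OF that]])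
    show "nrm (\<lambda>x. lift_shear (u x) - lift_shear (v x)) \<le> 1 * nrm (\<lambda>x. u x - v x)" if "u \<in> Hd" "v \<in> Hd" for u v
      unfolding lift_shear_diff[symmetric] mult_1 by (intro nrm_lift_shear L2_diff Hd_L2 that)
  qed
  have 1: "(\<lambda>u. ip (shear_term Lx Ly h U u) (?G u)) \<in> borel_measurable NN"
  proof -
    have e: "ip (shear_term Lx Ly h U u) (?G u) = (LINT x|M. (\<Sum>i\<in>UNIV. D i u x \<bullet> (if i = 1 then (\<lambda>u x. U (x $ 3) *\<^sub>R ?G u x) else (\<lambda>u x. 0)) u x)
        + (deriv U (x $ 3) *\<^sub>R lift_shear (u x)) \<bullet> ?G u x)" for u
      unfolding l2inner_def shear_term_def lift_shear_def
      by (intro Bochner_Integration.integral_cong refl) (simp add: sum_3 inner_add_left mult.commute)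
    show ?thesis unfolding e
      by (rule pairing_measurable) (auto intro!: L2cont_weight w G L2cont_zero lift split: if_splits)
  qed
  have 2: "(\<lambda>u. ginner u (?G u)) \<in> borel_measurable NN"
  proof -
    have e: "ip (D i u) (D i (?G u)) = (LINT x|M. (\<Sum>j\<in>UNIV. D j u x \<bullet> (if j = i then (\<lambda>u. D i (?G u)) else (\<lambda>u x. 0)) u x) + 0 \<bullet> (0 :: real^3))" for i u
    proof -
      have "(\<Sum>j\<in>UNIV. D j u x \<bullet> (if j = i then (\<lambda>u. D i (?G u)) else (\<lambda>u x. 0)) u x) = (\<Sum>j\<in>UNIV. if j = i then D i u x \<bullet> D i (?G u) x else 0)" for x
        by (intro sum.cong) auto
      then show ?thesis unfolding l2inner_def by simp
    qed
    have "(\<lambda>u. ip (D i u) (D i (?G u))) \<in> borel_measurable NN" for i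
    proof -
      have "(\<lambda>u. LINT x|M. (\<Sum>j\<in>UNIV. D j u x \<bullet> (if j = i then (\<lambda>u. D i (?G u)) else (\<lambda>u x. 0)) u x) + 0 \<bullet> (0 :: real^3)) \<in> borel_measurable NN"
        by (rule pairing_measurable[where a = "\<lambda>u x. 0" and b = "\<lambda>u x. 0" and \<psi> = "\<lambda>j. if j = i then (\<lambda>u. D i (?G u)) else (\<lambda>u x. 0)"]) (auto intro!: G L2cont_zero split: if_splits)
      then show ?thesis using e[of i] by simp
    qed
    then show ?thesis unfolding grad_inner_def by (intro borel_measurable_sum)
  qed
  have 3: "(\<lambda>u. ip (conv Lx Ly h u u) (?G u)) \<in> borel_measurable NN"
  proof -
    have e: "ip (conv Lx Ly h u u) (?G u) = (LINT x|M. (\<Sum>i\<in>UNIV. D i u x \<bullet> ((u x $ i) *\<^sub>R ?G u x)) + 0 \<bullet> (0 :: real^3))" for u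
      unfolding l2inner_def conv_def by (intro Bochner_Integration.integral_cong refl) (simp add: inner_sum_left)
    show ?thesis unfolding e
      by (rule pairing_measurable[where a = "\<lambda>u x. 0" and b = "\<lambda>u x. 0" and \<psi> = "\<lambda>i u x. (u x $ i) *\<^sub>R ?G u x"]) (auto intro!: GU L2cont_zero)
  qed
  show ?thesis unfolding F_pairing_def by (intro borel_measurable_diff borel_measurable_uminus borel_measurable_times borel_measurable_const 1 2 3)
qed

section \<open>The cutoff energy as a cylindrical test function\<close>

text \<open>Twice the kinetic energy in the modes of \<open>F\<close>.\<close>

definition low_energy :: "mode set \<Rightarrow> field \<Rightarrow> real" where
  "low_energy F u = (\<Sum>m\<in>F. (coef u m)\<^sup>2)"

text \<open>The gradient of \<open>cutoff_energy R (low_energy F u)\<close>.\<close>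

definition test_gradient :: "mode set \<Rightarrow> real \<Rightarrow> field \<Rightarrow> field" where
  "test_gradient F R u = comb (\<lambda>m. cutoff R (low_energy F u) * coef u m) F"

lemma low_energy_nonneg: "0 \<le> low_energy F u"
  by (simp add: low_energy_def sum_nonneg)

lemma continuous_coef_cutoff:
  assumes F: "F \<subseteq> modes" and R: "R > 0"
  shows "continuous_coef (\<lambda>m u. cutoff R (low_energy F u) * coef u m) F"
  unfolding continuous_coef_def low_energy_def
proof (intro allI impI ballI)
  fix f u m assume t: "tends f u" and m: "m \<in> F"
  have c: "(\<lambda>n. coef (f n) m) \<longlonglongrightarrow> coef u m" if "m \<in> F" for m using coef_tendsto[OF t subsetD[OF F that]] .
  show "(\<lambda>n. cutoff R (\<Sum>m\<in>F. (coef (f n) m)\<^sup>2) * coef (f n) m) \<longlonglongrightarrow> cutoff R (\<Sum>m\<in>F. (coef u m)\<^sup>2) * coef u m"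
    by (intro tendsto_mult cutoff_tendsto R tendsto_sum tendsto_power c m)
qed

lemma test_gradient_eq: "test_gradient F R u = (\<lambda>x. cutoff R (low_energy F u) *\<^sub>R comb (coef u) F x)"
  unfolding test_gradient_def comb_def by (simp add: scaleR_sum_right)

lemma cylindrical_cutoff_energy:
  assumes F: "finite F" "F \<subseteq> modes" and R: "R > 0"
  shows "cylindrical Lx Ly h (\<lambda>u. cutoff_energy R (low_energy F u))"
proof -
  obtain e where e: "bij_betw e {..<card F} F" using ex_bij_betw_nat_finite[OF F(1)] by (auto simp: atLeast0LessThan)
  let ?k = "card F"
  have "low_energy F u = (\<Sum>j<?k. (if j < ?k then ip u (w (e j)) else 0)\<^sup>2)" for u
    unfolding low_energy_def using sum.reindex_bij_betw[OF e, of "\<lambda>m. (coef u m)\<^sup>2", symmetric] by simp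
  then have "(\<lambda>u. cutoff_energy R (low_energy F u)) = (\<lambda>u. (\<lambda>x. cutoff_energy R (\<Sum>j<?k. (x j)\<^sup>2)) (\<lambda>j. if j < ?k then ip u (w (e j)) else 0))"
    by simp
  moreover have "\<forall>j<?k. w (e j) \<in> Vs" using bij_betwE[OF e] F(2) w_facts(2) by blast
  ultimately show ?thesis unfolding cylindrical_def using C1_compact_support_cutoff_energy[OF R, of ?k]
    by (intro exI[of _ ?k] exI[of _ "\<lambda>j. w (e j)"] exI[of _ "\<lambda>x. cutoff_energy R (\<Sum>j<?k. (x j)\<^sup>2)"]) blast
qed

text \<open>The one-variable expansion of \<open>cutoff_energy R\<close> at \<open>N = low_energy F u\<close>, where \<open>low_energy F (u + v) = N + 2 q + p\<close> with \<open>q\<close> linear in \<open>v\<close> and \<open>p\<close> at most \<open>\<parallel>v\<parallel>\<^sup>2\<close>.\<close>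

lemma has_gradient_cutoff_energy:
  assumes F: "finite F" "F \<subseteq> modes" and R: "R > 0" and u: "u \<in> Hd"
  shows "has_gradient Lx Ly h (\<lambda>u. cutoff_energy R (low_energy F u)) u (test_gradient F R u)"
  unfolding has_gradient_def
proof (intro conjI allI impI)
  show "test_gradient F R u \<in> Hd" unfolding test_gradient_def by (rule comb_Hdot(1)[OF F])
  fix e :: real assume e: "e > 0"
  define N where "N = low_energy F u"
  define A where "A = 2 * nrm u + 1"
  define T where "T = \<bar>cutoff R N / 2\<bar>"
  have A: "A > 0" unfolding A_def using nrm_nonneg[of u] by linarith
  have T: "0 \<le> T" by (simp add: T_def)
  have uL: "u \<in> LL" by (rule Hd_L2[OF u])
  have e1: "e / (2 * A) > 0" using e A by simp
  obtain d where d: "d > 0" "\<And>y. \<bar>y - N\<bar> < d \<Longrightarrow> \<bar>cutoff_energy R y - cutoff_energy R N - cutoff R N / 2 * (y - N)\<bar> \<le> e / (2 * A) * \<bar>y - N\<bar>"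
    using cutoff_energy_deriv[OF R, of N, unfolded has_field_derivative_def has_derivative_at_alt] e1 by (auto simp: real_norm_def)
  define \<delta> where "\<delta> = min 1 (min (d / A) (e / (2 * (T + 1))))"
  have \<delta>: "\<delta> > 0" using d(1) A e T by (simp add: \<delta>_def)
  show "\<exists>\<delta>>0. \<forall>v\<in>Hd. nrm v < \<delta> \<longrightarrow>
      \<bar>cutoff_energy R (low_energy F (\<lambda>x. u x + v x)) - cutoff_energy R (low_energy F u) - ip (test_gradient F R u) v\<bar> \<le> e * nrm v"
  proof (intro exI[of _ \<delta>] conjI \<delta> ballI impI)
    fix v assume v: "v \<in> Hd" and vd: "nrm v < \<delta>"
    have vL: "v \<in> LL" by (rule Hd_L2[OF v])
    let ?s = "nrm v"
    define q where "q = (\<Sum>m\<in>F. coef u m * coef v m)"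
    define p where "p = low_energy F v"
    have s: "?s < 1" "A * ?s < d" "(T + 1) * ?s < e / 2"
    proof -
      show "?s < 1" using vd by (simp add: \<delta>_def)
      have "?s < d / A" using vd by (simp add: \<delta>_def)
      then show "A * ?s < d" using A by (simp add: field_simps)
      have "?s < e / (2 * (T + 1))" using vd by (simp add: \<delta>_def)
      then show "(T + 1) * ?s < e / 2" using T by (simp add: field_simps)
    qed
    have N': "low_energy F (\<lambda>x. u x + v x) = N + 2 * q + p"
    proof -
      have "coef (\<lambda>x. u x + v x) m = coef u m + coef v m" if "m \<in> F" for m
        using ip_add_left[OF uL vL w_facts(3)[OF subsetD[OF F(2) that]]] .
      then have "low_energy F (\<lambda>x. u x + v x) = (\<Sum>m\<in>F. (coef u m)\<^sup>2 + 2 * (coef u m * coef v m) + (coef v m)\<^sup>2)"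
        unfolding low_energy_def by (intro sum.cong refl) (simp add: power2_sum)
      then show ?thesis by (simp add: N_def q_def p_def low_energy_def sum.distrib sum_distrib_left)
    qed
    have p: "0 \<le> p" "p \<le> ?s\<^sup>2" unfolding p_def using low_energy_nonneg Bessel(2)[OF F vL] by (auto simp: low_energy_def)
    have q: "\<bar>q\<bar> \<le> nrm u * ?s"
    proof -
      have "q = ip (comb (coef u) F) v" unfolding q_def ip_comb(2)[OF F vL] ..
      then have "\<bar>q\<bar> \<le> nrm (comb (coef u) F) * ?s" using Cauchy_Schwarz_ip[OF comb_facts(2)[OF F] vL] by simp
      also have "nrm (comb (coef u) F) \<le> nrm u"
        by (rule power2_le_imp_le) (use Bessel(2)[OF F uL] nrm_comb[OF F] in simp_all)
      finally show ?thesis by (simp add: mult_right_mono)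
    qed
    have "?s\<^sup>2 \<le> ?s" using s(1) by (simp add: power2_eq_square mult_left_le)
    then have "\<bar>2 * q + p\<bar> \<le> 2 * (nrm u * ?s) + ?s" using p q by linarith
    also have "\<dots> = A * ?s" by (simp add: A_def distrib_right)
    finally have diff: "\<bar>2 * q + p\<bar> \<le> A * ?s" .
    have "ip (test_gradient F R u) v = cutoff R N * q"
      unfolding test_gradient_def ip_comb(2)[OF F vL] q_def N_def by (simp add: sum_distrib_left mult.assoc)
    moreover have ident: "a - b - c * q = (a - b - c / 2 * ((N + 2 * q + p) - N)) + c / 2 * p" for a b c
      by (simp add: field_simps)
    ultimately have "\<bar>cutoff_energy R (low_energy F (\<lambda>x. u x + v x)) - cutoff_energy R (low_energy F u) - ip (test_gradient F R u) v\<bar>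
      = \<bar>(cutoff_energy R (N + 2 * q + p) - cutoff_energy R N - cutoff R N / 2 * ((N + 2 * q + p) - N)) + cutoff R N / 2 * p\<bar>"
      unfolding N' ident[symmetric] by (simp add: N_def[symmetric])
    also have "\<dots> \<le> e / (2 * A) * \<bar>(N + 2 * q + p) - N\<bar> + T * p"
    proof -
      have "\<bar>(N + 2 * q + p) - N\<bar> < d" using diff s(2) by simp
      from d(2)[OF this] have "\<bar>cutoff_energy R (N + 2 * q + p) - cutoff_energy R N - cutoff R N / 2 * ((N + 2 * q + p) - N)\<bar> \<le> e / (2 * A) * \<bar>(N + 2 * q + p) - N\<bar>" .
      moreover have "\<bar>cutoff R N / 2 * p\<bar> = T * p" using p(1) by (simp add: T_def abs_mult)
      ultimately show ?thesis using abs_triangle_ineq order_trans by fastforce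
    qed
    also have "\<dots> \<le> e / (2 * A) * (A * ?s) + T * ?s\<^sup>2"
      using diff e1 p T by (intro add_mono mult_left_mono) auto
    also have "\<dots> \<le> e / 2 * ?s + e / 2 * ?s"
    proof (intro add_mono)
      show "e / (2 * A) * (A * ?s) \<le> e / 2 * ?s" using A by simp
      have "T * ?s \<le> e / 2" using s(3) nrm_nonneg[of v] unfolding distrib_right by linarith
      then show "T * ?s\<^sup>2 \<le> e / 2 * ?s" using mult_right_mono[of "T * ?s" "e / 2" ?s] by (simp add: power2_eq_square mult.assoc)
    qed
    also have "\<dots> = e * ?s" by simp
    finally show "\<bar>cutoff_energy R (low_energy F (\<lambda>x. u x + v x)) - cutoff_energy R (low_energy F u) - ip (test_gradient F R u) v\<bar> \<le> e * nrm v" .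
  qed
qed

end

text \<open>A nonempty open set is not negligible.\<close>

section \<open>The shear rate\<close>

lemma continuous_le_of_AE_le:
  fixes f :: "real \<Rightarrow> real"
  assumes f: "continuous_on {a<..<b} f" and le: "AE z in lebesgue_on {a<..<b}. f z \<le> c" and z: "z \<in> {a<..<b}"
  shows "f z \<le> c"
proof (rule ccontr)
  assume nz: "\<not> f z \<le> c"
  let ?G = "{a<..<b} \<inter> f -` {c<..}"
  have G: "open ?G" using continuous_open_preimage[OF f, of "{c<..}"] by simp
  moreover have "z \<in> ?G" using nz z by simp
  ultimately have "\<not> negligible ?G" using open_not_negligible by blast
  moreover have "negligible ?G"
  proof -
    have "AE z in lebesgue. z \<in> {a<..<b} \<longrightarrow> f z \<le> c" using le by (simp add: AE_restrict_space_iff)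
    then have "AE z in lebesgue. z \<notin> ?G" by eventually_elim auto
    then show ?thesis unfolding negligible_iff_null_sets using AE_iff_null_sets[of ?G lebesgue] G by simp
  qed
  ultimately show False by contradiction
qed

context cell
begin

text \<open>By continuity the essential supremum bounds \<open>U'\<close> at every point, and it is finite because \<open>U'\<close> is bounded.\<close>

lemma shear_rate_bound:
  assumes U: "shear_profile h U" and z: "z \<in> {- h/2<..<h/2}"
  shows "\<bar>deriv U z\<bar> \<le> shear_rate h U"
proof -
  let ?I = "{- h/2<..<h/2}"
  let ?f = "\<lambda>z. ereal \<bar>deriv U z\<bar>"
  let ?e = "esssup (lebesgue_on ?I) ?f"
  have c: "continuous_on ?I (deriv U)" by (rule shear_profile_weights(3)[OF U])
  obtain C where C: "\<And>z. z \<in> ?I \<Longrightarrow> \<bar>deriv U z\<bar> \<le> C"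
    using shear_profile_weights(2)[OF U] unfolding weight_def by blast
  have "deriv U \<in> borel_measurable (lebesgue_on ?I)"
    by (rule continuous_imp_measurable_on_sets_lebesgue[OF c]) simp
  then have "?f \<in> borel_measurable (lebesgue_on ?I)" by measurable
  then have up: "?e \<le> ereal C" using C by (intro esssup_I AE_I2) auto
  have AE: "AE z in lebesgue_on ?I. ?f z \<le> ?e" by (rule esssup_AE)
  have "0 \<le> ?e"
  proof (rule ccontr)
    assume "\<not> 0 \<le> ?e"
    then have neg: "?e < 0" by simp
    have "AE z in lebesgue_on ?I. (\<lambda>z. 1) z \<le> (0::real)" using AE
    proof eventually_elim
      case (elim z)
      have "ereal \<bar>deriv U z\<bar> < 0" by (rule le_less_trans[OF elim neg])
      then show ?case by simp
    qed
    from continuous_le_of_AE_le[OF continuous_on_const this z] show False by simp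
  qed
  then have e: "?e = ereal (shear_rate h U)"
    using up unfolding shear_rate_def by (cases ?e) auto
  have "AE z in lebesgue_on ?I. \<bar>deriv U z\<bar> \<le> shear_rate h U" using AE unfolding e by eventually_elim simp
  from continuous_le_of_AE_le[OF _ this z] show ?thesis using c by (simp add: continuous_on_rabs)
qed

lemma shear_rate_nonneg: "shear_profile h U \<Longrightarrow> 0 \<le> shear_rate h U"
  using shear_rate_bound[of U 0] h_pos by fastforce

end

context stokes_modes
begin

section \<open>The energy balance of a set of modes\<close>

definition high :: "real \<Rightarrow> mode set" where
  "high \<kappa> = {m \<in> modes. \<kappa> \<le> kbar Lx Ly m}"

definition between :: "real \<Rightarrow> real \<Rightarrow> mode set" where
  "between \<kappa> \<kappa>' = {m \<in> modes. \<kappa> \<le> kbar Lx Ly m \<and> kbar Lx Ly m < \<kappa>'}"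

lemma high_modes: "high \<kappa> \<subseteq> modes" "between \<kappa> \<kappa>' \<subseteq> modes"
  by (auto simp: high_def between_def)

lemma kbar_nonneg: "0 \<le> kbar Lx Ly m"
  by (auto simp: kbar_def split: prod.splits)

text \<open>The horizontal wavenumber is a function of the squared horizontal frequencies.\<close>

lemma saturated_wavenumber_range: "saturated (high \<kappa>)" "saturated (between \<kappa> \<kappa>')"
proof -
  have k: "kbar Lx Ly n = kbar Lx Ly m" if "(al n)\<^sup>2 = (al m)\<^sup>2" "(be n)\<^sup>2 = (be m)\<^sup>2" for m n
    using kbar_sq[of m] kbar_sq[of n] that kbar_nonneg[of m] kbar_nonneg[of n] power2_eq_iff_nonneg by metis
  show "saturated (high \<kappa>)" unfolding saturated_def
  proof (intro conjI high_modes ballI)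
    fix m n assume "m \<in> high \<kappa>" "n \<in> modes - high \<kappa>"
    then have "kbar Lx Ly n \<noteq> kbar Lx Ly m" unfolding high_def by auto
    then show "(al n)\<^sup>2 \<noteq> (al m)\<^sup>2 \<or> (be n)\<^sup>2 \<noteq> (be m)\<^sup>2" using k by blast
  qed
  show "saturated (between \<kappa> \<kappa>')" unfolding saturated_def
  proof (intro conjI high_modes ballI)
    fix m n assume "m \<in> between \<kappa> \<kappa>'" "n \<in> modes - between \<kappa> \<kappa>'"
    then have "kbar Lx Ly n \<noteq> kbar Lx Ly m" unfolding between_def by auto
    then show "(al n)\<^sup>2 \<noteq> (al m)\<^sup>2 \<or> (be n)\<^sup>2 \<noteq> (be m)\<^sup>2" using k by blast
  qed
qed

lemma high_eq_Un: "\<kappa> \<le> \<kappa>' \<Longrightarrow> high \<kappa> = between \<kappa> \<kappa>' \<union> high \<kappa>'" "between \<kappa> \<kappa>' \<inter> high \<kappa>' = {}"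
  by (auto simp: high_def between_def)

lemma band_eq_proj: "band Lx Ly h w \<kappa> \<infinity> = proj (high \<kappa>)"
  "band Lx Ly h w (kbar1 Lx Ly) (ereal \<kappa>) = proj (modes - high \<kappa>)"
proof -
  have 1: "{m \<in> modes. \<kappa> \<le> kbar Lx Ly m \<and> ereal (kbar Lx Ly m) < \<infinity>} = high \<kappa>" by (auto simp: high_def)
  have 2: "{m \<in> modes. kbar1 Lx Ly \<le> kbar Lx Ly m \<and> ereal (kbar Lx Ly m) < ereal \<kappa>} = modes - high \<kappa>"
    using kbar_ge by (auto simp: high_def)
  show "band Lx Ly h w \<kappa> \<infinity> = proj (high \<kappa>)" unfolding fun_eq_iff band_def proj_def 1 by simp
  show "band Lx Ly h w (kbar1 Lx Ly) (ereal \<kappa>) = proj (modes - high \<kappa>)" unfolding fun_eq_iff band_def proj_def 2 by simp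
qed

lemma low_energy_tendsto:
  assumes u: "u \<in> LL" and S: "S \<subseteq> modes"
  shows "(\<lambda>n. low_energy (trunc_set S n) u) \<longlonglongrightarrow> (nrm (proj S u))\<^sup>2"
  using has_sum_imp_trunc[OF Parseval_proj[OF u S]] unfolding low_energy_def .

text \<open>On \<open>Vdot\<close> the cutoff factors out, and the rest is the energy balance of the modes in \<open>F\<close>.\<close>

lemma F_pairing_test_gradient:
  assumes u: "u \<in> Vd" and F: "finite F" "F \<subseteq> modes"
  shows "F_pairing Lx Ly h \<nu> U u (test_gradient F R u) = - cutoff R (low_energy F u) *
    (ip (shear_term Lx Ly h U u) (comb (coef u) F) + \<nu> * (\<Sum>m\<in>F. lam m * (coef u m)\<^sup>2) + ip (conv Lx Ly h u u) (comb (coef u) F))"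
proof -
  have "ginner u (test_gradient F R u) = cutoff R (low_energy F u) * (\<Sum>m\<in>F. lam m * (coef u m)\<^sup>2)"
    unfolding test_gradient_def ginner_comb[OF F u] sum_distrib_left
    by (intro sum.cong refl) (simp add: power2_eq_square)
  then show ?thesis unfolding F_pairing_def unfolding test_gradient_eq ip_scale_right by (simp add: algebra_simps)
qed

text \<open>The rate at which energy passes between the modes of \<open>S\<close> and the imposed shear, counted as a loss of the modes.\<close>

definition shear_production :: "(real \<Rightarrow> real) \<Rightarrow> mode set \<Rightarrow> field \<Rightarrow> real" where
  "shear_production U S u = ip (\<lambda>x. deriv U (x $ 3) *\<^sub>R lift_shear (proj S u x)) (proj S u)"

lemma shear_term_eq: "shear_term Lx Ly h U u = (\<lambda>x. U (x $ 3) *\<^sub>R D 1 u x + deriv U (x $ 3) *\<^sub>R lift_shear (u x))"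
  by (simp add: shear_term_def lift_shear_def fun_eq_iff mult.commute)

lemma shear_term_saturated:
  assumes U: "shear_profile h U" and u: "u \<in> Vd" and S: "saturated S"
  shows "shear_term Lx Ly h U u \<in> LL" "ip (shear_term Lx Ly h U u) (proj S u) = shear_production U S u"
proof -
  note w = shear_profile_weights[OF U]
  have S1: "S \<subseteq> modes" using S unfolding saturated_def by auto
  note L = L2_weight[OF w(1) V_D(3)[OF Vd_D(1)[OF u]]] L2_weight[OF w(2) L2_lift_shear[OF Vd_D(3)[OF u]]]
  show "shear_term Lx Ly h U u \<in> LL" unfolding shear_term_eq by (rule L2_add[OF L])
  show "ip (shear_term Lx Ly h U u) (proj S u) = shear_production U S u"
    unfolding shear_term_eq ip_add_left[OF L proj(1)[OF Vd_D(3)[OF u] S1]] shear_production_def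
      advection_saturated[OF u S w(1)] shear_production_saturated[OF Vd_D(2)[OF u] S w(2)] by simp
qed

lemma shear_term_bound:
  assumes U: "shear_profile h U"
  obtains C where "0 \<le> C" "\<And>u. u \<in> Vd \<Longrightarrow> nrm (shear_term Lx Ly h U u) \<le> C * sqrt (gsq u)"
proof -
  note w = shear_profile_weights[OF U]
  obtain C1 where C1: "0 \<le> C1" "\<And>x. x \<in> Om \<Longrightarrow> \<bar>U (x $ 3)\<bar> \<le> C1" using weight_bound[OF w(1)] by blast
  obtain C2 where C2: "0 \<le> C2" "\<And>x. x \<in> Om \<Longrightarrow> \<bar>deriv U (x $ 3)\<bar> \<le> C2" using weight_bound[OF w(2)] by blast
  show ?thesis
  proof (rule that[of "C1 + C2 * sqrt poincare_const"])
    show "0 \<le> C1 + C2 * sqrt poincare_const" using C1(1) C2(1) poincare_const by simp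
    fix u assume u: "u \<in> Vd"
    note D1 = V_D(3)[OF Vd_D(1)[OF u]] and Ls = L2_lift_shear[OF Vd_D(3)[OF u]]
    have "nrm (shear_term Lx Ly h U u) \<le> nrm (\<lambda>x. U (x $ 3) *\<^sub>R D 1 u x) + nrm (\<lambda>x. deriv U (x $ 3) *\<^sub>R lift_shear (u x))"
      unfolding shear_term_eq by (rule nrm_triangle[OF L2_weight[OF w(1) D1] L2_weight[OF w(2) Ls]])
    also have "\<dots> \<le> \<bar>C1\<bar> * nrm (D 1 u) + \<bar>C2\<bar> * nrm (\<lambda>x. lift_shear (u x))"
      by (rule add_mono[OF nrm_mult_bounded[OF D1 weight_measurable[OF w(1)] C1(2)] nrm_mult_bounded[OF Ls weight_measurable[OF w(2)] C2(2)]])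
    also have "\<dots> \<le> C1 * sqrt (gsq u) + C2 * (sqrt poincare_const * sqrt (gsq u))"
    proof -
      have "nrm u \<le> sqrt (poincare_const * gsq u)" using h1sq_le(2)[OF u] by (rule real_le_rsqrt)
      then have "nrm (\<lambda>x. lift_shear (u x)) \<le> sqrt poincare_const * sqrt (gsq u)"
        using nrm_lift_shear[OF Vd_D(3)[OF u]] by (simp add: real_sqrt_mult)
      then show ?thesis using C1(1) C2(1) nrm_wd_le[of 1 u] by (simp add: add_mono mult_left_mono)
    qed
    also have "\<dots> = (C1 + C2 * sqrt poincare_const) * sqrt (gsq u)" by (simp add: algebra_simps)
    finally show "nrm (shear_term Lx Ly h U u) \<le> (C1 + C2 * sqrt poincare_const) * sqrt (gsq u)" .
  qed
qed

lemma F_pairing_tendsto: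
  assumes U: "shear_profile h U" and u: "u \<in> Vd" and S: "saturated S" and R: "R > 0"
  shows "(\<lambda>n. F_pairing Lx Ly h \<nu> U u (test_gradient (trunc_set S n) R u)) \<longlonglongrightarrow>
    - cutoff R ((nrm (proj S u))\<^sup>2) * (shear_production U S u + \<nu> * gsq (proj S u) + ip (conv Lx Ly h u u) (proj S u))"
proof -
  have S1: "S \<subseteq> modes" using S unfolding saturated_def by auto
  note uL = Vd_D(3)[OF u]
  have "(\<lambda>n. ip (comb (coef u) (trunc_set S n)) (shear_term Lx Ly h U u)) \<longlonglongrightarrow> ip (proj S u) (shear_term Lx Ly h U u)"
    by (rule ip_proj_seq[OF uL S1 shear_term_saturated(1)[OF U u S]])
  then have 1: "(\<lambda>n. ip (shear_term Lx Ly h U u) (comb (coef u) (trunc_set S n))) \<longlonglongrightarrow> shear_production U S u"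
    unfolding shear_term_saturated(2)[OF U u S, symmetric] by (simp only: ip_commute[of "shear_term Lx Ly h U u"])
  show ?thesis
    unfolding F_pairing_test_gradient[OF u trunc_modes[OF S1]]
    by (intro tendsto_mult tendsto_add tendsto_minus cutoff_tendsto R low_energy_tendsto uL S1 1 tendsto_const
        has_sum_imp_trunc[OF Vd_proj(3)[OF u S1]] conv_proj_seq u)
qed

text \<open>The shear term and the dissipation are quadratic in \<open>\<nabla>u\<close> at once; the convective term is so because the cutoff confines the test field to norm \<open>R\<close>.\<close>

lemma F_pairing_bound:
  assumes C: "0 \<le> C" "nrm (shear_term Lx Ly h U u) \<le> C * sqrt (gsq u)"
    and U: "shear_profile h U" and \<nu>: "0 \<le> \<nu>" and R: "R > 0" and u: "u \<in> Vd"
    and F: "finite F" "F \<subseteq> modes" and K: "\<And>m. m \<in> F \<Longrightarrow> kbar Lx Ly m \<le> K"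
  shows "\<bar>F_pairing Lx Ly h \<nu> U u (test_gradient F R u)\<bar> \<le> 2 * (C * sqrt poincare_const + \<nu> + convection_const K * R) * gsq u"
proof (cases "cutoff R (low_energy F u) = 0")
  case True
  then show ?thesis unfolding F_pairing_test_gradient[OF u F]
    using C(1) \<nu> R poincare_const convection_const_nonneg[of K] by simp
next
  case False
  let ?c = "comb (coef u) F"
  \<comment> \<open>Where the cutoff does not vanish, the test field has norm less than \<open>R\<close>.\<close>
  have le: "low_energy F u < R\<^sup>2" by (rule cutoff_bound(2)[OF R low_energy_nonneg False])
  have cn: "(nrm ?c)\<^sup>2 = low_energy F u" unfolding nrm_comb[OF F] low_energy_def ..
  have cR: "nrm ?c \<le> R" by (rule power2_le_imp_le) (use le cn R in linarith)+
  have cu: "nrm ?c \<le> sqrt poincare_const * sqrt (gsq u)"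
  proof -
    have "(nrm ?c)\<^sup>2 \<le> poincare_const * gsq u"
      unfolding nrm_comb[OF F] using Bessel(2)[OF F Vd_D(3)[OF u]] h1sq_le(2)[OF u] by linarith
    then have "nrm ?c \<le> sqrt (poincare_const * gsq u)" by (rule real_le_rsqrt)
    then show ?thesis by (simp add: real_sqrt_mult)
  qed
  have st: "shear_term Lx Ly h U u \<in> LL"
    by (rule shear_term_saturated(1)[OF U u saturated_wavenumber_range(1)])
  have "\<bar>ip (shear_term Lx Ly h U u) ?c\<bar> \<le> nrm (shear_term Lx Ly h U u) * nrm ?c"
    by (rule Cauchy_Schwarz_ip[OF st comb_facts(2)[OF F]])
  also have "\<dots> \<le> (C * sqrt (gsq u)) * (sqrt poincare_const * sqrt (gsq u))"
    by (intro mult_mono C cu) (use C(1) in simp_all)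
  also have "\<dots> = C * sqrt poincare_const * (sqrt (gsq u) * sqrt (gsq u))" by (simp only: ac_simps)
  also have "\<dots> = C * sqrt poincare_const * gsq u" by simp
  finally have 1: "\<bar>ip (shear_term Lx Ly h U u) ?c\<bar> \<le> C * sqrt poincare_const * gsq u" .
  have s0: "0 \<le> (\<Sum>m\<in>F. lam m * (coef u m)\<^sup>2)"
  proof (rule sum_nonneg)
    fix m assume "m \<in> F"
    then have "m \<in> modes" using F by blast
    then show "0 \<le> lam m * (coef u m)\<^sup>2" using lam_pos[of m] by simp
  qed
  have 2: "\<bar>\<nu> * (\<Sum>m\<in>F. lam m * (coef u m)\<^sup>2)\<bar> \<le> \<nu> * gsq u"
    using s0 \<nu> gradient_Bessel[OF F u] by (simp add: abs_mult mult_left_mono)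
  have "\<bar>ip (conv Lx Ly h u u) ?c\<bar> \<le> convection_const K * nrm ?c * gsq u" by (rule conv_band_limited_bound[OF u F K])
  also have "\<dots> \<le> convection_const K * R * gsq u" using cR convection_const_nonneg[of K] by (intro mult_right_mono mult_left_mono) auto
  finally have 3: "\<bar>ip (conv Lx Ly h u u) ?c\<bar> \<le> convection_const K * R * gsq u" .
  have "\<bar>ip (shear_term Lx Ly h U u) ?c + \<nu> * (\<Sum>m\<in>F. lam m * (coef u m)\<^sup>2) + ip (conv Lx Ly h u u) ?c\<bar>
    \<le> (C * sqrt poincare_const + \<nu> + convection_const K * R) * gsq u"
    using 1 2 3 unfolding distrib_right by linarith
  moreover have "\<bar>cutoff R (low_energy F u)\<bar> \<le> 2" by (rule cutoff_bound(1)[OF R low_energy_nonneg])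
  ultimately have "\<bar>cutoff R (low_energy F u)\<bar> * \<bar>ip (shear_term Lx Ly h U u) ?c + \<nu> * (\<Sum>m\<in>F. lam m * (coef u m)\<^sup>2) + ip (conv Lx Ly h u u) ?c\<bar>
    \<le> 2 * ((C * sqrt poincare_const + \<nu> + convection_const K * R) * gsq u)" by (intro mult_mono) auto
  then show ?thesis unfolding F_pairing_test_gradient[OF u F] abs_mult abs_minus_cancel by (simp only: mult.assoc)
qed

text \<open>Pointwise \<open>|v\<^sub>1 v\<^sub>3| \<le> |v|\<^sup>2/2\<close>.\<close>

lemma shear_production_bound:
  assumes U: "shear_profile h U" and u: "u \<in> LL" and S: "S \<subseteq> modes"
  shows "\<bar>shear_production U S u\<bar> \<le> shear_rate h U / 2 * (nrm (proj S u))\<^sup>2"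
proof -
  let ?r = "proj S u"
  note w = shear_profile_weights[OF U] and r = proj(1)[OF u S]
  have pt: "\<bar>deriv U (x $ 3) *\<^sub>R lift_shear (?r x) \<bullet> ?r x\<bar> \<le> shear_rate h U / 2 * (norm (?r x))\<^sup>2" if x: "x \<in> Om" for x
  proof -
    let ?y = "?r x"
    have z: "x $ 3 \<in> {- h/2<..<h/2}" using x by (simp add: Omega_def)
    have "lift_shear ?y \<bullet> ?y = ?y $ 3 * ?y $ 1" by (simp add: lift_shear_def inner_axis inner_axis')
    moreover have "\<bar>?y $ 3 * ?y $ 1\<bar> \<le> 1 / 2 * (norm ?y)\<^sup>2"
    proof -
      have n: "(norm ?y)\<^sup>2 = (?y $ 1)\<^sup>2 + (?y $ 2)\<^sup>2 + (?y $ 3)\<^sup>2"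
        by (simp add: norm_vec_def L2_set_def sum_3 sum_nonneg)
      have "\<bar>a * b\<bar> \<le> 1 / 2 * (b\<^sup>2 + c\<^sup>2 + a\<^sup>2)" for a b c :: real
      proof -
        define p where "p = \<bar>a * b\<bar>"
        have "2 * p \<le> a\<^sup>2 + b\<^sup>2"
          using sum_squares_bound[of "\<bar>a\<bar>" "\<bar>b\<bar>"] unfolding p_def by (simp add: abs_mult mult.assoc)
        moreover have "a\<^sup>2 + b\<^sup>2 \<le> b\<^sup>2 + c\<^sup>2 + a\<^sup>2" by simp
        ultimately have "2 * p \<le> b\<^sup>2 + c\<^sup>2 + a\<^sup>2" by (rule order_trans)
        then show ?thesis unfolding p_def[symmetric] by simp
      qed
      then show ?thesis unfolding n .
    qed
    ultimately have "\<bar>lift_shear ?y \<bullet> ?y\<bar> \<le> 1 / 2 * (norm ?y)\<^sup>2" by simp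
    then have "\<bar>deriv U (x $ 3)\<bar> * \<bar>lift_shear ?y \<bullet> ?y\<bar> \<le> shear_rate h U * (1 / 2 * (norm ?y)\<^sup>2)"
      by (intro mult_mono shear_rate_bound[OF U z] shear_rate_nonneg[OF U]) auto
    then show ?thesis by (simp add: abs_mult)
  qed
  have "\<bar>shear_production U S u\<bar> \<le> (LINT x|M. \<bar>deriv U (x $ 3) *\<^sub>R lift_shear (?r x) \<bullet> ?r x\<bar>)"
    unfolding shear_production_def l2inner_def by (rule integral_abs_bound)
  also have "\<dots> \<le> (LINT x|M. shear_rate h U / 2 * (norm (?r x))\<^sup>2)"
    using pt L2D(2)[OF r] by (intro integral_mono integrable_abs L2_inner_integrable L2_weight[OF w(2) L2_lift_shear[OF r]] r) simp_all
  finally show ?thesis by (simp add: nrm_sq ip_self)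
qed

lemma proj_high_tail: "u \<in> Vd \<Longrightarrow> 0 < \<kappa> \<Longrightarrow> (nrm (proj (high \<kappa>) u))\<^sup>2 \<le> gsq u / \<kappa>\<^sup>2"
proof -
  assume u: "u \<in> Vd" and k: "0 < \<kappa>"
  have 1: "((\<lambda>m. \<kappa>\<^sup>2 * (coef u m)\<^sup>2) has_sum \<kappa>\<^sup>2 * (nrm (proj (high \<kappa>) u))\<^sup>2) (high \<kappa>)"
    by (intro has_sum_cmult_right Parseval_proj Vd_D(3) u high_modes)
  have "\<kappa>\<^sup>2 * (nrm (proj (high \<kappa>) u))\<^sup>2 \<le> gsq (proj (high \<kappa>) u)"
  proof (rule has_sum_mono[OF 1 Vd_proj(3)[OF u high_modes(1)]])
    fix m assume "m \<in> high \<kappa>"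
    then have "\<kappa>\<^sup>2 \<le> (kbar Lx Ly m)\<^sup>2" using k unfolding high_def by (intro power_mono) auto
    then show "\<kappa>\<^sup>2 * (coef u m)\<^sup>2 \<le> lam m * (coef u m)\<^sup>2" using lam_ge[of m] by (intro mult_right_mono) auto
  qed
  also have "\<dots> \<le> gsq u" by (rule gsq_proj_le[OF u high_modes(1)])
  finally show ?thesis using k by (simp add: field_simps)
qed

text \<open>Monotone convergence of the series: finitely many modes that come close to the sum have bounded wavenumbers.\<close>

lemma gsq_between_tendsto:
  assumes u: "u \<in> Vd" shows "((\<lambda>\<kappa>'. gsq (proj (between \<kappa> \<kappa>') u)) \<longlongrightarrow> gsq (proj (high \<kappa>) u)) at_top"
proof (rule order_tendstoI)
  note H = Vd_proj(3)[OF u high_modes(1)[of \<kappa>]] and B = Vd_proj(3)[OF u high_modes(2)[of \<kappa>]]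
  have nn: "0 \<le> lam m * (coef u m)\<^sup>2" if "m \<in> modes" for m using lam_pos[OF that] by simp
  {
    fix a assume "a < gsq (proj (high \<kappa>) u)"
    then have "eventually (\<lambda>F. a < (\<Sum>m\<in>F. lam m * (coef u m)\<^sup>2)) (finite_subsets_at_top (high \<kappa>))"
      using H unfolding has_sum_def by (rule order_tendstoD(1)[rotated])
    then obtain F where F: "finite F" "F \<subseteq> high \<kappa>" "a < (\<Sum>m\<in>F. lam m * (coef u m)\<^sup>2)"
      unfolding eventually_finite_subsets_at_top by blast
    have "eventually (\<lambda>\<kappa>'. \<forall>m\<in>F. kbar Lx Ly m < \<kappa>') at_top"
      using F(1) by (intro eventually_ball_finite ballI eventually_gt_at_top)
    then show "eventually (\<lambda>\<kappa>'. a < gsq (proj (between \<kappa> \<kappa>') u)) at_top"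
    proof eventually_elim
      case (elim \<kappa>')
      have FB: "F \<subseteq> between \<kappa> \<kappa>'" using elim F(2) unfolding between_def high_def by blast
      have "(\<Sum>m\<in>F. lam m * (coef u m)\<^sup>2) \<le> gsq (proj (between \<kappa> \<kappa>') u)"
      proof (rule has_sum_mono_neutral[OF has_sum_finite[OF F(1)] B])
        fix m assume "m \<in> between \<kappa> \<kappa>' - F"
        then show "0 \<le> lam m * (coef u m)\<^sup>2" using nn high_modes by blast
      qed (use FB in auto)
      then show ?case using F(3) by simp
    qed
  }
  fix a assume a: "gsq (proj (high \<kappa>) u) < a"
  have "gsq (proj (between \<kappa> \<kappa>') u) \<le> gsq (proj (high \<kappa>) u)" for \<kappa>'
  proof (rule has_sum_mono_neutral[OF B H])
    fix m assume "m \<in> high \<kappa> - between \<kappa> \<kappa>'"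
    then show "0 \<le> lam m * (coef u m)\<^sup>2" using nn high_modes by blast
  next
    fix m assume "m \<in> between \<kappa> \<kappa>' - high \<kappa>"
    then show "lam m * (coef u m)\<^sup>2 \<le> 0" unfolding between_def high_def by blast
  qed auto
  then show "eventually (\<lambda>\<kappa>'. gsq (proj (between \<kappa> \<kappa>') u) < a) at_top"
    using a by (intro always_eventually allI) (rule le_less_trans)
qed

text \<open>Written as the product with the fixed square-integrable shear term of \<open>u\<close>, it is linear in the band; the remainder is controlled by the tail of \<open>u\<close>.\<close>

lemma shear_production_between_tendsto:
  assumes U: "shear_profile h U" and u: "u \<in> Vd"
  shows "((\<lambda>\<kappa>'. shear_production U (between \<kappa> \<kappa>') u) \<longlongrightarrow> shear_production U (high \<kappa>) u) at_top"
proof -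
  note w = shear_profile_weights[OF U] and uL = Vd_D(3)[OF u]
  let ?b = "\<lambda>\<kappa>'. proj (between \<kappa> \<kappa>') u" and ?r = "proj (high \<kappa>) u"
  let ?v = "shear_term Lx Ly h U u"
  have v: "?v \<in> LL" by (rule shear_term_saturated(1)[OF U u saturated_wavenumber_range(1)])
  have e: "ip ?r ?v = ip (?b \<kappa>') ?v + ip (proj (high \<kappa>') u) ?v" if "\<kappa> \<le> \<kappa>'" for \<kappa>'
  proof -
    have "AE x in M. ?r x = ?b \<kappa>' x + proj (high \<kappa>') u x"
      unfolding high_eq_Un(1)[OF that] by (rule proj_union[OF uL high_modes(2,1) high_eq_Un(2)])
    then have "ip ?r ?v = ip (\<lambda>x. ?b \<kappa>' x + proj (high \<kappa>') u x) ?v"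
      by (rule ip_cong_AE) (intro AE_I2 refl L2D(1) L2_add proj(1) uL high_modes v)+
    also have "\<dots> = ip (?b \<kappa>') ?v + ip (proj (high \<kappa>') u) ?v"
      by (rule ip_add_left[OF proj(1)[OF uL high_modes(2)] proj(1)[OF uL high_modes(1)] v])
    finally show ?thesis .
  qed
  have "((\<lambda>\<kappa>'. ip (proj (high \<kappa>') u) ?v) \<longlongrightarrow> 0) at_top"
  proof (rule Lim_null_comparison)
    show "\<forall>\<^sub>F \<kappa>' in at_top. norm (ip (proj (high \<kappa>') u) ?v) \<le> sqrt (gsq u / \<kappa>'\<^sup>2) * nrm ?v"
      using eventually_gt_at_top[of 0]
    proof eventually_elim
      case (elim \<kappa>')
      have "nrm (proj (high \<kappa>') u) \<le> sqrt (gsq u / \<kappa>'\<^sup>2)" by (rule real_le_rsqrt[OF proj_high_tail[OF u elim]])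
      then have "nrm (proj (high \<kappa>') u) * nrm ?v \<le> sqrt (gsq u / \<kappa>'\<^sup>2) * nrm ?v" by (rule mult_right_mono) simp
      then show ?case using Cauchy_Schwarz_ip[OF proj(1)[OF uL high_modes(1)] v, of \<kappa>'] by simp
    qed
    have "((\<lambda>\<kappa>'. gsq u / \<kappa>'\<^sup>2) \<longlongrightarrow> 0) at_top"
      by (intro tendsto_divide_0[OF tendsto_const] filterlim_at_top_imp_at_infinity filterlim_pow_at_top filterlim_ident) simp
    from tendsto_mult_right[OF tendsto_real_sqrt[OF this], of "nrm ?v"]
    show "((\<lambda>\<kappa>'. sqrt (gsq u / \<kappa>'\<^sup>2) * nrm ?v) \<longlongrightarrow> 0) at_top" by simp
  qed
  from tendsto_diff[OF tendsto_const[of "ip ?r ?v"] this]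
  have "((\<lambda>\<kappa>'. ip ?r ?v - ip (proj (high \<kappa>') u) ?v) \<longlongrightarrow> ip ?r ?v) at_top" by simp
  moreover have "eventually (\<lambda>\<kappa>'. ip ?r ?v - ip (proj (high \<kappa>') u) ?v = ip (?b \<kappa>') ?v) at_top"
    using eventually_ge_at_top[of \<kappa>] by eventually_elim (use e in simp)
  ultimately have "((\<lambda>\<kappa>'. ip (?b \<kappa>') ?v) \<longlongrightarrow> ip ?r ?v) at_top" by (rule Lim_transform_eventually)
  then show ?thesis
    unfolding shear_term_saturated(2)[OF U u saturated_wavenumber_range(1), symmetric] shear_term_saturated(2)[OF U u saturated_wavenumber_range(2), symmetric]
    by (simp only: ip_commute[of ?v])
qed

end

section \<open>Balances in the mean\<close>

locale stationary_statistics = stokes_modes +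
  fixes \<nu> :: real and U :: "real \<Rightarrow> real" and \<mu> :: "field measure"
  assumes viscosity_pos: "0 < \<nu>" and profile: "shear_profile h U"
    and stationary: "foias_prodi Lx Ly h \<nu> U \<mu>"
    and flux_integrable: "\<And>\<kappa>. kbar1 Lx Ly \<le> \<kappa> \<Longrightarrow> integrable \<mu> (flux_integrand Lx Ly h w \<kappa>)"
begin

abbreviation "flux \<equiv> flux_integrand Lx Ly h w"

definition balance :: "mode set \<Rightarrow> field \<Rightarrow> real" where
  "balance S u = shear_production U S u + \<nu> * gsq (proj S u)"

lemma \<mu>_facts: "space \<mu> = Hd" "sets \<mu> = sets NN" "AE u in \<mu>. u \<in> Vd" "integrable \<mu> gsq"
  using stationary unfolding foias_prodi_def by blast+

lemma measurable_\<mu>: "f \<in> borel_measurable NN \<Longrightarrow> f \<in> borel_measurable \<mu>"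
  using measurable_cong_sets[OF \<mu>_facts(2) refl] by blast

lemma flux_split:
  assumes "\<kappa> \<le> \<kappa>'" and u: "u \<in> Vd"
  shows "ip (conv Lx Ly h u u) (proj (between \<kappa> \<kappa>') u) = flux \<kappa> u - flux \<kappa>' u"
  using conv_proj_union[OF u high_modes(2,1) high_eq_Un(2), of \<kappa> \<kappa>']
  unfolding flux_integrand_def band_eq_proj high_eq_Un(1)[OF assms(1)] by simp

lemma measurable_statistics:
  assumes S: "S \<subseteq> modes"
  shows "(\<lambda>u. (nrm (proj S u))\<^sup>2) \<in> borel_measurable \<mu>" "(\<lambda>u. gsq (proj S u)) \<in> borel_measurable \<mu>"
    "(\<lambda>u. hgrad_sq Lx Ly h (proj S u)) \<in> borel_measurable \<mu>" "shear_production U S \<in> borel_measurable \<mu>"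
proof -
  note P = L2cont_proj[OF S] and w = shear_profile_weights(2)[OF profile]
  show "(\<lambda>u. (nrm (proj S u))\<^sup>2) \<in> borel_measurable \<mu>" unfolding nrm_sq by (intro measurable_\<mu> L2cont_ip_measurable P)
  show "(\<lambda>u. gsq (proj S u)) \<in> borel_measurable \<mu>"
    unfolding grad_sq_def grad_inner_def by (intro measurable_\<mu> borel_measurable_sum wd_sq_measurable P)
  show "(\<lambda>u. hgrad_sq Lx Ly h (proj S u)) \<in> borel_measurable \<mu>"
    unfolding hgrad_sq_def by (intro measurable_\<mu> borel_measurable_sum wd_sq_measurable P)
  have "L2cont (\<lambda>u x. lift_shear (proj S u x))"
    unfolding L2cont_def
  proof (intro conjI ballI allI impI)
    show "(\<lambda>x. lift_shear (proj S u x)) \<in> LL" if "u \<in> Hd" for u by (rule L2_lift_shear[OF proj(1)[OF Hd_L2[OF that] S]])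
    fix f u assume t: "tends f u"
    show "(\<lambda>n. nrm (\<lambda>x. lift_shear (proj S (f n) x) - lift_shear (proj S u x))) \<longlonglongrightarrow> 0"
    proof (rule Lim_null_comparison[OF _ L2contD(2)[OF P t]])
      have "nrm (\<lambda>x. lift_shear (proj S (f n) x) - lift_shear (proj S u x)) \<le> nrm (\<lambda>x. proj S (f n) x - proj S u x)" for n
        unfolding lift_shear_diff[symmetric] by (intro nrm_lift_shear L2_diff proj(1) S tends_D(3)[OF t] tends_D(4)[OF t])
      then show "\<forall>\<^sub>F n in sequentially. norm (nrm (\<lambda>x. lift_shear (proj S (f n) x) - lift_shear (proj S u x))) \<le> nrm (\<lambda>x. proj S (f n) x - proj S u x)"
        by simp
    qed
  qed
  from L2cont_ip_measurable[OF L2cont_weight[OF w this] P]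
  have "(\<lambda>u. ip (\<lambda>x. deriv U (x $ 3) *\<^sub>R lift_shear (proj S u x)) (proj S u)) \<in> borel_measurable NN" .
  then show "shear_production U S \<in> borel_measurable \<mu>" using measurable_\<mu> unfolding shear_production_def by blast
qed

lemma hgrad_sq_bounds: "0 \<le> hgrad_sq Lx Ly h u" "hgrad_sq Lx Ly h u \<le> gsq u"
proof -
  show "0 \<le> hgrad_sq Lx Ly h u" unfolding hgrad_sq_def by (intro sum_nonneg) simp
  show "hgrad_sq Lx Ly h u \<le> gsq u" unfolding hgrad_sq_def grad_sq_def grad_inner_def by (intro sum_mono2) auto
qed

lemma statistics_bounds:
  assumes u: "u \<in> Vd" and S: "S \<subseteq> modes"
  shows "(nrm (proj S u))\<^sup>2 \<le> poincare_const * gsq u" "\<bar>shear_production U S u\<bar> \<le> shear_rate h U / 2 * poincare_const * gsq u"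
    "\<bar>balance S u\<bar> \<le> (shear_rate h U / 2 * poincare_const + \<nu>) * gsq u"
proof -
  have "(nrm (proj S u))\<^sup>2 \<le> (nrm u)\<^sup>2" using nrm_proj_le[OF Vd_D(3)[OF u] S] by (intro power_mono) auto
  then show 1: "(nrm (proj S u))\<^sup>2 \<le> poincare_const * gsq u" using h1sq_le(2)[OF u] by linarith
  have "shear_rate h U / 2 * (nrm (proj S u))\<^sup>2 \<le> shear_rate h U / 2 * (poincare_const * gsq u)"
    using 1 shear_rate_nonneg[OF profile] by (intro mult_left_mono) auto
  then show 2: "\<bar>shear_production U S u\<bar> \<le> shear_rate h U / 2 * poincare_const * gsq u"
    using shear_production_bound[OF profile Vd_D(3)[OF u] S] unfolding mult.assoc by linarith
  have "0 \<le> \<nu> * gsq (proj S u)" using viscosity_pos by simp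
  moreover have "\<nu> * gsq (proj S u) \<le> \<nu> * gsq u" using viscosity_pos gsq_proj_le[OF u S] by simp
  ultimately show "\<bar>balance S u\<bar> \<le> (shear_rate h U / 2 * poincare_const + \<nu>) * gsq u"
    using 2 unfolding balance_def distrib_right by linarith
qed

lemma integrable_of_gradient_bound:
  fixes f :: "field \<Rightarrow> real"
  assumes "f \<in> borel_measurable \<mu>" "\<And>u. u \<in> Vd \<Longrightarrow> \<bar>f u\<bar> \<le> C * gsq u" shows "integrable \<mu> f"
proof (rule Bochner_Integration.integrable_bound[OF integrable_mult_right[OF \<mu>_facts(4), of "\<bar>C\<bar>"] assms(1)])
  show "AE u in \<mu>. norm (f u) \<le> norm (\<bar>C\<bar> * gsq u)" using \<mu>_facts(3)
  proof eventually_elim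
    case (elim u)
    have "\<bar>f u\<bar> \<le> C * gsq u" by (rule assms(2)[OF elim])
    also have "\<dots> \<le> \<bar>C\<bar> * gsq u" by (intro mult_right_mono) auto
    finally show ?case by simp
  qed
qed

lemma integrable_statistics:
  assumes S: "S \<subseteq> modes"
  shows "integrable \<mu> (\<lambda>u. (nrm (proj S u))\<^sup>2)" "integrable \<mu> (\<lambda>u. gsq (proj S u))"
    "integrable \<mu> (\<lambda>u. hgrad_sq Lx Ly h (proj S u))" "integrable \<mu> (shear_production U S)" "integrable \<mu> (balance S)"
proof -
  note m = measurable_statistics[OF S]
  show "integrable \<mu> (\<lambda>u. (nrm (proj S u))\<^sup>2)"
    by (rule integrable_of_gradient_bound[OF m(1), where C = poincare_const]) (use statistics_bounds(1)[OF _ S] in simp)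
  show G: "integrable \<mu> (\<lambda>u. gsq (proj S u))"
    by (rule integrable_of_gradient_bound[OF m(2), where C = 1]) (use gsq_proj_le[OF _ S] in simp)
  show "integrable \<mu> (\<lambda>u. hgrad_sq Lx Ly h (proj S u))"
  proof (rule integrable_of_gradient_bound[OF m(3), where C = 1])
    fix u assume "u \<in> Vd"
    then show "\<bar>hgrad_sq Lx Ly h (proj S u)\<bar> \<le> 1 * gsq u"
      using hgrad_sq_bounds[of "proj S u"] gsq_proj_le[OF _ S, of u] by simp
  qed
  show P: "integrable \<mu> (shear_production U S)"
    by (rule integrable_of_gradient_bound[OF m(4), where C = "shear_rate h U / 2 * poincare_const"]) (use statistics_bounds(2)[OF _ S] in blast)
  have "integrable \<mu> (\<lambda>u. shear_production U S u + \<nu> * gsq (proj S u))"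
    by (intro Bochner_Integration.integrable_add P integrable_mult_right G)
  then show "integrable \<mu> (balance S)" unfolding balance_def .
qed

lemma stationary_test:
  assumes F: "finite F" "F \<subseteq> modes" and R: "R > 0"
  shows "(LINT u|\<mu>. F_pairing Lx Ly h \<nu> U u (test_gradient F R u)) = 0"
proof -
  have "\<forall>u\<in>Hd. has_gradient Lx Ly h (\<lambda>u. cutoff_energy R (low_energy F u)) u (test_gradient F R u) \<and> test_gradient F R u \<in> Vd"
    using has_gradient_cutoff_energy[OF F R] comb_Hdot(2)[OF F] unfolding test_gradient_def by blast
  then show ?thesis using stationary cylindrical_cutoff_energy[OF F R] unfolding foias_prodi_def by blast
qed

text \<open>The limit of all vertical modes at fixed \<open>R\<close>: the integrals vanish by stationarity, and both the pointwise limit and a dominating multiple of \<open>\<parallel>\<nabla>u\<parallel>\<^sup>2\<close> are available on \<open>Vdot\<close>, which carries the measure.\<close>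

lemma cutoff_balance:
  assumes k: "kbar1 Lx Ly \<le> \<kappa>" "\<kappa> \<le> \<kappa>'" and R: "R > 0"
  shows "(LINT u|\<mu>. - cutoff R ((nrm (proj (between \<kappa> \<kappa>') u))\<^sup>2) * (balance (between \<kappa> \<kappa>') u + (flux \<kappa> u - flux \<kappa>' u))) = 0"
proof -
  let ?B = "between \<kappa> \<kappa>'"
  let ?F = "trunc_set ?B"
  let ?p = "\<lambda>n u. F_pairing Lx Ly h \<nu> U u (test_gradient (?F n) R u)"
  let ?G = "\<lambda>u. - cutoff R ((nrm (proj ?B u))\<^sup>2) * (balance ?B u + (flux \<kappa> u - flux \<kappa>' u))"
  note B = high_modes(2)[of \<kappa> \<kappa>'] and F = trunc_modes[OF high_modes(2)[of \<kappa> \<kappa>']]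
  note fl = flux_integrable[OF k(1)] flux_integrable[OF order_trans[OF k]]
  obtain C where C: "0 \<le> C" "\<And>u. u \<in> Vd \<Longrightarrow> nrm (shear_term Lx Ly h U u) \<le> C * sqrt (gsq u)"
    using shear_term_bound[OF profile] by blast
  have "(\<lambda>n. LINT u|\<mu>. ?p n u) \<longlonglongrightarrow> (LINT u|\<mu>. ?G u)"
  proof (rule integral_dominated_convergence[where w = "\<lambda>u. 2 * (C * sqrt poincare_const + \<nu> + convection_const \<kappa>' * R) * gsq u"])
    have "(\<lambda>u. cutoff R ((nrm (proj ?B u))\<^sup>2)) \<in> borel_measurable \<mu>"
    proof -
      have "cutoff R \<in> borel_measurable borel"
        using cutoff_continuous[OF R continuous_on_id] by (intro borel_measurable_continuous_onI) simp
      from measurable_compose[OF measurable_statistics(1)[OF B] this] show ?thesis .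
    qed
    then show "?G \<in> borel_measurable \<mu>"
      using borel_measurable_integrable[OF fl(1)] borel_measurable_integrable[OF fl(2)] borel_measurable_integrable[OF integrable_statistics(5)[OF B]]
      by (intro borel_measurable_times borel_measurable_uminus borel_measurable_add borel_measurable_diff)
    show "?p n \<in> borel_measurable \<mu>" for n
      unfolding test_gradient_def
      by (rule measurable_\<mu>[OF F_pairing_measurable[OF profile F, where c = "\<lambda>m u. cutoff R (low_energy (?F n) u) * coef u m"]])
         (rule continuous_coef_cutoff[OF F(2) R])
    show "integrable \<mu> (\<lambda>u. 2 * (C * sqrt poincare_const + \<nu> + convection_const \<kappa>' * R) * gsq u)"
      by (rule integrable_mult_right[OF \<mu>_facts(4)])
    show "AE u in \<mu>. (\<lambda>n. ?p n u) \<longlonglongrightarrow> ?G u" using \<mu>_facts(3)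
    proof eventually_elim
      case (elim u)
      show ?case
        using F_pairing_tendsto[OF profile elim saturated_wavenumber_range(2) R, of \<nu> \<kappa> \<kappa>']
        unfolding balance_def flux_split[OF k(2) elim] .
    qed
    show "AE u in \<mu>. norm (?p n u) \<le> 2 * (C * sqrt poincare_const + \<nu> + convection_const \<kappa>' * R) * gsq u" for n using \<mu>_facts(3)
    proof eventually_elim
      case (elim u)
      have "kbar Lx Ly m \<le> \<kappa>'" if "m \<in> ?F n" for m
        using subsetD[OF trunc_set(2) that] unfolding between_def by simp
      then show ?case
        using F_pairing_bound[OF C(1) C(2)[OF elim] profile less_imp_le[OF viscosity_pos] R elim F] by (simp add: real_norm_def)
    qed
  qed
  moreover have "(LINT u|\<mu>. ?p n u) = 0" for n by (rule stationary_test[OF F R])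
  ultimately have "(\<lambda>n. 0 :: real) \<longlonglongrightarrow> (LINT u|\<mu>. ?G u)" by (simp only:)
  then show ?thesis unfolding LIMSEQ_const_iff by (rule sym)
qed

text \<open>Removal of the cutoff. What the convective term leaves is the difference of the fluxes through \<open>\<kappa>\<close> and \<open>\<kappa>'\<close>.\<close>

lemma energy_balance_between:
  assumes k: "kbar1 Lx Ly \<le> \<kappa>" "\<kappa> \<le> \<kappa>'"
  shows "(LINT u|\<mu>. balance (between \<kappa> \<kappa>') u) = (LINT u|\<mu>. flux \<kappa>' u) - (LINT u|\<mu>. flux \<kappa> u)"
proof -
  let ?B = "between \<kappa> \<kappa>'"
  let ?Q = "\<lambda>u. balance ?B u + (flux \<kappa> u - flux \<kappa>' u)"
  note B = high_modes(2)[of \<kappa> \<kappa>']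
  note fl = flux_integrable[OF k(1)] flux_integrable[OF order_trans[OF k]] and bl = integrable_statistics(5)[OF B]
  have Q: "integrable \<mu> ?Q" by (intro Bochner_Integration.integrable_add Bochner_Integration.integrable_diff fl bl)
  let ?c = "\<lambda>n u. cutoff (real (Suc n)) ((nrm (proj ?B u))\<^sup>2)"
  have "(\<lambda>n. LINT u|\<mu>. - ?c n u * ?Q u) \<longlonglongrightarrow> (LINT u|\<mu>. - ?Q u)"
  proof (rule integral_dominated_convergence[where w = "\<lambda>u. 2 * \<bar>?Q u\<bar>"])
    show "(\<lambda>u. - ?Q u) \<in> borel_measurable \<mu>" using borel_measurable_integrable[OF Q] by (rule borel_measurable_uminus)
    show "(\<lambda>u. - ?c n u * ?Q u) \<in> borel_measurable \<mu>" for n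
    proof -
      have "cutoff (real (Suc n)) \<in> borel_measurable borel"
        using cutoff_continuous[of "real (Suc n)", OF _ continuous_on_id] by (intro borel_measurable_continuous_onI) simp
      from measurable_compose[OF measurable_statistics(1)[OF B] this] borel_measurable_integrable[OF Q]
      show ?thesis by (intro borel_measurable_times borel_measurable_uminus)
    qed
    show "integrable \<mu> (\<lambda>u. 2 * \<bar>?Q u\<bar>)" by (intro integrable_mult_right integrable_abs Q)
    show "AE u in \<mu>. (\<lambda>n. - ?c n u * ?Q u) \<longlonglongrightarrow> - ?Q u"
    proof (rule AE_I2)
      fix u
      from tendsto_mult[OF tendsto_minus[OF cutoff_tendsto_1[of "(nrm (proj ?B u))\<^sup>2"]] tendsto_const[of "?Q u"]]
      show "(\<lambda>n. - ?c n u * ?Q u) \<longlonglongrightarrow> - ?Q u" by simp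
    qed
    show "AE u in \<mu>. norm (- ?c n u * ?Q u) \<le> 2 * \<bar>?Q u\<bar>" for n
    proof (rule AE_I2)
      fix u
      have "\<bar>?c n u\<bar> * \<bar>?Q u\<bar> \<le> 2 * \<bar>?Q u\<bar>" by (intro mult_right_mono cutoff_bound(1)) auto
      then show "norm (- ?c n u * ?Q u) \<le> 2 * \<bar>?Q u\<bar>" unfolding real_norm_def abs_mult abs_minus_cancel .
    qed
  qed
  moreover have "(LINT u|\<mu>. - ?c n u * ?Q u) = 0" for n by (rule cutoff_balance[OF k]) simp
  ultimately have "(\<lambda>n. 0 :: real) \<longlonglongrightarrow> (LINT u|\<mu>. - ?Q u)" by (simp only:)
  then have "(LINT u|\<mu>. ?Q u) = 0" unfolding LIMSEQ_const_iff Bochner_Integration.integral_minus by linarith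
  moreover have "(LINT u|\<mu>. ?Q u) = (LINT u|\<mu>. balance ?B u) + ((LINT u|\<mu>. flux \<kappa> u) - (LINT u|\<mu>. flux \<kappa>' u))"
    by (simp only: Bochner_Integration.integral_add[OF bl Bochner_Integration.integrable_diff[OF fl]] Bochner_Integration.integral_diff[OF fl])
  ultimately show ?thesis by simp
qed

lemma integral_balance_tendsto:
  "((\<lambda>\<kappa>'. LINT u|\<mu>. balance (between \<kappa> \<kappa>') u) \<longlongrightarrow> (LINT u|\<mu>. balance (high \<kappa>) u)) at_top"
proof (rule integral_dominated_convergence_at_top[where w = "\<lambda>u. (shear_rate h U / 2 * poincare_const + \<nu>) * gsq u"])
  show "balance (high \<kappa>) \<in> borel_measurable \<mu>" by (intro borel_measurable_integrable integrable_statistics high_modes)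
  show "balance (between \<kappa> \<kappa>') \<in> borel_measurable \<mu>" for \<kappa>' by (intro borel_measurable_integrable integrable_statistics high_modes)
  show "integrable \<mu> (\<lambda>u. (shear_rate h U / 2 * poincare_const + \<nu>) * gsq u)" by (rule integrable_mult_right[OF \<mu>_facts(4)])
  show "AE u in \<mu>. ((\<lambda>\<kappa>'. balance (between \<kappa> \<kappa>') u) \<longlongrightarrow> balance (high \<kappa>) u) at_top" using \<mu>_facts(3)
    by eventually_elim (unfold balance_def, intro tendsto_add tendsto_mult_left shear_production_between_tendsto gsq_between_tendsto profile)
  show "\<forall>\<^sub>F \<kappa>' in at_top. AE u in \<mu>. norm (balance (between \<kappa> \<kappa>') u) \<le> (shear_rate h U / 2 * poincare_const + \<nu>) * gsq u"
  proof (rule always_eventually, rule allI)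
    fix \<kappa>'
    show "AE u in \<mu>. norm (balance (between \<kappa> \<kappa>') u) \<le> (shear_rate h U / 2 * poincare_const + \<nu>) * gsq u" using \<mu>_facts(3)
      unfolding real_norm_def by eventually_elim (rule statistics_bounds(3)[OF _ high_modes(2)])
  qed
qed

text \<open>The flux through \<open>\<kappa>'\<close> differs from the flux through \<open>\<kappa>\<close> by a mean that has a limit, so the flux at infinity exists.\<close>

lemma restricted_flux_eq:
  assumes k: "kbar1 Lx Ly \<le> \<kappa>"
  shows "restricted_flux Lx Ly h \<mu> w \<kappa> = kappa1 Lx Ly h ^ 3 * (LINT u|\<mu>. balance (high \<kappa>) u)"
proof -
  let ?E = "energy_flux Lx Ly h \<mu> w" and ?k = "kappa1 Lx Ly h ^ 3"
  have e: "?E \<kappa>' = ?E \<kappa> - ?k * (LINT u|\<mu>. balance (between \<kappa> \<kappa>') u)" if "\<kappa> \<le> \<kappa>'" for \<kappa>'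
    unfolding energy_flux_def energy_balance_between[OF k that] by (simp add: algebra_simps)
  have "((\<lambda>\<kappa>'. ?E \<kappa> - ?k * (LINT u|\<mu>. balance (between \<kappa> \<kappa>') u)) \<longlongrightarrow> ?E \<kappa> - ?k * (LINT u|\<mu>. balance (high \<kappa>) u)) at_top"
    by (intro tendsto_diff tendsto_const tendsto_mult_left integral_balance_tendsto)
  moreover have "eventually (\<lambda>\<kappa>'. ?E \<kappa> - ?k * (LINT u|\<mu>. balance (between \<kappa> \<kappa>') u) = ?E \<kappa>') at_top"
    using eventually_ge_at_top[of \<kappa>] by eventually_elim (rule e[symmetric])
  ultimately have "(?E \<longlongrightarrow> ?E \<kappa> - ?k * (LINT u|\<mu>. balance (high \<kappa>) u)) at_top" by (rule Lim_transform_eventually)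
  then have "Lim at_top ?E = ?E \<kappa> - ?k * (LINT u|\<mu>. balance (high \<kappa>) u)" by (intro tendsto_Lim) simp
  then show ?thesis unfolding restricted_flux_def singularity_flux_def by simp
qed

section \<open>The bounds\<close>

text \<open>With \<open>A\<close> and \<open>Q\<close> the means of \<open>\<parallel>\<nabla>\<^sub>x\<^sub>,\<^sub>y v\<parallel>\<^sup>2\<close> and \<open>\<parallel>v\<parallel>\<^sup>2\<close>, the hypothesis reads \<open>S / (2 \<nu>) \<le> \<delta> A / Q\<close>, and \<open>A\<close> is at most the mean of \<open>\<parallel>\<nabla>v\<parallel>\<^sup>2\<close>. When \<open>A\<close> or \<open>Q\<close> is \<open>0\<close> the quotient has the value \<open>0\<close> and the hypothesis says nothing; then \<open>Q = 0\<close> in both cases, since a field without horizontal gradient has no modes.\<close>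

lemma mean_shear_production_bound:
  assumes \<delta>: "(kappa_s h \<nu> U)\<^sup>2 / (2 * (taylor_wavenumber Lx Ly h \<mu> w \<kappa>)\<^sup>2) \<le> \<delta>" and \<delta>0: "0 < \<delta>"
  shows "\<bar>LINT u|\<mu>. shear_production U (high \<kappa>) u\<bar> \<le> \<delta> * (\<nu> * (LINT u|\<mu>. gsq (proj (high \<kappa>) u)))"
proof -
  let ?H = "high \<kappa>"
  note H = high_modes(1)[of \<kappa>] and I = integrable_statistics[OF high_modes(1)[of \<kappa>]]
  define A where "A = (LINT u|\<mu>. hgrad_sq Lx Ly h (proj ?H u))"
  define Q where "Q = (LINT u|\<mu>. (nrm (proj ?H u))\<^sup>2)"
  define G where "G = (LINT u|\<mu>. gsq (proj ?H u))"
  define S where "S = shear_rate h U"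
  have S: "0 \<le> S" unfolding S_def by (rule shear_rate_nonneg[OF profile])
  have Q: "0 \<le> Q" unfolding Q_def by (intro Bochner_Integration.integral_nonneg) simp
  have A: "0 \<le> A" unfolding A_def by (intro Bochner_Integration.integral_nonneg hgrad_sq_bounds)
  have AG: "A \<le> G" unfolding A_def G_def by (intro integral_mono I hgrad_sq_bounds)
  have "\<bar>LINT u|\<mu>. shear_production U ?H u\<bar> \<le> (LINT u|\<mu>. \<bar>shear_production U ?H u\<bar>)" by (rule integral_abs_bound)
  also have "\<dots> \<le> (LINT u|\<mu>. S / 2 * (nrm (proj ?H u))\<^sup>2)"
  proof (rule integral_mono_AE)
    show "AE u in \<mu>. \<bar>shear_production U ?H u\<bar> \<le> S / 2 * (nrm (proj ?H u))\<^sup>2" using \<mu>_facts(3)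
      unfolding S_def by eventually_elim (rule shear_production_bound[OF profile Vd_D(3) H])
  qed (intro integrable_abs integrable_mult_right I)+
  also have "\<dots> = S / 2 * Q" by (simp add: Q_def)
  finally have 1: "\<bar>LINT u|\<mu>. shear_production U ?H u\<bar> \<le> S / 2 * Q" .
  have "S / 2 * Q \<le> \<delta> * (\<nu> * A)"
  proof (cases "A = 0")
    case True
    have "AE u in \<mu>. hgrad_sq Lx Ly h (proj ?H u) = 0"
      using integral_nonneg_eq_0_iff_AE[OF I(3)] True hgrad_sq_bounds(1) unfolding A_def by simp
    then have "AE u in \<mu>. (nrm (proj ?H u))\<^sup>2 = 0" using \<mu>_facts(3)
    proof eventually_elim
      case (elim u)
      have "(nrm (D 1 (proj ?H u)))\<^sup>2 + (nrm (D 2 (proj ?H u)))\<^sup>2 = 0"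
        using elim(1) by (simp add: hgrad_sq_def nrm_sq)
      then have "nrm (D 1 (proj ?H u)) = 0" "nrm (D 2 (proj ?H u)) = 0"
        by (simp_all add: sum_power2_eq_zero_iff)
      then show ?case using zero_horizontal_gradient[OF elim(2) H] by simp
    qed
    then have "Q = (LINT u|\<mu>. 0)" unfolding Q_def
      by (intro integral_cong_AE borel_measurable_integrable I borel_measurable_const)
    then show ?thesis using True by simp
  next
    case False
    show ?thesis
    proof (cases "Q = 0")
      case True
      then show ?thesis using \<delta>0 viscosity_pos A by simp
    next
      case Qn: False
      have k: "(kappa_s h \<nu> U)\<^sup>2 = S / \<nu>" using S viscosity_pos by (simp add: kappa_s_def S_def)
      have t: "(taylor_wavenumber Lx Ly h \<mu> w \<kappa>)\<^sup>2 = A / Q"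
        unfolding taylor_wavenumber_def band_eq_proj A_def[symmetric] Q_def[symmetric] using A Q by simp
      have "S / \<nu> / (2 * (A / Q)) \<le> \<delta>" using \<delta> unfolding k t .
      moreover have "A > 0" "Q > 0" using A Q False Qn by auto
      ultimately show ?thesis using viscosity_pos by (simp add: field_simps)
    qed
  qed
  also have "\<dots> \<le> \<delta> * (\<nu> * G)" using \<delta>0 viscosity_pos AG by simp
  finally show ?thesis using 1 unfolding G_def by linarith
qed

lemma kappa1_nonneg: "0 \<le> kappa1 Lx Ly h"
  unfolding kappa1_def by simp

text \<open>The restricted flux is the dissipation of the high modes up to the shear production, which is at most \<open>\<delta>\<close> times that dissipation; the latter lies between \<open>(1 - \<delta>) \<epsilon>\<close> and \<open>\<epsilon>\<close>. Each hypothesis contributes one factor \<open>1 - \<delta>\<close> to the lower bound.\<close>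

lemma restricted_flux_bounds:
  assumes k: "kbar1 Lx Ly \<le> \<kappa>" and \<delta>0: "0 < \<delta>"
    and taylor: "(kappa_s h \<nu> U)\<^sup>2 / (2 * (taylor_wavenumber Lx Ly h \<mu> w \<kappa>)\<^sup>2) \<le> \<delta>"
    and low: "band_dissipation Lx Ly h \<nu> \<mu> w (kbar1 Lx Ly) (ereal \<kappa>) / dissipation Lx Ly h \<nu> \<mu> \<le> \<delta>"
  shows "\<delta> \<le> 1 \<Longrightarrow> (1 - \<delta>)\<^sup>2 * dissipation Lx Ly h \<nu> \<mu> \<le> restricted_flux Lx Ly h \<mu> w \<kappa>"
    "restricted_flux Lx Ly h \<mu> w \<kappa> \<le> (1 + \<delta>) * dissipation Lx Ly h \<nu> \<mu>"
proof -
  let ?H = "high \<kappa>" and ?L = "modes - high \<kappa>"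
  have H: "?H \<subseteq> modes" "?L \<subseteq> modes" using high_modes by auto
  define c where "c = kappa1 Lx Ly h ^ 3"
  have c: "0 \<le> c" unfolding c_def by (intro zero_le_power kappa1_nonneg)
  define P where "P = c * (LINT u|\<mu>. shear_production U ?H u)"
  define e where "e = dissipation Lx Ly h \<nu> \<mu>"
  define eh where "eh = c * (\<nu> * (LINT u|\<mu>. gsq (proj ?H u)))"
  define el where "el = band_dissipation Lx Ly h \<nu> \<mu> w (kbar1 Lx Ly) (ereal \<kappa>)"
  have el: "el = c * (\<nu> * (LINT u|\<mu>. gsq (proj ?L u)))"
    unfolding el_def band_dissipation_def band_eq_proj c_def by simp
  have "(LINT u|\<mu>. gsq u) = (LINT u|\<mu>. gsq (proj ?H u) + gsq (proj ?L u))"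
  proof (rule integral_cong_AE)
    show "AE u in \<mu>. gsq u = gsq (proj ?H u) + gsq (proj ?L u)" using \<mu>_facts(3)
      by eventually_elim (rule gsq_split[OF _ H(1)])
  qed (intro borel_measurable_integrable Bochner_Integration.integrable_add integrable_statistics H \<mu>_facts)+
  also have "\<dots> = (LINT u|\<mu>. gsq (proj ?H u)) + (LINT u|\<mu>. gsq (proj ?L u))"
    by (intro Bochner_Integration.integral_add integrable_statistics H)
  finally have split: "e = eh + el" unfolding e_def dissipation_def eh_def el c_def by (simp add: algebra_simps)
  have nn: "0 \<le> eh" "0 \<le> el" unfolding eh_def el
    using c viscosity_pos by (intro mult_nonneg_nonneg Bochner_Integration.integral_nonneg; simp)+
  \<comment> \<open>For zero total dissipation the quotient of the hypothesis is \<open>0\<close> by convention, but both terms vanish anyway.\<close>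
  have ele: "el \<le> \<delta> * e"
  proof (cases "e = 0")
    case True
    then show ?thesis using split nn by simp
  next
    case False
    then have "e > 0" using split nn by simp
    then show ?thesis using low unfolding el_def[symmetric] e_def[symmetric] by (simp add: field_simps)
  qed
  have "\<bar>P\<bar> \<le> \<delta> * eh"
  proof -
    have "c * \<bar>LINT u|\<mu>. shear_production U ?H u\<bar> \<le> c * (\<delta> * (\<nu> * (LINT u|\<mu>. gsq (proj ?H u))))"
      by (rule mult_left_mono[OF mean_shear_production_bound[OF taylor \<delta>0] c])
    then show ?thesis using c unfolding P_def eh_def by (simp add: abs_mult ac_simps)
  qed
  then have P: "- (\<delta> * eh) \<le> P" "P \<le> \<delta> * eh" by auto
  have "(LINT u|\<mu>. balance ?H u) = (LINT u|\<mu>. shear_production U ?H u) + \<nu> * (LINT u|\<mu>. gsq (proj ?H u))"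
    unfolding balance_def using integrable_statistics[OF H(1)] by simp
  then have r: "restricted_flux Lx Ly h \<mu> w \<kappa> = P + eh"
    unfolding restricted_flux_eq[OF k] P_def eh_def c_def by (simp add: distrib_left)
  show "restricted_flux Lx Ly h \<mu> w \<kappa> \<le> (1 + \<delta>) * dissipation Lx Ly h \<nu> \<mu>"
  proof -
    have "P + eh \<le> (1 + \<delta>) * eh" using P by (simp add: algebra_simps)
    also have "\<dots> \<le> (1 + \<delta>) * e" using split nn \<delta>0 by (intro mult_left_mono) auto
    finally show ?thesis unfolding r e_def .
  qed
  show "(1 - \<delta>)\<^sup>2 * dissipation Lx Ly h \<nu> \<mu> \<le> restricted_flux Lx Ly h \<mu> w \<kappa>" if "\<delta> \<le> 1"
  proof -
    have "(1 - \<delta>) * ((1 - \<delta>) * e) \<le> (1 - \<delta>) * eh"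
      using that split ele by (intro mult_left_mono) (auto simp: algebra_simps)
    also have "\<dots> \<le> P + eh" using P by (simp add: algebra_simps)
    finally show ?thesis unfolding r e_def by (simp add: power2_eq_square mult.assoc)
  qed
qed

end

theorem theorem4p2:
  fixes Lx Ly h \<nu> \<delta> \<kappa> :: real
    and U :: "real \<Rightarrow> real"
    and w :: "mode \<Rightarrow> field"
    and \<mu> :: "field measure"
  assumes "Lx > 0" "Ly > 0" "h > 0" "\<nu> > 0"
    and "shear_profile h U"
    and "stokes_basis Lx Ly h w"
    and "foias_prodi Lx Ly h \<nu> U \<mu>"
    and "\<forall>\<kappa>'\<ge>kbar1 Lx Ly. integrable \<mu> (flux_integrand Lx Ly h w \<kappa>')"
    and "\<delta> > 0"
    and "\<kappa> \<ge> kbar1 Lx Ly"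
    and "(kappa_s h \<nu> U)\<^sup>2 / (2 * (taylor_wavenumber Lx Ly h \<mu> w \<kappa>)\<^sup>2) \<le> \<delta>"
    and "band_dissipation Lx Ly h \<nu> \<mu> w (kbar1 Lx Ly) (ereal \<kappa>) / dissipation Lx Ly h \<nu> \<mu> \<le> \<delta>"
  shows "(\<delta> \<le> 1 \<longrightarrow> (1 - \<delta>)\<^sup>2 * dissipation Lx Ly h \<nu> \<mu> \<le> restricted_flux Lx Ly h \<mu> w \<kappa>) \<and>
         restricted_flux Lx Ly h \<mu> w \<kappa> \<le> (1 + \<delta>) * dissipation Lx Ly h \<nu> \<mu>"
proof -
  interpret cell Lx Ly h by unfold_locales fact+
  have "\<exists>W. trig (al m) (be m) (ga m) W \<and> (\<forall>x\<in>Om. w m x = W x)" if "m \<in> modes" for m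
  proof -
    have "mode_shape Lx Ly h m (w m)" using assms(6) that unfolding stokes_basis_def by blast
    from mode_shape_trig[OF this] show ?thesis by metis
  qed
  then have "\<forall>m. \<exists>W. m \<in> modes \<longrightarrow> trig (al m) (be m) (ga m) W \<and> (\<forall>x\<in>Om. w m x = W x)" by blast
  from choice[OF this] obtain W
    where W: "\<And>m. m \<in> modes \<Longrightarrow> trig (al m) (be m) (ga m) (W m) \<and> (\<forall>x\<in>Om. w m x = W m x)" by blast
  interpret stationary_statistics Lx Ly h w W \<nu> U \<mu>
    by unfold_locales (use assms W in blast)+
  show ?thesis using restricted_flux_bounds[OF assms(10,9,11,12)] by blast
qed

end
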